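(* Let $G=(V,E)$ be a connected, locally finite graph, and suppose that $\mathrm{Aut}(G)$ has a quasi-transitive nonunimodular subgroup. Then $G$ satisfies the triangle condition at $p_c=p_c(G)$, that is, $$\nabla_{p_c}(v)=\sum_{x,y\in V}\tau_{p_c}(v,x)\,\tau_{p_c}(x,y)\,\tau_{p_c}(y,v)<\infty\quad\text{for every } v\in V.$$
   Context: For $p\in[0,1]$, $G[p]$ denotes the random subgraph of $G$ obtained by Bernoulli bond percolation: each edge is independently retained with probability $p$ and deleted otherwise. Clusters are connected components of $G[p]$. $p_c(G)=\inf\{p: G[p]$ contains an infinite cluster almost surely$\}$. $\tau_p(u,v)$ is the probability that $u$ and $v$ are connected in $G[p]$. A subgroup $\Gamma\subseteq\mathrm{Aut}(G)$ is quasi-transitive if its action on $V$ has only finitely many orbits. It is unimodular if $|\mathrm{Stab}_v u|=|\mathrm{Stab}_u v|$ for all $u,v\in V$ in the same $\Gamma$-orbit, where $\mathrm{Stab}_x$ is the stabilizer of $x$ in $\Gamma$ and $\mathrm{Stab}_x y$ is the orbit of $y$ under $\mathrm{Stab}_x$; otherwise it is nonunimodular. *)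

theory Defs
  imports "HOL-Probability.Probability" "HOL-Algebra.Group_Action"
begin

section \<open>Graphs\<close>

text \<open>A graph is a simple undirected graph: a set of vertices \<open>V\<close> and a set \<open>E\<close> of
  unordered pairs of distinct vertices.\<close>

definition simple_graph :: "'v set \<Rightarrow> 'v set set \<Rightarrow> bool" where
  "simple_graph V E \<longleftrightarrow> (\<forall>e\<in>E. e \<subseteq> V \<and> card e = 2)"

definition locally_finite_graph :: "'v set \<Rightarrow> 'v set set \<Rightarrow> bool" where
  "locally_finite_graph V E \<longleftrightarrow> (\<forall>v\<in>V. finite {e \<in> E. v \<in> e})"

definition linked :: "'v set set \<Rightarrow> 'v \<Rightarrow> 'v \<Rightarrow> bool" where
  "linked F u v \<longleftrightarrow> (u, v) \<in> {(x, y). {x, y} \<in> F}\<^sup>*"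

definition connected_graph :: "'v set \<Rightarrow> 'v set set \<Rightarrow> bool" where
  "connected_graph V E \<longleftrightarrow> (\<forall>u\<in>V. \<forall>v\<in>V. linked E u v)"

section \<open>Automorphisms\<close>

text \<open>\<open>BijGroup V\<close> consists of the bijections of \<open>V\<close> that take the value \<open>undefined\<close>
  outside \<open>V\<close>, so that automorphisms are determined by their values on \<open>V\<close>.\<close>

definition Aut :: "'v set \<Rightarrow> 'v set set \<Rightarrow> ('v \<Rightarrow> 'v) monoid" where
  "Aut V E = (BijGroup V)
     \<lparr>carrier := {f \<in> Bij V. \<forall>u\<in>V. \<forall>v\<in>V. {f u, f v} \<in> E \<longleftrightarrow> {u, v} \<in> E}\<rparr>"

text \<open>For a set \<open>\<Gamma>\<close> of automorphisms (in particular a subgroup, or the stabilizer of a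
  vertex in it), the orbit of \<open>x\<close> under the tautological action on vertices.\<close>

abbreviation vertex_orbit ::
    "'v set \<Rightarrow> 'v set set \<Rightarrow> ('v \<Rightarrow> 'v) set \<Rightarrow> 'v \<Rightarrow> 'v set" where
  "vertex_orbit V E \<Gamma> x \<equiv> orbit ((Aut V E)\<lparr>carrier := \<Gamma>\<rparr>) (\<lambda>g. g) x"

abbreviation vertex_stabilizer ::
    "'v set \<Rightarrow> 'v set set \<Rightarrow> ('v \<Rightarrow> 'v) set \<Rightarrow> 'v \<Rightarrow> ('v \<Rightarrow> 'v) set" where
  "vertex_stabilizer V E \<Gamma> x \<equiv> stabilizer ((Aut V E)\<lparr>carrier := \<Gamma>\<rparr>) (\<lambda>g. g) x"

definition quasi_transitive :: "'v set \<Rightarrow> 'v set set \<Rightarrow> ('v \<Rightarrow> 'v) set \<Rightarrow> bool" where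
  "quasi_transitive V E \<Gamma> \<longleftrightarrow> finite (orbits ((Aut V E)\<lparr>carrier := \<Gamma>\<rparr>) V (\<lambda>g. g))"

text \<open>In a connected, locally finite graph, stabilizer orbits are finite (they are contained
  in spheres), so \<open>card\<close> is the actual cardinality.\<close>

definition unimodular :: "'v set \<Rightarrow> 'v set set \<Rightarrow> ('v \<Rightarrow> 'v) set \<Rightarrow> bool" where
  "unimodular V E \<Gamma> \<longleftrightarrow>
     (\<forall>u\<in>V. \<forall>v\<in>V. u \<in> vertex_orbit V E \<Gamma> v \<longrightarrow>
        card (vertex_orbit V E (vertex_stabilizer V E \<Gamma> v) u) =
        card (vertex_orbit V E (vertex_stabilizer V E \<Gamma> u) v))"

lemma subgroup_Aut: "subgroup (carrier (Aut V E)) (BijGroup V)"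
proof -
  interpret group "BijGroup V" by (rule group_BijGroup)
  show ?thesis
  proof (rule subgroupI)
    show "carrier (Aut V E) \<subseteq> carrier (BijGroup V)"
      by (auto simp: Aut_def BijGroup_def)
    have "\<one>\<^bsub>BijGroup V\<^esub> \<in> carrier (Aut V E)"
      by (auto simp: Aut_def BijGroup_def id_Bij)
    then show "carrier (Aut V E) \<noteq> {}" by blast
  next
    fix f assume f: "f \<in> carrier (Aut V E)"
    then have fB: "f \<in> Bij V" and
      fE: "\<And>u v. u \<in> V \<Longrightarrow> v \<in> V \<Longrightarrow> {f u, f v} \<in> E \<longleftrightarrow> {u, v} \<in> E"
      by (auto simp: Aut_def)
    let ?g = "\<lambda>x\<in>V. inv_into V f x"
    have img: "f ` V = V" using fB by (auto simp: Bij_def bij_betw_def)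
    have g: "inv_into V f x \<in> V" "f (inv_into V f x) = x" if "x \<in> V" for x
      using that img by (auto intro: inv_into_into f_inv_into_f)
    have "{?g u, ?g v} \<in> E \<longleftrightarrow> {u, v} \<in> E" if "u \<in> V" "v \<in> V" for u v
      using fE[of "inv_into V f u" "inv_into V f v"] g that by simp
    then show "inv\<^bsub>BijGroup V\<^esub> f \<in> carrier (Aut V E)"
      by (simp add: inv_BijGroup[OF fB] Aut_def restrict_inv_into_Bij[OF fB])
  next
    fix f g assume "f \<in> carrier (Aut V E)" "g \<in> carrier (Aut V E)"
    moreover have "g u \<in> V" if "u \<in> V" for u
      using that \<open>g \<in> carrier (Aut V E)\<close> by (auto simp: Aut_def Bij_def bij_betw_def)
    ultimately show "f \<otimes>\<^bsub>BijGroup V\<^esub> g \<in> carrier (Aut V E)"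
      by (simp add: Aut_def BijGroup_def compose_Bij compose_eq)
  qed
qed

lemma group_Aut: "group (Aut V E)"
  using group.subgroup_imp_group[OF group_BijGroup subgroup_Aut[of V E]]
  by (simp add: Aut_def)

lemma group_action_Aut:
  assumes "subgroup \<Gamma> (Aut V E)"
  shows "group_action ((Aut V E)\<lparr>carrier := \<Gamma>\<rparr>) V (\<lambda>g. g)"
proof -
  have "\<Gamma> \<subseteq> carrier (BijGroup V)"
    using subgroup.subset[OF assms] subgroup.subset[OF subgroup_Aut[of V E]] by blast
  then show ?thesis
    unfolding group_action_def group_hom_def group_hom_axioms_def
    using group.subgroup_imp_group[OF group_Aut assms]
    by (auto simp: group_BijGroup hom_def Aut_def)
qed

section \<open>Bernoulli bond percolation\<close>

text \<open>A configuration \<open>\<omega>\<close> assigns to each edge whether it is retained. When the graph is connected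
  and locally finite, \<open>E\<close> is countable, so the connection and infinite-cluster events below
  are measurable.\<close>

definition percolation :: "'v set set \<Rightarrow> real \<Rightarrow> ('v set \<Rightarrow> bool) measure" where
  "percolation E p = PiM E (\<lambda>_. measure_pmf (bernoulli_pmf p))"

definition open_edges :: "'v set set \<Rightarrow> ('v set \<Rightarrow> bool) \<Rightarrow> 'v set set" where
  "open_edges E \<omega> = {e \<in> E. \<omega> e}"

definition cluster :: "'v set \<Rightarrow> 'v set set \<Rightarrow> ('v set \<Rightarrow> bool) \<Rightarrow> 'v \<Rightarrow> 'v set" where
  "cluster V E \<omega> v = {u \<in> V. linked (open_edges E \<omega>) v u}"

definition two_point :: "'v set set \<Rightarrow> real \<Rightarrow> 'v \<Rightarrow> 'v \<Rightarrow> real" where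
  "two_point E p u v =
     measure (percolation E p)
       {\<omega> \<in> space (percolation E p). linked (open_edges E \<omega>) u v}"

definition critical_probability :: "'v set \<Rightarrow> 'v set set \<Rightarrow> real" where
  "critical_probability V E =
     Inf {p \<in> {0..1}. AE \<omega> in percolation E p. \<exists>v\<in>V. infinite (cluster V E \<omega> v)}"

text \<open>The sum is taken in \<open>ennreal\<close>, where every family is summable, so divergence gives
  \<open>\<infinity>\<close> rather than the default value of \<open>infsum\<close>.\<close>

definition triangle_diagram :: "'v set \<Rightarrow> 'v set set \<Rightarrow> real \<Rightarrow> 'v \<Rightarrow> ennreal" where
  "triangle_diagram V E p v =
     (\<Sum>\<^sub>\<infinity>(x, y)\<in>V \<times> V. ennreal (two_point E p v x * two_point E p x y * two_point E p y v))"

end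

theory Submission imports Defs begin

text \<open>Nonunimodularity makes the modular function \<open>modr\<close> nontrivial, so its logarithm is an unbounded
 equivariant height \<open>l\<close>; a max-plus eigenvector argument replaces it by an equivariant height \<open>u\<close> at
 bounded distance along which every vertex has a uniformly climbing path. Opening such paths shows that a
 point count above a level that is large with some probability lets the cluster climb further, so that below
 criticality upward crossings by \<open>t\<close> have probability of order \<open>exp (- \<alpha> t)\<close>, and mass transport relates upward
 to downward crossings. Combining this duality with the BK inequality bounds the tilted susceptibility
 \<open>\<Sum>x. exp ((u x - u v) / 2) \<tau>(v, x)\<close> uniformly below the critical point, hence at it. Since the tilting
 weights cancel around a triangle, this tilted bound dominates the triangle diagram.\<close>

section \<open>Bernoulli percolation on finitely many edges\<close>

definition pexp :: "'e set \<Rightarrow> real \<Rightarrow> ('e set \<Rightarrow> real) \<Rightarrow> real" where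
 "pexp F p g = (\<Sum>om\<in>Pow F. p ^ card om * (1 - p) ^ card (F - om) * g om)"

definition Pr :: "'e set \<Rightarrow> real \<Rightarrow> ('e set \<Rightarrow> bool) \<Rightarrow> real" where
 "Pr F p A = pexp F p (%om. of_bool (A om))"

definition increasing_event :: "('e set \<Rightarrow> bool) \<Rightarrow> bool" where
 "increasing_event A \<longleftrightarrow> (\<forall>om om'. om \<subseteq> om' --> A om --> A om')"

lemma increasing_eventD: "increasing_event A ==> A om ==> om \<subseteq> om' ==> A om'"
 by (auto simp: increasing_event_def)

lemma pexp_empty [simp]: "pexp {} p g = g {}"
 by (simp add: pexp_def)

lemma pexp_insert:
 assumes "finite F" "e \<notin> F"
 shows "pexp (insert e F) p g
  = p * pexp F p (%om. g (insert e om)) + (1 - p) * pexp F p g"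
proof -
 have inj: "inj_on (insert e) (Pow F)" using assms by (auto simp: inj_on_def)
 have disj: "Pow F \<inter> insert e ` Pow F = {}" using assms by auto
 have "pexp (insert e F) p g =
   (\<Sum>om\<in>Pow F. p ^ card om * (1 - p) ^ card (insert e F - om) * g om)
  + (\<Sum>om\<in>Pow F. p ^ card (insert e om) * (1 - p) ^ card (insert e F - insert e om) * g (insert e om))"
  unfolding pexp_def Pow_insert
  by (subst sum.union_disjoint) (use assms disj in \<open>auto simp: sum.reindex[OF inj]\<close>)
 also have "(\<Sum>om\<in>Pow F. p ^ card om * (1 - p) ^ card (insert e F - om) * g om)
  = (1 - p) * pexp F p g"
  unfolding pexp_def sum_distrib_left
 proof (rule sum.cong[OF refl])
  fix om assume "om \<in> Pow F"
  hence "insert e F - om = insert e (F - om)" "e \<notin> F - om" "finite (F - om)" using assms by auto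
  thus "p ^ card om * (1 - p) ^ card (insert e F - om) * g om =
   (1 - p) * (p ^ card om * (1 - p) ^ card (F - om) * g om)" by simp
 qed
 also have "(\<Sum>om\<in>Pow F. p ^ card (insert e om) * (1 - p) ^ card (insert e F - insert e om) * g (insert e om))
  = p * pexp F p (%om. g (insert e om))"
  unfolding pexp_def sum_distrib_left
 proof (rule sum.cong[OF refl])
  fix om assume w: "om \<in> Pow F"
  hence "insert e F - insert e om = F - om" using assms by auto
  moreover have "card (insert e om) = Suc (card om)"
   using w assms by (intro card_insert_disjoint) (auto intro: finite_subset)
  ultimately show "p ^ card (insert e om) * (1 - p) ^ card (insert e F - insert e om) * g (insert e om) =
   p * (p ^ card om * (1 - p) ^ card (F - om) * g (insert e om))" by simp
 qed
 finally show ?thesis by simp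
qed

lemma pexp_cong: "(\<And>om. om \<subseteq> F ==> g om = g' om) ==> pexp F p g = pexp F p g'"
 unfolding pexp_def by (intro sum.cong) auto

lemma Pr_cong: "(\<And>om. om \<subseteq> F ==> A om = A' om) ==> Pr F p A = Pr F p A'"
 unfolding Pr_def by (rule pexp_cong) simp

lemma pexp_mono:
 assumes "0 <= p" "p <= 1" "\<And>om. om \<subseteq> F ==> g om <= g' om"
 shows "pexp F p g <= pexp F p g'"
 unfolding pexp_def using assms by (intro sum_mono mult_left_mono) auto

lemma pexp_add: "pexp F p (%om. g om + k om) = pexp F p g + pexp F p k"
 by (simp add: pexp_def algebra_simps sum.distrib)

lemma pexp_cmult: "pexp F p (%om. c * g om) = c * pexp F p g"
 by (simp add: pexp_def sum_distrib_left algebra_simps)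

lemma pexp_diff: "pexp F p (%om. g om - k om) = pexp F p g - pexp F p k"
 by (simp add: pexp_def algebra_simps sum_subtractf)

lemma pexp_sum: "pexp F p (%om. \<Sum>i\<in>I. g i om) = (\<Sum>i\<in>I. pexp F p (g i))"
 unfolding pexp_def by (subst sum.swap) (simp add: sum_distrib_left)

lemma pexp_const: "finite F ==> pexp F p (%om. c) = c"
 by (induction F rule: finite_induct) (simp_all add: pexp_insert algebra_simps)

lemma pexp_nonneg:
 assumes "0 <= p" "p <= 1" "\<And>om. om \<subseteq> F ==> 0 <= g om"
 shows "0 <= pexp F p g"
 unfolding pexp_def using assms by (intro sum_nonneg mult_nonneg_nonneg) auto

lemma Pr_nonneg: "0 <= p ==> p <= 1 ==> 0 <= Pr F p A"
 unfolding Pr_def by (rule pexp_nonneg) auto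

lemma Pr_mono:
 assumes "0 <= p" "p <= 1" "\<And>om. om \<subseteq> F ==> A om ==> A' om"
 shows "Pr F p A <= Pr F p A'"
 unfolding Pr_def using assms by (intro pexp_mono) (auto simp: of_bool_def)

lemma Pr_le_1: "finite F ==> 0 <= p ==> p <= 1 ==> Pr F p A <= 1"
 unfolding Pr_def using pexp_mono[of p F "%om. of_bool (A om)" "%_. 1"]
 by (simp add: pexp_const)

lemma Pr_True: "finite F ==> Pr F p (%om. True) = 1"
 unfolding Pr_def by (simp add: pexp_const)

lemma Pr_not: "finite F ==> Pr F p (%om. \<not> A om) = 1 - Pr F p A"
proof -
 assume "finite F"
 have "pexp F p (%om. of_bool (\<not> A om) + of_bool (A om)) = pexp F p (%om. 1)"
  by (rule pexp_cong) auto
 also have "... = 1" using \<open>finite F\<close> by (rule pexp_const)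
 finally show ?thesis unfolding Pr_def pexp_add by linarith
qed

lemma Pr_disj_le:
 assumes "0 <= p" "p <= 1"
 shows "Pr F p (%om. A om \<or> B om) <= Pr F p A + Pr F p B"
 unfolding Pr_def pexp_add[symmetric] using assms
 by (intro pexp_mono) auto

lemma Pr_Bex_le:
 assumes "0 <= p" "p <= 1" "finite I"
 shows "Pr F p (%om. \<exists>i\<in>I. A i om) <= (\<Sum>i\<in>I. Pr F p (A i))"
 unfolding Pr_def pexp_sum[symmetric]
proof (intro pexp_mono assms)
 fix om
 show "of_bool (\<exists>i\<in>I. A i om) <= (\<Sum>i\<in>I. of_bool (A i om) :: real)"
 proof (cases "\<exists>i\<in>I. A i om")
  case True
  then obtain i where i: "i \<in> I" "A i om" by blast
  have "(1::real) = of_bool (A i om)" using i by simp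
  also have "... <= (\<Sum>i\<in>I. of_bool (A i om))" using i assms by (intro member_le_sum) auto
  finally show ?thesis using True by simp
 qed (auto intro: sum_nonneg)
qed

lemma pexp_Un:
 assumes "finite F" "finite G" "F \<inter> G = {}"
 shows "pexp (F \<union> G) p g = pexp F p (%om. pexp G p (%\<eta>. g (om \<union> \<eta>)))"
 using assms
proof (induction F arbitrary: g rule: finite_induct)
 case empty thus ?case by simp
next
 case (insert e F)
 hence "e \<notin> F \<union> G" "finite (F \<union> G)" by auto
 thus ?case using insert
  by (simp add: pexp_insert)
qed

lemma pexp_restrict:
 assumes "finite F" "D \<subseteq> F"
 shows "pexp F p (%om. g (om \<inter> D)) = pexp D p g"
proof -
 have fin: "finite D" "finite (F - D)" using assms finite_subset by auto
 have F: "F = D \<union> (F - D)" using assms by auto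
 have "pexp (D \<union> (F - D)) p (%om. g (om \<inter> D)) =
  pexp D p (%om. pexp (F - D) p (%\<eta>. g ((om \<union> \<eta>) \<inter> D)))"
  by (rule pexp_Un) (use fin in auto)
 also have "... = pexp D p (%om. pexp (F - D) p (%\<eta>. g om))"
  by (intro pexp_cong arg_cong[where f = g]) auto
 also have "... = pexp D p g" using fin by (simp add: pexp_const)
 finally show ?thesis using F by simp
qed

lemma Pr_restrict:
 assumes "finite F"
 shows "Pr F p (%om. A (om \<inter> D)) = Pr (F \<inter> D) p A"
proof -
 have "Pr F p (%om. A (om \<inter> D)) = Pr F p (%om. A (om \<inter> (F \<inter> D)))"
  by (rule Pr_cong) (auto intro!: arg_cong[where f = A])
 thus ?thesis using pexp_restrict[OF assms, of "F \<inter> D"] by (simp add: Pr_def)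
qed

lemma pexp_indep:
 assumes "finite F" "A \<inter> B = {}"
 shows "pexp F p (%om. g (om \<inter> A) * k (om \<inter> B)) = pexp (F \<inter> A) p g * pexp (F \<inter> B) p k"
proof -
 let ?A = "F \<inter> A" and ?B = "F \<inter> B"
 have "pexp F p (%om. g (om \<inter> A) * k (om \<inter> B)) =
  pexp F p (%om. (%om. g (om \<inter> A) * k (om \<inter> B)) (om \<inter> (?A \<union> ?B)))"
  by (rule pexp_cong, rule arg_cong2[where f = "(*)"])
   (auto intro!: arg_cong[where f = g] arg_cong[where f = k])
 also have "... = pexp (?A \<union> ?B) p (%om. g (om \<inter> A) * k (om \<inter> B))"
  by (rule pexp_restrict) (use assms in auto)
 also have "... = pexp ?A p (%om. pexp ?B p (%\<eta>. g ((om \<union> \<eta>) \<inter> A) * k ((om \<union> \<eta>) \<inter> B)))"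
  by (rule pexp_Un) (use assms in auto)
 also have "... = pexp ?A p (%om. pexp ?B p (%\<eta>. g om * k \<eta>))"
 proof (intro pexp_cong)
  fix om \<eta> assume "om \<subseteq> F \<inter> A" "\<eta> \<subseteq> F \<inter> B"
  hence "(om \<union> \<eta>) \<inter> A = om" "(om \<union> \<eta>) \<inter> B = \<eta>" using assms by auto
  thus "g ((om \<union> \<eta>) \<inter> A) * k ((om \<union> \<eta>) \<inter> B) = g om * k \<eta>" by simp
 qed
 also have "... = pexp ?A p (%om. pexp ?B p k * g om)"
  by (simp add: pexp_cmult mult.commute)
 finally show ?thesis by (simp add: pexp_cmult)
qed

lemma Pr_mono_edges:
 assumes "finite G" "F \<subseteq> G" "increasing_event A" "0 <= p" "p <= 1"
 shows "Pr F p A <= Pr G p A"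
proof -
 have "Pr F p A = Pr G p (%om. A (om \<inter> F))"
  using Pr_restrict[of G p A F] assms by (simp add: Int_absorb1)
 also have "... <= Pr G p A"
  by (intro Pr_mono assms) (auto intro: increasing_eventD[OF assms(3)])
 finally show ?thesis .
qed

lemma pexp_image:
 assumes "inj_on f F"
 shows "pexp (f ` F) p g = pexp F p (%om. g (f ` om))"
proof -
 have inj: "inj_on ((`) f) (Pow F)" using assms by (rule inj_on_image_Pow)
 have "Pow (f ` F) = (`) f ` Pow F" by (simp add: image_Pow_surj)
 hence "pexp (f ` F) p g =
  (\<Sum>om\<in>Pow F. p ^ card (f ` om) * (1 - p) ^ card (f ` F - f ` om) * g (f ` om))"
  unfolding pexp_def by (simp add: sum.reindex[OF inj])
 also have "... = pexp F p (%om. g (f ` om))"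
  unfolding pexp_def
 proof (rule sum.cong[OF refl])
  fix om assume "om \<in> Pow F"
  hence w: "om \<subseteq> F" by auto
  hence "f ` F - f ` om = f ` (F - om)"
   using assms by (simp add: inj_on_image_set_diff)
  moreover have "card (f ` om) = card om" "card (f ` (F - om)) = card (F - om)"
   using w by (auto intro!: card_image inj_on_subset[OF assms])
  ultimately show "p ^ card (f ` om) * (1 - p) ^ card (f ` F - f ` om) * g (f ` om) =
   p ^ card om * (1 - p) ^ card (F - om) * g (f ` om)" by simp
 qed
 finally show ?thesis .
qed

lemma Pr_image: "inj_on f F ==> Pr (f ` F) p A = Pr F p (%om. A (f ` om))"
 by (simp add: Pr_def pexp_image)

lemma Pr_mono_p:
 assumes "finite F" "increasing_event A" "0 <= p" "p <= q" "q <= 1"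
 shows "Pr F p A <= Pr F q A"
proof -
 have q: "0 <= q" "p <= 1" using assms by auto
 have "pexp F p g <= pexp F q g" if "mono g" for g :: "_ \<Rightarrow> real"
  using assms(1) that
 proof (induction F arbitrary: g rule: finite_induct)
  case empty thus ?case by simp
 next
  case (insert e F)
  let ?g = "%om. g (insert e om)"
  have inc: "mono ?g" by (rule monoI, rule monoD[OF \<open>mono g\<close>]) auto
  have AA: "pexp F q g <= pexp F q ?g"
   by (rule pexp_mono[OF q(1) assms(5)], rule monoD[OF \<open>mono g\<close>]) auto
  have "pexp (insert e F) p g = p * pexp F p ?g + (1 - p) * pexp F p g"
   by (rule pexp_insert) fact+
  also have "... <= p * pexp F q ?g + (1 - p) * pexp F q g"
   using insert.IH[OF inc] insert.IH[OF \<open>mono g\<close>] assms(3) q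
   by (intro add_mono mult_left_mono) simp_all
  also have "... <= q * pexp F q ?g + (1 - q) * pexp F q g"
  proof -
   have "0 <= (q - p) * (pexp F q ?g - pexp F q g)" using AA assms(4) by simp
   thus ?thesis by (simp add: algebra_simps)
  qed
  also have "... = pexp (insert e F) q g"
   by (rule pexp_insert[symmetric]) fact+
  finally show ?case .
 qed
 moreover have "mono (%om. of_bool (A om) :: real)"
  using assms(2) by (auto simp: mono_def increasing_event_def of_bool_def)
 ultimately show ?thesis unfolding Pr_def by blast
qed

lemma pexp_force:
 assumes "finite F" "finite J" "\<And>om. 0 <= g om" "0 <= p" "p <= 1"
 shows "p ^ card J * pexp F p (%om. g (om \<union> J)) <= pexp (F \<union> J) p g"
proof -
 have one: "p * pexp F p (%om. g (insert e om)) <= pexp (insert e F) p g"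
  if "finite F" "\<And>om. 0 <= g om" for F e g
 proof (cases "e \<in> F")
  case False
  thus ?thesis using that assms pexp_nonneg[of p F g]
   by (simp add: pexp_insert)
 next
  case True
  then obtain F' where F': "F = insert e F'" "e \<notin> F'" by (meson mk_disjoint_insert)
  hence fin: "finite F'" using that by auto
  have "p * pexp F p (%om. g (insert e om)) = p * pexp F' p (%om. g (insert e om))"
   unfolding F'(1) by (simp add: pexp_insert[OF fin F'(2)] algebra_simps)
  also have "... <= pexp (insert e F) p g"
   using pexp_nonneg[of p F' g] that assms
   unfolding F'(1) insert_absorb2 by (simp add: pexp_insert[OF fin F'(2)])
  finally show ?thesis .
 qed
 show ?thesis using assms(2,3)
 proof (induction J arbitrary: g rule: finite_induct)
  case empty thus ?case by simp
 next
  case (insert e J)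
  have "p ^ card (insert e J) * pexp F p (%om. g (om \<union> insert e J))
   = p * (p ^ card J * pexp F p (%om. (%om. g (insert e om)) (om \<union> J)))"
   using insert by simp
  also have "... <= p * pexp (F \<union> J) p (%om. g (insert e om))"
   using insert assms by (intro mult_left_mono insert.IH) auto
  also have "... <= pexp (insert e (F \<union> J)) p g"
   using insert assms by (intro one) auto
  finally show ?case by simp
 qed
qed

lemma Pr_force:
 assumes "finite F" "finite J" "0 <= p" "p <= 1"
  and "\<And>om. om \<subseteq> F ==> B om ==> A (om \<union> J)"
 shows "p ^ card J * Pr F p B <= Pr (F \<union> J) p A"
proof -
 have "p ^ card J * Pr F p B <= p ^ card J * pexp F p (%om. of_bool (A (om \<union> J)))"
  unfolding Pr_def using assms by (intro mult_left_mono pexp_mono) auto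
 also have "... <= Pr (F \<union> J) p A"
  unfolding Pr_def by (rule pexp_force) (use assms in auto)
 finally show ?thesis .
qed

lemma Pr_all_open:
 assumes "finite F" "J \<subseteq> F" "0 <= p" "p <= 1"
 shows "p ^ card J <= Pr F p (%om. J \<subseteq> om)"
proof -
 have "finite J" using assms finite_subset by blast
 hence "p ^ card J * Pr F p (%om. True) <= Pr (F \<union> J) p (%om. J \<subseteq> om)"
  by (intro Pr_force assms) auto
 thus ?thesis using assms by (simp add: Pr_True Un_absorb2)
qed

lemma continuous_on_pexp: "continuous_on UNIV (%p. pexp F p g)"
 unfolding pexp_def by (intro continuous_intros)

lemma perc_two_stage:
 assumes "finite F" "F \<inter> R = {}" "0 <= p" "p <= 1" "increasing_event Q" "0 <= c"
  and "\<And>om. om \<subseteq> F ==> P om ==> \<exists>G. finite G \<and> G \<subseteq> R \<and> c <= Pr G p (%\<eta>. Q (om \<union> \<eta>))"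
 shows "\<exists>G. finite G \<and> G \<subseteq> R \<and> c * Pr F p P <= Pr (F \<union> G) p Q"
proof -
 have "\<forall>om. \<exists>G. om \<subseteq> F --> P om --> finite G \<and> G \<subseteq> R \<and> c <= Pr G p (%\<eta>. Q (om \<union> \<eta>))"
  using assms(7) by blast
 then obtain G where G: "\<And>om. om \<subseteq> F ==> P om ==> finite (G om) \<and> G om \<subseteq> R \<and>
   c <= Pr (G om) p (%\<eta>. Q (om \<union> \<eta>))" by metis
 define GG where "GG = (\<Union>om\<in>{om\<in>Pow F. P om}. G om)"
 have fin: "finite GG" and sub: "GG \<subseteq> R" using G assms(1) by (auto simp: GG_def)
 have "c * Pr F p P = pexp F p (%om. c * of_bool (P om))"
  by (simp add: Pr_def pexp_cmult)
 also have "... <= pexp F p (%om. Pr GG p (%\<eta>. Q (om \<union> \<eta>)))"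
 proof (intro pexp_mono assms)
  fix om assume w: "om \<subseteq> F"
  show "c * of_bool (P om) <= Pr GG p (%\<eta>. Q (om \<union> \<eta>))"
  proof (cases "P om")
   case True
   have "increasing_event (%\<eta>. Q (om \<union> \<eta>))"
    using assms(5) unfolding increasing_event_def by (metis Un_mono order_refl)
   hence "Pr (G om) p (%\<eta>. Q (om \<union> \<eta>)) <= Pr GG p (%\<eta>. Q (om \<union> \<eta>))"
    by (intro Pr_mono_edges fin assms) (use w True in \<open>auto simp: GG_def\<close>)
   thus ?thesis using G[OF w True] True by simp
  qed (use assms in \<open>simp add: Pr_nonneg\<close>)
 qed
 also have "... = Pr (F \<union> GG) p Q"
  unfolding Pr_def by (rule pexp_Un[symmetric]) (use assms fin sub in auto)
 finally show ?thesis using fin sub by blast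
qed

section \<open>The BK inequality for witness families\<close>

lemma BK_split:
 fixes p :: real
 assumes "finite F" "0 <= p" "p <= 1" "X \<inter> F = {}" "Y \<inter> F = {}"
 shows "Pr F p (%om. \<exists>P\<in>\<A>. \<exists>Q\<in>\<B>. P \<inter> Q \<inter> F = {} \<and> P \<subseteq> om \<union> X \<and> Q \<subseteq> om \<union> Y)
  <= Pr F p (%om. \<exists>P\<in>\<A>. P \<subseteq> om \<union> X) * Pr F p (%om. \<exists>Q\<in>\<B>. Q \<subseteq> om \<union> Y)"
 using assms(1,4,5)
proof (induction F arbitrary: X Y rule: finite_induct)
 case empty thus ?case by (auto simp: Pr_def)
next
 case (insert e F)
 define ev where "ev X Y = (%om. \<exists>P\<in>\<A>. \<exists>Q\<in>\<B>. P \<inter> Q \<inter> F = {} \<and> P \<subseteq> om \<union> X \<and> Q \<subseteq> om \<union> Y)" for X Y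
 define a where "a X = Pr F p (%om. \<exists>P\<in>\<A>. P \<subseteq> om \<union> X)" for X
 define b where "b Y = Pr F p (%om. \<exists>Q\<in>\<B>. Q \<subseteq> om \<union> Y)" for Y
 let ?X = "insert e X" and ?Y = "insert e Y"
 have dis: "X \<inter> F = {}" "Y \<inter> F = {}" "?X \<inter> F = {}" "?Y \<inter> F = {}" "e \<notin> X" "e \<notin> Y"
  using insert by auto
 have IH: "Pr F p (ev X' Y') <= a X' * b Y'" if "X' \<inter> F = {}" "Y' \<inter> F = {}" for X' Y'
  using insert.IH[OF that] by (simp add: ev_def a_def b_def)
 have mono: "ev X' Y' om" if ev: "ev X1 Y1 om" and "X1 \<subseteq> X'" "Y1 \<subseteq> Y'" for X1 Y1 X' Y' om
 proof -
  obtain P Q where PQ: "P \<in> \<A>" "Q \<in> \<B>" "P \<inter> Q \<inter> F = {}" "P \<subseteq> om \<union> X1" "Q \<subseteq> om \<union> Y1"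
   using ev unfolding ev_def by (elim bexE conjE)
  show ?thesis unfolding ev_def
   by (intro bexI[OF _ PQ(1)] bexI[OF _ PQ(2)]) (use PQ that in auto)
 qed
 have "Pr (insert e F) p (%om. \<exists>P\<in>\<A>. \<exists>Q\<in>\<B>. P \<inter> Q \<inter> insert e F = {} \<and> P \<subseteq> om \<union> X \<and> Q \<subseteq> om \<union> Y)
  = p * Pr F p (%om. \<exists>P\<in>\<A>. \<exists>Q\<in>\<B>. P \<inter> Q \<inter> insert e F = {} \<and> P \<subseteq> insert e om \<union> X \<and> Q \<subseteq> insert e om \<union> Y)
  + (1 - p) * Pr F p (%om. \<exists>P\<in>\<A>. \<exists>Q\<in>\<B>. P \<inter> Q \<inter> insert e F = {} \<and> P \<subseteq> om \<union> X \<and> Q \<subseteq> om \<union> Y)"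
  unfolding Pr_def using insert by (simp add: pexp_insert)
 also have "... <= p * Pr F p (%om. ev ?X Y om \<or> ev X ?Y om) + (1 - p) * Pr F p (ev X Y)"
 proof (intro add_mono mult_left_mono Pr_mono)
  fix om assume "om \<subseteq> F" "\<exists>P\<in>\<A>. \<exists>Q\<in>\<B>. P \<inter> Q \<inter> insert e F = {} \<and> P \<subseteq> insert e om \<union> X \<and> Q \<subseteq> insert e om \<union> Y"
  then obtain P Q where PQ: "P \<in> \<A>" "Q \<in> \<B>" "P \<inter> Q \<inter> insert e F = {}" "P \<subseteq> insert e om \<union> X"
   "Q \<subseteq> insert e om \<union> Y" by (elim bexE conjE)
  show "ev ?X Y om \<or> ev X ?Y om"
  proof (cases "e \<in> P")
   case True
   have "P \<inter> Q \<inter> F = {}" "P \<subseteq> om \<union> ?X" "Q \<subseteq> om \<union> Y" using PQ True by blast+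
   hence "ev ?X Y om" unfolding ev_def using PQ(1,2) by (intro bexI conjI)
   thus ?thesis ..
  next
   case False
   have "P \<inter> Q \<inter> F = {}" "P \<subseteq> om \<union> X" "Q \<subseteq> om \<union> ?Y" using PQ False by blast+
   hence "ev X ?Y om" unfolding ev_def using PQ(1,2) by (intro bexI conjI)
   thus ?thesis ..
  qed
 next
  fix om assume "\<exists>P\<in>\<A>. \<exists>Q\<in>\<B>. P \<inter> Q \<inter> insert e F = {} \<and> P \<subseteq> om \<union> X \<and> Q \<subseteq> om \<union> Y"
  then obtain P Q where PQ: "P \<in> \<A>" "Q \<in> \<B>" "P \<inter> Q \<inter> insert e F = {}" "P \<subseteq> om \<union> X" "Q \<subseteq> om \<union> Y"
   by (elim bexE conjE)
  show "ev X Y om" unfolding ev_def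
   by (intro bexI[OF _ PQ(1)] bexI[OF _ PQ(2)]) (use PQ in auto)
 qed (use assms(2,3) in simp_all)
 also have "... <= p * p * (a ?X * b ?Y) + p * (1 - p) * (a ?X * b Y + a X * b ?Y) + (1 - p) * (1 - p) * (a X * b Y)"
 proof -
  let ?U = "Pr F p (%om. ev ?X Y om \<or> ev X ?Y om)" and ?N = "Pr F p (ev X Y)"
  have 1: "?U <= a ?X * b ?Y"
  proof -
   have "?U <= Pr F p (ev ?X ?Y)"
    proof (intro Pr_mono assms)
     fix om assume "ev ?X Y om \<or> ev X ?Y om"
     thus "ev ?X ?Y om" by (auto intro: mono)
    qed
   thus ?thesis using IH[of ?X ?Y] dis by linarith
  qed
  have 2: "?U <= a ?X * b Y + a X * b ?Y - ?N"
  proof -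
   have "?U + ?N <= Pr F p (ev ?X Y) + Pr F p (ev X ?Y)"
    unfolding Pr_def pexp_add[symmetric]
   proof (intro pexp_mono assms)
    fix om
    have "ev X Y om ==> ev ?X Y om" "ev X Y om ==> ev X ?Y om"
     by (auto intro: mono)
    thus "of_bool (ev ?X Y om \<or> ev X ?Y om) + of_bool (ev X Y om)
     <= (of_bool (ev ?X Y om) + of_bool (ev X ?Y om) :: real)" by auto
   qed
   thus ?thesis using IH[of ?X Y] IH[of X ?Y] dis by linarith
  qed
  have 3: "?N <= a X * b Y" using IH dis by blast
  have "p * ?U + (1 - p) * ?N = p * p * ?U + p * (1 - p) * ?U + (1 - p) * ?N"
   by (simp add: algebra_simps)
  also have "... <= p * p * (a ?X * b ?Y) + p * (1 - p) * (a ?X * b Y + a X * b ?Y - ?N) + (1 - p) * ?N"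
   using 1 2 assms by (intro add_mono mult_left_mono order_refl) auto
  also have "... = p * p * (a ?X * b ?Y) + p * (1 - p) * (a ?X * b Y + a X * b ?Y) + (1 - p) * (1 - p) * ?N"
   by (simp add: algebra_simps)
  also have "... <= p * p * (a ?X * b ?Y) + p * (1 - p) * (a ?X * b Y + a X * b ?Y) + (1 - p) * (1 - p) * (a X * b Y)"
   using 3 assms by (intro add_mono mult_left_mono order_refl) auto
  finally show ?thesis .
 qed
 also have "... = (p * a ?X + (1 - p) * a X) * (p * b ?Y + (1 - p) * b Y)"
  by (simp add: algebra_simps)
 also have "... = Pr (insert e F) p (%om. \<exists>P\<in>\<A>. P \<subseteq> om \<union> X) * Pr (insert e F) p (%om. \<exists>Q\<in>\<B>. Q \<subseteq> om \<union> Y)"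
  unfolding Pr_def a_def b_def using insert by (simp add: pexp_insert)
 finally show ?case .
qed

theorem BK_inequality:
 fixes p :: real
 assumes "finite F" "0 <= p" "p <= 1"
 shows "Pr F p (%om. \<exists>P Q. P \<in> \<A> \<and> Q \<in> \<B> \<and> P \<inter> Q = {} \<and> P \<subseteq> om \<and> Q \<subseteq> om)
  <= Pr F p (%om. \<exists>P\<in>\<A>. P \<subseteq> om) * Pr F p (%om. \<exists>Q\<in>\<B>. Q \<subseteq> om)"
proof -
 have "Pr F p (%om. \<exists>P Q. P \<in> \<A> \<and> Q \<in> \<B> \<and> P \<inter> Q = {} \<and> P \<subseteq> om \<and> Q \<subseteq> om)
  <= Pr F p (%om. \<exists>P\<in>\<A>. \<exists>Q\<in>\<B>. P \<inter> Q \<inter> F = {} \<and> P \<subseteq> om \<union> {} \<and> Q \<subseteq> om \<union> {})"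
  by (rule Pr_mono) (use assms in auto)
 also have "... <= Pr F p (%om. \<exists>P\<in>\<A>. P \<subseteq> om \<union> {}) * Pr F p (%om. \<exists>Q\<in>\<B>. Q \<subseteq> om \<union> {})"
  by (rule BK_split) (use assms in auto)
 finally show ?thesis by simp
qed

section \<open>Russo's formula\<close>

lemma russo_formula:
 assumes "finite F"
 shows "((%p. pexp F p g) has_real_derivative
  (\<Sum>e\<in>F. pexp (F - {e}) p (%om. g (insert e om) - g om))) (at p)"
 using assms
proof (induction F arbitrary: g rule: finite_induct)
 case empty thus ?case by simp
next
 case (insert f F)
 let ?g = "%om. g (insert f om)"
 have IH: "((%p. pexp F p g) has_real_derivative (\<Sum>e\<in>F. pexp (F - {e}) p (%om. g (insert e om) - g om))) (at p)" for g
  using insert by blast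
 have "((%p. p * pexp F p ?g + (1 - p) * pexp F p g) has_real_derivative
  (pexp F p ?g + p * (\<Sum>e\<in>F. pexp (F - {e}) p (%om. ?g (insert e om) - ?g om))
   + (- pexp F p g + (1 - p) * (\<Sum>e\<in>F. pexp (F - {e}) p (%om. g (insert e om) - g om))))) (at p)"
  by (auto intro!: derivative_eq_intros IH)
 moreover have "pexp F p ?g + p * (\<Sum>e\<in>F. pexp (F - {e}) p (%om. ?g (insert e om) - ?g om))
   + (- pexp F p g + (1 - p) * (\<Sum>e\<in>F. pexp (F - {e}) p (%om. g (insert e om) - g om)))
  = (\<Sum>e\<in>insert f F. pexp (insert f F - {e}) p (%om. g (insert e om) - g om))"
 proof -
  have "pexp (insert f F - {e}) p (%om. g (insert e om) - g om) =
   p * pexp (F - {e}) p (%om. ?g (insert e om) - ?g om)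
   + (1 - p) * pexp (F - {e}) p (%om. g (insert e om) - g om)" if "e \<in> F" for e
  proof -
   have "insert f F - {e} = insert f (F - {e})" "f \<notin> F - {e}" using that insert by auto
   thus ?thesis using insert by (simp add: pexp_insert insert_commute)
  qed
  moreover have "insert f F - {f} = F" using insert by auto
  ultimately have "(\<Sum>e\<in>insert f F. pexp (insert f F - {e}) p (%om. g (insert e om) - g om)) =
   pexp F p (%om. ?g om - g om) + (\<Sum>e\<in>F. p * pexp (F - {e}) p (%om. ?g (insert e om) - ?g om)
   + (1 - p) * pexp (F - {e}) p (%om. g (insert e om) - g om))"
   using insert by (simp del: pexp_diff)
  thus ?thesis
   by (simp only: sum.distrib sum_distrib_left[symmetric] pexp_diff[of F])
 qed
 moreover have "(%p. pexp (insert f F) p g) = (%p. p * pexp F p ?g + (1 - p) * pexp F p g)"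
  using insert by (intro ext) (rule pexp_insert)
 ultimately show ?case by simp
qed

section \<open>Connections and paths\<close>

lemma linked_refl [simp]: "linked F x x"
 by (simp add: linked_def)

lemma linked_trans: "linked F x y ==> linked F y z ==> linked F x z"
 by (auto simp: linked_def)

lemma linked_sym: "linked F x y ==> linked F y x"
proof -
 have "sym {(x, y). {x, y} \<in> F}" by (auto simp: sym_def insert_commute)
 hence "sym ({(x, y). {x, y} \<in> F}\<^sup>*)" by (rule sym_rtrancl)
 thus "linked F x y ==> linked F y x" by (auto simp: linked_def sym_def)
qed

lemma linked_commute: "linked F x y \<longleftrightarrow> linked F y x"
 using linked_sym[of F x y] linked_sym[of F y x] by iprover

lemma linked_mono: "linked F x y ==> F \<subseteq> G ==> linked G x y"
 
proof -
 assume "linked F x y" "F \<subseteq> G"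
 moreover have "{(x, y). {x, y} \<in> F}\<^sup>* \<subseteq> {(x, y). {x, y} \<in> G}\<^sup>*"
  by (rule rtrancl_mono) (use \<open>F \<subseteq> G\<close> in auto)
 ultimately show ?thesis by (auto simp: linked_def)
qed

lemma linked_edge: "{x, y} \<in> F ==> linked F x y"
 by (auto simp: linked_def)

lemma linked_image: "linked F x y ==> linked ((`) g ` F) (g x) (g y)"
 unfolding linked_def
proof (induction rule: rtrancl_induct)
 case (step y z)
 have "{g y, g z} \<in> (`) g ` F" using step(2) by (auto intro!: image_eqI[of _ _ "{y, z}"])
 thus ?case using step(3) by (auto intro: rtrancl_into_rtrancl)
qed simp

lemma increasing_linked: "increasing_event (%om. linked om x y)"
 unfolding increasing_event_def using linked_mono by metis

fun path_edges :: "'v list \<Rightarrow> 'v set set" where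
 "path_edges (x # y # zs) = insert {x, y} (path_edges (y # zs))"
| "path_edges _ = {}"

lemma path_edges_append: "path_edges (as @ z # bs) = path_edges (as @ [z]) \<union> path_edges (z # bs)"
proof (induction as)
 case (Cons a as) thus ?case by (cases as) simp_all
qed simp

lemma path_edges_endpoints: "e \<in> path_edges xs ==> \<exists>a\<in>set xs. \<exists>b\<in>set xs. e = {a, b}"
proof (induction xs rule: path_edges.induct)
 case (1 x y zs)
 show ?case
 proof (cases "e = {x, y}")
  case False
  hence "e \<in> path_edges (y # zs)" using 1(2) by simp
  from 1(1)[OF this] obtain a b where "a \<in> set (y # zs)" "b \<in> set (y # zs)" "e = {a, b}" by (elim bexE)
  thus ?thesis by (intro bexI[of _ a] bexI[of _ b]) simp_all
 qed auto
qed simp_all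

lemma path_edges_snoc:
 "e \<in> path_edges (as @ [z]) ==> \<exists>a\<in>set as. \<exists>b\<in>set (as @ [z]). e = {a, b}"
proof (induction as)
 case (Cons a as)
 show ?case
 proof (cases as)
  case Nil thus ?thesis using Cons.prems by auto
 next
  case (Cons b bs)
  hence "e = {a, b} \<or> e \<in> path_edges (as @ [z])" using Cons.prems by simp
  thus ?thesis
  proof
   assume "e = {a, b}"
   thus ?thesis using Cons by auto
  next
   assume "e \<in> path_edges (as @ [z])"
   from Cons.IH[OF this] obtain c d where "c \<in> set as" "d \<in> set (as @ [z])" "e = {c, d}" by (elim bexE)
   thus ?thesis by auto
  qed
 qed
qed simp

lemma path_edges_disjoint:
 assumes "distinct (as @ z # bs)"
 shows "path_edges (as @ [z]) \<inter> path_edges (z # bs) = {}"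
proof (rule ccontr)
 assume "\<not> ?thesis"
 then obtain e where e: "e \<in> path_edges (as @ [z])" "e \<in> path_edges (z # bs)" by blast
 then obtain a b c d where "a \<in> set as" "e = {a, b}" "c \<in> set (z # bs)" "d \<in> set (z # bs)" "e = {c, d}"
  using path_edges_snoc[OF e(1)] path_edges_endpoints[OF e(2)] by blast
 thus False using assms by (auto simp: doubleton_eq_iff)
qed

lemma linked_path_edges: "xs \<noteq> [] ==> linked (path_edges xs) (hd xs) (last xs)"
proof (induction xs rule: path_edges.induct)
 case (1 x y zs)
 hence "linked (path_edges (y # zs)) y (last (y # zs))" by simp
 hence "linked (path_edges (x # y # zs)) y (last (y # zs))" by (rule linked_mono) auto
 moreover have "linked (path_edges (x # y # zs)) x y" by (rule linked_edge) simp
 ultimately show ?case by (auto intro: linked_trans)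
qed auto

lemma linked_imp_path:
 assumes "linked F x y"
 shows "\<exists>xs. xs \<noteq> [] \<and> hd xs = x \<and> last xs = y \<and> distinct xs \<and> path_edges xs \<subseteq> F"
 using assms unfolding linked_def
proof (induction rule: converse_rtrancl_induct)
 case base
 show ?case by (intro exI[of _ "[y]"]) simp
next
 case (step a b)
 then obtain xs where xs: "xs \<noteq> []" "hd xs = b" "last xs = y" "distinct xs" "path_edges xs \<subseteq> F" by blast
 show ?case
 proof (cases "a \<in> set xs")
  case True
  then obtain as bs where "xs = as @ a # bs" by (meson split_list)
  thus ?thesis using xs path_edges_append[of as a bs] by (intro exI[of _ "a # bs"]) auto
 next
  case False
  obtain zs where "xs = b # zs" using xs by (cases xs) auto
  thus ?thesis using xs False step(1) by (intro exI[of _ "a # xs"]) auto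
 qed
qed

lemma linked_prefix: "linked (path_edges (as @ [z])) (hd (as @ [z])) z"
 using linked_path_edges[of "as @ [z]"] by simp

abbreviation reaches :: "('v \<Rightarrow> real) \<Rightarrow> real \<Rightarrow> 'v \<Rightarrow> 'v set set \<Rightarrow> bool" where
 "reaches h T v \<equiv> %om. \<exists>x. T <= h x \<and> linked om v x"

text \<open>\<open>lo h T\<close>: edges with an endpoint below level \<open>T\<close>; \<open>hi h T\<close>: edges inside \<open>{h \<ge> T}\<close>.
 These are complementary, so explorations below a level leave the edges above it fresh.\<close>

definition lo :: "('v \<Rightarrow> real) \<Rightarrow> real \<Rightarrow> 'v set set" where
 "lo h T = {e. \<exists>x\<in>e. h x < T}"

definition hi :: "('v \<Rightarrow> real) \<Rightarrow> real \<Rightarrow> 'v set set" where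
 "hi h T = {e. \<forall>x\<in>e. T <= h x}"

definition le :: "('v \<Rightarrow> real) \<Rightarrow> real \<Rightarrow> 'v set set" where
 "le h T = {e. \<forall>x\<in>e. h x <= T}"

lemma lo_eq: "lo h T = - hi h T"
 by (rule Set.set_eqI) (simp add: lo_def hi_def not_le)

lemma lo_hi_disjoint [simp]: "lo h T \<inter> hi h T = {}" "hi h T \<inter> lo h T = {}"
 by (simp_all add: lo_eq)

lemma hi_antimono: "S <= T ==> hi h T \<subseteq> hi h S"
 by (rule subsetI) (simp add: hi_def, metis order_trans)

lemma lo_mono: "S <= T ==> lo h S \<subseteq> lo h T"
 by (simp add: lo_eq hi_antimono)

lemma split_at_max:
 fixes h :: "'v \<Rightarrow> real"
 assumes "linked F v w"
 shows "\<exists>z P Q. P \<subseteq> F \<inter> lo h (h z) \<inter> le h (h z) \<and> Q \<subseteq> F \<inter> le h (h z) \<and> P \<inter> Q = {} \<and>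
  linked P v z \<and> linked Q z w \<and> h v <= h z \<and> h w <= h z"
proof -
 obtain xs where xs: "xs \<noteq> []" "hd xs = v" "last xs = w" "distinct xs" "path_edges xs \<subseteq> F"
  using linked_imp_path[OF assms] by blast
 define M where "M = Max (h ` set xs)"
 have M: "\<And>x. x \<in> set xs ==> h x <= M" by (auto simp: M_def)
 have "M \<in> h ` set xs" unfolding M_def by (rule Max_in) (use xs in auto)
 hence "\<exists>x\<in>set xs. h x = M" by auto
 then obtain as z bs where sp: "xs = as @ z # bs" "h z = M" "\<forall>a\<in>set as. h a \<noteq> M"
  using split_list_first_prop[of xs "%x. h x = M"] by blast
 let ?P = "path_edges (as @ [z])" and ?Q = "path_edges (z # bs)"
 have sub: "path_edges xs = ?P \<union> ?Q" using sp path_edges_append by simp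
 have "?P \<subseteq> lo h M"
 proof
  fix e assume "e \<in> ?P"
  then obtain a b where "a \<in> set as" "e = {a, b}" using path_edges_snoc by fast
  thus "e \<in> lo h M" using sp M[of a] by (force simp: lo_def)
 qed
 moreover have "path_edges xs \<subseteq> le h M"
  using path_edges_endpoints M by (fastforce simp: le_def)
 moreover have "linked ?P v z" using linked_prefix[of as z] xs sp by (cases as) auto
 moreover have "linked ?Q z w" using linked_path_edges[of "z # bs"] xs sp by simp
 moreover have "h v <= M" "h w <= M" using M xs by auto
 moreover have "?P \<inter> ?Q = {}" using path_edges_disjoint[of as z bs] xs sp by simp
 ultimately show ?thesis using sub xs sp(2)
  by - (rule exI[of _ z], rule exI[of _ ?P], rule exI[of _ ?Q], auto)
qed

lemma split_at_min:
 fixes h :: "'v \<Rightarrow> real"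
 assumes "linked F v w"
 shows "\<exists>z P Q. P \<subseteq> F \<inter> hi h (h z) \<and> Q \<subseteq> F \<inter> hi h (h z) \<and> P \<inter> Q = {} \<and>
  linked P v z \<and> linked Q z w \<and> h z <= h v \<and> h z <= h w"
proof -
 have "le (%x. - h x) (- h z) = hi h (h z)" for z by (auto simp: le_def hi_def)
 thus ?thesis using split_at_max[OF assms, of "%x. - h x"] by auto
qed

lemma first_hit:
 assumes "linked F v x" "A x"
 shows "\<exists>z. A z \<and> linked (F \<inter> {e. \<exists>y\<in>e. \<not> A y}) v z \<and> linked F z x"
proof -
 obtain xs where xs: "xs \<noteq> []" "hd xs = v" "last xs = x" "distinct xs" "path_edges xs \<subseteq> F"
  using linked_imp_path[OF assms(1)] by blast
 hence "\<exists>x\<in>set xs. A x" using assms(2) last_in_set by blast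
 then obtain as z bs where sp: "xs = as @ z # bs" "A z" "\<forall>a\<in>set as. \<not> A a"
  using split_list_first_prop[of xs A] by blast
 have sub: "path_edges xs = path_edges (as @ [z]) \<union> path_edges (z # bs)"
  using sp path_edges_append by simp
 have "path_edges (as @ [z]) \<subseteq> F \<inter> {e. \<exists>y\<in>e. \<not> A y}"
 proof
  fix e assume e: "e \<in> path_edges (as @ [z])"
  then obtain a b where "a \<in> set as" "e = {a, b}" using path_edges_snoc by fast
  thus "e \<in> F \<inter> {e. \<exists>y\<in>e. \<not> A y}" using sp sub xs e by auto
 qed
 moreover have "linked (path_edges (as @ [z])) v z"
  using linked_prefix[of as z] xs sp by (cases as) auto
 moreover have "linked F z x"
  using linked_path_edges[of "z # bs"] xs sp sub by (auto intro: linked_mono)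
 ultimately show ?thesis using sp(2) by (blast intro: linked_mono)
qed

lemma first_hit_level:
 assumes "linked F v x" "T <= h x"
 shows "\<exists>z. T <= h z \<and> linked (F \<inter> lo h T) v z \<and> linked F z x"
proof -
 have "{e. \<exists>y\<in>e. \<not> T <= h y} = lo h T" by (auto simp: lo_def not_le)
 thus ?thesis using first_hit[OF assms(1), of "%y. T <= h y"] assms(2) by simp
qed

lemma split_tree:
 assumes "linked F v x" "linked F v y"
 shows "\<exists>w P Q R. P \<subseteq> F \<and> Q \<subseteq> F \<and> R \<subseteq> F \<and> P \<inter> Q = {} \<and> (P \<union> Q) \<inter> R = {} \<and>
  linked P v w \<and> linked Q w x \<and> linked R w y"
proof -
 obtain xs where xs: "xs \<noteq> []" "hd xs = v" "last xs = x" "distinct xs" "path_edges xs \<subseteq> F"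
  using linked_imp_path[OF assms(1)] by blast
 obtain ys where ys: "ys \<noteq> []" "hd ys = y" "last ys = v" "distinct ys" "path_edges ys \<subseteq> F"
  using linked_imp_path[OF linked_sym[OF assms(2)]] by blast
 have "v \<in> set xs" "v \<in> set ys" using xs ys last_in_set[of ys] by auto
 hence "\<exists>a\<in>set ys. a \<in> set xs" by blast
 then obtain as w bs where sp: "ys = as @ w # bs" "w \<in> set xs" "\<forall>a\<in>set as. a \<notin> set xs"
  using split_list_first_prop[of ys "%a. a \<in> set xs"] by blast
 obtain cs ds where sx: "xs = cs @ w # ds" using sp(2) by (meson split_list)
 let ?P = "path_edges (cs @ [w])" and ?Q = "path_edges (w # ds)" and ?R = "path_edges (as @ [w])"
 have sub: "path_edges xs = ?P \<union> ?Q" "?R \<subseteq> path_edges ys"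
  using sx sp path_edges_append[of cs w ds] path_edges_append[of as w bs] by auto
 have "path_edges xs \<inter> ?R = {}"
 proof (rule ccontr)
  assume "\<not> ?thesis"
  then obtain e where e: "e \<in> ?R" "e \<in> path_edges xs" by blast
  then obtain a b c d where "a \<in> set as" "e = {a, b}" "c \<in> set xs" "d \<in> set xs" "e = {c, d}"
   using path_edges_snoc[OF e(1)] path_edges_endpoints[OF e(2)] by blast
  thus False using sp by (auto simp: doubleton_eq_iff)
 qed
 moreover have "linked ?P v w" using linked_prefix[of cs w] xs sx by (cases cs) auto
 moreover have "linked ?Q w x" using linked_path_edges[of "w # ds"] xs sx by simp
 moreover have "linked ?R w y"
  using linked_prefix[of as w] ys sp by (cases as) (auto intro: linked_sym)
 moreover have "?P \<inter> ?Q = {}" using path_edges_disjoint[of cs w ds] xs sx by simp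
 ultimately show ?thesis using sub xs ys
  by - (rule exI[of _ w], rule exI[of _ ?P], rule exI[of _ ?Q], rule exI[of _ ?R], auto)
qed

lemma split_at_boundary:
 assumes "linked F v x" "v \<in> S" "x \<notin> S"
 shows "\<exists>a b P Q. a \<in> S \<and> b \<notin> S \<and> {a, b} \<in> F \<and> P \<subseteq> F \<inter> Pow S \<and> Q \<subseteq> F \<and>
  P \<inter> {{a, b}} = {} \<and> (P \<union> {{a, b}}) \<inter> Q = {} \<and> linked P v a \<and> linked Q b x"
proof -
 obtain xs where xs: "xs \<noteq> []" "hd xs = v" "last xs = x" "distinct xs" "path_edges xs \<subseteq> F"
  using linked_imp_path[OF assms(1)] by blast
 hence "\<exists>a\<in>set xs. a \<notin> S" using assms(3) last_in_set by blast
 then obtain as b bs where sp: "xs = as @ b # bs" "b \<notin> S" "\<forall>a\<in>set as. a \<in> S"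
  using split_list_first_prop[of xs "%a. a \<notin> S"] by blast
 have "as \<noteq> []" using sp xs assms(2) by (cases as) auto
 then obtain cs a where as: "as = cs @ [a]" by (cases as rule: rev_exhaust) auto
 let ?P = "path_edges (cs @ [a])" and ?Q = "path_edges (b # bs)"
 have PE: "path_edges xs = ?P \<union> insert {a, b} ?Q"
  using sp as path_edges_append[of cs a "b # bs"] by simp
 have "?P \<subseteq> Pow S" using path_edges_endpoints[of _ "cs @ [a]"] sp as by fastforce
 moreover have "{a, b} \<notin> Pow S" using sp by auto
 moreover have "?P \<inter> path_edges (a # b # bs) = {}"
  by (rule path_edges_disjoint) (use xs sp as in auto)
 moreover have "{a, b} \<notin> ?Q"
 proof
  assume "{a, b} \<in> ?Q"
  hence "a \<in> set (b # bs)" using path_edges_endpoints[of "{a, b}" "b # bs"] by (auto simp: doubleton_eq_iff)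
  thus False using xs sp as by auto
 qed
 moreover have "linked ?P v a" using linked_prefix[of cs a] xs sp as by (cases cs) auto
 moreover have "linked ?Q b x" using linked_path_edges[of "b # bs"] xs sp by simp
 ultimately show ?thesis using PE xs sp as
  by - (rule exI[of _ a], rule exI[of _ b], rule exI[of _ ?P], rule exI[of _ ?Q], auto)
qed

lemma linked_reach_finite:
 assumes "finite F" "\<And>e. e \<in> F ==> finite e"
 shows "finite {x. linked F v x}"
proof -
 have "{x. linked F v x} \<subseteq> insert v (\<Union>F)"
  unfolding linked_def by (auto elim: rtranclE)
 thus ?thesis using assms by (meson finite_Union finite_insert finite_subset)
qed

section \<open>BK bounds for connections\<close>

lemma linked_witness: "(\<exists>P\<in>{P. P \<subseteq> D \<and> linked P x y}. P \<subseteq> om) \<longleftrightarrow> linked (om \<inter> D) x y"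
proof
 assume "\<exists>P\<in>{P. P \<subseteq> D \<and> linked P x y}. P \<subseteq> om"
 then obtain P where "P \<subseteq> D" "linked P x y" "P \<subseteq> om" by auto
 thus "linked (om \<inter> D) x y" using linked_mono[of P x y] by simp
next
 assume "linked (om \<inter> D) x y"
 thus "\<exists>P\<in>{P. P \<subseteq> D \<and> linked P x y}. P \<subseteq> om" by (intro bexI[of _ "om \<inter> D"]) auto
qed

abbreviation conn :: "'v set set \<Rightarrow> real \<Rightarrow> 'v \<Rightarrow> 'v \<Rightarrow> real" where
 "conn F p x y \<equiv> Pr F p (%om. linked om x y)"

lemma BK_linked2:
 fixes p :: real
 assumes "finite F" "0 <= p" "p <= 1"
 shows "Pr F p (%om. \<exists>P Q. P \<subseteq> om \<inter> D1 \<and> Q \<subseteq> om \<inter> D2 \<and> P \<inter> Q = {} \<and> linked P a b \<and> linked Q c d)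
 <= conn (F \<inter> D1) p a b * conn (F \<inter> D2) p c d"
proof -
 let ?A = "{P. P \<subseteq> D1 \<and> linked P a b}" and ?B = "{P. P \<subseteq> D2 \<and> linked P c d}"
 have "Pr F p (%om. \<exists>P Q. P \<subseteq> om \<inter> D1 \<and> Q \<subseteq> om \<inter> D2 \<and> P \<inter> Q = {} \<and> linked P a b \<and> linked Q c d)
  <= Pr F p (%om. \<exists>P Q. P \<in> ?A \<and> Q \<in> ?B \<and> P \<inter> Q = {} \<and> P \<subseteq> om \<and> Q \<subseteq> om)"
  by (rule Pr_mono[OF assms(2,3)]) blast
 also have "... <= Pr F p (%om. \<exists>P\<in>?A. P \<subseteq> om) * Pr F p (%om. \<exists>Q\<in>?B. Q \<subseteq> om)"
  by (rule BK_inequality[OF assms])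
 also have "... = conn (F \<inter> D1) p a b * conn (F \<inter> D2) p c d"
  unfolding linked_witness by (simp add: Pr_restrict[OF assms(1), where A = "%om. linked om _ _"])
 finally show ?thesis .
qed

lemma BK_linked3:
 fixes p :: real
 assumes "finite F" "0 <= p" "p <= 1"
 shows "Pr F p (%om. \<exists>P Q R. P \<subseteq> om \<inter> D1 \<and> Q \<subseteq> om \<inter> D2 \<and> R \<subseteq> om \<inter> D3 \<and> P \<inter> Q = {} \<and> (P \<union> Q) \<inter> R = {} \<and>
   linked P a b \<and> linked Q c d \<and> linked R e f)
 <= conn (F \<inter> D1) p a b * conn (F \<inter> D2) p c d
  * conn (F \<inter> D3) p e f"
proof -
 let ?A = "{S. \<exists>P Q. S = P \<union> Q \<and> P \<subseteq> D1 \<and> Q \<subseteq> D2 \<and> P \<inter> Q = {} \<and> linked P a b \<and> linked Q c d}"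
  and ?B = "{P. P \<subseteq> D3 \<and> linked P e f}"
 have "Pr F p (%om. \<exists>P Q R. P \<subseteq> om \<inter> D1 \<and> Q \<subseteq> om \<inter> D2 \<and> R \<subseteq> om \<inter> D3 \<and> P \<inter> Q = {} \<and> (P \<union> Q) \<inter> R = {} \<and>
   linked P a b \<and> linked Q c d \<and> linked R e f)
  <= Pr F p (%om. \<exists>P Q. P \<in> ?A \<and> Q \<in> ?B \<and> P \<inter> Q = {} \<and> P \<subseteq> om \<and> Q \<subseteq> om)"
 proof (rule Pr_mono[OF assms(2,3)])
  fix om assume "\<exists>P Q R. P \<subseteq> om \<inter> D1 \<and> Q \<subseteq> om \<inter> D2 \<and> R \<subseteq> om \<inter> D3 \<and> P \<inter> Q = {} \<and> (P \<union> Q) \<inter> R = {} \<and>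
   linked P a b \<and> linked Q c d \<and> linked R e f"
  then obtain P Q R where *: "P \<subseteq> om \<inter> D1" "Q \<subseteq> om \<inter> D2" "R \<subseteq> om \<inter> D3" "P \<inter> Q = {}" "(P \<union> Q) \<inter> R = {}"
   "linked P a b" "linked Q c d" "linked R e f" by (elim exE conjE)
  show "\<exists>P Q. P \<in> ?A \<and> Q \<in> ?B \<and> P \<inter> Q = {} \<and> P \<subseteq> om \<and> Q \<subseteq> om"
  proof (rule exI[of _ "P \<union> Q"], rule exI[of _ R], intro conjI)
   show "P \<union> Q \<in> ?A" using * by blast
  qed (use * in auto)
 qed
 also have "... <= Pr F p (%om. \<exists>P\<in>?A. P \<subseteq> om) * Pr F p (%om. \<exists>Q\<in>?B. Q \<subseteq> om)"
  by (rule BK_inequality[OF assms])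
 also have "... <= (conn (F \<inter> D1) p a b * conn (F \<inter> D2) p c d)
  * conn (F \<inter> D3) p e f"
 proof (intro mult_mono)
  have "Pr F p (%om. \<exists>P\<in>?A. P \<subseteq> om) <=
   Pr F p (%om. \<exists>P Q. P \<subseteq> om \<inter> D1 \<and> Q \<subseteq> om \<inter> D2 \<and> P \<inter> Q = {} \<and> linked P a b \<and> linked Q c d)"
  proof (rule Pr_mono[OF assms(2,3)])
   fix om assume "\<exists>P\<in>?A. P \<subseteq> om"
   then obtain P Q where *: "P \<union> Q \<subseteq> om" "P \<subseteq> D1" "Q \<subseteq> D2" "P \<inter> Q = {}" "linked P a b" "linked Q c d"
    by auto
   show "\<exists>P Q. P \<subseteq> om \<inter> D1 \<and> Q \<subseteq> om \<inter> D2 \<and> P \<inter> Q = {} \<and> linked P a b \<and> linked Q c d"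
    by (rule exI[of _ P], rule exI[of _ Q]) (use * in auto)
  qed
  also have "... <= conn (F \<inter> D1) p a b * conn (F \<inter> D2) p c d"
   by (rule BK_linked2[OF assms])
  finally show "Pr F p (%om. \<exists>P\<in>?A. P \<subseteq> om) <= ..." .
  show "Pr F p (%om. \<exists>Q\<in>?B. Q \<subseteq> om) <= conn (F \<inter> D3) p e f"
   unfolding linked_witness by (simp add: Pr_restrict[OF assms(1), where A = "%om. linked om _ _"])
 qed (use assms in \<open>simp_all add: Pr_nonneg\<close>)
 finally show ?thesis .
qed

lemma linked_prob_max:
 fixes h :: "'v \<Rightarrow> real"
 assumes F: "finite F" "\<And>e. e \<in> F ==> finite e" and p: "0 <= p" "p <= 1"
  and Z: "finite Z" "\<And>z. linked F v z ==> h v <= h z ==> h w <= h z ==> z \<in> Z"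
 shows "conn F p v w <=
  (\<Sum>z\<in>Z. conn (F \<inter> lo h (h z)) p v z * conn (F \<inter> le h (h z)) p z w)"
proof -
 let ?ev = "%z om. \<exists>P Q. P \<subseteq> om \<inter> lo h (h z) \<and> Q \<subseteq> om \<inter> le h (h z) \<and> P \<inter> Q = {} \<and> linked P v z \<and> linked Q z w"
 have "conn F p v w <= Pr F p (%om. \<exists>z\<in>Z. ?ev z om)"
 proof (rule Pr_mono[OF p])
  fix om assume w: "om \<subseteq> F" "linked om v w"
  from split_at_max[OF w(2), of h] obtain z P Q where
   *: "P \<subseteq> om \<inter> lo h (h z) \<inter> le h (h z)" "Q \<subseteq> om \<inter> le h (h z)" "P \<inter> Q = {}" "linked P v z"
    "linked Q z w" "h v <= h z" "h w <= h z" by (elim exE conjE)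
  have "linked F v z" by (rule linked_mono[OF *(4)]) (use * w in auto)
  hence "z \<in> Z" using Z * by blast
  moreover have "?ev z om" using * by blast
  ultimately show "\<exists>z\<in>Z. ?ev z om" by (rule bexI[rotated])
 qed
 also have "... <= (\<Sum>z\<in>Z. Pr F p (?ev z))"
  by (rule Pr_Bex_le[OF p Z(1)])
 also have "... <= (\<Sum>z\<in>Z. conn (F \<inter> lo h (h z)) p v z * conn (F \<inter> le h (h z)) p z w)"
  by (rule sum_mono, rule BK_linked2[OF F(1) p])
 finally show ?thesis .
qed

lemma linked_prob_tree:
 assumes F: "finite F" "\<And>e. e \<in> F ==> finite e" and p: "0 <= p" "p <= 1"
  and Z: "finite Z" "\<And>z. linked F v z ==> z \<in> Z"
 shows "Pr F p (%om. linked om v x \<and> linked om v y) <=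
  (\<Sum>w\<in>Z. conn F p v w * conn F p w x * conn F p w y)"
proof -
 let ?ev = "%w om. \<exists>P Q R. P \<subseteq> om \<inter> UNIV \<and> Q \<subseteq> om \<inter> UNIV \<and> R \<subseteq> om \<inter> UNIV \<and> P \<inter> Q = {} \<and> (P \<union> Q) \<inter> R = {} \<and>
   linked P v w \<and> linked Q w x \<and> linked R w y"
 have "Pr F p (%om. linked om v x \<and> linked om v y) <= Pr F p (%om. \<exists>w\<in>Z. ?ev w om)"
 proof (rule Pr_mono[OF p])
  fix om assume w: "om \<subseteq> F" "linked om v x \<and> linked om v y"
  from split_tree[of om v x y] w obtain z P Q R where
   *: "P \<subseteq> om" "Q \<subseteq> om" "R \<subseteq> om" "P \<inter> Q = {}" "(P \<union> Q) \<inter> R = {}" "linked P v z"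
    "linked Q z x" "linked R z y" by (elim exE conjE) blast
  have "linked F v z" by (rule linked_mono[OF *(6)]) (use * w in auto)
  hence "z \<in> Z" using Z by blast
  moreover have "?ev z om" using * by auto
  ultimately show "\<exists>z\<in>Z. ?ev z om" by (rule bexI[rotated])
 qed
 also have "... <= (\<Sum>w\<in>Z. Pr F p (?ev w))"
  by (rule Pr_Bex_le[OF p Z(1)])
 also have "... <= (\<Sum>w\<in>Z. conn F p v w * conn F p w x * conn F p w y)"
  using BK_linked3[OF F(1) p, of UNIV UNIV UNIV] by (intro sum_mono) simp
 finally show ?thesis .
qed

lemma linked_prob_boundary:
 assumes F: "finite F" and p: "0 <= p" "p <= 1"
  and "v \<in> S" "x \<notin> S" "finite B" "\<And>a b. a \<in> S ==> b \<notin> S ==> {a, b} \<in> F ==> (a, b) \<in> B"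
  and B: "\<And>a b. (a, b) \<in> B ==> a \<noteq> b"
 shows "conn F p v x <=
  (\<Sum>(a, b)\<in>B. conn (F \<inter> Pow S) p v a * p * conn F p b x)"
proof -
 let ?ev = "%(a, b) om. \<exists>P Q R. P \<subseteq> om \<inter> Pow S \<and> Q \<subseteq> om \<inter> {{a, b}} \<and> R \<subseteq> om \<inter> UNIV \<and> P \<inter> Q = {} \<and> (P \<union> Q) \<inter> R = {} \<and>
   linked P v a \<and> linked Q a b \<and> linked R b x"
 have "conn F p v x <= Pr F p (%om. \<exists>ab\<in>B. ?ev ab om)"
 proof (rule Pr_mono[OF p])
  fix om assume w: "om \<subseteq> F" "linked om v x"
  from split_at_boundary[OF w(2) \<open>v \<in> S\<close> \<open>x \<notin> S\<close>] obtain a b P Q where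
   *: "a \<in> S" "b \<notin> S" "{a, b} \<in> om" "P \<subseteq> om \<inter> Pow S" "Q \<subseteq> om" "P \<inter> {{a, b}} = {}"
    "(P \<union> {{a, b}}) \<inter> Q = {}" "linked P v a" "linked Q b x" by (elim exE conjE)
  have "(a, b) \<in> B" using assms * w by blast
  moreover have "?ev (a, b) om" unfolding prod.case
   by (rule exI[of _ P], rule exI[of _ "{{a, b}}"], rule exI[of _ Q]) (use * in \<open>auto intro: linked_edge\<close>)
  ultimately show "\<exists>ab\<in>B. ?ev ab om" by (rule bexI[rotated])
 qed
 also have "... <= (\<Sum>ab\<in>B. Pr F p (?ev ab))"
  by (rule Pr_Bex_le[OF p \<open>finite B\<close>])
 also have "... <= (\<Sum>(a, b)\<in>B. conn (F \<inter> Pow S) p v a * p * conn F p b x)"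
 proof (rule sum_mono)
  fix ab assume abB: "ab \<in> B"
  obtain a b where ab_eq: "ab = (a, b)" by (cases ab)
  have ab: "(a, b) \<in> B" using abB ab_eq by simp
  have "conn (F \<inter> {{a, b}}) p a b <= conn {{a, b}} p a b"
   by (rule Pr_mono_edges[OF _ _ increasing_linked p]) auto
  also have "... <= p"
  proof -
   have "\<not> linked {} a b" using B[OF ab] by (auto simp: linked_def)
   thus ?thesis using p unfolding Pr_def
    by (simp add: pexp_insert[of "{}" "{a, b}"])
  qed
  finally have e: "conn (F \<inter> {{a, b}}) p a b <= p" .
  have "Pr F p (?ev (a, b)) <= conn (F \<inter> Pow S) p v a *
   conn (F \<inter> {{a, b}}) p a b * conn F p b x"
   using BK_linked3[OF F p, of "Pow S" "{{a, b}}" UNIV v a a b b x] by simp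
  also have "... <= conn (F \<inter> Pow S) p v a * p * conn F p b x"
   using e p by (intro mult_right_mono mult_left_mono Pr_nonneg)
  finally show "Pr F p (?ev ab) <= (case ab of (a, b) \<Rightarrow>
    conn (F \<inter> Pow S) p v a * p * conn F p b x)"
   unfolding ab_eq prod.case .
 qed
 finally show ?thesis .
qed

section \<open>Quasi-transitive graphs\<close>

locale qt_graph =
 fixes V :: "'v set" and E :: "'v set set" and \<Gamma> :: "('v \<Rightarrow> 'v) set"
 assumes simple: "simple_graph V E" and conn: "connected_graph V E" and lf: "locally_finite_graph V E"
  and G_bij: "g \<in> \<Gamma> ==> bij_betw g V V"
  and G_edge: "g \<in> \<Gamma> ==> x \<in> V ==> y \<in> V ==> {g x, g y} \<in> E \<longleftrightarrow> {x, y} \<in> E"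
  and G_comp: "g \<in> \<Gamma> ==> k \<in> \<Gamma> ==> \<exists>j\<in>\<Gamma>. \<forall>x\<in>V. j x = g (k x)"
  and G_inv: "g \<in> \<Gamma> ==> \<exists>j\<in>\<Gamma>. \<forall>x\<in>V. j (g x) = x \<and> g (j x) = x"
  and G_id: "\<exists>j\<in>\<Gamma>. \<forall>x\<in>V. j x = x"
  and G_fin: "\<exists>R. finite R \<and> R \<subseteq> V \<and> (\<forall>x\<in>V. \<exists>r\<in>R. \<exists>g\<in>\<Gamma>. x = g r)"
begin

lemma G_in: "g \<in> \<Gamma> ==> x \<in> V ==> g x \<in> V"
 using G_bij bij_betwE by blast

lemma G_inj: "g \<in> \<Gamma> ==> inj_on g V"
 using G_bij bij_betw_imp_inj_on by blast

lemma edge_sub: "e \<in> E ==> e \<subseteq> V"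
 using simple by (auto simp: simple_graph_def)

lemma edge_finite: "e \<in> E ==> finite e"
 using simple by (auto simp: simple_graph_def intro: card_ge_0_finite)

lemma edge_form: "e \<in> E ==> \<exists>x\<in>V. \<exists>y\<in>V. x \<noteq> y \<and> e = {x, y}"
proof -
 assume "e \<in> E"
 hence e: "e \<subseteq> V" "card e = 2" using simple by (auto simp: simple_graph_def)
 then obtain x y where "e = {x, y}" "x \<noteq> y" by (auto simp: card_2_iff)
 thus ?thesis using e by auto
qed

lemma edge_in: "{x, y} \<in> E ==> x \<in> V \<and> y \<in> V \<and> x \<noteq> y"
 using simple by (force simp: simple_graph_def)

lemma linked_in: "F \<subseteq> E ==> x \<in> V ==> linked F x y ==> y \<in> V"
 unfolding linked_def by (erule rtranclE) (auto dest!: edge_in)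

definition orb :: "'v \<Rightarrow> 'v set" where "orb x = (%g. g x) ` \<Gamma>"

definition nb :: "'v \<Rightarrow> 'v set" where "nb x = {y. {x, y} \<in> E}"

fun bl :: "nat \<Rightarrow> 'v \<Rightarrow> 'v set" where
 "bl 0 x = {x}"
| "bl (Suc n) x = bl n x \<union> (\<Union>y\<in>bl n x. nb y)"

lemma orb_in: "x \<in> V ==> orb x \<subseteq> V"
 by (auto simp: orb_def G_in)

lemma nb_finite: "finite (nb x)"
proof (cases "x \<in> V")
 case True
 have "inj_on (%y. {x, y}) (nb x)" by (auto simp: inj_on_def doubleton_eq_iff)
 moreover have "(%y. {x, y}) ` nb x \<subseteq> {e \<in> E. x \<in> e}" by (auto simp: nb_def)
 moreover have "finite {e \<in> E. x \<in> e}" using lf True by (auto simp: locally_finite_graph_def)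
 ultimately show ?thesis by (meson finite_imageD finite_subset)
next
 case False
 hence "nb x = {}" using edge_in by (auto simp: nb_def)
 thus ?thesis by simp
qed

lemma nb_in: "y \<in> nb x ==> y \<in> V"
 using edge_in by (auto simp: nb_def)

lemma nb_sym: "y \<in> nb x \<longleftrightarrow> x \<in> nb y"
 by (simp add: nb_def insert_commute)

lemma bl_finite: "finite (bl n x)"
 by (induction n) (auto simp: nb_finite)

lemma bl_self: "x \<in> bl n x"
 by (induction n) auto

lemma bl_in: "x \<in> V ==> bl n x \<subseteq> V"
 by (induction n) (auto dest: nb_in)

lemma bl_mono: "m <= n ==> bl m x \<subseteq> bl n x"
 by (induction n) (auto simp: le_Suc_eq)

lemma bl_trans: "y \<in> bl m x ==> z \<in> bl n y ==> z \<in> bl (m + n) x"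
 by (induction n arbitrary: z) auto

lemma bl_sym: "y \<in> bl n x ==> x \<in> bl n y"
proof (induction n arbitrary: y)
 case (Suc n)
 show ?case
 proof (cases "y \<in> bl n x")
  case True thus ?thesis using Suc.IH by auto
 next
  case False
  then obtain z where "z \<in> bl n x" "y \<in> nb z" using Suc.prems by auto
  hence "x \<in> bl n z" "z \<in> bl (Suc 0) y" using Suc.IH nb_sym by auto
  thus ?thesis using bl_trans[of z "Suc 0" y x n] by simp
 qed
qed simp

lemma bl_cover:
 assumes "x \<in> V" "y \<in> V"
 shows "\<exists>n. y \<in> bl n x"
proof -
 have "linked E x y" using conn assms by (auto simp: connected_graph_def)
 thus ?thesis unfolding linked_def
 proof (induction rule: rtrancl_induct)
  case base thus ?case by (intro exI[of _ 0]) simp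
 next
  case (step y z)
  then obtain n where "y \<in> bl n x" by blast
  thus ?case using step(2) by (intro exI[of _ "Suc n"]) (auto simp: nb_def)
 qed
qed

lemma nb_G:
 assumes "g \<in> \<Gamma>" "x \<in> V"
 shows "nb (g x) = g ` nb x"
proof
 show "g ` nb x \<subseteq> nb (g x)" using assms G_edge edge_in by (auto simp: nb_def)
 show "nb (g x) \<subseteq> g ` nb x"
 proof
  fix y assume y: "y \<in> nb (g x)"
  obtain j where j: "j \<in> \<Gamma>" "\<forall>x\<in>V. j (g x) = x \<and> g (j x) = x" using G_inv assms by blast
  have "y \<in> V" using nb_in y by blast
  hence "g (j y) = y" "j y \<in> V" using j G_in by auto
  moreover have "{x, j y} \<in> E" using G_edge[OF assms \<open>j y \<in> V\<close>] y calculation by (simp add: nb_def)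
  ultimately show "y \<in> g ` nb x" by (force simp: nb_def)
 qed
qed

lemma bl_G: "g \<in> \<Gamma> ==> x \<in> V ==> bl n (g x) = g ` bl n x"
proof (induction n)
 case (Suc n)
 have "(\<Union>y\<in>g ` bl n x. nb y) = (\<Union>y\<in>bl n x. g ` nb y)"
  using bl_in[OF Suc.prems(2), of n] nb_G[OF Suc.prems(1)] by (simp add: subset_iff)
 thus ?case using Suc by (simp add: image_Un image_UN)
qed simp

lemma unif_bound:
 fixes \<phi> :: "'v \<Rightarrow> real"
 assumes "\<And>g x. g \<in> \<Gamma> ==> x \<in> V ==> \<phi> (g x) = \<phi> x"
 shows "\<exists>C. \<forall>x\<in>V. \<phi> x <= C"
proof -
 obtain R where R: "finite R" "R \<subseteq> V" "\<forall>x\<in>V. \<exists>r\<in>R. \<exists>g\<in>\<Gamma>. x = g r" using G_fin by blast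
 have "\<phi> x <= Max (insert 0 (\<phi> ` R))" if x: "x \<in> V" for x
 proof -
  obtain r g where "r \<in> R" "g \<in> \<Gamma>" "x = g r" using R x by blast
  hence "\<phi> x = \<phi> r" "\<phi> r \<in> \<phi> ` R" using assms R by auto
  thus ?thesis using R by (intro Max_ge) auto
 qed
 thus ?thesis by blast
qed

lemma bl_card: "\<exists>N. \<forall>x\<in>V. card (bl n x) <= N"
proof -
 have "\<exists>C. \<forall>x\<in>V. real (card (bl n x)) <= C"
 proof (rule unif_bound)
  fix g x assume "g \<in> \<Gamma>" "x \<in> V"
  thus "real (card (bl n (g x))) = real (card (bl n x))"
   using card_image[OF inj_on_subset[OF G_inj bl_in]] by (simp add: bl_G)
 qed
 then obtain C where C: "\<forall>x\<in>V. real (card (bl n x)) <= C" by blast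
 have "card (bl n x) <= nat \<lceil>C\<rceil>" if "x \<in> V" for x
 proof -
  have "real (card (bl n x)) <= real (nat \<lceil>C\<rceil>)"
   using order_trans[OF bspec[OF C that] real_nat_ceiling_ge[of C]] .
  thus ?thesis by simp
 qed
 thus ?thesis by blast
qed

lemma cocompact: "\<exists>L. \<forall>x\<in>V. \<forall>v\<in>V. \<exists>g\<in>\<Gamma>. g v \<in> bl L x"
proof -
 obtain R where R: "finite R" "R \<subseteq> V" "\<forall>x\<in>V. \<exists>r\<in>R. \<exists>g\<in>\<Gamma>. x = g r" using G_fin by blast
 have "\<forall>r\<in>R. \<forall>r'\<in>R. \<exists>n. r' \<in> bl n r" using bl_cover R by blast
 then obtain n where n: "\<And>r r'. r \<in> R ==> r' \<in> R ==> r' \<in> bl (n r r') r" by metis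
 define L where "L = Max (insert 0 ((%(r, r'). n r r') ` (R \<times> R)))"
 have L: "n r r' <= L" if "r \<in> R" "r' \<in> R" for r r'
  unfolding L_def by (rule Max_ge) (use R that in auto)
 have "\<exists>g\<in>\<Gamma>. g v \<in> bl L x" if xv: "x \<in> V" "v \<in> V" for x v
 proof -
  obtain r g where r: "r \<in> R" "g \<in> \<Gamma>" "x = g r" using R xv by blast
  obtain r' g' where r': "r' \<in> R" "g' \<in> \<Gamma>" "v = g' r'" using R xv by blast
  have rV: "r \<in> V" "r' \<in> V" using R r r' by auto
  obtain j where j: "j \<in> \<Gamma>" "\<forall>x\<in>V. j (g' x) = x \<and> g' (j x) = x" using G_inv r' by blast
  obtain k where k: "k \<in> \<Gamma>" "\<forall>x\<in>V. k x = g (j x)" using G_comp r j by blast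
  have "k v = g r'" using k j r' rV xv by auto
  moreover have "r' \<in> bl L r" using n[OF r(1) r'(1)] bl_mono[OF L[OF r(1) r'(1)]] by blast
  ultimately have "k v \<in> bl L x" using r rV by (simp add: bl_G)
  thus ?thesis using k by blast
 qed
 thus ?thesis by blast
qed

lemma bl_path:
 assumes "y \<in> bl n x"
 shows "\<exists>J. finite J \<and> card J <= n \<and> J \<subseteq> E \<and> (\<forall>e\<in>J. e \<subseteq> bl n x) \<and> linked J x y"
 using assms
proof (induction n arbitrary: y)
 case 0 thus ?case by (intro exI[of _ "{}"]) auto
next
 case (Suc n)
 show ?case
 proof (cases "y \<in> bl n x")
  case True
  then obtain J where "finite J \<and> card J <= n \<and> J \<subseteq> E \<and> (\<forall>e\<in>J. e \<subseteq> bl n x) \<and> linked J x y"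
   using Suc.IH by blast
  thus ?thesis by (intro exI[of _ J]) auto
 next
  case False
  then obtain z where z: "z \<in> bl n x" "y \<in> nb z" using Suc.prems by auto
  then obtain J where J: "finite J" "card J <= n" "J \<subseteq> E" "\<forall>e\<in>J. e \<subseteq> bl n x" "linked J x z"
   using Suc.IH by blast
  have "linked (insert {z, y} J) x z" by (rule linked_mono[OF J(5)]) auto
  moreover have "linked (insert {z, y} J) z y" by (rule linked_edge) simp
  ultimately have "linked (insert {z, y} J) x y" by (rule linked_trans)
  moreover have "card (insert {z, y} J) <= Suc n" using J by (simp add: card_insert_if)
  moreover have "{z, y} \<in> E" "y \<in> bl (Suc n) x" "z \<in> bl (Suc n) x" using z by (auto simp: nb_def)
  ultimately show ?thesis using J by (intro exI[of _ "insert {z, y} J"]) auto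
 qed
qed

section \<open>The modular function and the mass-transport principle\<close>

definition stab :: "'v \<Rightarrow> ('v \<Rightarrow> 'v) set" where "stab x = {g \<in> \<Gamma>. g x = x}"

definition sorb :: "'v \<Rightarrow> 'v \<Rightarrow> 'v set" where "sorb x y = (%g. g y) ` stab x"

definition porb :: "'v \<Rightarrow> 'v \<Rightarrow> 'v \<Rightarrow> 'v set" where "porb x y z = (%g. g z) ` (stab x \<inter> stab y)"

lemma sorb_finite: "x \<in> V ==> y \<in> V ==> finite (sorb x y)"
proof -
 assume xy: "x \<in> V" "y \<in> V"
 then obtain n where n: "y \<in> bl n x" using bl_cover by blast
 have "sorb x y \<subseteq> bl n x"
 proof
  fix z assume "z \<in> sorb x y"
  then obtain g where g: "g \<in> \<Gamma>" "g x = x" "z = g y" by (auto simp: sorb_def stab_def)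
  have "z \<in> bl n (g x)" unfolding bl_G[OF g(1) xy(1)] using n g by simp
  thus "z \<in> bl n x" using g by simp
 qed
 thus ?thesis using bl_finite finite_subset by blast
qed

lemma porb_sub: "porb x y z \<subseteq> sorb x z"
 by (auto simp: porb_def sorb_def)

lemma porb_commute: "porb x y z = porb y x z"
 by (simp add: porb_def Int_commute)

lemma sorb_self: "y \<in> V ==> y \<in> sorb x y" if "x \<in> V"
proof -
 assume "y \<in> V"
 moreover obtain j where "j \<in> \<Gamma>" "\<forall>x\<in>V. j x = x" using G_id by blast
 ultimately show ?thesis unfolding sorb_def stab_def using that by (intro image_eqI[of _ _ j]) auto
qed

lemma porb_self: "z \<in> V ==> z \<in> porb x y z" if "x \<in> V" "y \<in> V"
proof -
 assume "z \<in> V"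
 moreover obtain j where "j \<in> \<Gamma>" "\<forall>x\<in>V. j x = x" using G_id by blast
 ultimately show ?thesis unfolding porb_def stab_def using that by (intro image_eqI[of _ _ j]) auto
qed

lemma sorb_card_pos: "x \<in> V ==> y \<in> V ==> 0 < card (sorb x y)"
 unfolding card_gt_0_iff using sorb_finite[of x y] sorb_self[of x y] by auto

lemma porb_card_pos: "x \<in> V ==> y \<in> V ==> z \<in> V ==> 0 < card (porb x y z)"
 unfolding card_gt_0_iff using finite_subset[OF porb_sub sorb_finite, of x z y] porb_self[of x y z] by auto

lemma card_pair_orbit:
 assumes "x \<in> V" "y \<in> V" "z \<in> V"
 shows "card ((%g. (g y, g z)) ` stab x) = card (sorb x y) * card (porb x y z)"
proof -
 let ?P = "(%g. (g y, g z)) ` stab x"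
 have P: "?P = Sigma (sorb x y) (%u. {c. (u, c) \<in> ?P})" by (auto simp: sorb_def)
 have fib: "card {c. (u, c) \<in> ?P} = card (porb x y z)" if u: "u \<in> sorb x y" for u
 proof -
  obtain k where k: "k \<in> \<Gamma>" "k x = x" "k y = u" using u by (auto simp: sorb_def stab_def)
  obtain j where j: "j \<in> \<Gamma>" "\<forall>x\<in>V. j (k x) = x \<and> k (j x) = x" using G_inv k by blast
  have "{c. (u, c) \<in> ?P} = k ` porb x y z"
  proof
   show "{c. (u, c) \<in> ?P} \<subseteq> k ` porb x y z"
   proof
    fix c assume "c \<in> {c. (u, c) \<in> ?P}"
    then obtain g where g: "g \<in> \<Gamma>" "g x = x" "g y = u" "g z = c" by (auto simp: stab_def)
    obtain i where i: "i \<in> \<Gamma>" "\<forall>x\<in>V. i x = j (g x)" using G_comp j g by blast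
    have "i x = x" "i y = y" using i j g k assms by auto
    moreover have "k (i z) = c" using i j g assms G_in by auto
    ultimately show "c \<in> k ` porb x y z" using i by (force simp: porb_def stab_def)
   qed
   show "k ` porb x y z \<subseteq> {c. (u, c) \<in> ?P}"
   proof
    fix c assume "c \<in> k ` porb x y z"
    then obtain g where g: "g \<in> \<Gamma>" "g x = x" "g y = y" "c = k (g z)" by (auto simp: porb_def stab_def)
    obtain i where i: "i \<in> \<Gamma>" "\<forall>x\<in>V. i x = k (g x)" using G_comp k g by blast
    have "i \<in> stab x" "i y = u" "i z = c" using i g k assms by (auto simp: stab_def)
    thus "c \<in> {c. (u, c) \<in> ?P}" by force
   qed
  qed
  moreover have "inj_on k (porb x y z)"
   by (rule inj_on_subset[OF G_inj[OF k(1)]]) (use assms G_in in \<open>auto simp: porb_def stab_def\<close>)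
  ultimately show ?thesis by (simp add: card_image)
 qed
 have "card ?P = (\<Sum>u\<in>sorb x y. card {c. (u, c) \<in> ?P})"
 proof (subst P, rule card_SigmaI)
  show "finite (sorb x y)" using sorb_finite assms by blast
  show "\<forall>u\<in>sorb x y. finite {c. (u, c) \<in> ?P}"
  proof
   fix u
   have "{c. (u, c) \<in> ?P} \<subseteq> sorb x z" by (auto simp: sorb_def)
   thus "finite {c. (u, c) \<in> ?P}" using sorb_finite[OF assms(1,3)] finite_subset by blast
  qed
 qed
 also have "... = card (sorb x y) * card (porb x y z)" using fib by simp
 finally show ?thesis .
qed

lemma orbit_identity:
 assumes "x \<in> V" "y \<in> V" "z \<in> V"
 shows "card (sorb x y) * card (porb x y z) = card (sorb x z) * card (porb x z y)"
proof -
 have "(%g. (g z, g y)) ` stab x = prod.swap ` ((%g. (g y, g z)) ` stab x)" by (simp add: image_image)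
 hence "card ((%g. (g z, g y)) ` stab x) = card ((%g. (g y, g z)) ` stab x)"
  by (simp add: card_image)
 thus ?thesis using card_pair_orbit[OF assms] card_pair_orbit[OF assms(1,3,2)] by simp
qed

definition modr :: "'v \<Rightarrow> 'v \<Rightarrow> real" where
 "modr x y = real (card (sorb x y)) / real (card (sorb y x))"

lemma modr_pos: "x \<in> V ==> y \<in> V ==> 0 < modr x y"
 by (simp add: modr_def sorb_card_pos)

lemma modr_cocycle:
 assumes "x \<in> V" "y \<in> V" "z \<in> V"
 shows "modr x y = modr x z * modr z y"
proof -
 let ?a = "%x y. real (card (sorb x y))" and ?t = "%x y z. real (card (porb x y z))"
 have 1: "?a x y * ?t x y z = ?a x z * ?t x z y"
  using arg_cong[OF orbit_identity[OF assms], of real] by simp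
 have 2: "?a y x * ?t x y z = ?a y z * ?t y z x"
  using arg_cong[OF orbit_identity[OF assms(2,1,3)], of real] by (simp add: porb_commute[of y x])
 have 3: "?a z x * ?t x z y = ?a z y * ?t y z x"
  using arg_cong[OF orbit_identity[OF assms(3,1,2)], of real] by (simp add: porb_commute[of z])
 have pos: "0 < ?a x y" "0 < ?a y x" "0 < ?a x z" "0 < ?a z x" "0 < ?a y z" "0 < ?a z y"
  "0 < ?t x y z" "0 < ?t x z y" "0 < ?t y z x"
  using assms by (simp_all add: sorb_card_pos porb_card_pos)
 have "modr x y = (?a x y * ?t x y z) / (?a y x * ?t x y z)" using pos by (simp add: modr_def)
 also have "... = (?a x z * ?t x z y) / (?a y z * ?t y z x)" by (simp only: 1 2)
 also have "... = (?a x z * (?a z y * ?t y z x / ?a z x)) / (?a y z * ?t y z x)"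
  using 3 pos by (simp add: field_simps)
 also have "... = modr x z * modr z y" using pos by (simp add: modr_def field_simps)
 finally show ?thesis .
qed

lemma sorb_G:
 assumes "g \<in> \<Gamma>" "x \<in> V" "y \<in> V"
 shows "card (sorb (g x) (g y)) = card (sorb x y)"
proof -
 have le: "card (sorb x y) <= card (sorb (g x) (g y))" if gxy: "g \<in> \<Gamma>" "x \<in> V" "y \<in> V" for g x y
 proof (rule card_inj_on_le)
  show "inj_on g (sorb x y)"
   by (rule inj_on_subset[OF G_inj[OF gxy(1)]]) (use gxy G_in in \<open>auto simp: sorb_def stab_def\<close>)
  show "finite (sorb (g x) (g y))" using sorb_finite G_in gxy by blast
  show "g ` sorb x y \<subseteq> sorb (g x) (g y)"
  proof
   fix c assume "c \<in> g ` sorb x y"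
   then obtain k where k: "k \<in> \<Gamma>" "k x = x" "c = g (k y)" by (auto simp: sorb_def stab_def)
   obtain j where j: "j \<in> \<Gamma>" "\<forall>x\<in>V. j (g x) = x \<and> g (j x) = x" using G_inv gxy by blast
   obtain i where i: "i \<in> \<Gamma>" "\<forall>x\<in>V. i x = k (j x)" using G_comp k j by blast
   obtain f where f: "f \<in> \<Gamma>" "\<forall>x\<in>V. f x = g (i x)" using G_comp gxy i by blast
   have "f (g x) = g x" "f (g y) = c" using f i j k gxy G_in by auto
   thus "c \<in> sorb (g x) (g y)" using f by (force simp: sorb_def stab_def)
  qed
 qed
 obtain j where j: "j \<in> \<Gamma>" "\<forall>x\<in>V. j (g x) = x \<and> g (j x) = x" using G_inv assms by blast
 have "card (sorb (g x) (g y)) <= card (sorb (j (g x)) (j (g y)))"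
  by (rule le) (use j assms G_in in auto)
 thus ?thesis using le[OF assms] j assms by simp
qed

lemma modr_G: "g \<in> \<Gamma> ==> x \<in> V ==> y \<in> V ==> modr (g x) (g y) = modr x y"
 by (simp add: modr_def sorb_G)

theorem mass_transport:
 fixes F :: "'v \<Rightarrow> 'v \<Rightarrow> real"
 assumes inv: "\<And>g x y. g \<in> \<Gamma> ==> x \<in> V ==> y \<in> V ==> F (g x) (g y) = F x y"
  and nn: "\<And>x y. 0 <= F x y" and zv: "z \<in> V" "v \<in> V" and W: "finite W" "W \<subseteq> orb v"
 shows "\<exists>Y. finite Y \<and> Y \<subseteq> orb z \<and> (\<Sum>w\<in>W. F z w) <= (\<Sum>y\<in>Y. F y v * modr y v)"
proof -
 have "\<forall>w\<in>W. \<exists>g\<in>\<Gamma>. g w = v"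
 proof
  fix w assume "w \<in> W"
  then obtain k where k: "k \<in> \<Gamma>" "w = k v" using W by (auto simp: orb_def)
  thus "\<exists>g\<in>\<Gamma>. g w = v" using G_inv[OF k(1)] zv by auto
 qed
 then obtain g where g: "\<And>w. w \<in> W ==> g w \<in> \<Gamma> \<and> g w w = v" by metis
 define y where "y w = g w z" for w
 have WV: "w \<in> V" if "w \<in> W" for w using that W orb_in zv by blast
 have yV: "y w \<in> V" if "w \<in> W" for w using that g G_in zv by (simp add: y_def)
 define Y where "Y = (\<Union>w\<in>W. sorb v (y w))"
 have Yfin: "finite Y" using W yV zv sorb_finite by (auto simp: Y_def)
 have Yorb: "Y \<subseteq> orb z"
 proof
  fix a assume "a \<in> Y"
  then obtain w k where w: "w \<in> W" "k \<in> \<Gamma>" "a = k (y w)" by (auto simp: Y_def sorb_def stab_def)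
  then obtain i where "i \<in> \<Gamma>" "\<forall>x\<in>V. i x = k (g w x)" using G_comp[of k "g w"] g by blast
  thus "a \<in> orb z" unfolding orb_def using w zv by (intro image_eqI[of _ _ i]) (auto simp: y_def)
 qed
 have YV: "a \<in> V" if "a \<in> Y" for a using that Yorb orb_in zv by blast
 have same: "F a v = F (y w) v" "card (sorb v a) = card (sorb v (y w))"
  if wa: "w \<in> W" "a \<in> sorb v (y w)" for w a
 proof -
  obtain k where k: "k \<in> \<Gamma>" "k v = v" "a = k (y w)" using wa by (auto simp: sorb_def stab_def)
  show "F a v = F (y w) v" using inv[OF k(1) yV[OF wa(1)] zv(2)] k by simp
  show "card (sorb v a) = card (sorb v (y w))" using sorb_G[OF k(1) zv(2) yV[OF wa(1)]] k by simp
 qed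
 have Fzw: "F z w = (\<Sum>a\<in>Y. if a \<in> sorb v (y w) then F a v / card (sorb v a) else 0)" if w: "w \<in> W" for w
 proof -
  have "(\<Sum>a\<in>Y. if a \<in> sorb v (y w) then F a v / card (sorb v a) else 0)
   = (\<Sum>a\<in>sorb v (y w). F a v / card (sorb v a))"
   using Yfin w by (intro sum.mono_neutral_cong_right) (auto simp: Y_def)
  also have "... = (\<Sum>a\<in>sorb v (y w). F (y w) v / card (sorb v (y w)))"
   using same[OF w] by (intro sum.cong) auto
  also have "... = F (y w) v" using sorb_card_pos[OF zv(2) yV[OF w]] by simp
  also have "... = F z w" using inv[of "g w" z w] g[OF w] zv WV[OF w] by (simp add: y_def)
  finally show ?thesis ..
 qed
 have cnt: "card {w \<in> W. a \<in> sorb v (y w)} <= card (sorb a v)" if a: "a \<in> Y" for a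
 proof -
  have ex: "\<exists>k\<in>\<Gamma>. k z = a \<and> k w = v" if w: "w \<in> W" "a \<in> sorb v (y w)" for w
  proof -
   obtain k where k: "k \<in> \<Gamma>" "k v = v" "a = k (y w)" using w by (auto simp: sorb_def stab_def)
   obtain i where i: "i \<in> \<Gamma>" "\<forall>x\<in>V. i x = k (g w x)" using G_comp[of k "g w"] k g w by blast
   have "i z = a" "i w = v" using i k w zv WV g by (auto simp: y_def)
   thus ?thesis using i by blast
  qed
  obtain w0 where w0: "w0 \<in> W" "a \<in> sorb v (y w0)" using a by (auto simp: Y_def)
  then obtain k0 where k0: "k0 \<in> \<Gamma>" "k0 z = a" using ex by blast
  show ?thesis
  proof (rule card_inj_on_le)
   show "inj_on k0 {w \<in> W. a \<in> sorb v (y w)}"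
    by (rule inj_on_subset[OF G_inj[OF k0(1)]]) (use WV in auto)
   show "finite (sorb a v)" using sorb_finite YV a zv by blast
   show "k0 ` {w \<in> W. a \<in> sorb v (y w)} \<subseteq> sorb a v"
   proof
    fix c assume "c \<in> k0 ` {w \<in> W. a \<in> sorb v (y w)}"
    then obtain w where w: "w \<in> W" "a \<in> sorb v (y w)" "c = k0 w" by auto
    then obtain k where k: "k \<in> \<Gamma>" "k z = a" "k w = v" using ex by blast
    obtain j where j: "j \<in> \<Gamma>" "\<forall>x\<in>V. j (k x) = x \<and> k (j x) = x" using G_inv k by blast
    obtain i where i: "i \<in> \<Gamma>" "\<forall>x\<in>V. i x = k0 (j x)" using G_comp k0 j by blast
    have "j a = z" "j v = w" using j k zv WV w by auto
    hence "i a = a" "i v = c" using i k0 w zv YV a by auto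
    thus "c \<in> sorb a v" using i by (force simp: sorb_def stab_def)
   qed
  qed
 qed
 have "(\<Sum>w\<in>W. F z w) = (\<Sum>w\<in>W. \<Sum>a\<in>Y. if a \<in> sorb v (y w) then F a v / card (sorb v a) else 0)"
  using Fzw by simp
 also have "... = (\<Sum>a\<in>Y. \<Sum>w\<in>W. if a \<in> sorb v (y w) then F a v / card (sorb v a) else 0)"
  by (rule sum.swap)
 also have "... = (\<Sum>a\<in>Y. F a v / card (sorb v a) * card {w \<in> W. a \<in> sorb v (y w)})"
  using W by (intro sum.cong) (auto simp: sum.If_cases Int_def)
 also have "... <= (\<Sum>a\<in>Y. F a v / card (sorb v a) * card (sorb a v))"
  using cnt nn by (intro sum_mono mult_left_mono) auto
 also have "... = (\<Sum>a\<in>Y. F a v * modr a v)"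
  by (simp add: modr_def)
 finally show ?thesis using Yfin Yorb by blast
qed

end

section \<open>Height functions with monotone paths\<close>

context qt_graph
begin

fun mx :: "('v \<Rightarrow> real) \<Rightarrow> nat \<Rightarrow> 'v \<Rightarrow> real" where
 "mx H 0 x = H x"
| "mx H (Suc n) x = Max (mx H n ` nb x)"

text \<open>The maximal height \<open>mx H n x\<close> seen by walks of length \<open>n\<close> from \<open>x\<close> grows linearly at a
 rate \<open>\<theta>\<close> independent of \<open>x\<close>; the superior limit of \<open>mx H n x - n \<theta>\<close> is
 the required correction of \<open>H\<close> (a max-plus eigenvector).\<close>

theorem monotone_height:
 fixes H :: "'v \<Rightarrow> real"
 assumes inv: "\<And>g x y. g \<in> \<Gamma> ==> x \<in> V ==> y \<in> V ==> H (g x) - H (g y) = H x - H y"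
  and o: "v0 \<in> V" "g0 \<in> \<Gamma>" "H (g0 v0) > H v0"
 shows "\<exists>u \<theta> C. 0 < \<theta> \<and> (\<forall>x\<in>V. \<bar>u x - H x\<bar> <= C) \<and>
  (\<forall>g\<in>\<Gamma>. \<forall>x\<in>V. \<forall>y\<in>V. u (g x) - u (g y) = u x - u y) \<and>
  (\<forall>x\<in>V. \<exists>z. {x, z} \<in> E \<and> u x + \<theta> <= u z)"
proof -
 have nbne: "nb x \<noteq> {}" if x: "x \<in> V" for x
 proof -
  have "g0 v0 \<in> V" "g0 v0 \<noteq> v0" using o G_in by auto
  then obtain y where y: "y \<in> V" "y \<noteq> x" using o by blast
  obtain n where "y \<in> bl n x" using bl_cover x y by blast
  moreover have "bl n x = {x}" if "nb x = {}" for n using that by (induction n) auto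
  ultimately show ?thesis using y by auto
 qed
 obtain R where R: "finite R" "R \<subseteq> V" "\<forall>x\<in>V. \<exists>r\<in>R. \<exists>g\<in>\<Gamma>. x = g r" using G_fin by blast
 have "R \<noteq> {}" using R o by auto
 have mxG: "mx H n (g x) = mx H n x + (H (g x) - H x)" if g: "g \<in> \<Gamma>" and "x \<in> V" for g x n
  using that(2)
 proof (induction n arbitrary: x)
  case (Suc n)
  have "mx H n (g y) = mx H n y + (H (g x) - H x)" if "y \<in> nb x" for y
   using Suc.IH[OF nb_in[OF that]] inv[OF g nb_in[OF that] Suc.prems] by simp
  hence "mx H n ` g ` nb x = (%t. t + (H (g x) - H x)) ` (mx H n ` nb x)"
   unfolding image_image by (intro image_cong) auto
  hence "mx H (Suc n) (g x) = Max ((%t. t + (H (g x) - H x)) ` (mx H n ` nb x))"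
   using nb_G[OF g Suc.prems] by simp
  also have "... = Max (mx H n ` nb x) + (H (g x) - H x)"
   by (rule mono_Max_commute[symmetric]) (use nb_finite nbne[OF Suc.prems] in \<open>auto simp: mono_def\<close>)
  finally show ?case by simp
 qed simp
 define a where "a n x = mx H n x - H x" for n x
 have aG: "a n (g x) = a n x" if "g \<in> \<Gamma>" "x \<in> V" for g x n
  using mxG[OF that] by (simp add: a_def)
 define A where "A n = Max (a n ` R)" for n
 define I where "I n = Min (a n ` R)" for n
 have aA: "I n <= a n x" "a n x <= A n" if x: "x \<in> V" for n x
 proof -
  obtain r g where "r \<in> R" "g \<in> \<Gamma>" "x = g r" using R x by blast
  hence "a n x = a n r" "r \<in> R" using aG R by auto
  thus "I n <= a n x" "a n x <= A n" using R by (auto simp: A_def I_def)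
 qed
 have Aat: "\<exists>r\<in>V. A n = a n r" for n
 proof -
  have "A n \<in> a n ` R" unfolding A_def by (rule Max_in) (use R \<open>R \<noteq> {}\<close> in auto)
  thus ?thesis using R by auto
 qed
 have Iat: "\<exists>r\<in>V. I n = a n r" for n
 proof -
  have "I n \<in> a n ` R" unfolding I_def by (rule Min_in) (use R \<open>R \<noteq> {}\<close> in auto)
  thus ?thesis using R by auto
 qed
 have mxle: "mx H n z <= mx H (Suc n) x" if "z \<in> nb x" for n x z
  using that nb_finite by simp
 have mxat: "\<exists>z\<in>nb x. mx H (Suc n) x = mx H n z" if "x \<in> V" for n x
 proof -
  have "mx H (Suc n) x \<in> mx H n ` nb x" unfolding mx.simps
   by (rule Max_in) (use nb_finite nbne[OF that] in auto)
  thus ?thesis by auto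
 qed
 have mxA: "mx H (n + k) x <= mx H n x + A k" if "x \<in> V" for n k x
  using that
 proof (induction n arbitrary: x)
  case 0 thus ?case using aA(2)[of x k] by (simp add: a_def)
 next
  case (Suc n)
  obtain z where z: "z \<in> nb x" "mx H (Suc (n + k)) x = mx H (n + k) z" using mxat Suc.prems by blast
  thus ?case using Suc.IH[OF nb_in[OF z(1)]] mxle[OF z(1), of n] by simp
 qed
 have mxI: "mx H n x + I k <= mx H (n + k) x" if "x \<in> V" for n k x
  using that
 proof (induction n arbitrary: x)
  case 0 thus ?case using aA(1)[of x k] by (simp add: a_def)
 next
  case (Suc n)
  obtain z where z: "z \<in> nb x" "mx H (Suc n) x = mx H n z" using mxat Suc.prems by blast
  thus ?case using Suc.IH[OF nb_in[OF z(1)]] mxle[OF z(1), of "n + k"] by simp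
 qed
 have Asub: "A (n + k) <= A n + A k" for n k
 proof -
  obtain r where r: "r \<in> V" "A (n + k) = a (n + k) r" using Aat by blast
  thus ?thesis using mxA[OF r(1), of n k] aA(2)[OF r(1), of n] by (simp add: a_def)
 qed
 have Isup: "I n + I k <= I (n + k)" for n k
 proof -
  obtain r where r: "r \<in> V" "I (n + k) = a (n + k) r" using Iat by blast
  thus ?thesis using mxI[OF r(1), of n k] aA(1)[OF r(1), of n] by (simp add: a_def)
 qed
 have A0: "A 0 = 0" "I 0 = 0" using Aat[of 0] Iat[of 0] by (auto simp: a_def)
 define D where "D = \<bar>A (Suc 0)\<bar>"
 have step: "mx H n z <= mx H n x + D" if "z \<in> nb x" "x \<in> V" for n x z
  using mxle[OF that(1), of n] mxA[OF that(2), of n "Suc 0"] by (simp add: D_def)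
 have Hstep: "H z <= H x + D" if "z \<in> nb x" "x \<in> V" for x z
  using step[OF that, of 0] by simp
 obtain L where L: "\<forall>x\<in>V. \<forall>v\<in>V. \<exists>g\<in>\<Gamma>. g v \<in> bl L x" using cocompact by blast
 have ball: "a n y <= a n x + 2 * D * real l" if "y \<in> bl l x" "x \<in> V" for l n x y
  using that
 proof (induction l arbitrary: y)
  case (Suc l)
  have D: "0 <= D" by (simp add: D_def)
  show ?case
  proof (cases "y \<in> bl l x")
   case True thus ?thesis using Suc.IH[OF True Suc.prems(2)] D by (simp add: algebra_simps)
  next
   case False
   then obtain z where z: "z \<in> bl l x" "y \<in> nb z" using Suc.prems by auto
   have zV: "z \<in> V" using bl_in Suc.prems z by blast
   have "z \<in> nb y" "y \<in> V" using z nb_sym nb_in by auto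
   hence "a n y <= a n z + 2 * D"
    using step[OF z(2) zV, of n] Hstep[of z y] by (simp add: a_def)
   thus ?thesis using Suc.IH[OF z(1) Suc.prems(2)] by (simp add: algebra_simps)
  qed
 qed simp
 define C where "C = 2 * D * real L"
 have AI: "A n <= I n + C" for n
 proof -
  obtain r where r: "r \<in> V" "A n = a n r" using Aat by blast
  obtain s where s: "s \<in> V" "I n = a n s" using Iat by blast
  obtain g where g: "g \<in> \<Gamma>" "g r \<in> bl L s" using L r s by blast
  show ?thesis using ball[OF g(2) s(1), of n] aG[OF g(1) r(1), of n] r s by (simp add: C_def)
 qed
 have Ik: "real k * I n <= I (k * n)" for k n
 proof (induction k)
  case (Suc k) thus ?case using Isup[of n "k * n"] by (simp add: algebra_simps)
 qed (simp add: A0)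
 have Ak: "A (k * n) <= real k * A n" for k n
 proof (induction k)
  case (Suc k) thus ?case using Asub[of n "k * n"] by (simp add: algebra_simps)
 qed (simp add: A0)
 have IA: "I n <= A n" for n using Aat[of n] aA by fastforce
 have cross: "I n / real n <= A j / real j" if "0 < n" "0 < j" for n j
 proof -
  have "real j * I n <= real n * A j"
   using Ik[of j n] IA[of "j * n"] Ak[of n j] by (simp add: mult.commute)
  thus ?thesis using that by (simp add: field_simps)
 qed
 define \<theta> where "\<theta> = (SUP n\<in>{0<..}. I n / real n)"
 have bdd: "bdd_above ((%n. I n / real n) ` {0<..})"
  by (rule bdd_aboveI2[of _ _ "A 1 / real 1"]) (use cross[of _ 1] in auto)
 have I\<theta>: "I n <= real n * \<theta>" for n
 proof (cases "n = 0")
  case False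
  hence "I n / real n <= \<theta>" unfolding \<theta>_def by (intro cSUP_upper bdd) auto
  thus ?thesis using False by (simp add: field_simps)
 qed (simp add: A0)
 have A\<theta>: "real j * \<theta> <= A j" for j
 proof (cases "j = 0")
  case False
  have "\<theta> <= A j / real j" unfolding \<theta>_def by (rule cSUP_least) (use cross False in auto)
  thus ?thesis using False by (simp add: field_simps)
 qed (simp add: A0)
 have near: "\<bar>a n x - real n * \<theta>\<bar> <= C" if "x \<in> V" for n x
  using aA[OF that, of n] I\<theta>[of n] A\<theta>[of n] AI[of n] by linarith
 have exact: "\<exists>j\<le>l. \<forall>n. mx H n y <= mx H (n + j) x" if "y \<in> bl l x" for l x y
  using that
 proof (induction l arbitrary: y)
  case 0 thus ?case by (intro exI[of _ 0]) simp
 next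
  case (Suc l)
  show ?case
  proof (cases "y \<in> bl l x")
   case True thus ?thesis using Suc.IH by (meson le_SucI)
  next
   case False
   then obtain z where z: "z \<in> bl l x" "y \<in> nb z" using Suc.prems by auto
   then obtain j where j: "j <= l" "\<And>n. mx H n z <= mx H (n + j) x" using Suc.IH by blast
   have "mx H n y <= mx H (n + Suc j) x" for n
    using mxle[OF z(2), of n] j(2)[of "Suc n"] by simp
   thus ?thesis using j(1) by (intro exI[of _ "Suc j"]) auto
  qed
 qed
 have \<theta>pos: "0 < \<theta>"
 proof -
  define \<tau> where "\<tau> = H (g0 v0) - H v0"
  obtain l where "g0 v0 \<in> bl l v0" using bl_cover o G_in by blast
  then obtain j where j: "\<And>n. mx H n (g0 v0) <= mx H (n + j) v0" using exact by blast
  have "mx H n (g0 v0) = mx H n v0 + \<tau>" for n using mxG[OF o(2,1)] by (simp add: \<tau>_def)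
  hence j': "mx H n v0 + \<tau> <= mx H (n + j) v0" for n using j by metis
  have grow: "H v0 + real k * \<tau> <= mx H (k * j) v0" for k
  proof (induction k)
   case (Suc k) thus ?case using j'[of "k * j"] by (simp add: algebra_simps)
  qed simp
  have lin: "real k * \<tau> <= real k * (real j * \<theta>) + C" for k
   using grow[of k] near[OF o(1), of "k * j"] by (simp add: a_def abs_le_iff algebra_simps)
  have \<tau>: "0 < \<tau>" using o by (simp add: \<tau>_def)
  have "0 < real j * \<theta>"
  proof (rule ccontr)
   assume "\<not> 0 < real j * \<theta>"
   hence le: "real k * \<tau> <= C" for k
    using lin[of k] mult_nonneg_nonpos[of "real k" "real j * \<theta>"] by simp
   obtain k where "C / \<tau> < real k" using reals_Archimedean2 by blast
   thus False using le[of k] \<tau> by (simp add: field_simps)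
  qed
  thus ?thesis by (simp add: zero_less_mult_iff)
 qed
 define s where "s n x = mx H n x - real n * \<theta>" for n x
 have sb: "H x - C <= s n x" "s n x <= H x + C" if "x \<in> V" for n x
  using near[OF that, of n] by (auto simp: a_def s_def abs_le_iff)
 define Sx where "Sx x = {r. \<exists>\<^sub>F n in sequentially. r <= s n x}" for x
 define u where "u x = Sup (Sx x)" for x
 have Sin: "H x - C \<in> Sx x" if "x \<in> V" for x
  using sb(1)[OF that] by (simp add: Sx_def)
 have Sbd: "r <= H x + C" if xr: "x \<in> V" "r \<in> Sx x" for x r
 proof -
  have "\<exists>n. r <= s n x" using xr(2) unfolding Sx_def by (intro frequently_ex) simp
  then obtain n where "r <= s n x" by blast
  thus ?thesis using sb(2)[OF xr(1), of n] by simp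
 qed
 have Sbdd: "bdd_above (Sx x)" if "x \<in> V" for x
  by (rule bdd_aboveI[of _ "H x + C"]) (rule Sbd[OF that])
 have uH: "\<bar>u x - H x\<bar> <= C" if "x \<in> V" for x
 proof -
  have "H x - C <= u x" unfolding u_def by (rule cSup_upper[OF Sin[OF that] Sbdd[OF that]])
  moreover have "u x <= H x + C" unfolding u_def
   by (rule cSup_least) (use Sin[OF that] Sbd[OF that] in auto)
  ultimately show ?thesis by simp
 qed
 have uGle: "u x + (H (g x) - H x) <= u (g x)" if g: "g \<in> \<Gamma>" "x \<in> V" for g x
 proof -
  have "r <= u (g x) - (H (g x) - H x)" if "r \<in> Sx x" for r
  proof -
   have "s n (g x) = s n x + (H (g x) - H x)" for n using mxG[OF g, of n] by (simp add: s_def)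
   hence "r + (H (g x) - H x) \<in> Sx (g x)" using that by (simp add: Sx_def)
   hence "r + (H (g x) - H x) <= u (g x)" unfolding u_def
    by (rule cSup_upper) (rule Sbdd, use g G_in in blast)
   thus ?thesis by simp
  qed
  hence "u x <= u (g x) - (H (g x) - H x)" unfolding u_def[of x]
   by (intro cSup_least) (use Sin[OF g(2)] in auto)
  thus ?thesis by simp
 qed
 have uG: "u (g x) = u x + (H (g x) - H x)" if g: "g \<in> \<Gamma>" "x \<in> V" for g x
 proof -
  obtain j where j: "j \<in> \<Gamma>" "\<forall>x\<in>V. j (g x) = x \<and> g (j x) = x" using G_inv g(1) by blast
  have "u (g x) + (H x - H (g x)) <= u x" using uGle[OF j(1) G_in[OF g]] j(2) g(2) by simp
  thus ?thesis using uGle[OF g] by simp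
 qed
 have up: "\<exists>z. {x, z} \<in> E \<and> u x + \<theta> <= u z" if x: "x \<in> V" for x
 proof (rule ccontr)
  assume neg: "\<not> ?thesis"
  have lt: "u z < u x + \<theta>" if "z \<in> nb x" for z
   using neg that by (auto simp: nb_def not_le)
  define M where "M = Max (u ` nb x)"
  have M: "M < u x + \<theta>" "\<And>z. z \<in> nb x ==> u z <= M"
   using lt nb_finite nbne[OF x] by (auto simp: M_def)
  obtain c where c: "M < c" "c < u x + \<theta>" using M(1) dense by blast
  have "c - \<theta> < Sup (Sx x)" using c by (simp add: u_def)
  then obtain r where r: "r \<in> Sx x" "c - \<theta> < r" using less_cSup_iff[of "Sx x"] Sin[OF x] Sbdd[OF x] by auto
  have ev: "\<forall>\<^sub>F n in sequentially. \<forall>z\<in>nb x. s n z < c"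
  proof (rule eventually_ball_finite[OF nb_finite], rule ballI)
   fix z assume z: "z \<in> nb x"
   have "c \<notin> Sx z"
   proof
    assume "c \<in> Sx z"
    hence "c <= u z" unfolding u_def by (rule cSup_upper) (rule Sbdd[OF nb_in[OF z]])
    thus False using M(2)[OF z] c by simp
   qed
   thus "\<forall>\<^sub>F n in sequentially. s n z < c"
    by (simp add: Sx_def not_frequently not_le)
  qed
  have "\<forall>\<^sub>F n in sequentially. s (Suc n) x < c - \<theta>"
   using ev
  proof eventually_elim
   case (elim n)
   obtain z where z: "z \<in> nb x" "mx H (Suc n) x = mx H n z" using mxat x by blast
   thus ?case using elim by (auto simp: s_def algebra_simps)
  qed
  hence "\<forall>\<^sub>F n in sequentially. s n x < c - \<theta>"
   using eventually_sequentially_Suc[of "%n. s n x < c - \<theta>"] by blast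
  hence "\<forall>\<^sub>F n in sequentially. \<not> r <= s n x"
   by eventually_elim (use r in auto)
  thus False using r(1) by (simp add: Sx_def frequently_def)
 qed
 have equiv: "u (g x) - u (g y) = u x - u y" if "g \<in> \<Gamma>" "x \<in> V" "y \<in> V" for g x y
  using uG that inv[OF that] by simp
 show ?thesis
  by (rule exI[of _ u], rule exI[of _ \<theta>], rule exI[of _ C])
   (intro conjI ballI \<theta>pos uH up equiv; assumption)
qed

end

section \<open>Automorphism invariance and infinite-volume connection probabilities\<close>

context qt_graph
begin

lemma img_inj: "g \<in> \<Gamma> ==> inj_on ((`) g) E"
 by (rule inj_on_subset[OF inj_on_image_Pow[OF G_inj]]) (use edge_sub in auto)

lemma img_edge: "g \<in> \<Gamma> ==> e \<in> E ==> g ` e \<in> E"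
proof -
 assume g: "g \<in> \<Gamma>" "e \<in> E"
 then obtain x y where "x \<in> V" "y \<in> V" "e = {x, y}" using edge_form by blast
 thus "g ` e \<in> E" using G_edge[OF g(1)] g(2) by simp
qed

lemma img_inverse:
 assumes "g \<in> \<Gamma>"
 shows "\<exists>j\<in>\<Gamma>. (\<forall>x\<in>V. j (g x) = x \<and> g (j x) = x) \<and> (\<forall>e\<in>E. j ` g ` e = e \<and> g ` j ` e = e)"
proof -
 obtain j where j: "j \<in> \<Gamma>" "\<forall>x\<in>V. j (g x) = x \<and> g (j x) = x" using G_inv assms by blast
 have "j ` g ` e = e \<and> g ` j ` e = e" if "e \<in> E" for e
 proof -
  have "\<And>x. x \<in> e ==> j (g x) = x \<and> g (j x) = x" using j(2) edge_sub[OF that] by blast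
  thus ?thesis by (simp add: image_image)
 qed
 thus ?thesis using j by (intro bexI[of _ j]) auto
qed

lemma linked_img_iff:
 assumes g: "g \<in> \<Gamma>" and "F \<subseteq> E" "x \<in> V" "y \<in> V"
 shows "linked ((`) g ` F) (g x) (g y) \<longleftrightarrow> linked F x y"
proof
 assume "linked F x y" thus "linked ((`) g ` F) (g x) (g y)" by (rule linked_image)
next
 assume *: "linked ((`) g ` F) (g x) (g y)"
 obtain j where j: "j \<in> \<Gamma>" "\<forall>x\<in>V. j (g x) = x \<and> g (j x) = x"
  "\<forall>e\<in>E. j ` g ` e = e \<and> g ` j ` e = e" using img_inverse[OF g] by blast
 have "linked ((`) j ` (`) g ` F) (j (g x)) (j (g y))" by (rule linked_image[OF *])
 moreover have "(`) j ` (`) g ` F = F"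
 proof -
  have "\<And>e. e \<in> F ==> j ` g ` e = e" using j(3) assms(2) by blast
  thus ?thesis by (simp add: image_image)
 qed
 ultimately show "linked F x y" using j(2) assms by simp
qed

lemma prob_img:
 assumes g: "g \<in> \<Gamma>" and "F \<subseteq> E" "x \<in> V" "y \<in> V"
 shows "conn ((`) g ` F) p (g x) (g y) = conn F p x y"
proof -
 have "conn ((`) g ` F) p (g x) (g y) = Pr F p (%om. linked ((`) g ` om) (g x) (g y))"
  by (rule Pr_image) (rule inj_on_subset[OF img_inj[OF g] assms(2)])
 also have "... = conn F p x y"
  by (rule Pr_cong) (use linked_img_iff[OF g] assms in auto)
 finally show ?thesis .
qed

definition tau :: "real \<Rightarrow> 'v set set \<Rightarrow> 'v \<Rightarrow> 'v \<Rightarrow> real" where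
 "tau p D x y = (SUP F\<in>{F. finite F \<and> F \<subseteq> E \<inter> D}. conn F p x y)"

lemma tau_upper:
 assumes "0 <= p" "p <= 1" "finite F" "F \<subseteq> E \<inter> D"
 shows "conn F p x y <= tau p D x y"
 unfolding tau_def
proof (rule cSUP_upper)
 show "bdd_above ((%F. conn F p x y) ` {F. finite F \<and> F \<subseteq> E \<inter> D})"
  by (rule bdd_aboveI2[of _ _ 1]) (use assms Pr_le_1 in auto)
qed (use assms in auto)

lemma tau_least:
 assumes "\<And>F. finite F ==> F \<subseteq> E \<inter> D ==> conn F p x y <= c"
 shows "tau p D x y <= c"
 unfolding tau_def
proof (rule cSUP_least)
 show "{F. finite F \<and> F \<subseteq> E \<inter> D} \<noteq> {}" by blast
 fix F assume "F \<in> {F. finite F \<and> F \<subseteq> E \<inter> D}"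
 thus "conn F p x y <= c" using assms[of F] by simp
qed

lemma tau_nonneg: "0 <= p ==> p <= 1 ==> 0 <= tau p D x y"
 using tau_upper[of p "{}" D x y] Pr_nonneg[of p "{}" "%om. linked om x y"] by simp

lemma tau_approx:
 assumes "0 <= p" "p <= 1" "0 < \<epsilon>"
 shows "\<exists>F. finite F \<and> F \<subseteq> E \<inter> D \<and> tau p D x y - \<epsilon> < conn F p x y"
proof (rule ccontr)
 assume "\<not> ?thesis"
 hence "tau p D x y <= tau p D x y - \<epsilon>"
  by (intro tau_least) (meson not_less)
 thus False using assms by simp
qed

lemma tau_commute: "tau p D x y = tau p D y x"
 unfolding tau_def by (simp add: linked_commute[of _ x y])

lemma tau_img_le:
 assumes "0 <= p" "p <= 1" and g: "g \<in> \<Gamma>" and "x \<in> V" "y \<in> V"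
  and "\<And>e. e \<in> E \<inter> D ==> g ` e \<in> D'"
 shows "tau p D x y <= tau p D' (g x) (g y)"
proof (rule tau_least)
 fix F assume F: "finite F" "F \<subseteq> E \<inter> D"
 have "conn F p x y = conn ((`) g ` F) p (g x) (g y)"
  using prob_img[OF g] F assms by simp
 also have "... <= tau p D' (g x) (g y)"
 proof (rule tau_upper[OF assms(1,2)])
  show "(`) g ` F \<subseteq> E \<inter> D'" using F(2) assms(6) img_edge[OF g] by blast
 qed (use F in simp)
 finally show "conn F p x y <= tau p D' (g x) (g y)" .
qed

lemma tau_img:
 assumes p: "0 <= p" "p <= 1" and g: "g \<in> \<Gamma>" and xy: "x \<in> V" "y \<in> V"
  and D: "\<And>e. e \<in> E ==> g ` e \<in> D' \<longleftrightarrow> e \<in> D"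
 shows "tau p D' (g x) (g y) = tau p D x y"
proof (rule antisym)
 obtain j where j: "j \<in> \<Gamma>" "\<forall>x\<in>V. j (g x) = x \<and> g (j x) = x"
  "\<forall>e\<in>E. j ` g ` e = e \<and> g ` j ` e = e" using img_inverse[OF g] by blast
 have "tau p D' (g x) (g y) <= tau p D (j (g x)) (j (g y))"
 proof (rule tau_img_le[OF p j(1)])
  fix e assume e: "e \<in> E \<inter> D'"
  thus "j ` e \<in> D" using D[of "j ` e"] bspec[OF j(3), of e] img_edge[OF j(1), of e] by simp
 qed (use xy G_in g in auto)
 thus "tau p D' (g x) (g y) <= tau p D x y" using j(2) xy by simp
 show "tau p D x y <= tau p D' (g x) (g y)"
  by (rule tau_img_le[OF p g xy]) (use D in auto)
qed

lemma tau_sum_le: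
 assumes p: "0 <= p" "p <= 1" and Z: "finite Z" and c: "\<And>z. z \<in> Z ==> 0 <= c z"
  and B: "\<And>F. finite F ==> F \<subseteq> E ==> (\<Sum>z\<in>Z. c z * conn (F \<inter> D z) p (a z) (b z)) <= B"
 shows "(\<Sum>z\<in>Z. c z * tau p (D z) (a z) (b z)) <= B"
proof (rule field_le_epsilon)
 fix \<epsilon> :: real assume \<epsilon>: "0 < \<epsilon>"
 define S where "S = 1 + sum c Z"
 have S: "0 < S" using c sum_nonneg[of Z c] by (simp add: S_def add_pos_nonneg)
 have "\<forall>z. \<exists>F. finite F \<and> F \<subseteq> E \<inter> D z \<and> tau p (D z) (a z) (b z) - \<epsilon> / S < conn F p (a z) (b z)"
  using tau_approx[OF p, of "\<epsilon> / S"] \<epsilon> S by simp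
 then obtain F where F: "\<And>z. finite (F z) \<and> F z \<subseteq> E \<inter> D z \<and>
  tau p (D z) (a z) (b z) - \<epsilon> / S < conn (F z) p (a z) (b z)" by metis
 define FF where "FF = (\<Union>z\<in>Z. F z)"
 have FF: "finite FF" "FF \<subseteq> E" using F Z by (auto simp: FF_def)
 have "(\<Sum>z\<in>Z. c z * tau p (D z) (a z) (b z)) <=
  (\<Sum>z\<in>Z. c z * (conn (FF \<inter> D z) p (a z) (b z) + \<epsilon> / S))"
 proof (intro sum_mono mult_left_mono c)
  fix z assume z: "z \<in> Z"
  have "F z \<subseteq> FF \<inter> D z" using F[of z] z by (auto simp: FF_def)
  hence "conn (F z) p (a z) (b z) <= conn (FF \<inter> D z) p (a z) (b z)"
   by (intro Pr_mono_edges increasing_linked p) (use FF in auto)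
  thus "tau p (D z) (a z) (b z) <= conn (FF \<inter> D z) p (a z) (b z) + \<epsilon> / S"
   using F[of z] by simp
 qed
 also have "... = (\<Sum>z\<in>Z. c z * conn (FF \<inter> D z) p (a z) (b z)) + sum c Z * (\<epsilon> / S)"
  by (simp add: distrib_left sum.distrib sum_distrib_right sum_divide_distrib)
 also have "... <= B + \<epsilon>"
 proof (intro add_mono B FF)
  have "sum c Z * \<epsilon> <= S * \<epsilon>" using \<epsilon> by (simp add: S_def)
  thus "sum c Z * (\<epsilon> / S) <= \<epsilon>" using S by (simp add: field_simps)
 qed
 finally show "(\<Sum>z\<in>Z. c z * tau p (D z) (a z) (b z)) <= B + \<epsilon>" .
qed

abbreviation transport_const :: "real \<Rightarrow> bool" where
 "transport_const r \<equiv>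
  (\<forall>F c. (\<forall>g\<in>\<Gamma>. \<forall>x\<in>V. \<forall>y\<in>V. F (g x) (g y) = F x y) --> (\<forall>x y. 0 <= F x y) -->
  (\<forall>w\<in>V. \<forall>Z. finite Z --> Z \<subseteq> V --> (\<Sum>z\<in>Z. F z w * modr z w) <= c) -->
  (\<forall>z\<in>V. \<forall>W. finite W --> W \<subseteq> V --> (\<Sum>w\<in>W. F z w) <= r * c))"

lemma mass_transport_bound:
 fixes F :: "'v \<Rightarrow> 'v \<Rightarrow> real"
 shows "\<exists>r>0. transport_const r"
proof -
 obtain R where R: "finite R" "R \<subseteq> V" "\<forall>x\<in>V. \<exists>r\<in>R. \<exists>g\<in>\<Gamma>. x = g r" using G_fin by blast
 have main: "(\<Sum>w\<in>W. F z w) <= (real (card R) + 1) * c"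
  if inv: "\<forall>g\<in>\<Gamma>. \<forall>x\<in>V. \<forall>y\<in>V. F (g x) (g y) = F x y" and nn: "\<forall>x y. 0 <= F x y"
  and bd: "\<forall>w\<in>V. \<forall>Z. finite Z --> Z \<subseteq> V --> (\<Sum>z\<in>Z. F z w * modr z w) <= c"
  and z: "z \<in> V" and W: "finite W" "W \<subseteq> V" for F :: "'v \<Rightarrow> 'v \<Rightarrow> real" and c z W
 proof -
  have c: "0 <= c" using bd[rule_format, OF z, of "{}"] by simp
  have "W \<subseteq> (\<Union>r\<in>R. W \<inter> orb r)" using R W by (fastforce simp: orb_def)
  hence "(\<Sum>w\<in>W. F z w) <= (\<Sum>w\<in>(\<Union>r\<in>R. W \<inter> orb r). F z w)"
   using nn W R by (intro sum_mono2) auto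
  also have "... <= (\<Sum>r\<in>R. \<Sum>w\<in>W \<inter> orb r. F z w)"
  proof -
   have "(\<Sum>w\<in>(\<Union>r\<in>I. W \<inter> orb r). F z w) <= (\<Sum>r\<in>I. \<Sum>w\<in>W \<inter> orb r. F z w)" if "finite I" for I
    using that
   proof (induction I rule: finite_induct)
    case (insert i I)
    have "(\<Sum>w\<in>(\<Union>r\<in>insert i I. W \<inter> orb r). F z w) =
     (\<Sum>w\<in>(W \<inter> orb i) \<union> (\<Union>r\<in>I. W \<inter> orb r). F z w)" by simp
    also have "... <= (\<Sum>w\<in>W \<inter> orb i. F z w) + (\<Sum>w\<in>(\<Union>r\<in>I. W \<inter> orb r). F z w)"
     using sum.union_inter[of "W \<inter> orb i" "\<Union>r\<in>I. W \<inter> orb r" "F z"] W insert nn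
     sum_nonneg[of "W \<inter> orb i \<inter> (\<Union>r\<in>I. W \<inter> orb r)" "F z"] by simp
    finally show ?case using insert by simp
   qed simp
   thus ?thesis using R by blast
  qed
  also have "... <= (\<Sum>r\<in>R. c)"
  proof (rule sum_mono)
   fix r assume r: "r \<in> R"
   hence rV: "r \<in> V" using R by auto
   obtain Y where Y: "finite Y" "Y \<subseteq> orb z" "(\<Sum>w\<in>W \<inter> orb r. F z w) <= (\<Sum>y\<in>Y. F y r * modr y r)"
    using mass_transport[of F z r "W \<inter> orb r"] inv nn z rV W by auto
   have "Y \<subseteq> V" using Y orb_in[OF z] by auto
   thus "(\<Sum>w\<in>W \<inter> orb r. F z w) <= c" using Y bd rV by fastforce
  qed
  also have "... <= (real (card R) + 1) * c" using c by (simp add: algebra_simps)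
  finally show ?thesis .
 qed
 show ?thesis
  by (rule exI[of _ "real (card R) + 1"]) (use main in \<open>intro conjI allI impI ballI; simp add: add_nonneg_pos\<close>)
qed

section \<open>Chains, Lipschitz bounds and local finiteness\<close>

definition equivariant :: "('v \<Rightarrow> real) \<Rightarrow> bool" where
 "equivariant h \<longleftrightarrow> (\<forall>g\<in>\<Gamma>. \<forall>x\<in>V. \<forall>y\<in>V. h (g x) - h (g y) = h x - h y)"

lemma equivariantD: "equivariant h ==> g \<in> \<Gamma> ==> x \<in> V ==> y \<in> V ==> h (g x) - h (g y) = h x - h y"
 unfolding equivariant_def by blast

lemma equivariant_uminus: "equivariant h ==> equivariant (%x. - h x)"
 unfolding equivariant_def by simp

lemma lip_ball:
 assumes lip: "\<And>x y. {x, y} \<in> E ==> \<bar>h x - h y\<bar> <= D" and D: "0 <= D" and "y \<in> bl n x"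
 shows "\<bar>h y - h x\<bar> <= real n * D"
 using assms(3)
proof (induction n arbitrary: y)
 case (Suc n)
 show ?case
 proof (cases "y \<in> bl n x")
  case True
  show ?thesis using Suc.IH[OF True] D by (simp add: algebra_simps)
 next
  case False
  then obtain z where z: "z \<in> bl n x" "{z, y} \<in> E" using Suc.prems by (auto simp: nb_def)
  show ?thesis using Suc.IH[OF z(1)] lip[OF z(2)] by (simp add: algebra_simps)
 qed
qed simp

lemma up_chain:
 assumes up: "\<And>x. x \<in> V ==> \<exists>z. {x, z} \<in> E \<and> h x + \<theta> <= h z" and \<theta>: "0 < \<theta>"
  and x: "x \<in> V" and T: "T - h x <= real k * \<theta>"
 shows "\<exists>z J. z \<in> bl k x \<and> T <= h z \<and> finite J \<and> J \<subseteq> E \<inter> hi h (h x) \<inter> lo h T \<and>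
  card J <= k \<and> (\<forall>e\<in>J. e \<subseteq> bl k x) \<and> linked J x z"
 using x T
proof (induction k arbitrary: x)
 case 0 thus ?case by (intro exI[of _ x] exI[of _ "{}"]) auto
next
 case (Suc k)
 show ?case
 proof (cases "T <= h x")
  case True thus ?thesis using bl_self[of x "Suc k"] by (intro exI[of _ x] exI[of _ "{}"]) auto
 next
  case False
  obtain y where y: "{x, y} \<in> E" "h x + \<theta> <= h y" using up Suc.prems(1) by blast
  have yV: "y \<in> V" using edge_in y by blast
  have "T - h y <= real k * \<theta>" using Suc.prems(2) y(2) by (simp add: algebra_simps)
  from Suc.IH[OF yV this] obtain z J where zJ: "z \<in> bl k y" "T <= h z" "finite J" "J \<subseteq> E \<inter> hi h (h y) \<inter> lo h T"
   "card J <= k" "\<forall>e\<in>J. e \<subseteq> bl k y" "linked J y z" by (elim exE conjE)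
  have y1: "y \<in> bl (Suc 0) x" using y by (simp add: nb_def)
  have sub: "bl k y \<subseteq> bl (Suc k) x" using bl_trans[OF y1] by auto
  have "{x, y} \<in> hi h (h x)" "{x, y} \<in> lo h T" using y False \<theta> by (auto simp: hi_def lo_def)
  moreover have "hi h (h y) \<subseteq> hi h (h x)" using y \<theta> by (intro hi_antimono) simp
  ultimately have "insert {x, y} J \<subseteq> E \<inter> hi h (h x) \<inter> lo h T" using zJ y by blast
  moreover have "card (insert {x, y} J) <= Suc k" using zJ by (simp add: card_insert_if)
  moreover have "\<forall>e\<in>insert {x, y} J. e \<subseteq> bl (Suc k) x"
   using zJ(6) sub bl_self[of x "Suc k"] bl_self[of y k] by blast
  moreover have "linked (insert {x, y} J) x z"
   by (rule linked_trans[OF linked_edge linked_mono[OF zJ(7)]]) auto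
  moreover have "z \<in> bl (Suc k) x" "finite (insert {x, y} J)" using zJ sub by auto
  ultimately show ?thesis using zJ(2)
   by (intro exI[of _ z] exI[of _ "insert {x, y} J"] conjI)
 qed
qed

lemma ball_edges_finite: "finite {e \<in> E. e \<subseteq> bl n x}"
 by (rule finite_subset[of _ "Pow (bl n x)"]) (auto simp: bl_finite)

lemma ball_edges_card: "\<exists>N. \<forall>x\<in>V. card {e \<in> E. e \<subseteq> bl n x} <= N"
proof -
 obtain N where N: "\<forall>x\<in>V. card (bl n x) <= N" using bl_card by blast
 have "card {e \<in> E. e \<subseteq> bl n x} <= 2 ^ N" if "x \<in> V" for x
 proof -
  have "card {e \<in> E. e \<subseteq> bl n x} <= card (Pow (bl n x))" by (rule card_mono) (auto simp: bl_finite)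
  also have "... <= 2 ^ N" using N that by (simp add: card_Pow bl_finite)
  finally show ?thesis .
 qed
 thus ?thesis by blast
qed

lemma finite_edges_ball:
 assumes "finite F" "F \<subseteq> E" "x \<in> V"
 shows "\<exists>R. \<forall>e\<in>F. e \<subseteq> bl R x"
 using assms(1,2)
proof (induction F rule: finite_induct)
 case (insert e F)
 then obtain R where R: "\<forall>e\<in>F. e \<subseteq> bl R x" by blast
 obtain a b where ab: "a \<in> V" "b \<in> V" "e = {a, b}" using edge_form insert.prems by blast
 obtain n m where "a \<in> bl n x" "b \<in> bl m x" using bl_cover assms(3) ab by blast
 hence "a \<in> bl (R + n + m) x" "b \<in> bl (R + n + m) x"
  using bl_mono[of n "R + n + m" x] bl_mono[of m "R + n + m" x] by auto
 moreover have "\<forall>e\<in>F. e \<subseteq> bl (R + n + m) x" using R bl_mono[of R "R + n + m" x] by auto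
 ultimately show ?case using ab by (intro exI[of _ "R + n + m"]) auto
qed auto

lemma linked_last_edge: "linked F x b ==> b \<noteq> x ==> \<exists>c. {c, b} \<in> F"
 unfolding linked_def by (erule rtranclE) auto

end

section \<open>Concentration for sums of local functions\<close>

lemma pexp_local:
 assumes "finite F" "\<And>om. om \<subseteq> F ==> g om = g (om \<inter> K)"
 shows "pexp F p g = pexp (F \<inter> K) p g"
proof -
 have "pexp F p g = pexp F p (%om. g (om \<inter> (F \<inter> K)))"
 proof (rule pexp_cong)
  fix om assume w: "om \<subseteq> F"
  hence "om \<inter> (F \<inter> K) = om \<inter> K" by auto
  thus "g om = g (om \<inter> (F \<inter> K))" using assms(2)[OF w] by simp
 qed
 also have "... = pexp (F \<inter> K) p g" by (rule pexp_restrict) (use assms(1) in auto)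
 finally show ?thesis .
qed

lemma pexp_mult_local:
 assumes "finite F" "\<And>om. om \<subseteq> F ==> g om = g (om \<inter> K)" "\<And>om. om \<subseteq> F ==> k om = k (om \<inter> L)" "K \<inter> L = {}"
 shows "pexp F p (%om. g om * k om) = pexp F p g * pexp F p k"
proof -
 have "pexp F p (%om. g om * k om) = pexp F p (%om. g (om \<inter> K) * k (om \<inter> L))"
 proof (rule pexp_cong)
  fix om assume "om \<subseteq> F"
  show "g om * k om = g (om \<inter> K) * k (om \<inter> L)"
   using assms(2)[OF \<open>om \<subseteq> F\<close>] assms(3)[OF \<open>om \<subseteq> F\<close>] by presburger
 qed
 also have "... = pexp (F \<inter> K) p g * pexp (F \<inter> L) p k"
  by (rule pexp_indep[OF assms(1,4)])
 also have "... = pexp F p g * pexp F p k"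
  using pexp_local[of F g K p] pexp_local[of F k L p] assms by simp
 finally show ?thesis .
qed

lemma perc_chebyshev:
 fixes W :: "'a \<Rightarrow> 'e set \<Rightarrow> real"
 assumes F: "finite F" and q: "0 <= q" "q <= 1" and A: "finite A" "A \<noteq> {}"
  and loc: "\<And>a om. a \<in> A ==> om \<subseteq> F ==> W a om = W a (om \<inter> K a)"
  and bd: "\<And>a om. a \<in> A ==> om \<subseteq> F ==> 0 <= W a om \<and> W a om <= M"
  and N: "\<And>a. a \<in> A ==> real (card {b \<in> A. K a \<inter> K b \<noteq> {}}) <= N"
  and \<mu>: "0 < \<mu>" "\<And>a. a \<in> A ==> \<mu> <= pexp F q (W a)"
 shows "Pr F q (%om. (\<Sum>a\<in>A. W a om) < real (card A) * \<mu> / 2) <= 4 * N * M\<^sup>2 / (real (card A) * \<mu>\<^sup>2)"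
proof -
 define n where "n = real (card A)"
 have n: "0 < n" using A by (simp add: n_def card_gt_0_iff)
 define X where "X om = (\<Sum>a\<in>A. W a om)" for om
 define S where "S = (\<Sum>a\<in>A. pexp F q (W a))"
 have EX: "pexp F q X = S" unfolding X_def S_def by (rule pexp_sum)
 have nS: "n * \<mu> <= S" unfolding S_def n_def using \<mu>(2) by (rule sum_bounded_below)
 have pos: "0 < n * \<mu> / 2" using n \<mu> by simp
 have "Pr F q (%om. X om < n * \<mu> / 2) <= pexp F q (%om. 1 / (n * \<mu> / 2)\<^sup>2 * (X om - S)\<^sup>2)"
  unfolding Pr_def
 proof (intro pexp_mono q)
  fix om
  show "of_bool (X om < n * \<mu> / 2) <= 1 / (n * \<mu> / 2)\<^sup>2 * (X om - S)\<^sup>2"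
  proof (cases "X om < n * \<mu> / 2")
   case True
   hence "n * \<mu> / 2 <= S - X om" using nS by simp
   hence "(n * \<mu> / 2)\<^sup>2 <= (S - X om)\<^sup>2" using pos by (intro power_mono) auto
   hence "(n * \<mu> / 2)\<^sup>2 <= (X om - S)\<^sup>2" by (simp add: power2_commute)
   moreover have "0 < (n * \<mu> / 2)\<^sup>2" using pos by (rule zero_less_power)
   ultimately show ?thesis using True by (simp add: pos_le_divide_eq del: power_divide)
  qed simp
 qed
 also have "... = 1 / (n * \<mu> / 2)\<^sup>2 * pexp F q (%om. (X om - S)\<^sup>2)"
  by (rule pexp_cmult)
 also have "... <= 1 / (n * \<mu> / 2)\<^sup>2 * (n * N * M\<^sup>2)"
 proof (rule mult_left_mono)
  have "pexp F q (%om. (X om - S)\<^sup>2) = pexp F q (%om. X om * X om + (- 2 * S) * X om + S\<^sup>2)"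
   by (rule pexp_cong) (simp add: power2_eq_square algebra_simps)
  also have "... = pexp F q (%om. X om * X om) - S * S"
   by (simp only: pexp_add pexp_cmult EX pexp_const[OF F]) (simp add: power2_eq_square)
  also have "pexp F q (%om. X om * X om) = (\<Sum>a\<in>A. \<Sum>b\<in>A. pexp F q (%om. W a om * W b om))"
   unfolding X_def sum_product pexp_sum ..
  also have "S * S = (\<Sum>a\<in>A. \<Sum>b\<in>A. pexp F q (W a) * pexp F q (W b))"
   unfolding S_def sum_product ..
  also have "(\<Sum>a\<in>A. \<Sum>b\<in>A. pexp F q (%om. W a om * W b om)) - (\<Sum>a\<in>A. \<Sum>b\<in>A. pexp F q (W a) * pexp F q (W b))
   = (\<Sum>a\<in>A. \<Sum>b\<in>A. pexp F q (%om. W a om * W b om) - pexp F q (W a) * pexp F q (W b))"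
   by (simp add: sum_subtractf)
  also have "... <= (\<Sum>a\<in>A. \<Sum>b\<in>A. if K a \<inter> K b \<noteq> {} then M\<^sup>2 else 0)"
  proof (intro sum_mono)
   fix a b assume ab: "a \<in> A" "b \<in> A"
   show "pexp F q (%om. W a om * W b om) - pexp F q (W a) * pexp F q (W b)
    <= (if K a \<inter> K b \<noteq> {} then M\<^sup>2 else 0)"
   proof (cases "K a \<inter> K b = {}")
    case True
    have "pexp F q (%om. W a om * W b om) = pexp F q (W a) * pexp F q (W b)"
     by (rule pexp_mult_local[of F "W a" "K a" "W b" "K b"]) (use F loc ab True in auto)
    thus ?thesis using True by simp
   next
    case False
    have "pexp F q (%om. W a om * W b om) <= pexp F q (%om. M\<^sup>2)"
    proof (intro pexp_mono q)
     fix om assume "om \<subseteq> F"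
     thus "W a om * W b om <= M\<^sup>2"
      unfolding power2_eq_square using bd[OF ab(1)] bd[OF ab(2)] by (intro mult_mono) (auto intro: order_trans)
    qed
    also have "... = M\<^sup>2" by (rule pexp_const[OF F])
    moreover have "0 <= pexp F q (W a) * pexp F q (W b)"
     using bd ab q by (intro mult_nonneg_nonneg pexp_nonneg) auto
    ultimately show ?thesis using False by simp
   qed
  qed
  also have "... = (\<Sum>a\<in>A. real (card {b \<in> A. K a \<inter> K b \<noteq> {}}) * M\<^sup>2)"
   using A by (intro sum.cong refl) (simp add: sum.If_cases Int_def)
  also have "... <= (\<Sum>a\<in>A. N * M\<^sup>2)"
   using N by (intro sum_mono mult_right_mono) auto
  also have "... = n * N * M\<^sup>2" by (simp add: n_def)
  finally show "pexp F q (%om. (X om - S)\<^sup>2) <= n * N * M\<^sup>2" .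
 qed simp
 also have "1 / (n * \<mu> / 2)\<^sup>2 * (n * N * M\<^sup>2) = 4 * N * M\<^sup>2 / (n * \<mu>\<^sup>2)"
  using n by (simp add: power2_eq_square field_simps)
 finally show ?thesis by (simp add: X_def n_def)
qed

section \<open>Regeneration: many points at a level climb further\<close>

text \<open>The two height functions \<open>u\<close> and \<open>l\<close> differ by a bounded amount; from every vertex one can climb
 along \<open>u\<close> and descend along \<open>l\<close>. Both orientations \<open>(u, l, s)\<close> and \<open>(-l, -u, -s)\<close> are used later.\<close>

locale climb = qt_graph V E \<Gamma> for V :: "'v set" and E \<Gamma> +
 fixes u l :: "'v \<Rightarrow> real" and \<theta> D B \<kappa> s pm :: real
 assumes u_inv: "equivariant u" and l_inv: "equivariant l"
  and u_lip: "\<And>x y. {x, y} \<in> E ==> \<bar>u x - u y\<bar> <= D"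
  and l_lip: "\<And>x y. {x, y} \<in> E ==> \<bar>l x - l y\<bar> <= D"
  and ul: "\<And>x. x \<in> V ==> \<bar>u x - l x\<bar> <= B"
  and u_up: "\<And>x. x \<in> V ==> \<exists>z. {x, z} \<in> E \<and> u x + \<theta> <= u z"
  and l_down: "\<And>x. x \<in> V ==> \<exists>z. {x, z} \<in> E \<and> l z <= l x - \<theta>"
  and \<theta>: "0 < \<theta>" and D0: "0 <= D" and B0: "0 <= B" and \<kappa>: "0 < \<kappa>" and s: "\<bar>s\<bar> <= 1"
  and modr_le: "\<And>x y. x \<in> V ==> y \<in> V ==> modr x y <= \<kappa> * exp (s * (u x - u y))"
  and pm: "0 < pm" "pm <= 1"
begin

definition Nn :: "nat \<Rightarrow> 'v \<Rightarrow> 'v \<Rightarrow> 'v set set" where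
 "Nn c b a = {e \<in> E. e \<in> le l (l b) \<and> e \<in> hi u (u a) \<and> e \<subseteq> bl c b}"

definition Tg :: "nat \<Rightarrow> 'v \<Rightarrow> 'v set" where
 "Tg c b = {a \<in> bl c b. u a <= u b - (D + 2 * B) \<and> linked (Nn c b a) b a}"

definition Qy :: "real \<Rightarrow> nat \<Rightarrow> 'v \<Rightarrow> 'v set set" where
 "Qy t R y = {e \<in> E. e \<in> lo u (u y) \<and> (\<exists>x\<in>e. l y - t < l x) \<and> e \<subseteq> bl R y}"

definition Bz :: "real \<Rightarrow> nat \<Rightarrow> 'v \<Rightarrow> 'v set" where
 "Bz t R y = {b \<in> bl R y. l y - t - D <= l b \<and> l b <= l y - t}"

definition Zy :: "real \<Rightarrow> nat \<Rightarrow> 'v \<Rightarrow> 'v set set \<Rightarrow> 'v set" where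
 "Zy t R y om = {b \<in> Bz t R y. linked (om \<inter> Qy t R y) y b}"

definition fr :: "real \<Rightarrow> nat \<Rightarrow> 'v \<Rightarrow> 'v \<Rightarrow> 'v set set \<Rightarrow> real" where
 "fr t R y b om = of_bool (b \<in> Zy t R y om) / real (card (Zy t R y om))"

definition Fm :: "nat \<Rightarrow> real \<Rightarrow> nat \<Rightarrow> real \<Rightarrow> 'v \<Rightarrow> 'v \<Rightarrow> real" where
 "Fm c t R q y a = (\<Sum>b\<in>Bz t R y. of_bool (a \<in> Tg c b) * pexp (Qy t R y) q (fr t R y b))"

lemma u_ball: "y \<in> bl n x ==> \<bar>u y - u x\<bar> <= real n * D"
 by (rule lip_ball[of u D, OF u_lip D0])

lemma l_ball: "y \<in> bl n x ==> \<bar>l y - l x\<bar> <= real n * D"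
 by (rule lip_ball[of l D, OF l_lip D0])

lemma edge_u: "e \<in> E ==> x \<in> e ==> y \<in> e ==> \<bar>u x - u y\<bar> <= D"
proof -
 assume e: "e \<in> E" "x \<in> e" "y \<in> e"
 then obtain a b where "e = {a, b}" using edge_form by blast
 thus ?thesis using u_lip[of a b] u_lip[of b a] e D0 by (auto simp: insert_commute)
qed

lemma edge_ne: "e \<in> E ==> e \<noteq> {}"
 using edge_form by blast

lemma target:
 "\<exists>c. \<forall>b\<in>V. \<forall>v\<in>V. \<exists>a\<in>orb v. a \<in> Tg c b"
proof -
 obtain L where L: "\<forall>x\<in>V. \<forall>v\<in>V. \<exists>g\<in>\<Gamma>. g v \<in> bl L x" using cocompact by blast
 define G2 where "G2 = (real L + 4) * D + 6 * B"
 define k2 where "k2 = nat \<lceil>G2 / \<theta>\<rceil>"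
 have k2: "G2 <= real k2 * \<theta>"
  using real_nat_ceiling_ge[of "G2 / \<theta>"] \<theta> by (simp add: k2_def field_simps)
 define G where "G = (2 * real k2 + 2 * real L) * D"
 define k3 where "k3 = nat \<lceil>G / \<theta>\<rceil>"
 have k3: "G <= real k3 * \<theta>"
  using real_nat_ceiling_ge[of "G / \<theta>"] \<theta> by (simp add: k3_def field_simps)
 have G0: "0 <= real L * D" "0 <= real k2 * D" using D0 by auto
 have Geq: "G = 2 * (real k2 * D) + 2 * (real L * D)" "G2 = real L * D + 4 * D + 6 * B"
  by (simp_all add: G_def G2_def algebra_simps)
 define c where "c = k2 + L + k3 + k3"
 have "\<exists>a\<in>orb v. a \<in> Tg c b" if bv: "b \<in> V" "v \<in> V" for b v
 proof -
  have "\<exists>z. {x, z} \<in> E \<and> - l x + \<theta> <= - l z" if "x \<in> V" for x using l_down[OF that] by force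
  from up_chain[of "%x. - l x", OF this \<theta> bv(1), of "- l b + G2" k2] k2
  obtain b' J1 where b': "b' \<in> bl k2 b" "- l b + G2 <= - l b'" "finite J1"
   "J1 \<subseteq> E \<inter> hi (%x. - l x) (- l b) \<inter> lo (%x. - l x) (- l b + G2)" "\<forall>e\<in>J1. e \<subseteq> bl k2 b" "linked J1 b b'" by auto
  from up_chain[of u, OF u_up \<theta> bv(2), of "u v + G" k3] k3
  obtain z J3 where z: "z \<in> bl k3 v" "u v + G <= u z" "finite J3"
   "J3 \<subseteq> E \<inter> hi u (u v) \<inter> lo u (u v + G)" "\<forall>e\<in>J3. e \<subseteq> bl k3 v" "linked J3 v z" by auto
  have b'V: "b' \<in> V" using b' bl_in[OF bv(1)] by blast
  have zV: "z \<in> V" using z bl_in[OF bv(2)] by blast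
  obtain g where g: "g \<in> \<Gamma>" "g z \<in> bl L b'" using L b'V zV by blast
  define a where "a = g v"
  have aV: "a \<in> V" "g z \<in> V" using G_in g bv zV by (auto simp: a_def)
  obtain J2 where J2: "J2 \<subseteq> E" "\<forall>e\<in>J2. e \<subseteq> bl L b'" "linked J2 b' (g z)" using bl_path[OF g(2)] by blast
  have ugz: "u a + G <= u (g z)" using equivariantD[OF u_inv g(1) zV bv(2)] z(2) by (simp add: a_def)
  have h1: "\<bar>u b' - u b\<bar> <= real k2 * D" using u_ball[OF b'(1)] .
  have h2: "\<bar>u (g z) - u b'\<bar> <= real L * D" using u_ball[OF g(2)] .
  have ulb: "\<bar>u b' - l b'\<bar> <= B" "\<bar>u b - l b\<bar> <= B" using ul b'V bv by auto
  have "v \<in> bl k3 z" using bl_sym[OF z(1)] .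
  hence "a \<in> bl k3 (g z)" using bl_G[OF g(1) zV] by (auto simp: a_def)
  hence a_near: "a \<in> bl (k2 + (L + k3)) b" using bl_trans[OF b'(1) bl_trans[OF g(2)]] by simp
  have abl: "a \<in> bl c b" using a_near bl_mono[of "k2 + (L + k3)" c b] by (auto simp: c_def)
  have ua: "u a <= u b - (D + 2 * B)"
  proof -
   have "u a <= u (g z) - G" using ugz by simp
   also have "... <= u b' + real L * D - G" using h2 by simp
   also have "... <= l b' + B + real L * D - G" using ulb by simp
   also have "... <= l b - G2 + B + real L * D - G" using b'(2) by simp
   also have "... <= u b + 2 * B + real L * D - G2 - G" using ulb by simp
   also have "... <= u b - (D + 2 * B)" using G0 D0 B0 Geq by linarith
   finally show ?thesis .
  qed
  have J1N: "J1 \<subseteq> Nn c b a"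
  proof
   fix e assume e: "e \<in> J1"
   hence eE: "e \<in> E" "e \<subseteq> bl k2 b" "e \<in> hi (%x. - l x) (- l b)" using b' by auto
   have "u a <= u x" if "x \<in> e" for x
   proof -
    have "\<bar>u x - u b\<bar> <= real k2 * D" using u_ball that eE by blast
    thus ?thesis using h1 h2 ugz G0 Geq by linarith
   qed
   moreover have "e \<subseteq> bl c b" using eE bl_mono[of k2 c b] by (auto simp: c_def)
   ultimately show "e \<in> Nn c b a" using eE by (auto simp: Nn_def le_def hi_def)
  qed
  have J2N: "J2 \<subseteq> Nn c b a"
  proof
   fix e assume e: "e \<in> J2"
   hence eE: "e \<in> E" "e \<subseteq> bl L b'" using J2 by auto
   have "u a <= u x \<and> l x <= l b" if "x \<in> e" for x
   proof -
    have "\<bar>u x - u b'\<bar> <= real L * D" "\<bar>l x - l b'\<bar> <= real L * D" using u_ball l_ball that eE by blast+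
    thus ?thesis using h2 ugz G0 b'(2) D0 B0 Geq by linarith
   qed
   moreover have "e \<subseteq> bl c b"
   proof
    fix x assume "x \<in> e"
    hence "x \<in> bl (k2 + L) b" using bl_trans[OF b'(1)] eE by blast
    thus "x \<in> bl c b" using bl_mono[of "k2 + L" c b] by (auto simp: c_def)
   qed
   ultimately show "e \<in> Nn c b a" using eE by (auto simp: Nn_def le_def hi_def)
  qed
  have J3N: "(`) g ` J3 \<subseteq> Nn c b a"
  proof
   fix e assume "e \<in> (`) g ` J3"
   then obtain e0 where e0: "e0 \<in> J3" "e = g ` e0" by auto
   hence eE: "e0 \<in> E" "e0 \<subseteq> bl k3 v" "e0 \<in> hi u (u v)" "e0 \<in> lo u (u v + G)" using z by auto
   have e0V: "e0 \<subseteq> V" using edge_sub eE by blast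
   have "u a <= u x \<and> l x <= l b" if x: "x \<in> e" for x
   proof -
    obtain w where w: "w \<in> e0" "x = g w" using x e0 by auto
    have wV: "w \<in> V" using w e0V by auto
    have xV: "x \<in> V" using G_in g wV w by auto
    have ux: "u x = u a + (u w - u v)" using equivariantD[OF u_inv g(1) wV bv(2)] w by (simp add: a_def)
    have "u v <= u w" using eE w by (auto simp: hi_def)
    moreover obtain w' where "w' \<in> e0" "u w' < u v + G" using eE by (auto simp: lo_def)
    hence "u w <= u v + G + D" using edge_u[OF eE(1) w(1)] by fastforce
    moreover have "l x <= u x + B" using ul[OF xV] by simp
    ultimately show ?thesis using ux h2 ulb ugz b'(2) D0 B0 G0 Geq by linarith
   qed
   moreover have "e \<subseteq> bl c b"
   proof -
    have "e \<subseteq> bl k3 a" using bl_G[OF g(1) bv(2)] eE e0 by (auto simp: a_def)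
    moreover have "bl k3 a \<subseteq> bl c b"
    proof
     fix x assume "x \<in> bl k3 a"
     hence "x \<in> bl (k2 + (L + k3) + k3) b" by (rule bl_trans[OF a_near])
     thus "x \<in> bl c b" by (simp add: c_def add.assoc)
    qed
    ultimately show ?thesis by blast
   qed
   moreover have "e \<in> E" using img_edge[OF g(1) eE(1)] e0 by simp
   ultimately show "e \<in> Nn c b a" by (auto simp: Nn_def le_def hi_def)
  qed
  have "linked (Nn c b a) b b'" by (rule linked_mono[OF b'(6) J1N])
  moreover have "linked (Nn c b a) b' (g z)" by (rule linked_mono[OF J2(3) J2N])
  moreover have "linked (Nn c b a) (g z) a"
   unfolding a_def by (rule linked_sym, rule linked_mono[OF linked_image[OF z(6)]]) (use J3N in \<open>simp add: a_def\<close>)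
  ultimately have "linked (Nn c b a) b a" by (blast intro: linked_trans)
  hence "a \<in> Tg c b" using abl ua by (simp add: Tg_def)
  moreover have "a \<in> orb v" using g by (auto simp: orb_def a_def)
  ultimately show ?thesis by blast
 qed
 thus ?thesis by blast
qed

end

context qt_graph
begin

lemma bl_inv: "g \<in> \<Gamma> ==> x \<in> V ==> y \<in> V ==> g x \<in> bl n (g y) \<longleftrightarrow> x \<in> bl n y"
 using bl_G[of g y n] inj_on_image_mem_iff[OF G_inj, of g x "bl n y"] bl_in[of y n] by simp

lemma bl_sub_inv: "g \<in> \<Gamma> ==> e \<in> E ==> y \<in> V ==> g ` e \<subseteq> bl n (g y) \<longleftrightarrow> e \<subseteq> bl n y"
 using bl_inv[of g _ y n] edge_sub[of e] by (auto simp: subset_iff)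

lemma img_Collect_edges:
 assumes g: "g \<in> \<Gamma>" and P: "\<And>e. e \<in> E ==> P' (g ` e) \<longleftrightarrow> P e"
 shows "{e \<in> E. P' e} = (`) g ` {e \<in> E. P e}"
proof (rule Set.set_eqI, rule iffI)
 fix e assume e: "e \<in> {e \<in> E. P' e}"
 obtain j where j: "j \<in> \<Gamma>" "\<forall>x\<in>V. j (g x) = x \<and> g (j x) = x"
  "\<forall>e\<in>E. j ` g ` e = e \<and> g ` j ` e = e" using img_inverse[OF g] by blast
 have "j ` e \<in> E" "g ` j ` e = e" using img_edge[OF j(1)] j(3) e by auto
 hence "j ` e \<in> {e \<in> E. P e}" using P[of "j ` e"] e by simp
 thus "e \<in> (`) g ` {e \<in> E. P e}" using \<open>g ` j ` e = e\<close> by (intro image_eqI[of _ _ "j ` e"]) auto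
next
 fix e assume "e \<in> (`) g ` {e \<in> E. P e}"
 thus "e \<in> {e \<in> E. P' e}" using P img_edge[OF g] by auto
qed

lemma img_Collect_vertices:
 assumes g: "g \<in> \<Gamma>" and X: "X \<subseteq> V" "X' = g ` X" and P: "\<And>x. x \<in> X ==> P' (g x) \<longleftrightarrow> P x"
 shows "{x \<in> X'. P' x} = g ` {x \<in> X. P x}"
 using P by (auto simp: X(2))

lemma equivariant_le_iff:
 assumes "equivariant h" "g \<in> \<Gamma>" "x \<in> V" "y \<in> V"
 shows "h (g x) <= h (g y) + c \<longleftrightarrow> h x <= h y + c" "h (g x) < h (g y) + c \<longleftrightarrow> h x < h y + c"
  "h (g y) + c <= h (g x) \<longleftrightarrow> h y + c <= h x" "h (g y) + c < h (g x) \<longleftrightarrow> h y + c < h x"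
 using equivariantD[OF assms] by auto

lemma img_lo_iff:
 assumes "equivariant h" "g \<in> \<Gamma>" "e \<in> E" "y \<in> V"
 shows "g ` e \<in> lo h (h (g y) + c) \<longleftrightarrow> e \<in> lo h (h y + c)"
 using equivariant_le_iff(2)[OF assms(1,2) _ assms(4)] edge_sub[OF assms(3)] by (auto simp: lo_def)

lemma img_hi_iff:
 assumes "equivariant h" "g \<in> \<Gamma>" "e \<in> E" "y \<in> V"
 shows "g ` e \<in> hi h (h (g y) + c) \<longleftrightarrow> e \<in> hi h (h y + c)"
 using img_lo_iff[OF assms, of c] by (simp add: lo_eq)

lemma img_le_iff:
 assumes "equivariant h" "g \<in> \<Gamma>" "e \<in> E" "y \<in> V"
 shows "g ` e \<in> le h (h (g y) + c) \<longleftrightarrow> e \<in> le h (h y + c)"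
 using equivariant_le_iff(1)[OF assms(1,2) _ assms(4)] edge_sub[OF assms(3)] by (auto simp: le_def)

end

context climb
begin

lemma Nn_img:
 assumes g: "g \<in> \<Gamma>" and ab: "a \<in> V" "b \<in> V"
 shows "Nn c (g b) (g a) = (`) g ` Nn c b a"
 unfolding Nn_def
proof (rule img_Collect_edges[OF g])
 fix e assume e: "e \<in> E"
 show "(g ` e \<in> le l (l (g b)) \<and> g ` e \<in> hi u (u (g a)) \<and> g ` e \<subseteq> bl c (g b)) =
  (e \<in> le l (l b) \<and> e \<in> hi u (u a) \<and> e \<subseteq> bl c b)"
  using img_le_iff[OF l_inv g e ab(2), of 0] img_hi_iff[OF u_inv g e ab(1), of 0] bl_sub_inv[OF g e ab(2)] by simp
qed

lemma Tg_img:
 assumes g: "g \<in> \<Gamma>" and b: "b \<in> V"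
 shows "Tg c (g b) = g ` Tg c b"
 unfolding Tg_def
proof (rule img_Collect_vertices[OF g bl_in[OF b] bl_G[OF g b]])
 fix a assume "a \<in> bl c b"
 hence a: "a \<in> V" using bl_in[OF b] by blast
 have "Nn c b a \<subseteq> E" by (auto simp: Nn_def)
 moreover have "(u (g a) <= u (g b) - (D + 2 * B)) = (u a <= u b - (D + 2 * B))"
  using equivariantD[OF u_inv g a b] by auto
 ultimately show "(u (g a) <= u (g b) - (D + 2 * B) \<and> linked (Nn c (g b) (g a)) (g b) (g a)) =
  (u a <= u b - (D + 2 * B) \<and> linked (Nn c b a) b a)"
  by (simp add: Nn_img[OF g a b] linked_img_iff[OF g _ b a])
qed

lemma Qy_sub: "Qy t R y \<subseteq> E"
 by (auto simp: Qy_def)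

lemma Qy_finite: "finite (Qy t R y)"
 by (rule finite_subset[OF _ ball_edges_finite[of R y]]) (auto simp: Qy_def)

lemma Bz_finite: "finite (Bz t R y)"
 by (rule finite_subset[OF _ bl_finite[of R y]]) (auto simp: Bz_def)

lemma Zy_sub: "Zy t R y om \<subseteq> Bz t R y"
 by (auto simp: Zy_def)

lemma Bz_sub: "y \<in> V ==> Bz t R y \<subseteq> V"
 using bl_in by (auto simp: Bz_def)

lemma Qy_img:
 assumes g: "g \<in> \<Gamma>" and y: "y \<in> V"
 shows "Qy t R (g y) = (`) g ` Qy t R y"
 unfolding Qy_def
proof (rule img_Collect_edges[OF g])
 fix e assume e: "e \<in> E"
 have "(\<exists>x\<in>g ` e. l (g y) - t < l x) = (\<exists>x\<in>e. l y - t < l x)"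
  using equivariant_le_iff(4)[OF l_inv g _ y, of _ "- t"] edge_sub[OF e] by auto
 thus "(g ` e \<in> lo u (u (g y)) \<and> (\<exists>x\<in>g ` e. l (g y) - t < l x) \<and> g ` e \<subseteq> bl R (g y)) =
  (e \<in> lo u (u y) \<and> (\<exists>x\<in>e. l y - t < l x) \<and> e \<subseteq> bl R y)"
  using img_lo_iff[OF u_inv g e y, of 0] bl_sub_inv[OF g e y] by simp
qed

lemma Bz_img:
 assumes g: "g \<in> \<Gamma>" and y: "y \<in> V"
 shows "Bz t R (g y) = g ` Bz t R y"
 unfolding Bz_def
proof (rule img_Collect_vertices[OF g bl_in[OF y] bl_G[OF g y]])
 fix b assume "b \<in> bl R y"
 hence b: "b \<in> V" using bl_in[OF y] by blast
 show "(l (g y) - t - D <= l (g b) \<and> l (g b) <= l (g y) - t) = (l y - t - D <= l b \<and> l b <= l y - t)"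
  using equivariantD[OF l_inv g b y] by auto
qed

lemma Zy_img:
 assumes g: "g \<in> \<Gamma>" and y: "y \<in> V" and w: "om \<subseteq> E"
 shows "Zy t R (g y) ((`) g ` om) = g ` Zy t R y om"
 unfolding Zy_def
proof (rule img_Collect_vertices[OF g Bz_sub[OF y] Bz_img[OF g y]])
 fix b assume "b \<in> Bz t R y"
 hence b: "b \<in> V" using Bz_sub[OF y] by blast
 have "(`) g ` om \<inter> Qy t R (g y) = (`) g ` (om \<inter> Qy t R y)"
  using inj_on_image_Int[OF img_inj[OF g] w Qy_sub] by (simp add: Qy_img[OF g y])
 thus "linked ((`) g ` om \<inter> Qy t R (g y)) (g y) (g b) = linked (om \<inter> Qy t R y) y b"
  using linked_img_iff[OF g _ y b, of "om \<inter> Qy t R y"] w by auto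
qed

lemma fr_img:
 assumes g: "g \<in> \<Gamma>" and y: "y \<in> V" and w: "om \<subseteq> E" and b: "b \<in> V"
 shows "fr t R (g y) (g b) ((`) g ` om) = fr t R y b om"
proof -
 have sub: "Zy t R y om \<subseteq> V" using Zy_sub Bz_sub[OF y] by blast
 have "card (g ` Zy t R y om) = card (Zy t R y om)"
  by (rule card_image) (rule inj_on_subset[OF G_inj[OF g] sub])
 moreover have "g b \<in> g ` Zy t R y om \<longleftrightarrow> b \<in> Zy t R y om"
  by (rule inj_on_image_mem_iff[OF G_inj[OF g] b sub])
 ultimately show ?thesis by (simp add: fr_def Zy_img[OF g y w])
qed

lemma Fm_img:
 assumes g: "g \<in> \<Gamma>" and y: "y \<in> V" and a: "a \<in> V"
 shows "Fm c t R q (g y) (g a) = Fm c t R q y a"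
proof -
 have inj: "inj_on g (Bz t R y)" by (rule inj_on_subset[OF G_inj[OF g] Bz_sub[OF y]])
 have "Fm c t R q (g y) (g a) = (\<Sum>b\<in>Bz t R y. of_bool (g a \<in> Tg c (g b)) * pexp (Qy t R (g y)) q (fr t R (g y) (g b)))"
  unfolding Fm_def Bz_img[OF g y] by (subst sum.reindex[OF inj]) simp
 also have "... = Fm c t R q y a"
  unfolding Fm_def
 proof (rule sum.cong[OF refl])
  fix b assume "b \<in> Bz t R y"
  hence b: "b \<in> V" using Bz_sub[OF y] by blast
  have "Tg c b \<subseteq> V" using bl_in[OF b] by (auto simp: Tg_def)
  hence "g a \<in> Tg c (g b) \<longleftrightarrow> a \<in> Tg c b"
   unfolding Tg_img[OF g b] by (rule inj_on_image_mem_iff[OF G_inj[OF g] a])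
  moreover have "pexp (Qy t R (g y)) q (fr t R (g y) (g b)) = pexp (Qy t R y) q (fr t R y b)"
  proof -
   have "pexp (Qy t R (g y)) q (fr t R (g y) (g b)) = pexp (Qy t R y) q (%om. fr t R (g y) (g b) ((`) g ` om))"
    unfolding Qy_img[OF g y] by (rule pexp_image[OF inj_on_subset[OF img_inj[OF g] Qy_sub]])
   also have "... = pexp (Qy t R y) q (fr t R y b)"
    by (rule pexp_cong, rule fr_img[OF g y _ b]) (use Qy_sub in blast)
   finally show ?thesis .
  qed
  ultimately show "of_bool (g a \<in> Tg c (g b)) * pexp (Qy t R (g y)) q (fr t R (g y) (g b)) =
   of_bool (a \<in> Tg c b) * pexp (Qy t R y) q (fr t R y b)" by simp
 qed
 finally show ?thesis .
qed

lemma fr_nonneg: "0 <= fr t R y b om"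
 by (simp add: fr_def)

lemma fr_sum: "(\<Sum>b\<in>Bz t R y. fr t R y b om) = of_bool (Zy t R y om \<noteq> {})"
proof -
 have fin: "finite (Zy t R y om)" using finite_subset[OF Zy_sub Bz_finite] .
 have "(\<Sum>b\<in>Bz t R y. fr t R y b om) = (\<Sum>b\<in>Zy t R y om. 1 / real (card (Zy t R y om)))"
  unfolding fr_def by (rule sum.mono_neutral_cong_right) (use Bz_finite Zy_sub in auto)
 also have "... = of_bool (Zy t R y om \<noteq> {})" using fin by (auto simp: card_eq_0_iff)
 finally show ?thesis .
qed

lemma Fm_nonneg: "0 <= q ==> q <= 1 ==> 0 <= Fm c t R q y a"
 unfolding Fm_def by (intro sum_nonneg mult_nonneg_nonneg pexp_nonneg fr_nonneg) auto

lemma transport_heights: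
 assumes y: "y \<in> V" and b: "b \<in> Bz t R y" and a: "a \<in> Tg c b"
 shows "a \<in> bl (R + c) y" "\<bar>u y - u a - t\<bar> <= 2 * B + D + real c * D" "u a <= l y - t - D - B" "u b <= l y - t + B"
proof -
 have bV: "b \<in> V" using b Bz_sub[OF y] by blast
 have "b \<in> bl R y" "a \<in> bl c b" using a b by (auto simp: Bz_def Tg_def)
 thus "a \<in> bl (R + c) y" by (rule bl_trans)
 have 1: "\<bar>u a - u b\<bar> <= real c * D" using u_ball \<open>a \<in> bl c b\<close> by blast
 have 2: "\<bar>u b - l b\<bar> <= B" "\<bar>u y - l y\<bar> <= B" using ul bV y by auto
 have 3: "l y - t - D <= l b" "l b <= l y - t" using b by (auto simp: Bz_def)
 show "\<bar>u y - u a - t\<bar> <= 2 * B + D + real c * D" using 1 2 3 D0 by linarith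
 show "u b <= l y - t + B" using 2 3 by linarith
 thus "u a <= l y - t - D - B" using a by (simp add: Tg_def)
qed

lemma mass_lower:
 assumes c: "\<forall>b\<in>V. \<forall>v\<in>V. \<exists>a\<in>orb v. a \<in> Tg c b" and y0: "y0 \<in> V" and a: "a \<in> V" and q: "0 <= q" "q <= 1"
  and \<psi>: "\<psi> <= Pr (Qy t R y0) q (%om. Zy t R y0 om \<noteq> {})"
 shows "\<psi> * exp (- s * t) / (\<kappa> * exp (2 * B + D + real c * D)) <= (\<Sum>y\<in>orb y0 \<inter> bl (R + c) a. Fm c t R q y a)"
proof -
 define c5 where "c5 = 2 * B + D + real c * D"
 define W where "W = orb a \<inter> bl (R + c) y0"
 have W: "finite W" "W \<subseteq> orb a" by (auto simp: W_def bl_finite)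
 have "\<psi> <= pexp (Qy t R y0) q (%om. \<Sum>b\<in>Bz t R y0. fr t R y0 b om)"
  using \<psi> by (simp add: fr_sum Pr_def)
 also have "... = (\<Sum>b\<in>Bz t R y0. pexp (Qy t R y0) q (fr t R y0 b))" by (rule pexp_sum)
 also have "... <= (\<Sum>b\<in>Bz t R y0. \<Sum>a'\<in>W. of_bool (a' \<in> Tg c b) * pexp (Qy t R y0) q (fr t R y0 b))"
 proof (rule sum_mono)
  fix b assume b: "b \<in> Bz t R y0"
  have e: "0 <= pexp (Qy t R y0) q (fr t R y0 b)" by (intro pexp_nonneg q fr_nonneg)
  obtain a' where a': "a' \<in> orb a" "a' \<in> Tg c b" using c b Bz_sub[OF y0] a by blast
  have "a' \<in> W" using a' transport_heights(1)[OF y0 b] by (auto simp: W_def)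
  hence "of_bool (a' \<in> Tg c b) * pexp (Qy t R y0) q (fr t R y0 b) <=
   (\<Sum>a'\<in>W. of_bool (a' \<in> Tg c b) * pexp (Qy t R y0) q (fr t R y0 b))"
   using e W(1) by (intro member_le_sum) auto
  thus "pexp (Qy t R y0) q (fr t R y0 b) <= (\<Sum>a'\<in>W. of_bool (a' \<in> Tg c b) * pexp (Qy t R y0) q (fr t R y0 b))"
   using a' by simp
 qed
 also have "... = (\<Sum>a'\<in>W. Fm c t R q y0 a')" unfolding Fm_def by (rule sum.swap)
 finally have 1: "\<psi> <= (\<Sum>a'\<in>W. Fm c t R q y0 a')" .
 have "\<exists>Y. finite Y \<and> Y \<subseteq> orb y0 \<and> (\<Sum>w\<in>W. Fm c t R q y0 w) <= (\<Sum>y\<in>Y. Fm c t R q y a * modr y a)"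
  by (rule mass_transport[of "Fm c t R q", OF Fm_img Fm_nonneg[OF q] y0 a W])
 then obtain Y where Y: "finite Y" "Y \<subseteq> orb y0" "(\<Sum>w\<in>W. Fm c t R q y0 w) <= (\<Sum>y\<in>Y. Fm c t R q y a * modr y a)"
  by (elim exE conjE)
 have "(\<Sum>y\<in>Y. Fm c t R q y a * modr y a) <= (\<Sum>y\<in>Y. of_bool (y \<in> bl (R + c) a) * (Fm c t R q y a * (\<kappa> * exp (s * t + c5))))"
 proof (rule sum_mono)
  fix y assume "y \<in> Y"
  hence y: "y \<in> V" using Y orb_in[OF y0] by blast
  show "Fm c t R q y a * modr y a <= of_bool (y \<in> bl (R + c) a) * (Fm c t R q y a * (\<kappa> * exp (s * t + c5)))"
  proof (cases "Fm c t R q y a = 0")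
   case False
   have "Fm c t R q y a = 0" if n: "\<forall>b\<in>Bz t R y. a \<notin> Tg c b"
    unfolding Fm_def by (rule sum.neutral) (use n in simp)
   with False obtain b where b: "b \<in> Bz t R y" "a \<in> Tg c b" by blast
   have near: "y \<in> bl (R + c) a" using transport_heights(1)[OF y b] bl_sym by blast
   have "s * (u y - u a) - s * t = s * (u y - u a - t)" by (simp add: algebra_simps)
   also have "... <= \<bar>s\<bar> * \<bar>u y - u a - t\<bar>" by (metis abs_ge_self abs_mult)
   also have "... <= 1 * c5" using s transport_heights(2)[OF y b] by (intro mult_mono) (auto simp: c5_def)
   finally have "s * (u y - u a) <= s * t + c5" by simp
   hence "modr y a <= \<kappa> * exp (s * t + c5)"
    using modr_le[OF y a] \<kappa> by (smt (verit) exp_le_cancel_iff mult_left_mono)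
   thus ?thesis using near Fm_nonneg[OF q, of c t R y a] by (simp add: mult_left_mono)
  qed simp
 qed
 also have "... = (\<Sum>y\<in>Y \<inter> bl (R + c) a. Fm c t R q y a) * (\<kappa> * exp (s * t + c5))"
  unfolding sum_distrib_right by (rule sum.mono_neutral_cong_right) (use Y in auto)
 also have "... <= (\<Sum>y\<in>orb y0 \<inter> bl (R + c) a. Fm c t R q y a) * (\<kappa> * exp (s * t + c5))"
  using Y \<kappa> Fm_nonneg[OF q] by (intro mult_right_mono sum_mono2) (auto simp: bl_finite)
 finally have "\<psi> <= (\<Sum>y\<in>orb y0 \<inter> bl (R + c) a. Fm c t R q y a) * (\<kappa> * exp (s * t + c5))"
  using 1 Y(3) by linarith
 thus ?thesis using \<kappa> by (simp add: exp_add exp_minus c5_def field_simps)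
qed

end

context climb
begin

definition Nu :: "nat \<Rightarrow> real \<Rightarrow> 'v \<Rightarrow> 'v set set" where
 "Nu k T' y = {e \<in> E. e \<in> hi u (u y) \<and> e \<in> lo u T' \<and> e \<subseteq> bl k y}"

definition Kk :: "real \<Rightarrow> real \<Rightarrow> nat \<Rightarrow> 'v \<Rightarrow> 'v set set" where
 "Kk T T' R a = {e \<in> E. e \<in> hi u T \<and> e \<in> lo u T' \<and> e \<subseteq> bl R a}"

definition trial :: "nat \<Rightarrow> nat \<Rightarrow> real \<Rightarrow> real \<Rightarrow> nat \<Rightarrow> 'v \<Rightarrow> 'v \<Rightarrow> 'v set set \<Rightarrow> real" where
 "trial c k T' t R y0 a om = (\<Sum>y\<in>orb y0 \<inter> bl (R + c) a. \<Sum>b\<in>Bz t R y.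
  of_bool (a \<in> Tg c b \<and> Nn c b a \<union> Nu k T' y \<subseteq> om) * fr t R y b om)"

lemma trial_regions:
 assumes aV: "a \<in> V" and y: "y \<in> V" and b: "b \<in> Bz t R y" and a: "a \<in> Tg c b"
  and T: "T <= u a" "u a <= T + D" and t: "2 * B + D + real c * D <= t" "2 * B < t"
  and T': "T' = T + t + (2 * D + 2 * B + real c * D)"
 shows "Qy t R y \<subseteq> Kk T T' (R + c + (R + c + k)) a" "Nn c b a \<subseteq> Kk T T' (R + c + (R + c + k)) a"
  "Nu k T' y \<subseteq> Kk T T' (R + c + (R + c + k)) a" "u y <= T'" "T' - u y <= 4 * B + 3 * D + 2 * (real c * D)"
  "Qy t R y \<inter> (Nn c b a \<union> Nu k T' y) = {}"
proof -
 have th: "a \<in> bl (R + c) y" "\<bar>u y - u a - t\<bar> <= 2 * B + D + real c * D" "u a <= l y - t - D - B" "u b <= l y - t + B"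
  using transport_heights[OF y b a] by auto
 have bV: "b \<in> V" using b Bz_sub[OF y] by blast
 have ya: "y \<in> bl (R + c) a" using bl_sym[OF th(1)] .
 have bb: "b \<in> bl R y" "l b <= l y - t" using b by (auto simp: Bz_def)
 show uy: "u y <= T'" "T' - u y <= 4 * B + 3 * D + 2 * (real c * D)" using th(2) T T' by linarith+
 have far: "bl m y \<subseteq> bl (R + c + (R + c + k)) a" if "m <= R + c + k" for m
 proof
  fix x assume "x \<in> bl m y"
  hence "x \<in> bl (R + c + m) a" by (rule bl_trans[OF ya])
  thus "x \<in> bl (R + c + (R + c + k)) a" using bl_mono[of "R + c + m" "R + c + (R + c + k)" a] that by auto
 qed
 show "Qy t R y \<subseteq> Kk T T' (R + c + (R + c + k)) a"
 proof
  fix e assume "e \<in> Qy t R y"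
  hence e: "e \<in> E" "e \<in> lo u (u y)" "e \<subseteq> bl R y" and "\<exists>x\<in>e. l y - t < l x" by (auto simp: Qy_def)
  then obtain x where x: "x \<in> e" "l y - t < l x" by blast
  have xV: "x \<in> V" using x e edge_sub by blast
  have "T <= u z" if "z \<in> e" for z
   using edge_u[OF e(1) x(1) that] ul[OF xV] x(2) th(3) T(1) by linarith
  hence "e \<in> hi u T" by (simp add: hi_def)
  moreover have "e \<in> lo u T'" using e(2) lo_mono[OF uy(1)] by blast
  ultimately show "e \<in> Kk T T' (R + c + (R + c + k)) a" using e far[of R] by (auto simp: Kk_def)
 qed
 show "Nn c b a \<subseteq> Kk T T' (R + c + (R + c + k)) a"
 proof
  fix e assume "e \<in> Nn c b a"
  hence e: "e \<in> E" "e \<in> le l (l b)" "e \<in> hi u (u a)" "e \<subseteq> bl c b" by (auto simp: Nn_def)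
  obtain x where x: "x \<in> e" using edge_ne[OF e(1)] by blast
  have xV: "x \<in> V" using x e edge_sub by blast
  have "l x <= l b" using e(2) x by (auto simp: le_def)
  hence "u x < T'" using ul[OF xV] ul[OF y] bb(2) uy(1) t(2) by linarith
  hence "e \<in> lo u T'" using x by (auto simp: lo_def)
  moreover have "e \<in> hi u T" using e(3) hi_antimono[OF T(1)] by blast
  moreover have "e \<subseteq> bl (R + c) y" using e(4) bl_trans[OF bb(1)] by blast
  ultimately show "e \<in> Kk T T' (R + c + (R + c + k)) a" using e(1) far[of "R + c"] by (auto simp: Kk_def)
 qed
 show "Nu k T' y \<subseteq> Kk T T' (R + c + (R + c + k)) a"
 proof
  fix e assume "e \<in> Nu k T' y"
  hence e: "e \<in> E" "e \<in> hi u (u y)" "e \<in> lo u T'" "e \<subseteq> bl k y" by (auto simp: Nu_def)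
  have "T <= u y" using th(2) T(1) t(1) by linarith
  hence "e \<in> hi u T" using e(2) hi_antimono by blast
  thus "e \<in> Kk T T' (R + c + (R + c + k)) a" using e far[of k] by (auto simp: Kk_def)
 qed
 show "Qy t R y \<inter> (Nn c b a \<union> Nu k T' y) = {}"
 proof -
  have "e \<notin> Nn c b a \<union> Nu k T' y" if "e \<in> Qy t R y" for e
  proof -
   have e: "e \<in> lo u (u y)" and "\<exists>x\<in>e. l y - t < l x" using that by (auto simp: Qy_def)
   then obtain x where x: "x \<in> e" "l y - t < l x" by blast
   hence "e \<notin> le l (l b)" using bb(2) by (force simp: le_def)
   moreover have "e \<notin> hi u (u y)" using e lo_hi_disjoint by blast
   ultimately show ?thesis by (simp add: Nn_def Nu_def)
  qed
  thus ?thesis by blast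
 qed
qed

lemma fr_local: "Qy t R y \<subseteq> K ==> fr t R y b (om \<inter> K) = fr t R y b om"
proof -
 assume "Qy t R y \<subseteq> K"
 hence "om \<inter> K \<inter> Qy t R y = om \<inter> Qy t R y" by blast
 thus ?thesis by (simp add: fr_def Zy_def)
qed

lemma trial_local:
 assumes aV: "a \<in> V" and y0: "y0 \<in> V"
  and T: "T <= u a" "u a <= T + D" and t: "2 * B + D + real c * D <= t" "2 * B < t"
  and T': "T' = T + t + (2 * D + 2 * B + real c * D)"
 shows "trial c k T' t R y0 a (om \<inter> Kk T T' (R + c + (R + c + k)) a) = trial c k T' t R y0 a om"
 unfolding trial_def
proof (intro sum.cong refl)
 fix y b assume "y \<in> orb y0 \<inter> bl (R + c) a" and b: "b \<in> Bz t R y"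
 hence y: "y \<in> V" using bl_in[OF aV] by blast
 let ?K = "Kk T T' (R + c + (R + c + k)) a"
 show "of_bool (a \<in> Tg c b \<and> Nn c b a \<union> Nu k T' y \<subseteq> om \<inter> ?K) * fr t R y b (om \<inter> ?K) =
    of_bool (a \<in> Tg c b \<and> Nn c b a \<union> Nu k T' y \<subseteq> om) * fr t R y b om"
 proof (cases "a \<in> Tg c b")
  case True
  note r = trial_regions(1,2,3,6)[OF aV y b True T t T', where k = k]
  have "Nn c b a \<union> Nu k T' y \<subseteq> om \<inter> ?K \<longleftrightarrow> Nn c b a \<union> Nu k T' y \<subseteq> om" using r(2,3) by blast
  thus ?thesis by (simp add: fr_local[OF r(1)])
 qed simp
qed

lemma trial_bounds:
 "0 <= trial c k T' t R y0 a om" "trial c k T' t R y0 a om <= real (card (bl (R + c) a))"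
proof -
 show "0 <= trial c k T' t R y0 a om" unfolding trial_def by (intro sum_nonneg mult_nonneg_nonneg fr_nonneg) auto
 have "trial c k T' t R y0 a om <= (\<Sum>y\<in>orb y0 \<inter> bl (R + c) a. 1)"
  unfolding trial_def
 proof (rule sum_mono)
  fix y
  have "(\<Sum>b\<in>Bz t R y. of_bool (a \<in> Tg c b \<and> Nn c b a \<union> Nu k T' y \<subseteq> om) * fr t R y b om) <= (\<Sum>b\<in>Bz t R y. fr t R y b om)"
   by (intro sum_mono) (simp add: fr_nonneg of_bool_def)
  also have "... <= 1" by (simp add: fr_sum)
  finally show "(\<Sum>b\<in>Bz t R y. of_bool (a \<in> Tg c b \<and> Nn c b a \<union> Nu k T' y \<subseteq> om) * fr t R y b om) <= 1" .
 qed
 also have "... <= real (card (bl (R + c) a))" by (simp add: card_mono bl_finite)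
 finally show "trial c k T' t R y0 a om <= real (card (bl (R + c) a))" .
qed

lemma trial_mean:
 assumes aV: "a \<in> V" and y0: "y0 \<in> V"
  and T: "T <= u a" "u a <= T + D" and t: "2 * B + D + real c * D <= t" "2 * B < t"
  and T': "T' = T + t + (2 * D + 2 * B + real c * D)"
  and F: "finite F" "Kk T T' (R + c + (R + c + k)) a \<subseteq> F" and q: "pm <= q" "q <= 1"
  and N1: "\<forall>x\<in>V. card {e \<in> E. e \<subseteq> bl c x} <= N1" and N2: "\<forall>x\<in>V. card {e \<in> E. e \<subseteq> bl k x} <= N2"
 shows "pm ^ (N1 + N2) * (\<Sum>y\<in>orb y0 \<inter> bl (R + c) a. Fm c t R q y a) <= pexp F q (trial c k T' t R y0 a)"
proof -
 have q0: "0 <= q" using q pm by simp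
 have eq1: "pexp F q (trial c k T' t R y0 a) = (\<Sum>y\<in>orb y0 \<inter> bl (R + c) a. \<Sum>b\<in>Bz t R y.
  pexp F q (%om. of_bool (a \<in> Tg c b \<and> Nn c b a \<union> Nu k T' y \<subseteq> om) * fr t R y b om))"
  unfolding trial_def pexp_sum ..
 have eq2: "pm ^ (N1 + N2) * (\<Sum>y\<in>orb y0 \<inter> bl (R + c) a. Fm c t R q y a) =
  (\<Sum>y\<in>orb y0 \<inter> bl (R + c) a. \<Sum>b\<in>Bz t R y. pm ^ (N1 + N2) * (of_bool (a \<in> Tg c b) * pexp (Qy t R y) q (fr t R y b)))"
  by (simp add: Fm_def sum_distrib_left)
 have key: "pm ^ (N1 + N2) * (of_bool (a \<in> Tg c b) * pexp (Qy t R y) q (fr t R y b)) <=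
  pexp F q (%om. of_bool (a \<in> Tg c b \<and> Nn c b a \<union> Nu k T' y \<subseteq> om) * fr t R y b om)"
  if ya: "y \<in> orb y0 \<inter> bl (R + c) a" and b: "b \<in> Bz t R y" for y b
 proof (cases "a \<in> Tg c b")
  case False
  thus ?thesis by (simp add: pexp_nonneg q0 q)
 next
  case True
  have y: "y \<in> V" using ya bl_in[OF aV] by blast
  have bV: "b \<in> V" using b Bz_sub[OF y] by blast
  note r = trial_regions(1,2,3,6)[OF aV y b True T t T', where k = k]
  let ?N = "Nn c b a \<union> Nu k T' y"
  have NF: "?N \<subseteq> F" using r(2,3) F(2) by blast
  have fN: "finite (Nn c b a)" "finite (Nu k T' y)" using NF F(1) finite_subset by auto
  have "card ?N <= card (Nn c b a) + card (Nu k T' y)" by (rule card_Un_le)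
  also have "... <= card {e \<in> E. e \<subseteq> bl c b} + card {e \<in> E. e \<subseteq> bl k y}"
   by (intro add_mono card_mono ball_edges_finite) (auto simp: Nn_def Nu_def)
  also have "... <= N1 + N2" using N1 N2 bV y by (simp add: add_mono)
  finally have card: "card ?N <= N1 + N2" .
  have "pm ^ (N1 + N2) <= pm ^ card ?N" using card pm by (intro power_decreasing) auto
  also have "... <= q ^ card ?N" using q pm by (intro power_mono) auto
  also have "... <= Pr F q (%om. ?N \<subseteq> om)" by (rule Pr_all_open[OF F(1) NF q0 q(2)])
  finally have P: "pm ^ (N1 + N2) <= pexp F q (%om. of_bool (?N \<subseteq> om))" by (simp add: Pr_def)
  have fl: "pexp F q (fr t R y b) = pexp (Qy t R y) q (fr t R y b)"
  proof -
   have "pexp F q (fr t R y b) = pexp (F \<inter> Qy t R y) q (fr t R y b)"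
    by (rule pexp_local[OF F(1)]) (simp add: fr_local)
   moreover have "F \<inter> Qy t R y = Qy t R y" using r(1) F(2) by blast
   ultimately show ?thesis by simp
  qed
  have "pexp F q (%om. of_bool (?N \<subseteq> om) * fr t R y b om) = pexp F q (%om. of_bool (?N \<subseteq> om)) * pexp F q (fr t R y b)"
  proof (rule pexp_mult_local[OF F(1), of _ ?N _ "Qy t R y"])
   fix om
   have "?N \<subseteq> om \<longleftrightarrow> ?N \<subseteq> om \<inter> ?N" by blast
   thus "(of_bool (?N \<subseteq> om) :: real) = of_bool (?N \<subseteq> om \<inter> ?N)" by simp
   show "fr t R y b om = fr t R y b (om \<inter> Qy t R y)" by (simp add: fr_local)
  qed (use r(4) in blast)
  moreover have "0 <= pexp F q (fr t R y b)" by (intro pexp_nonneg q0 q fr_nonneg)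
  ultimately have "pm ^ (N1 + N2) * pexp F q (fr t R y b) <= pexp F q (%om. of_bool (?N \<subseteq> om) * fr t R y b om)"
   using mult_right_mono[OF P] by simp
  thus ?thesis using True by (simp add: fl)
 qed
 show ?thesis unfolding eq1 eq2 by (intro sum_mono key)
qed

abbreviation extends_with :: "real \<Rightarrow> real \<Rightarrow> real \<Rightarrow> real \<Rightarrow> real \<Rightarrow> bool" where
 "extends_with q t c2 c C0 \<equiv>
  ((\<forall>T A. finite A --> A \<noteq> {} --> A \<subseteq> V --> (\<forall>a\<in>A. T <= u a \<and> u a <= T + D) -->
   (\<exists>F. finite F \<and> F \<subseteq> E \<inter> hi u T \<inter> lo u (T + t + c2) \<and>
    Pr F q (%om. real (card {x. T + t + c2 <= u x \<and> (\<exists>a\<in>A. linked om a x)}) < c * real (card A))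
     <= C0 / real (card A))))"

lemma trial_count:
 assumes A: "finite A" "A \<subseteq> V" "\<forall>a\<in>A. T <= u a \<and> u a <= T + D" and y0: "y0 \<in> V"
  and t: "2 * B + D + real c * D <= t" "2 * B < t"
  and T': "T' = T + t + (2 * D + 2 * B + real c * D)"
  and k: "4 * B + 3 * D + 2 * (real c * D) <= real k * \<theta>"
  and NT: "\<forall>x\<in>V. card (bl c x) <= NT" and N6: "\<forall>x\<in>V. card (bl k x) <= N6" and w: "finite om" "om \<subseteq> E"
 shows "(\<Sum>a\<in>A. trial c k T' t R y0 a om) <= real (NT * N6) * real (card {x. T' <= u x \<and> (\<exists>a\<in>A. linked om a x)})"
proof -
 define X where "X = {x. T' <= u x \<and> (\<exists>a\<in>A. linked om a x)}"
 have "X \<subseteq> (\<Union>a\<in>A. {x. linked om a x})" by (auto simp: X_def)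
 moreover have "finite (\<Union>a\<in>A. {x. linked om a x})"
  using A(1) linked_reach_finite[OF w(1)] edge_finite w(2) by blast
 ultimately have Xf: "finite X" by (rule finite_subset)
 have XV: "X \<subseteq> V" using A(2) linked_in[OF w(2)] by (auto simp: X_def)
 define Y where "Y = (\<Union>a\<in>A. orb y0 \<inter> bl (R + c) a)"
 have Yf: "finite Y" using A(1) by (simp add: Y_def bl_finite)
 have YV: "Y \<subseteq> V" using orb_in[OF y0] by (auto simp: Y_def)
 define Yx where "Yx = (\<Union>x\<in>X. bl k x)"
 define \<phi> where "\<phi> a y b = of_bool (a \<in> Tg c b \<and> Nn c b a \<union> Nu k T' y \<subseteq> om) * fr t R y b om" for a y b
 have \<phi>0: "0 <= \<phi> a y b" for a y b by (simp add: \<phi>_def fr_nonneg)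
 have key: "\<phi> a y b <= of_bool (y \<in> Yx) * (of_bool (a \<in> Tg c b) * fr t R y b om)"
  if a: "a \<in> A" and y: "y \<in> Y" and b: "b \<in> Bz t R y" for a y b
 proof (cases "\<phi> a y b = 0")
  case True
  thus ?thesis by (simp add: fr_nonneg)
 next
  case False
  hence at: "a \<in> Tg c b" "Nn c b a \<subseteq> om" "Nu k T' y \<subseteq> om" and "fr t R y b om \<noteq> 0" by (auto simp: \<phi>_def)
  hence "b \<in> Zy t R y om" by (auto simp: fr_def)
  hence yb: "linked om y b" using linked_mono by (fastforce simp: Zy_def)
  have ba: "linked om b a" using at(1,2) linked_mono by (fastforce simp: Tg_def)
  have yV: "y \<in> V" and aV: "a \<in> V" using y YV a A(2) by auto
  have "T' - u y <= 4 * B + 3 * D + 2 * (real c * D)"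
   using trial_regions(5)[OF aV yV b at(1) _ _ t T'] A(3) a by blast
  hence "T' - u y <= real k * \<theta>" using k by simp
  from up_chain[of u, OF u_up \<theta> yV, of T' k] this
  obtain z J where z: "z \<in> bl k y" "T' <= u z" "J \<subseteq> E \<inter> hi u (u y) \<inter> lo u T'" "\<forall>e\<in>J. e \<subseteq> bl k y" "linked J y z"
   by auto
  have "J \<subseteq> Nu k T' y" using z by (auto simp: Nu_def)
  hence "J \<subseteq> om" using at(3) by blast
  hence "linked om y z" using linked_mono[OF z(5)] by blast
  hence "linked om a z" using linked_trans[OF linked_trans[OF linked_sym[OF ba] linked_sym[OF yb]]] by blast
  hence "z \<in> X" using z(2) a by (auto simp: X_def)
  hence "y \<in> Yx" using bl_sym[OF z(1)] by (auto simp: Yx_def)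
  thus ?thesis using at(1) by (simp add: \<phi>_def fr_nonneg)
 qed
 have "(\<Sum>a\<in>A. trial c k T' t R y0 a om) <= (\<Sum>a\<in>A. \<Sum>y\<in>Y. \<Sum>b\<in>Bz t R y. \<phi> a y b)"
  unfolding trial_def \<phi>_def[symmetric]
  by (intro sum_mono sum_mono2 sum_nonneg \<phi>0) (use Yf in \<open>auto simp: Y_def\<close>)
 also have "... <= (\<Sum>a\<in>A. \<Sum>y\<in>Y. \<Sum>b\<in>Bz t R y. of_bool (y \<in> Yx) * (of_bool (a \<in> Tg c b) * fr t R y b om))"
  by (intro sum_mono key)
 also have "... = (\<Sum>y\<in>Y. \<Sum>b\<in>Bz t R y. \<Sum>a\<in>A. of_bool (y \<in> Yx) * (of_bool (a \<in> Tg c b) * fr t R y b om))"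
  by (subst sum.swap) (intro sum.cong refl sum.swap)
 also have "... <= (\<Sum>y\<in>Y. of_bool (y \<in> Yx) * real NT)"
 proof (rule sum_mono)
  fix y assume y: "y \<in> Y"
  have "(\<Sum>b\<in>Bz t R y. \<Sum>a\<in>A. of_bool (y \<in> Yx) * (of_bool (a \<in> Tg c b) * fr t R y b om))
   <= (\<Sum>b\<in>Bz t R y. of_bool (y \<in> Yx) * (real NT * fr t R y b om))"
  proof (rule sum_mono)
   fix b assume b: "b \<in> Bz t R y"
   have bV: "b \<in> V" using b Bz_sub y YV by blast
   have "(\<Sum>a\<in>A. of_bool (a \<in> Tg c b)) = real (card (A \<inter> Tg c b))" using A(1) by (simp add: of_bool_def sum.If_cases)
   also have "... <= real (card (bl c b))" by (simp, rule card_mono[OF bl_finite]) (auto simp: Tg_def)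
   also have "... <= real NT" using NT bV by simp
   finally have "(\<Sum>a\<in>A. of_bool (a \<in> Tg c b)) * fr t R y b om <= real NT * fr t R y b om"
    by (rule mult_right_mono) (rule fr_nonneg)
   moreover have "(\<Sum>a\<in>A. of_bool (y \<in> Yx) * (of_bool (a \<in> Tg c b) * fr t R y b om)) =
    of_bool (y \<in> Yx) * ((\<Sum>a\<in>A. of_bool (a \<in> Tg c b)) * fr t R y b om)"
    by (simp add: sum_distrib_left sum_distrib_right)
   ultimately show "(\<Sum>a\<in>A. of_bool (y \<in> Yx) * (of_bool (a \<in> Tg c b) * fr t R y b om)) <= of_bool (y \<in> Yx) * (real NT * fr t R y b om)"
    by (simp add: of_bool_def)
  qed
  also have "... = of_bool (y \<in> Yx) * (real NT * (\<Sum>b\<in>Bz t R y. fr t R y b om))"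
   by (simp add: sum_distrib_left)
  also have "... <= of_bool (y \<in> Yx) * real NT" by (simp add: fr_sum)
  finally show "(\<Sum>b\<in>Bz t R y. \<Sum>a\<in>A. of_bool (y \<in> Yx) * (of_bool (a \<in> Tg c b) * fr t R y b om)) <= of_bool (y \<in> Yx) * real NT" .
 qed
 also have "... = real (card (Y \<inter> Yx)) * real NT"
  using Yf by (simp add: of_bool_def sum_distrib_right[symmetric] sum.If_cases)
 also have "... <= (real N6 * real (card X)) * real NT"
 proof (rule mult_right_mono)
  have "card (Y \<inter> Yx) <= card Yx" by (rule card_mono) (use Xf in \<open>auto simp: Yx_def bl_finite\<close>)
  also have "... <= (\<Sum>x\<in>X. card (bl k x))" unfolding Yx_def by (rule card_UN_le[OF Xf])
  also have "... <= (\<Sum>x\<in>X. N6)" using N6 XV by (intro sum_mono) auto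
  also have "... = N6 * card X" by simp
  finally show "real (card (Y \<inter> Yx)) <= real N6 * real (card X)" by (metis of_nat_le_iff of_nat_mult)
 qed simp
 finally show ?thesis by (simp add: X_def mult_ac)
qed

theorem extension_step:
 "\<exists>c1>0. \<exists>c2\<ge>0. \<exists>t1. \<forall>t\<ge>t1. \<forall>y0\<in>V. \<forall>R. \<forall>\<psi>>0. \<exists>C0. \<forall>q. pm <= q --> q <= 1 -->
  \<psi> <= Pr (Qy t R y0) q (%om. Zy t R y0 om \<noteq> {}) -->
  extends_with q t c2 (c1 * exp (- s * t) * \<psi>) C0"
proof -
 obtain c where c: "\<forall>b\<in>V. \<forall>v\<in>V. \<exists>a\<in>orb v. a \<in> Tg c b" using target by blast
 define c5 where "c5 = 2 * B + D + real c * D"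
 define c2 where "c2 = 2 * D + 2 * B + real c * D"
 define k where "k = nat \<lceil>(4 * B + 3 * D + 2 * (real c * D)) / \<theta>\<rceil>"
 have k: "4 * B + 3 * D + 2 * (real c * D) <= real k * \<theta>"
  using real_nat_ceiling_ge[of "(4 * B + 3 * D + 2 * (real c * D)) / \<theta>"] \<theta> by (simp add: k_def field_simps)
 obtain N1 where N1: "\<forall>x\<in>V. card {e \<in> E. e \<subseteq> bl c x} <= N1" using ball_edges_card by blast
 obtain N2 where N2: "\<forall>x\<in>V. card {e \<in> E. e \<subseteq> bl k x} <= N2" using ball_edges_card by blast
 obtain NT' where NT': "\<forall>x\<in>V. card (bl c x) <= NT'" using bl_card by blast
 obtain N6' where N6': "\<forall>x\<in>V. card (bl k x) <= N6'" using bl_card by blast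
 define NT where "NT = Suc NT'"
 define N6 where "N6 = Suc N6'"
 have NT: "\<forall>x\<in>V. card (bl c x) <= NT" and N6: "\<forall>x\<in>V. card (bl k x) <= N6"
  using NT' N6' by (auto simp: NT_def N6_def le_SucI)
 define c1 where "c1 = pm ^ (N1 + N2) / (2 * \<kappa> * exp c5 * real (NT * N6))"
 have "0 < real (NT * N6)" by (simp only: NT_def N6_def of_nat_0_less_iff nat_0_less_mult_iff) simp
 note NN = this
 from NN have c1: "0 < c1" unfolding c1_def using pm \<kappa> by (intro divide_pos_pos mult_pos_pos) auto
 have c20: "0 <= c2" using D0 B0 by (simp add: c2_def)
 have main: "\<exists>C0. \<forall>q. pm <= q --> q <= 1 -->
  \<psi> <= Pr (Qy t R y0) q (%om. Zy t R y0 om \<noteq> {}) -->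
  extends_with q t c2 (c1 * exp (- s * t) * \<psi>) C0"
  if t: "c5 <= t" "2 * B < t" and y0: "y0 \<in> V" and \<psi>: "0 < \<psi>" for t y0 R \<psi>
 proof -
  define R3 where "R3 = R + c + (R + c + k)"
  obtain NR where NR: "\<forall>x\<in>V. card (bl (R + c) x) <= NR" using bl_card by blast
  obtain NK where NK: "\<forall>x\<in>V. card (bl (R3 + R3) x) <= NK" using bl_card by blast
  define \<mu> where "\<mu> = pm ^ (N1 + N2) * (\<psi> * exp (- s * t) / (\<kappa> * exp c5))"
  have \<mu>: "0 < \<mu>" using pm \<psi> \<kappa> by (simp add: \<mu>_def)
  have fin: "\<exists>F. finite F \<and> F \<subseteq> E \<inter> hi u T \<inter> lo u (T + t + c2) \<and>
    Pr F q (%om. real (card {x. T + t + c2 <= u x \<and> (\<exists>a\<in>A. linked om a x)}) < c1 * exp (- s * t) * \<psi> * real (card A))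
     <= (4 * real NK * (real NR)\<^sup>2 / \<mu>\<^sup>2) / real (card A)"
   if q: "pm <= q" "q <= 1" and cross: "\<psi> <= Pr (Qy t R y0) q (%om. Zy t R y0 om \<noteq> {})"
    and A: "finite A" "A \<noteq> {}" "A \<subseteq> V" "\<forall>a\<in>A. T <= u a \<and> u a <= T + D" for q T A
  proof -
   have q0: "0 <= q" using q pm by simp
   define T' where "T' = T + t + c2"
   have T': "T' = T + t + (2 * D + 2 * B + real c * D)" by (simp add: T'_def c2_def)
   define F where "F = (\<Union>a\<in>A. Kk T T' R3 a)"
   have Kfin: "finite (Kk T T' R3 a)" for a
    by (rule finite_subset[OF _ ball_edges_finite[of R3 a]]) (auto simp: Kk_def)
   have Ff: "finite F" using A(1) Kfin by (simp add: F_def)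
   have FE: "F \<subseteq> E \<inter> hi u T \<inter> lo u T'" by (auto simp: F_def Kk_def)
   define W where "W a = trial c k T' t R y0 a" for a
   have KF: "Kk T T' R3 a \<subseteq> F" if "a \<in> A" for a using that by (auto simp: F_def)
   have T5: "2 * B + D + real c * D <= t" using t(1) by (simp add: c5_def)
   have cheb: "Pr F q (%om. (\<Sum>a\<in>A. W a om) < real (card A) * \<mu> / 2) <= 4 * real NK * (real NR)\<^sup>2 / (real (card A) * \<mu>\<^sup>2)"
   proof (rule perc_chebyshev[of F q A W "Kk T T' R3"])
    fix a om assume "a \<in> A" "om \<subseteq> F"
    thus "W a om = W a (om \<inter> Kk T T' R3 a)"
     using trial_local[of a y0 T c t T' k R om] A y0 T5 t(2) T' by (auto simp: W_def R3_def)
    have "card (bl (R + c) a) <= NR" using NR A(3) \<open>a \<in> A\<close> by blast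
    thus "0 <= W a om \<and> W a om <= real NR"
     using trial_bounds[of c k T' t R y0 a om] by (auto simp: W_def)
   next
    fix a assume a: "a \<in> A"
    have "{b \<in> A. Kk T T' R3 a \<inter> Kk T T' R3 b \<noteq> {}} \<subseteq> bl (R3 + R3) a"
    proof
     fix b assume "b \<in> {b \<in> A. Kk T T' R3 a \<inter> Kk T T' R3 b \<noteq> {}}"
     then obtain e where e: "e \<in> E" "e \<subseteq> bl R3 a" "e \<subseteq> bl R3 b" by (auto simp: Kk_def)
     then obtain x where "x \<in> e" using edge_ne by blast
     hence "x \<in> bl R3 a" "b \<in> bl R3 x" using e bl_sym by blast+
     thus "b \<in> bl (R3 + R3) a" by (rule bl_trans)
    qed
    hence "card {b \<in> A. Kk T T' R3 a \<inter> Kk T T' R3 b \<noteq> {}} <= card (bl (R3 + R3) a)"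
     by (rule card_mono[OF bl_finite])
    moreover have "card (bl (R3 + R3) a) <= NK" using NK A(3) a by blast
    ultimately show "real (card {b \<in> A. Kk T T' R3 a \<inter> Kk T T' R3 b \<noteq> {}}) <= real NK" by simp
    have aV: "a \<in> V" and aT: "T <= u a" "u a <= T + D" using A a by auto
    have "\<psi> * exp (- s * t) / (\<kappa> * exp c5) <= (\<Sum>y\<in>orb y0 \<inter> bl (R + c) a. Fm c t R q y a)"
     unfolding c5_def by (rule mass_lower[OF c y0 aV q0 q(2) cross])
    hence "\<mu> <= pm ^ (N1 + N2) * (\<Sum>y\<in>orb y0 \<inter> bl (R + c) a. Fm c t R q y a)"
     unfolding \<mu>_def using pm by (intro mult_left_mono) auto
    also have "... <= pexp F q (W a)"
     unfolding W_def by (rule trial_mean[OF aV y0 aT T5 t(2) T' Ff _ q N1 N2]) (use KF[OF a] in \<open>simp add: R3_def\<close>)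
    finally show "\<mu> <= pexp F q (W a)" .
   qed (use Ff q0 q A \<mu> in auto)
   have "Pr F q (%om. real (card {x. T' <= u x \<and> (\<exists>a\<in>A. linked om a x)}) < c1 * exp (- s * t) * \<psi> * real (card A))
    <= Pr F q (%om. (\<Sum>a\<in>A. W a om) < real (card A) * \<mu> / 2)"
   proof (rule Pr_mono[OF q0 q(2)])
    fix om assume w: "om \<subseteq> F" and few: "real (card {x. T' <= u x \<and> (\<exists>a\<in>A. linked om a x)}) < c1 * exp (- s * t) * \<psi> * real (card A)"
    have "(\<Sum>a\<in>A. W a om) <= real (NT * N6) * real (card {x. T' <= u x \<and> (\<exists>a\<in>A. linked om a x)})"
     unfolding W_def
     by (rule trial_count[OF A(1,3,4) y0 T5 t(2) T' k NT N6]) (use w Ff FE finite_subset in auto)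
    also have "... < real (NT * N6) * (c1 * exp (- s * t) * \<psi> * real (card A))"
     using few NN by (intro mult_strict_left_mono)
    also have "... = real (card A) * \<mu> / 2"
     using \<kappa> NN by (simp add: c1_def \<mu>_def field_simps del: of_nat_mult)
    finally show "(\<Sum>a\<in>A. W a om) < real (card A) * \<mu> / 2" .
   qed
   also note cheb
   also have "4 * real NK * (real NR)\<^sup>2 / (real (card A) * \<mu>\<^sup>2) = (4 * real NK * (real NR)\<^sup>2 / \<mu>\<^sup>2) / real (card A)"
    by (simp add: field_simps)
   finally show ?thesis using Ff FE unfolding T'_def by blast
  qed
  show ?thesis
   by (rule exI[of _ "4 * real NK * (real NR)\<^sup>2 / \<mu>\<^sup>2"], intro allI impI, rule fin)
 qed
 show ?thesis
 proof (rule exI[of _ c1], intro conjI c1, rule exI[of _ c2], intro conjI c20, rule exI[of _ "max c5 (2 * B + 1)"], intro allI impI ballI)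
  fix t y0 R \<psi> assume h: "max c5 (2 * B + 1) <= t" "y0 \<in> V" "(0::real) < \<psi>"
  show "\<exists>C0. \<forall>q. pm <= q --> q <= 1 -->
   \<psi> <= Pr (Qy t R y0) q (%om. Zy t R y0 om \<noteq> {}) -->
   extends_with q t c2 (c1 * exp (- s * t) * \<psi>) C0"
   by (rule main) (use h in simp_all)
 qed
qed

end

context climb
begin

lemma level_window:
 assumes w: "om \<subseteq> E \<inter> lo u T" and x: "T <= u x" "linked om a x" and a: "u a <= T + D"
 shows "u x <= T + D"
proof (cases "x = a")
 case False
 obtain c where c: "{c, x} \<in> om" using linked_last_edge[OF x(2) False] by blast
 hence "{c, x} \<in> E" "{c, x} \<in> lo u T" using w by auto
 hence "u c < T" "\<bar>u c - u x\<bar> <= D" using x(1) u_lip[of c x] by (auto simp: lo_def)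
 thus ?thesis by linarith
qed (use a in simp)

lemma increasing_reach: "increasing_event (%om. \<exists>a\<in>A. \<exists>x. T <= u x \<and> linked om a x)"
 unfolding increasing_event_def
proof (intro allI impI)
 fix om om' :: "'v set set" assume s: "om \<subseteq> om'" and "\<exists>a\<in>A. \<exists>x. T <= u x \<and> linked om a x"
 then obtain a x where a: "a \<in> A" "T <= u x" "linked om a x" by blast
 have "linked om' a x" by (rule linked_mono[OF a(3) s])
 thus "\<exists>a\<in>A. \<exists>x. T <= u x \<and> linked om' a x" using a(1,2) by blast
qed

abbreviation climbs_with :: "real \<Rightarrow> real \<Rightarrow> real \<Rightarrow> real \<Rightarrow> bool" where
 "climbs_with q t C b \<equiv>
  ((\<forall>T v F0 k. v \<in> V --> u v <= T + D --> finite F0 --> F0 \<subseteq> E \<inter> lo u T -->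
   (\<exists>F1. finite F1 \<and> F1 \<subseteq> E \<inter> hi u T \<and>
    Pr F0 q (%om. C * b ^ k <= real (card {x. T <= u x \<and> linked om v x}))
     <= 2 * Pr (F0 \<union> F1) q (%om. \<exists>x. T + real k * t <= u x \<and> linked om v x))))"

lemma climb_iterate:
 assumes step: "\<And>T A. finite A ==> A \<noteq> {} ==> A \<subseteq> V ==> \<forall>a\<in>A. T <= u a \<and> u a <= T + D ==>
   \<exists>F. finite F \<and> F \<subseteq> E \<inter> hi u T \<inter> lo u (T + t) \<and>
    Pr F q (%om. real (card {x. T + t <= u x \<and> (\<exists>a\<in>A. linked om a x)}) < r * real (card A)) <= C0 / real (card A)"
  and q: "0 <= q" "q <= 1" and b: "2 <= b" "1 <= b * r" and t: "0 <= t" and C: "0 <= C0" "0 < C" "C0 <= C"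
  and A: "finite A" "A \<subseteq> V" "\<forall>a\<in>A. T <= u a \<and> u a <= T + D" "C * b ^ k <= real (card A)"
 shows "\<exists>F. finite F \<and> F \<subseteq> E \<inter> hi u T \<and>
   1 - C0 / C * (1 - (1 / 2) ^ k) <= Pr F q (%om. \<exists>a\<in>A. \<exists>x. T + real k * t <= u x \<and> linked om a x)"
 using A
proof (induction k arbitrary: A T)
 case 0
 have "A \<noteq> {}" using 0 C by auto
 hence "\<exists>a\<in>A. \<exists>x. T + real 0 * t <= u x \<and> linked {} a x" using 0(3) by (metis add_cancel_right_right ex_in_conv linked_refl mult_zero_left of_nat_0)
 thus ?case by (intro exI[of _ "{}"]) (simp add: Pr_def)
next
 case (Suc k)
 define \<delta> where "\<delta> = C0 / C"
 have \<delta>: "0 <= \<delta>" "\<delta> <= 1" using C by (auto simp: \<delta>_def)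
 have bk: "0 < C * b ^ Suc k" using C b by simp
 hence cA: "0 < real (card A)" using Suc.prems(4) by linarith
 hence "A \<noteq> {}" by auto
 obtain F where F: "finite F" "F \<subseteq> E \<inter> hi u T \<inter> lo u (T + t)"
  "Pr F q (%om. real (card {x. T + t <= u x \<and> (\<exists>a\<in>A. linked om a x)}) < r * real (card A)) <= C0 / real (card A)"
  using step[OF Suc.prems(1) \<open>A \<noteq> {}\<close> Suc.prems(2,3)] by blast
 define X where "X om = {x. T + t <= u x \<and> (\<exists>a\<in>A. linked om a x)}" for om
 define P where "P om \<longleftrightarrow> \<not> real (card (X om)) < r * real (card A)" for om
 have "C0 / real (card A) <= C0 / (C * b ^ Suc k)" using C(1) bk Suc.prems(4) cA by (intro divide_left_mono) auto
 also have "... = \<delta> * (1 / b) ^ Suc k" by (simp add: \<delta>_def power_divide)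
 also have "... <= \<delta> * (1 / 2) ^ Suc k" using b \<delta> by (intro mult_left_mono power_mono) auto
 finally have PP: "1 - \<delta> * (1 / 2) ^ Suc k <= Pr F q P"
  using F(3) Pr_not[OF F(1), of q "%om. real (card (X om)) < r * real (card A)"]
  by (simp only: P_def[abs_def] X_def)
 have "(1/2::real) ^ k <= 1" "0 <= (1/2::real)^k" by (auto intro: power_le_one)
 hence gk: "0 <= 1 - \<delta> * (1 - (1/2) ^ k)" "1 - \<delta> * (1 - (1/2) ^ k) <= 1"
  using \<delta> mult_mono[of \<delta> 1 "1 - (1/2)^k" 1] by auto
 define Q where "Q om \<longleftrightarrow> (\<exists>a\<in>A. \<exists>x. T + real (Suc k) * t <= u x \<and> linked om a x)" for om
 have "\<exists>G. finite G \<and> G \<subseteq> E \<inter> hi u (T + t) \<and> (1 - \<delta> * (1 - (1/2) ^ k)) * Pr F q P <= Pr (F \<union> G) q Q"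
 proof (rule perc_two_stage[OF F(1) _ q _ gk(1)])
  show "F \<inter> (E \<inter> hi u (T + t)) = {}" using F(2) lo_hi_disjoint by fastforce
  show "increasing_event Q" unfolding Q_def by (rule increasing_reach)
  fix om assume w: "om \<subseteq> F" "P om"
  have wf: "finite om" "om \<subseteq> E" using w F finite_subset by auto
  have "X om \<subseteq> (\<Union>a\<in>A. {x. linked om a x})" by (auto simp: X_def)
  moreover have "finite (\<Union>a\<in>A. {x. linked om a x})"
   using Suc.prems(1) linked_reach_finite[OF wf(1)] edge_finite wf(2) by blast
  ultimately have Xf: "finite (X om)" by (rule finite_subset)
  have XV: "X om \<subseteq> V" using Suc.prems(2) linked_in[OF wf(2)] by (auto simp: X_def)
  have Xu: "\<forall>x\<in>X om. T + t <= u x \<and> u x <= T + t + D"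
  proof
   fix x assume "x \<in> X om"
   then obtain a where a: "a \<in> A" "linked om a x" "T + t <= u x" by (auto simp: X_def)
   have "u a <= T + t + D" using Suc.prems(3) a(1) t by fastforce
   thus "T + t <= u x \<and> u x <= T + t + D" using level_window[of om "T + t" x a] w F(2) a by blast
  qed
  have "C * b ^ k <= C * b ^ k * (b * r)" using mult_left_mono[of 1 "b * r" "C * b ^ k"] C b by simp
  also have "... = r * (C * b ^ Suc k)" by simp
  also have "... <= r * real (card A)"
  proof (rule mult_left_mono[OF Suc.prems(4)])
   have "0 < b * r" using b by linarith
   thus "0 <= r" using b by (simp add: zero_less_mult_iff)
  qed
  also have "... <= real (card (X om))" using w(2) by (simp add: P_def)
  finally have "C * b ^ k <= real (card (X om))" .
  from Suc.IH[OF Xf XV Xu this] obtain G where G: "finite G" "G \<subseteq> E \<inter> hi u (T + t)"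
   "1 - C0 / C * (1 - (1 / 2) ^ k) <= Pr G q (%om'. \<exists>a\<in>X om. \<exists>x. T + t + real k * t <= u x \<and> linked om' a x)" by (elim exE conjE)
  have "Pr G q (%om'. \<exists>a\<in>X om. \<exists>x. T + t + real k * t <= u x \<and> linked om' a x) <= Pr G q (%\<eta>. Q (om \<union> \<eta>))"
  proof (rule Pr_mono[OF q])
   fix \<eta> assume "\<exists>a\<in>X om. \<exists>x. T + t + real k * t <= u x \<and> linked \<eta> a x"
   then obtain y x where yx: "y \<in> X om" "T + t + real k * t <= u x" "linked \<eta> y x" by blast
   then obtain a where a: "a \<in> A" "linked om a y" by (auto simp: X_def)
   have "linked (om \<union> \<eta>) a x"
    by (rule linked_trans[OF linked_mono[OF a(2)] linked_mono[OF yx(3)]]) auto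
   moreover have "T + real (Suc k) * t <= u x" using yx(2) by (simp add: algebra_simps)
   ultimately show "Q (om \<union> \<eta>)" using a(1) by (auto simp: Q_def)
  qed
  with G(3) have "1 - \<delta> * (1 - (1/2) ^ k) <= Pr G q (%\<eta>. Q (om \<union> \<eta>))" unfolding \<delta>_def by linarith
  thus "\<exists>G. finite G \<and> G \<subseteq> E \<inter> hi u (T + t) \<and> 1 - \<delta> * (1 - (1/2) ^ k) <= Pr G q (%\<eta>. Q (om \<union> \<eta>))"
   by (intro exI[of _ G] conjI G(1,2))
 qed
 then obtain G where G: "finite G" "G \<subseteq> E \<inter> hi u (T + t)"
  "(1 - \<delta> * (1 - (1/2) ^ k)) * Pr F q P <= Pr (F \<union> G) q Q" by (elim exE conjE)
 define \<rho> where "\<rho> = \<delta> * (1 / 2) ^ Suc k"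
 define \<gamma> where "\<gamma> = 1 - \<delta> * (1 - (1/2) ^ k)"
 have "1 - \<delta> * (1 - (1/2) ^ Suc k) = \<gamma> - \<rho>" by (simp add: \<gamma>_def \<rho>_def algebra_simps)
 also have "... <= \<gamma> - \<gamma> * \<rho>" using gk(2) \<delta> mult_right_mono[of \<gamma> 1 \<rho>] by (simp add: \<gamma>_def \<rho>_def)
 also have "... = \<gamma> * (1 - \<rho>)" by (simp add: algebra_simps)
 also have "... <= \<gamma> * Pr F q P" using PP gk(1) by (intro mult_left_mono) (auto simp: \<rho>_def \<gamma>_def)
 also have "... <= Pr (F \<union> G) q Q" using G(3) by (simp add: \<gamma>_def)
 finally have "1 - \<delta> * (1 - (1/2) ^ Suc k) <= Pr (F \<union> G) q Q" .
 moreover have "F \<union> G \<subseteq> E \<inter> hi u T" using F(2) G(2) hi_antimono[of T "T + t" u] t by auto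
 ultimately show ?case unfolding \<delta>_def Q_def using F(1) G(1) by (intro exI[of _ "F \<union> G"]) auto
qed

theorem climb_from_level:
 "\<exists>c1>0. \<exists>t1. \<forall>t\<ge>t1. \<forall>y0\<in>V. \<forall>R. \<forall>\<psi>>0. \<forall>b\<ge>2. 1 <= b * (c1 * exp (- s * t) * \<psi>) -->
  (\<exists>C>0. \<forall>q. pm <= q --> q <= 1 --> \<psi> <= Pr (Qy t R y0) q (%om. Zy t R y0 om \<noteq> {}) -->
  climbs_with q t C b)"
proof -
 obtain c1 c2 t1 where c: "0 < c1" "0 <= c2" and step: "\<forall>t\<ge>t1. \<forall>y0\<in>V. \<forall>R. \<forall>\<psi>>0. \<exists>C0. \<forall>q. pm <= q --> q <= 1 -->
  \<psi> <= Pr (Qy t R y0) q (%om. Zy t R y0 om \<noteq> {}) -->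
  extends_with q t c2 (c1 * exp (- s * t) * \<psi>) C0"
  using extension_step by (elim exE conjE)
 have main: "\<exists>C>0. \<forall>q. pm <= q --> q <= 1 --> \<psi> <= Pr (Qy t R y0) q (%om. Zy t R y0 om \<noteq> {}) -->
  climbs_with q t C b"
  if t: "max t1 0 <= t" and y0: "y0 \<in> V" and \<psi>: "0 < \<psi>" and b: "2 <= b" "1 <= b * (c1 * exp (- s * t) * \<psi>)" for t y0 R \<psi> b
 proof -
  have "t1 <= t" using t by simp
  note step[THEN spec, THEN mp, OF \<open>t1 <= t\<close>, THEN bspec, OF y0, THEN spec[of _ R], THEN spec[of _ \<psi>], THEN mp, OF \<psi>]
  then obtain C0 where C0: "\<forall>q. pm <= q --> q <= 1 --> \<psi> <= Pr (Qy t R y0) q (%om. Zy t R y0 om \<noteq> {}) -->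
   extends_with q t c2 (c1 * exp (- s * t) * \<psi>) C0"
   by (elim exE)
  define C0' where "C0' = max C0 0"
  define C where "C = 2 * C0' + 1"
  have C: "0 <= C0'" "0 < C" "C0' <= C" "C0' / C <= 1 / 2" by (auto simp: C_def C0'_def field_simps)
  have fin: "\<exists>F1. finite F1 \<and> F1 \<subseteq> E \<inter> hi u T \<and>
    Pr F0 q (%om. C * b ^ k <= real (card {x. T <= u x \<and> linked om v x}))
     <= 2 * Pr (F0 \<union> F1) q (reaches u (T + real k * t) v)"
   if q: "pm <= q" "q <= 1" and cr: "\<psi> <= Pr (Qy t R y0) q (%om. Zy t R y0 om \<noteq> {})"
    and v: "v \<in> V" "u v <= T + D" and F0: "finite F0" "F0 \<subseteq> E \<inter> lo u T" for q T v F0 k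
  proof -
   have q0: "0 <= q" using q pm by simp
   define X where "X om = {x. T <= u x \<and> linked om v x}" for om
   define Q where "Q om \<longleftrightarrow> (\<exists>x. T + real k * t <= u x \<and> linked om v x)" for om
   have "\<exists>G. finite G \<and> G \<subseteq> E \<inter> hi u T \<and> 1/2 * Pr F0 q (%om. C * b ^ k <= real (card (X om))) <= Pr (F0 \<union> G) q Q"
   proof (rule perc_two_stage[OF F0(1) _ q0 q(2)])
    show "F0 \<inter> (E \<inter> hi u T) = {}" using F0(2) lo_hi_disjoint by fastforce
    show "increasing_event Q" unfolding Q_def using increasing_reach[of "{v}"] by simp
    fix om assume w: "om \<subseteq> F0" "C * b ^ k <= real (card (X om))"
    have wf: "finite om" "om \<subseteq> E" using w F0 finite_subset by auto
    have "finite {x. linked om v x}" using linked_reach_finite[OF wf(1)] edge_finite wf(2) by blast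
    hence Xf: "finite (X om)" by (rule finite_subset[rotated]) (auto simp: X_def)
    have XV: "X om \<subseteq> V" using v linked_in[OF wf(2)] by (auto simp: X_def)
    have Xu: "\<forall>x\<in>X om. T <= u x \<and> u x <= T + D"
     using level_window[of om T _ v] w F0(2) v by (auto simp: X_def)
    have "\<exists>F. finite F \<and> F \<subseteq> E \<inter> hi u T \<and>
     1 - C0' / C * (1 - (1 / 2) ^ k) <= Pr F q (%om'. \<exists>a\<in>X om. \<exists>x. T + real k * (t + c2) <= u x \<and> linked om' a x)"
    proof (rule climb_iterate[of "t + c2" q "c1 * exp (- s * t) * \<psi>" C0' b C "X om" T k])
     fix T A assume A: "finite A" "A \<noteq> {}" "A \<subseteq> V" "\<forall>a\<in>A. T <= u a \<and> u a <= T + D"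
     have "C0 / real (card A) <= C0' / real (card A)" by (simp add: C0'_def divide_right_mono)
     moreover obtain F where F: "finite F" "F \<subseteq> E \<inter> hi u T \<inter> lo u (T + t + c2)"
      "Pr F q (%om. real (card {x. T + t + c2 <= u x \<and> (\<exists>a\<in>A. linked om a x)}) < c1 * exp (- s * t) * \<psi> * real (card A))
       <= C0 / real (card A)"
      using C0[THEN spec, THEN mp, OF q(1), THEN mp, OF q(2), THEN mp, OF cr, THEN spec, THEN spec, THEN mp, OF A(1),
       THEN mp, OF A(2), THEN mp, OF A(3), THEN mp, OF A(4)] by (elim exE conjE)
     ultimately show "\<exists>F. finite F \<and> F \<subseteq> E \<inter> hi u T \<inter> lo u (T + (t + c2)) \<and>
      Pr F q (%om. real (card {x. T + (t + c2) <= u x \<and> (\<exists>a\<in>A. linked om a x)}) < c1 * exp (- s * t) * \<psi> * real (card A)) <= C0' / real (card A)"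
      by (intro exI[of _ F]) (simp add: add.assoc)
    qed (use q0 q b t c C Xf XV Xu w in auto)
    then obtain G where G: "finite G" "G \<subseteq> E \<inter> hi u T"
     "1 - C0' / C * (1 - (1 / 2) ^ k) <= Pr G q (%om'. \<exists>a\<in>X om. \<exists>x. T + real k * (t + c2) <= u x \<and> linked om' a x)" by (elim exE conjE)
    have "C0' / C * (1 - (1 / 2) ^ k) <= 1/2 * 1" using C by (intro mult_mono) (auto intro: power_le_one)
    hence "1/2 <= Pr G q (%om'. \<exists>a\<in>X om. \<exists>x. T + real k * (t + c2) <= u x \<and> linked om' a x)" using G(3) by simp
    also have "... <= Pr G q (%\<eta>. Q (om \<union> \<eta>))"
    proof (rule Pr_mono[OF q0 q(2)])
     fix \<eta> assume "\<exists>a\<in>X om. \<exists>x. T + real k * (t + c2) <= u x \<and> linked \<eta> a x"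
     then obtain y x where yx: "y \<in> X om" "T + real k * (t + c2) <= u x" "linked \<eta> y x" by blast
     hence a: "linked om v y" by (auto simp: X_def)
     have "linked (om \<union> \<eta>) v x"
      by (rule linked_trans[OF linked_mono[OF a] linked_mono[OF yx(3)]]) auto
     moreover have "real k * t <= real k * (t + c2)" using c by (intro mult_left_mono) auto
     ultimately show "Q (om \<union> \<eta>)" using yx(2) unfolding Q_def by (meson add_left_mono order_trans)
    qed
    finally show "\<exists>G. finite G \<and> G \<subseteq> E \<inter> hi u T \<and> 1/2 <= Pr G q (%\<eta>. Q (om \<union> \<eta>))"
     by (intro exI[of _ G] conjI G(1,2))
   qed simp
   then obtain G where G: "finite G" "G \<subseteq> E \<inter> hi u T"
    "1/2 * Pr F0 q (%om. C * b ^ k <= real (card (X om))) <= Pr (F0 \<union> G) q Q" by (elim exE conjE)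
   have "Pr F0 q (%om. C * b ^ k <= real (card (X om))) <= 2 * Pr (F0 \<union> G) q Q" using G(3) by linarith
   thus ?thesis unfolding X_def Q_def by (intro exI[of _ G] conjI G(1,2))
  qed
  show ?thesis
   by (rule exI[of _ C], intro conjI C(2) allI impI, rule fin)
 qed
 show ?thesis
 proof (rule exI[of _ c1], intro conjI c, rule exI[of _ "max t1 0"], intro allI impI ballI)
  fix t y0 R \<psi> b assume h: "max t1 0 <= t" "y0 \<in> V" "(0::real) < \<psi>" "2 <= b" "1 <= b * (c1 * exp (- s * t) * \<psi>)"
  show "\<exists>C>0. \<forall>q. pm <= q --> q <= 1 --> \<psi> <= Pr (Qy t R y0) q (%om. Zy t R y0 om \<noteq> {}) -->
  climbs_with q t C b"
   by (rule main) (use h in simp_all)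
 qed
qed

end

section \<open>Sharpness of the phase transition\<close>

context qt_graph
begin

definition bdry :: "'v set \<Rightarrow> ('v \<times> 'v) set" where
 "bdry S = {(a, b). a \<in> S \<and> b \<notin> S \<and> {a, b} \<in> E}"

definition phi :: "real \<Rightarrow> 'v \<Rightarrow> 'v set \<Rightarrow> real" where
 "phi p v S = (\<Sum>(a, b)\<in>bdry S. conn (E \<inter> Pow S) p v a * p)"

lemma bdry_finite: "finite S ==> finite (bdry S)"
proof -
 assume S: "finite S"
 have "finite (S \<times> (\<Union>a\<in>S. nb a))" using S nb_finite by blast
 moreover have "bdry S \<subseteq> S \<times> (\<Union>a\<in>S. nb a)" by (auto simp: bdry_def nb_def)
 ultimately show ?thesis by (rule finite_subset[rotated])
qed

lemma inside_finite: "finite S ==> finite (E \<inter> Pow S)"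
 by simp

lemma bdry_img:
 assumes g: "g \<in> \<Gamma>" and S: "S \<subseteq> V"
 shows "bdry (g ` S) = (%(a, b). (g a, g b)) ` bdry S"
proof (rule Set.set_eqI, rule iffI)
 fix x assume "x \<in> bdry (g ` S)"
 then obtain a b' where x: "x = (g a, b')" "a \<in> S" "b' \<notin> g ` S" "{g a, b'} \<in> E" by (auto simp: bdry_def)
 obtain j where j: "j \<in> \<Gamma>" "\<forall>x\<in>V. j (g x) = x \<and> g (j x) = x" using G_inv[OF g] by blast
 have b'V: "b' \<in> V" and aV: "a \<in> V" using x edge_in S by auto
 have b: "j b' \<in> V" "g (j b') = b'" using j b'V G_in by auto
 have "{g a, g (j b')} \<in> E" using x(4) b(2) by simp
 hence "{a, j b'} \<in> E" using G_edge[OF g aV b(1)] by simp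
 moreover have "j b' \<notin> S" using x(3) b(2) by force
 ultimately have "(a, j b') \<in> bdry S" using x(2) by (simp add: bdry_def)
 thus "x \<in> (%(a, b). (g a, g b)) ` bdry S" using x(1) b(2) by force
next
 fix x assume "x \<in> (%(a, b). (g a, g b)) ` bdry S"
 then obtain a b where x: "x = (g a, g b)" "a \<in> S" "b \<notin> S" "{a, b} \<in> E" by (auto simp: bdry_def)
 have V: "a \<in> V" "b \<in> V" using x edge_in by auto
 have "g b \<notin> g ` S" using inj_on_image_mem_iff[OF G_inj[OF g] V(2) S] x(3) by simp
 thus "x \<in> bdry (g ` S)" using x G_edge[OF g V] by (auto simp: bdry_def)
qed

lemma inside_img:
 assumes g: "g \<in> \<Gamma>" and S: "S \<subseteq> V"
 shows "E \<inter> Pow (g ` S) = (`) g ` (E \<inter> Pow S)"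
proof -
 have *: "{e \<in> E. e \<subseteq> g ` S} = (`) g ` {e \<in> E. e \<subseteq> S}"
 proof (rule img_Collect_edges[OF g])
  fix e assume "e \<in> E"
  hence eV: "e \<subseteq> V" using edge_sub by blast
  show "g ` e \<subseteq> g ` S \<longleftrightarrow> e \<subseteq> S" by (rule inj_on_image_subset_iff[OF G_inj[OF g] eV S])
 qed
 have "E \<inter> Pow X = {e \<in> E. e \<subseteq> X}" for X by blast
 thus ?thesis using * by simp
qed

lemma phi_img:
 assumes g: "g \<in> \<Gamma>" and S: "S \<subseteq> V" and v: "v \<in> V"
 shows "phi p (g v) (g ` S) = phi p v S"
proof -
 have inj: "inj_on (%(a, b). (g a, g b)) (bdry S)"
 proof (rule inj_onI)
  fix x y assume xy: "x \<in> bdry S" "y \<in> bdry S" "(%(a, b). (g a, g b)) x = (%(a, b). (g a, g b)) y"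
  obtain a b c d where x: "x = (a, b)" and y: "y = (c, d)" by (cases x, cases y)
  have "a \<in> V" "b \<in> V" "c \<in> V" "d \<in> V" using xy(1,2) x y edge_in by (auto simp: bdry_def)
  thus "x = y" using xy(3) x y inj_onD[OF G_inj[OF g], of a c] inj_onD[OF G_inj[OF g], of b d] by simp
 qed
 have "phi p (g v) (g ` S) = (\<Sum>x\<in>bdry S. conn (E \<inter> Pow (g ` S)) p (g v) (g (fst x)) * p)"
  unfolding phi_def bdry_img[OF g S] by (subst sum.reindex[OF inj]) (simp add: split_beta)
 also have "... = (\<Sum>x\<in>bdry S. conn (E \<inter> Pow S) p v (fst x) * p)"
 proof (rule sum.cong[OF refl])
  fix x assume "x \<in> bdry S"
  hence "fst x \<in> V" using S by (auto simp: bdry_def)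
  hence "conn (E \<inter> Pow (g ` S)) p (g v) (g (fst x)) = conn (E \<inter> Pow S) p v (fst x)"
   unfolding inside_img[OF g S] by (intro prob_img[OF g _ v]) auto
  thus "conn (E \<inter> Pow (g ` S)) p (g v) (g (fst x)) * p = conn (E \<inter> Pow S) p v (fst x) * p"
   by simp
 qed
 finally show ?thesis by (simp add: phi_def split_beta)
qed

lemma phi_mono:
 assumes "finite S" "0 <= p" "p <= q" "q <= 1"
 shows "phi p v S <= phi q v S"
 unfolding phi_def
proof (rule sum_mono)
 fix x assume "x \<in> bdry S"
 have "conn (E \<inter> Pow S) p v (fst x) <= conn (E \<inter> Pow S) q v (fst x)"
  by (rule Pr_mono_p) (use assms inside_finite increasing_linked in auto)
 thus "(case x of (a, b) \<Rightarrow> conn (E \<inter> Pow S) p v a * p) <=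
  (case x of (a, b) \<Rightarrow> conn (E \<inter> Pow S) q v a * q)"
  using assms by (auto simp: split_beta intro!: mult_mono Pr_nonneg)
qed

lemma phi_uniform:
 assumes ex: "\<And>v. v \<in> V ==> \<exists>S. finite S \<and> S \<subseteq> V \<and> v \<in> S \<and> phi p v S < 1"
 shows "\<exists>N::nat. \<forall>v\<in>V. \<exists>S. finite S \<and> S \<subseteq> V \<and> v \<in> S \<and> card S <= N \<and> phi p v S <= 1 - 1 / (real N + 1)"
proof -
 define P where "P v n \<longleftrightarrow> (\<exists>S. finite S \<and> S \<subseteq> V \<and> v \<in> S \<and> card S <= n \<and> phi p v S <= 1 - 1 / (real n + 1))" for v and n :: nat
 have mono: "P v n" if P: "P v m" and mn: "m <= n" for v m n
 proof -
  obtain S where S: "finite S" "S \<subseteq> V" "v \<in> S" "card S <= m" "phi p v S <= 1 - 1 / (real m + 1)" using P by (auto simp: P_def)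
  have "1 / (real n + 1) <= 1 / (real m + 1)" using mn by (intro divide_left_mono) auto
  thus ?thesis unfolding P_def by (intro exI[of _ S]) (use S mn in auto)
 qed
 have exP: "\<exists>n. P v n" if v: "v \<in> V" for v
 proof -
  obtain S where S: "finite S" "S \<subseteq> V" "v \<in> S" "phi p v S < 1" using ex[OF v] by blast
  obtain n where n: "inverse (of_nat (Suc n)) < 1 - phi p v S" using reals_Archimedean[of "1 - phi p v S"] S(4) by auto
  have "P v (max n (card S))"
  proof -
   have "1 / (real (max n (card S)) + 1) <= 1 / (real n + 1)" by (intro divide_left_mono) auto
   hence "phi p v S <= 1 - 1 / (real (max n (card S)) + 1)" using n by (simp add: inverse_eq_divide add.commute)
   thus ?thesis unfolding P_def by (intro exI[of _ S]) (use S in auto)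
  qed
  thus ?thesis by blast
 qed
 have imp: "P (g v) n" if P: "P v n" and g: "g \<in> \<Gamma>" and v: "v \<in> V" for g v n
 proof -
  obtain S where S: "finite S" "S \<subseteq> V" "v \<in> S" "card S <= n" "phi p v S <= 1 - 1 / (real n + 1)" using P by (auto simp: P_def)
  have "card (g ` S) <= n" using card_image_le[OF S(1), of g] S(4) by simp
  moreover have "g ` S \<subseteq> V" using S(2) G_in[OF g] by blast
  ultimately show ?thesis unfolding P_def by (intro exI[of _ "g ` S"]) (use S phi_img[OF g S(2) v] in auto)
 qed
 have iff: "P (g v) n \<longleftrightarrow> P v n" if g: "g \<in> \<Gamma>" and v: "v \<in> V" for g v n
 proof
  assume h: "P (g v) n"
  obtain j where j: "j \<in> \<Gamma>" "\<forall>x\<in>V. j (g x) = x \<and> g (j x) = x" using G_inv[OF g] by blast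
  show "P v n" using imp[OF h j(1) G_in[OF g v]] j(2) v by simp
 qed (rule imp[OF _ g v])
 define \<phi> where "\<phi> v = real (LEAST n. P v n)" for v
 have "\<exists>C. \<forall>x\<in>V. \<phi> x <= C" by (rule unif_bound) (simp add: \<phi>_def iff)
 then obtain C where C: "\<forall>x\<in>V. \<phi> x <= C" by blast
 have "P v (nat \<lceil>C\<rceil>)" if v: "v \<in> V" for v
 proof (rule mono)
  show "P v (LEAST n. P v n)" using exP[OF v] by (rule LeastI_ex)
  have "real (LEAST n. P v n) <= C" using C v by (auto simp: \<phi>_def)
  thus "(LEAST n. P v n) <= nat \<lceil>C\<rceil>" by linarith
 qed
 thus ?thesis unfolding P_def by blast
qed

theorem subcritical_bound:
 assumes p: "0 <= p" "p <= 1" and ex: "\<And>v. v \<in> V ==> \<exists>S. finite S \<and> S \<subseteq> V \<and> v \<in> S \<and> phi p v S < 1"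
 shows "\<exists>C. \<forall>v\<in>V. \<forall>F X. finite F --> F \<subseteq> E --> finite X --> (\<Sum>x\<in>X. conn F p v x) <= C"
proof -
 obtain N :: nat where N: "\<forall>v\<in>V. \<exists>S. finite S \<and> S \<subseteq> V \<and> v \<in> S \<and> card S <= N \<and> phi p v S <= 1 - 1 / (real N + 1)"
  using phi_uniform[OF ex] by blast
 have "(\<Sum>x\<in>X. conn F p v x) <= real N * (real N + 1)"
  if v: "v \<in> V" and F: "finite F" "F \<subseteq> E" and X: "finite X" for v F X
 proof -
  define G where "G w = (\<Sum>x\<in>X. conn F p w x)" for w
  have G0: "0 <= G w" for w unfolding G_def by (intro sum_nonneg Pr_nonneg p)
  have "G w <= real (card X)" for w
   unfolding G_def using sum_mono[of X "%x. conn F p w x" "%_. 1"] Pr_le_1[OF F(1) p] by simp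
  hence bdd: "bdd_above (G ` V)" by (intro bdd_aboveI2[of V G "real (card X)"])
  define M where "M = (SUP w\<in>V. G w)"
  have M: "G w <= M" if "w \<in> V" for w unfolding M_def by (rule cSUP_upper[OF that bdd])
  have M0: "0 <= M" using M[OF v] G0[of v] by linarith
  have step: "G w <= real N + (1 - 1 / (real N + 1)) * M" if w: "w \<in> V" for w
  proof -
   obtain S where S: "finite S" "S \<subseteq> V" "w \<in> S" "card S <= N" "phi p w S <= 1 - 1 / (real N + 1)" using N w by blast
   have "G w = (\<Sum>x\<in>X \<inter> S. conn F p w x) + (\<Sum>x\<in>X - S. conn F p w x)"
    unfolding G_def by (rule sum.Int_Diff[OF X])
   also have "(\<Sum>x\<in>X \<inter> S. conn F p w x) <= (\<Sum>x\<in>X \<inter> S. 1)"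
    by (intro sum_mono Pr_le_1 F p)
   also have "... <= real N" using card_mono[OF S(1), of "X \<inter> S"] S(4) by simp
   also have "(\<Sum>x\<in>X - S. conn F p w x) <=
     (\<Sum>x\<in>X - S. \<Sum>(a, b)\<in>bdry S. conn (F \<inter> Pow S) p w a * p * conn F p b x)"
   proof (rule sum_mono)
    fix x assume "x \<in> X - S"
    hence x: "x \<notin> S" by simp
    show "conn F p w x <=
     (\<Sum>(a, b)\<in>bdry S. conn (F \<inter> Pow S) p w a * p * conn F p b x)"
     by (rule linked_prob_boundary[OF F(1) p S(3) x bdry_finite[OF S(1)]]) (use F(2) in \<open>auto simp: bdry_def\<close>)
   qed
   also have "... = (\<Sum>(a, b)\<in>bdry S. conn (F \<inter> Pow S) p w a * p * (\<Sum>x\<in>X - S. conn F p b x))"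
    unfolding split_beta by (subst sum.swap) (simp add: sum_distrib_left)
   also have "... <= (\<Sum>(a, b)\<in>bdry S. conn (E \<inter> Pow S) p w a * p * M)"
   proof (rule sum_mono)
    fix z assume z: "z \<in> bdry S"
    obtain a b where ab: "z = (a, b)" by (cases z)
    have bV: "b \<in> V" using z ab edge_in by (auto simp: bdry_def)
    have "(\<Sum>x\<in>X - S. conn F p b x) <= G b"
     unfolding G_def by (intro sum_mono2 X Pr_nonneg p) auto
    hence 1: "(\<Sum>x\<in>X - S. conn F p b x) <= M" using M[OF bV] by linarith
    have 2: "conn (F \<inter> Pow S) p w a <= conn (E \<inter> Pow S) p w a"
     by (rule Pr_mono_edges) (use S(1) F(2) p increasing_linked in auto)
    have "conn (F \<inter> Pow S) p w a * p * (\<Sum>x\<in>X - S. conn F p b x) <=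
     conn (E \<inter> Pow S) p w a * p * M"
     using 1 2 p by (intro mult_mono) (auto intro!: sum_nonneg mult_nonneg_nonneg Pr_nonneg)
    thus "(case z of (a, b) \<Rightarrow> conn (F \<inter> Pow S) p w a * p * (\<Sum>x\<in>X - S. conn F p b x))
     <= (case z of (a, b) \<Rightarrow> conn (E \<inter> Pow S) p w a * p * M)" by (simp add: ab)
   qed
   also have "... = phi p w S * M" by (simp add: phi_def sum_distrib_right split_beta)
   also have "... <= (1 - 1 / (real N + 1)) * M" using S(5) M0 by (rule mult_right_mono)
   finally show ?thesis by linarith
  qed
  have "M <= real N + (1 - 1 / (real N + 1)) * M" unfolding M_def
   by (rule cSUP_least) (use v step in \<open>auto simp: M_def\<close>)
  hence "M / (real N + 1) <= real N" by (simp add: algebra_simps)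
  hence "M <= real N * (real N + 1)" by (simp add: pos_divide_le_eq)
  thus ?thesis using M[OF v] by (simp add: G_def)
 qed
 thus ?thesis by blast
qed

definition escape :: "'v set \<Rightarrow> 'v \<Rightarrow> 'v set set \<Rightarrow> bool" where
 "escape \<Lambda> x om \<longleftrightarrow> (\<exists>y. y \<notin> \<Lambda> \<and> linked om x y)"

definition trap :: "'v set \<Rightarrow> 'v set set \<Rightarrow> 'v set" where
 "trap \<Lambda> om = {x \<in> \<Lambda>. \<not> escape \<Lambda> x om}"

lemma escape_mono: "escape \<Lambda> x om ==> om \<subseteq> om' ==> escape \<Lambda> x om'"
 unfolding escape_def by (elim exE conjE) (rule exI, rule conjI, assumption, rule linked_mono)

lemma escape_link: "linked om x z ==> escape \<Lambda> z om ==> escape \<Lambda> x om"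
 unfolding escape_def by (elim exE conjE) (rule exI, rule conjI, assumption, rule linked_trans)

lemma escape_outside_trap:
 assumes "escape \<Lambda> x om"
 shows "escape \<Lambda> x (om - Pow (trap \<Lambda> om))"
proof -
 obtain y where y: "y \<notin> \<Lambda>" "linked om x y" using assms by (auto simp: escape_def)
 let ?r = "%F::'v set set. {(x, y). {x, y} \<in> F}"
 have "(x, y) \<in> (?r om)\<^sup>*" using y(2) by (simp add: linked_def)
 hence "linked (om - Pow (trap \<Lambda> om)) x y"
 proof (induction rule: converse_rtrancl_induct)
  case (step a b)
  have ab: "{a, b} \<in> om" using step(1) by simp
  have "linked om b y" using step(2) by (simp add: linked_def)
  hence "linked om a y" using linked_trans[OF linked_edge[OF ab]] by blast
  hence "escape \<Lambda> a om" using y(1) by (auto simp: escape_def)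
  hence "a \<notin> trap \<Lambda> om" by (simp add: trap_def)
  hence "{a, b} \<in> om - Pow (trap \<Lambda> om)" using ab by auto
  thus ?case using linked_trans[OF linked_edge step(3)] by blast
 qed simp
 thus ?thesis using y(1) by (auto simp: escape_def)
qed

lemma trap_local: "trap \<Lambda> om = S \<longleftrightarrow> trap \<Lambda> (om - Pow S) = S"
proof
 assume S: "trap \<Lambda> om = S"
 have "escape \<Lambda> x (om - Pow S) \<longleftrightarrow> escape \<Lambda> x om" for x
  using escape_outside_trap[of \<Lambda> x om] escape_mono[of \<Lambda> x "om - Pow S" om] S by blast
 thus "trap \<Lambda> (om - Pow S) = S" using S by (simp add: trap_def)
next
 assume S: "trap \<Lambda> (om - Pow S) = S"
 have "escape \<Lambda> x (om - Pow S) \<longleftrightarrow> escape \<Lambda> x om" if x: "x \<in> \<Lambda>" for x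
 proof
  assume h: "escape \<Lambda> x om"
  show "escape \<Lambda> x (om - Pow S)"
  proof (rule ccontr)
   assume n: "\<not> escape \<Lambda> x (om - Pow S)"
   hence "x \<in> trap \<Lambda> (om - Pow S)" using x by (simp add: trap_def)
   hence xS: "x \<in> S" using S by simp
   obtain y where y: "y \<notin> \<Lambda>" "linked om x y" using h by (auto simp: escape_def)
   have "S \<subseteq> \<Lambda>" using S by (auto simp: trap_def)
   hence "y \<notin> S" using y by auto
   obtain a b P Q where ab: "a \<in> S" "b \<notin> S" "{a, b} \<in> om"
    using split_at_boundary[OF y(2) xS \<open>y \<notin> S\<close>] by (elim exE conjE)
   have e: "{a, b} \<in> om - Pow S" using ab by auto
   have "escape \<Lambda> b (om - Pow S)"
   proof (cases "b \<in> \<Lambda>")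
    case True
    thus ?thesis using ab(2) S by (auto simp: trap_def)
   qed (auto simp: escape_def intro!: exI[of _ b])
   hence "escape \<Lambda> a (om - Pow S)" by (rule escape_link[OF linked_edge[OF e]])
   thus False using ab(1) S by (auto simp: trap_def)
  qed
 qed (rule escape_mono, auto)
 thus "trap \<Lambda> om = S" using S by (auto simp: trap_def)
qed

lemma pivotal_count:
 assumes \<Lambda>: "finite \<Lambda>" and F: "finite F" "\<And>a b. a \<in> \<Lambda> ==> {a, b} \<in> E ==> {a, b} \<in> F"
  and v: "v \<in> \<Lambda>" and w: "om \<subseteq> F" "\<not> escape \<Lambda> v om"
 shows "(\<Sum>(a, b)\<in>bdry (trap \<Lambda> om). of_bool (linked (om \<inter> Pow (trap \<Lambda> om)) v a))
  <= (\<Sum>e\<in>F. of_bool (e \<notin> om \<and> escape \<Lambda> v (insert e om)) :: real)"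
proof -
 define S where "S = trap \<Lambda> om"
 have S: "S \<subseteq> \<Lambda>" by (auto simp: S_def trap_def)
 have inj: "inj_on (%(a, b). {a, b}) (bdry S)"
  by (auto simp: inj_on_def bdry_def doubleton_eq_iff)
 have "(\<Sum>(a, b)\<in>bdry S. of_bool (linked (om \<inter> Pow S) v a)) <= (\<Sum>(a, b)\<in>bdry S. of_bool ({a, b} \<notin> om \<and> escape \<Lambda> v (insert {a, b} om)) :: real)"
 proof (rule sum_mono)
  fix z assume z: "z \<in> bdry S"
  obtain a b where ab: "z = (a, b)" by (cases z)
  have h: "a \<in> S" "b \<notin> S" "{a, b} \<in> E" using z ab by (auto simp: bdry_def)
  have eb: "escape \<Lambda> b om"
  proof (cases "b \<in> \<Lambda>")
   case True
   thus ?thesis using h(2) by (auto simp: S_def trap_def)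
  qed (auto simp: escape_def intro!: exI[of _ b])
  have ne: "{a, b} \<notin> om"
  proof
   assume "{a, b} \<in> om"
   hence "escape \<Lambda> a om" by (rule escape_link[OF linked_edge eb])
   thus False using h(1) by (simp add: S_def trap_def)
  qed
  have "escape \<Lambda> v (insert {a, b} om)" if l: "linked (om \<inter> Pow S) v a"
  proof -
   have "linked (insert {a, b} om) v a" by (rule linked_mono[OF l]) auto
   moreover have "linked (insert {a, b} om) a b" by (rule linked_edge) simp
   ultimately have "linked (insert {a, b} om) v b" by (rule linked_trans)
   moreover have "escape \<Lambda> b (insert {a, b} om)" by (rule escape_mono[OF eb]) auto
   ultimately show ?thesis by (rule escape_link)
  qed
  thus "(case z of (a, b) \<Rightarrow> of_bool (linked (om \<inter> Pow S) v a)) <= (case z of (a, b) \<Rightarrow> (of_bool ({a, b} \<notin> om \<and> escape \<Lambda> v (insert {a, b} om)) :: real))"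
   using ne by (simp add: ab)
 qed
 also have "... = (\<Sum>e\<in>(%(a, b). {a, b}) ` bdry S. of_bool (e \<notin> om \<and> escape \<Lambda> v (insert e om)))"
  by (subst sum.reindex[OF inj]) (simp add: split_beta)
 also have "... <= (\<Sum>e\<in>F. of_bool (e \<notin> om \<and> escape \<Lambda> v (insert e om)))"
  using F S by (intro sum_mono2) (auto simp: bdry_def)
 finally show ?thesis by (simp add: S_def)
qed

lemma escape_derivative:
 assumes \<Lambda>: "finite \<Lambda>" "\<Lambda> \<subseteq> V" and F: "finite F" "\<And>a b. a \<in> \<Lambda> ==> {a, b} \<in> E ==> {a, b} \<in> F" "F \<subseteq> E"
  and v: "v \<in> \<Lambda>" and r: "0 <= r" "r <= 1"
  and phi: "\<And>S. finite S ==> S \<subseteq> V ==> v \<in> S ==> 1 <= phi r v S"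
 shows "1 - Pr F r (escape \<Lambda> v) <=
  (\<Sum>e\<in>F. pexp (F - {e}) r (%om. of_bool (escape \<Lambda> v (insert e om)) - of_bool (escape \<Lambda> v om)))"
proof -
 define U where "U = {S. S \<subseteq> \<Lambda> \<and> v \<in> S}"
 have Uf: "finite U" using \<Lambda>(1) by (simp add: U_def)
 have "1 - Pr F r (escape \<Lambda> v) = Pr F r (%om. \<not> escape \<Lambda> v om)"
  by (rule Pr_not[OF F(1), symmetric])
 also have "... <= (\<Sum>S\<in>U. Pr F r (%om. trap \<Lambda> om = S))"
 proof -
  have "Pr F r (%om. \<not> escape \<Lambda> v om) <= Pr F r (%om. \<exists>S\<in>U. trap \<Lambda> om = S)"
   by (rule Pr_mono[OF r]) (use v in \<open>auto simp: U_def trap_def\<close>)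
  also have "... <= (\<Sum>S\<in>U. Pr F r (%om. trap \<Lambda> om = S))" by (rule Pr_Bex_le[OF r Uf])
  finally show ?thesis .
 qed
 also have "... <= (\<Sum>S\<in>U. Pr F r (%om. trap \<Lambda> om = S) * (\<Sum>(a, b)\<in>bdry S. conn (E \<inter> Pow S) r v a))"
 proof (rule sum_mono)
  fix S assume "S \<in> U"
  hence S: "finite S" "S \<subseteq> V" "v \<in> S" using \<Lambda> finite_subset by (auto simp: U_def)
  have "1 <= phi r v S" by (rule phi[OF S])
  also have "... <= (\<Sum>(a, b)\<in>bdry S. conn (E \<inter> Pow S) r v a)"
   unfolding phi_def
  proof (rule sum_mono)
   fix z
   show "(case z of (a, b) \<Rightarrow> conn (E \<inter> Pow S) r v a * r) <= (case z of (a, b) \<Rightarrow> conn (E \<inter> Pow S) r v a)"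
    using r Pr_nonneg[OF r, of "E \<inter> Pow S" "%om. linked om v (fst z)"] by (simp add: split_beta mult_left_le)
  qed
  finally show "Pr F r (%om. trap \<Lambda> om = S) <=
   Pr F r (%om. trap \<Lambda> om = S) * (\<Sum>(a, b)\<in>bdry S. conn (E \<inter> Pow S) r v a)"
   using mult_left_mono[of 1 _ "Pr F r (%om. trap \<Lambda> om = S)"] Pr_nonneg[OF r] by fastforce
 qed
 also have "... = (\<Sum>S\<in>U. \<Sum>z\<in>bdry S. pexp F r (%om. of_bool (trap \<Lambda> om = S) * of_bool (linked (om \<inter> Pow S) v (fst z))))"
  unfolding sum_distrib_left
 proof (intro sum.cong refl)
  fix S z assume "S \<in> U" "z \<in> bdry S"
  have SF: "F \<inter> Pow S = E \<inter> Pow S"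
  proof (rule Set.set_eqI, rule iffI)
   fix e assume e: "e \<in> E \<inter> Pow S"
   then obtain x y where xy: "e = {x, y}" using edge_form by blast
   hence "x \<in> \<Lambda>" using e \<open>S \<in> U\<close> by (auto simp: U_def)
   thus "e \<in> F \<inter> Pow S" using F(2)[of x y] e xy by auto
  qed (use F(3) in auto)
  have "pexp F r (%om. of_bool (trap \<Lambda> om = S) * of_bool (linked (om \<inter> Pow S) v (fst z))) =
   pexp F r (%om. of_bool (trap \<Lambda> om = S)) * pexp F r (%om. of_bool (linked (om \<inter> Pow S) v (fst z)))"
  proof (rule pexp_mult_local[OF F(1), of _ "- Pow S" _ "Pow S"])
   fix om
   show "(of_bool (trap \<Lambda> om = S) :: real) = of_bool (trap \<Lambda> (om \<inter> - Pow S) = S)"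
    using trap_local[of \<Lambda> om S] by (simp add: Diff_eq)
  qed auto
  also have "pexp F r (%om. of_bool (linked (om \<inter> Pow S) v (fst z))) = conn (E \<inter> Pow S) r v (fst z)"
   using Pr_restrict[OF F(1), of r "%om. linked om v (fst z)" "Pow S"] SF by (simp add: Pr_def)
  finally show "Pr F r (%om. trap \<Lambda> om = S) * (case z of (a, b) \<Rightarrow> conn (E \<inter> Pow S) r v a) =
   pexp F r (%om. of_bool (trap \<Lambda> om = S) * of_bool (linked (om \<inter> Pow S) v (fst z)))"
   by (simp add: Pr_def split_beta)
 qed
 also have "... = pexp F r (%om. \<Sum>S\<in>U. of_bool (trap \<Lambda> om = S) * (\<Sum>z\<in>bdry S. of_bool (linked (om \<inter> Pow S) v (fst z))))"
  by (simp add: pexp_sum sum_distrib_left)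
 also have "... <= pexp F r (%om. \<Sum>e\<in>F. of_bool (e \<notin> om \<and> \<not> escape \<Lambda> v om \<and> escape \<Lambda> v (insert e om)))"
 proof (rule pexp_mono[OF r])
  fix om assume w: "om \<subseteq> F"
  have eq: "(\<Sum>S\<in>U. of_bool (trap \<Lambda> om = S) * (\<Sum>z\<in>bdry S. of_bool (linked (om \<inter> Pow S) v (fst z)))) =
   (\<Sum>S\<in>U. if trap \<Lambda> om = S then (\<Sum>z\<in>bdry S. of_bool (linked (om \<inter> Pow S) v (fst z))) else (0::real))"
   by (intro sum.cong refl) simp
  show "(\<Sum>S\<in>U. of_bool (trap \<Lambda> om = S) * (\<Sum>z\<in>bdry S. of_bool (linked (om \<inter> Pow S) v (fst z))))
   <= (\<Sum>e\<in>F. of_bool (e \<notin> om \<and> \<not> escape \<Lambda> v om \<and> escape \<Lambda> v (insert e om)) :: real)"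
  proof (cases "escape \<Lambda> v om")
   case True
   hence "trap \<Lambda> om \<notin> U" by (auto simp: U_def trap_def)
   thus ?thesis unfolding eq using Uf by (simp add: sum_nonneg)
  next
   case False
   hence "trap \<Lambda> om \<in> U" using v by (auto simp: U_def trap_def)
   thus ?thesis unfolding eq using Uf False pivotal_count[OF \<Lambda>(1) F(1,2) v w False]
    by (simp add: split_beta)
  qed
 qed
 also have "... = (\<Sum>e\<in>F. pexp F r (%om. of_bool (e \<notin> om \<and> \<not> escape \<Lambda> v om \<and> escape \<Lambda> v (insert e om))))"
  by (rule pexp_sum)
 also have "... <= (\<Sum>e\<in>F. pexp (F - {e}) r (%om. of_bool (escape \<Lambda> v (insert e om)) - of_bool (escape \<Lambda> v om)))"
 proof (rule sum_mono)
  fix e assume "e \<in> F"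
  hence eq: "insert e (F - {e}) = F" by auto
  let ?k = "%om. of_bool (e \<notin> om \<and> \<not> escape \<Lambda> v om \<and> escape \<Lambda> v (insert e om)) :: real"
  let ?d = "%om. of_bool (escape \<Lambda> v (insert e om)) - of_bool (escape \<Lambda> v om) :: real"
  have k0: "pexp (F - {e}) r (%om. ?k (insert e om)) = 0" by (simp add: pexp_def)
  have em: "escape \<Lambda> v om ==> escape \<Lambda> v (insert e om)" for om by (rule escape_mono) auto
  have kd: "pexp (F - {e}) r ?k <= pexp (F - {e}) r ?d"
   by (rule pexp_mono[OF r]) (use em in \<open>auto simp: of_bool_def\<close>)
  have "pexp F r ?k = (1 - r) * pexp (F - {e}) r ?k"
   using pexp_insert[of "F - {e}" e r ?k] F(1) k0 eq by simp
  also have "... <= pexp (F - {e}) r ?k"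
   using r pexp_nonneg[OF r, of "F - {e}" ?k] by (simp add: mult_left_le_one_le)
  finally show "pexp F r ?k <= pexp (F - {e}) r ?d" using kd by linarith
 qed
 finally show ?thesis .
qed

theorem supercritical_escape:
 assumes p: "0 <= p" "p <= q" "q <= 1" and v: "v \<in> V"
  and phi: "\<And>S. finite S ==> S \<subseteq> V ==> v \<in> S ==> 1 <= phi p v S"
 shows "1 - exp (p - q) <= Pr {e \<in> E. e \<subseteq> bl (Suc n) v} q (escape (bl n v) v)"
proof -
 define F where "F = {e \<in> E. e \<subseteq> bl (Suc n) v}"
 define g where "g r = Pr F r (escape (bl n v) v)" for r
 have F: "finite F" "F \<subseteq> E" unfolding F_def by (rule ball_edges_finite) auto
 have F2: "{a, b} \<in> F" if "a \<in> bl n v" "{a, b} \<in> E" for a b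
  using that by (auto simp: F_def nb_def)
 define g' where "g' r = (\<Sum>e\<in>F. pexp (F - {e}) r (%om. of_bool (escape (bl n v) v (insert e om)) - of_bool (escape (bl n v) v om)))" for r
 have der: "(g has_real_derivative g' r) (at r)" for r
  unfolding g_def g'_def Pr_def by (rule russo_formula[OF F(1)])
 have ge: "1 - g r <= g' r" if r: "p <= r" "r <= q" for r
  unfolding g_def g'_def
 proof (rule escape_derivative[OF bl_finite bl_in[OF v] F(1) F2 F(2) bl_self])
  show "0 <= r" "r <= 1" using r p by auto
  fix S assume S: "finite S" "S \<subseteq> V" "v \<in> S"
  show "1 <= phi r v S" using phi[OF S] phi_mono[OF S(1) p(1) r(1), of v] r(2) p(3) by linarith
 qed
 define k where "k r = exp r * (1 - g r)" for r
 have "k q <= k p"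
 proof (rule DERIV_nonpos_imp_nonincreasing[OF p(2)])
  fix r assume r: "p <= r" "r <= q"
  have "(k has_real_derivative exp r * (1 - g r) - exp r * g' r) (at r)"
   unfolding k_def by (auto intro!: derivative_eq_intros der)
  moreover have "exp r * (1 - g r) - exp r * g' r <= 0" using ge[OF r] by simp
  ultimately show "\<exists>y. (k has_real_derivative y) (at r) \<and> y <= 0" by blast
 qed
 moreover have "0 <= g p" unfolding g_def using p by (intro Pr_nonneg) auto
 hence "exp p * (1 - g p) <= exp p * 1" by (intro mult_left_mono) auto
 with calculation have "exp q * (1 - g q) <= exp p" unfolding k_def by linarith
 hence "1 - g q <= exp (p - q)" by (simp add: exp_diff pos_le_divide_eq mult.commute)
 thus ?thesis by (simp add: g_def F_def)
qed

end

section \<open>The percolation measure\<close>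

lemma finite_path_edges: "finite (path_edges xs)"
 by (induction xs rule: path_edges.induct) auto

lemma linked_finite_witness: "linked F x y ==> \<exists>J. finite J \<and> J \<subseteq> F \<and> linked J x y"
proof -
 assume l: "linked F x y"
 from linked_imp_path[OF l] obtain xs where xs: "xs \<noteq> []" "hd xs = x" "last xs = y" "distinct xs" "path_edges xs \<subseteq> F"
  by (elim exE conjE)
 have "linked (path_edges xs) x y" using linked_path_edges[OF xs(1)] xs(2,3) by simp
 thus ?thesis using xs(5) finite_path_edges by blast
qed

lemma prob_space_percolation: "prob_space (percolation E p)"
 unfolding percolation_def by (intro prob_space_PiM measure_pmf.prob_space_axioms)

lemma open_measurable:
 assumes "e \<in> E"
 shows "{om \<in> space (percolation E p). om e \<in> S} \<in> sets (percolation E p)"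
proof -
 have "(%om. om e) \<in> measurable (percolation E p) (measure_pmf (bernoulli_pmf p))"
  unfolding percolation_def by (rule measurable_component_singleton[OF assms])
 hence "(%om. om e) -` S \<inter> space (percolation E p) \<in> sets (percolation E p)"
  by (rule measurable_sets) simp
 moreover have "(%om. om e) -` S \<inter> space (percolation E p) = {om \<in> space (percolation E p). om e \<in> S}" by blast
 ultimately show ?thesis by simp
qed

lemma percolation_cylinder:
 fixes E :: "'v set set"
 assumes "J \<subseteq> E" "finite J"
 shows "{om \<in> space (percolation E p). \<forall>e\<in>J. om e \<in> X e} \<in> sets (percolation E p)"
  "measure (percolation E p) {om \<in> space (percolation E p). \<forall>e\<in>J. om e \<in> X e} =
   (\<Prod>e\<in>J. measure (measure_pmf (bernoulli_pmf p)) (X e))"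
proof -
 interpret product_prob_space "%_::'v set. measure_pmf (bernoulli_pmf p)" E
  by (intro product_prob_spaceI measure_pmf.prob_space_axioms)
 have eq: "{om \<in> space (percolation E p). \<forall>e\<in>J. om e \<in> X e} = emb E J (Pi\<^sub>E J X)"
  unfolding prod_emb_def percolation_def using assms by (auto simp: space_PiM Pi_iff)
 show "measure (percolation E p) {om \<in> space (percolation E p). \<forall>e\<in>J. om e \<in> X e} =
   (\<Prod>e\<in>J. measure (measure_pmf (bernoulli_pmf p)) (X e))"
  unfolding eq unfolding percolation_def by (rule measure_PiM_emb) (use assms in auto)
 show "{om \<in> space (percolation E p). \<forall>e\<in>J. om e \<in> X e} \<in> sets (percolation E p)"
  unfolding eq unfolding percolation_def by (rule sets_PiM_I[OF assms(2,1)]) auto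
qed

lemma measure_finite_event:
 assumes p: "0 <= p" "p <= 1" and F: "finite F" "F \<subseteq> E"
 shows "measure (percolation E p) {om \<in> space (percolation E p). A (open_edges E om \<inter> F)} = Pr F p A"
proof -
 define C where "C w = {om \<in> space (percolation E p). \<forall>e\<in>F. om e \<in> (if e \<in> w then {True} else {False})}" for w
 interpret prob_space "percolation E p" by (rule prob_space_percolation)
 have C_sets: "C w \<in> sets (percolation E p)" for w unfolding C_def by (rule percolation_cylinder(1)[OF F(2,1)])
 have C_eq: "C w = {om \<in> space (percolation E p). open_edges E om \<inter> F = w}" if "w \<subseteq> F" for w
  using that F(2) by (auto simp: C_def open_edges_def split: if_splits)
 have Cm: "measure (percolation E p) (C w) = p ^ card w * (1 - p) ^ card (F - w)" if w: "w \<subseteq> F" for w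
 proof -
  have "measure (percolation E p) (C w) = (\<Prod>e\<in>F. measure (measure_pmf (bernoulli_pmf p)) (if e \<in> w then {True} else {False}))"
   unfolding C_def by (rule percolation_cylinder(2)[OF F(2,1)])
  also have "... = (\<Prod>e\<in>F. if e \<in> w then p else 1 - p)"
   using p by (intro prod.cong refl) (simp add: measure_pmf_single)
  also have "... = p ^ card w * (1 - p) ^ card (F - w)"
  proof -
   have "F \<inter> {e. e \<in> w} = w" "F \<inter> - {e. e \<in> w} = F - w" using w by auto
   thus ?thesis using F(1) by (simp add: prod.If_cases)
  qed
  finally show ?thesis .
 qed
 have "{om \<in> space (percolation E p). A (open_edges E om \<inter> F)} = (\<Union>w\<in>{w \<in> Pow F. A w}. C w)"
 proof (rule Set.set_eqI, rule iffI)
  fix om assume w: "om \<in> {om \<in> space (percolation E p). A (open_edges E om \<inter> F)}"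
  hence 1: "om \<in> C (open_edges E om \<inter> F)" by (simp add: C_eq)
  have 2: "open_edges E om \<inter> F \<in> {w \<in> Pow F. A w}" using w by simp
  show "om \<in> (\<Union>w\<in>{w \<in> Pow F. A w}. C w)" by (rule UN_I[of _ _ _ C, OF 2 1])
 next
  fix om assume "om \<in> (\<Union>w\<in>{w \<in> Pow F. A w}. C w)"
  then obtain w where w: "w \<subseteq> F" "A w" "om \<in> C w" by auto
  thus "om \<in> {om \<in> space (percolation E p). A (open_edges E om \<inter> F)}" using C_eq[OF w(1)] by simp
 qed
 also have "measure (percolation E p) ... = (\<Sum>w\<in>{w \<in> Pow F. A w}. measure (percolation E p) (C w))"
 proof (rule finite_measure_finite_Union)
  show "finite {w \<in> Pow F. A w}" using F(1) by simp
  show "C ` {w \<in> Pow F. A w} \<subseteq> sets (percolation E p)" using C_sets by blast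
  show "disjoint_family_on C {w \<in> Pow F. A w}" using C_eq by (auto simp: disjoint_family_on_def)
 qed
 also have "... = (\<Sum>w\<in>Pow F. p ^ card w * (1 - p) ^ card (F - w) * of_bool (A w))"
  by (rule sum.mono_neutral_cong_left) (use F(1) Cm in auto)
 finally show ?thesis by (simp add: Pr_def pexp_def)
qed

lemma linked_measurable:
 assumes "sigma_algebra \<Omega> \<A>" "countable D" "\<And>e. e \<in> D ==> {om \<in> \<Omega>. om e} \<in> \<A>"
 shows "{om \<in> \<Omega>. linked {e \<in> D. om e} x y} \<in> \<A>"
proof -
 interpret sigma_algebra \<Omega> \<A> by (rule assms)
 define \<J> where "\<J> = {J. finite J \<and> J \<subseteq> D \<and> linked J x y}"
 have "countable {J. finite J \<and> J \<subseteq> D}" by (rule countable_Collect_finite_subset[OF assms(2)])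
 hence cJ: "countable \<J>" by (rule countable_subset[rotated]) (auto simp: \<J>_def)
 have "linked {e \<in> D. om e} x y \<longleftrightarrow> (\<exists>J\<in>\<J>. \<forall>e\<in>J. om e)" for om
 proof
  assume l: "linked {e \<in> D. om e} x y"
  from linked_finite_witness[OF l] obtain J where J: "finite J" "J \<subseteq> {e \<in> D. om e}" "linked J x y"
   by (elim exE conjE)
  hence "J \<in> \<J>" by (auto simp: \<J>_def)
  thus "\<exists>J\<in>\<J>. \<forall>e\<in>J. om e" using J(2) by blast
 next
  assume "\<exists>J\<in>\<J>. \<forall>e\<in>J. om e"
  then obtain J where J: "J \<subseteq> D" "linked J x y" "\<forall>e\<in>J. om e" by (auto simp: \<J>_def)
  show "linked {e \<in> D. om e} x y" by (rule linked_mono[OF J(2)]) (use J in auto)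
 qed
 moreover have "{om \<in> \<Omega>. \<exists>J\<in>\<J>. \<forall>e\<in>J. om e} \<in> \<A>"
 proof (rule sets_Collect_countable_Ex'[OF _ cJ])
  fix J assume "J \<in> \<J>"
  thus "{om \<in> \<Omega>. \<forall>e\<in>J. om e} \<in> \<A>"
   by (intro sets_Collect_countable_All' assms(3)) (auto simp: \<J>_def countable_finite)
 qed
 ultimately show ?thesis by simp
qed

context qt_graph
begin

lemma V_countable: "countable V"
proof (cases "V = {}")
 case False
 then obtain v where v: "v \<in> V" by blast
 have "V \<subseteq> (\<Union>n. bl n v)" using bl_cover[OF v] by blast
 thus ?thesis by (rule countable_subset) (auto intro: countable_finite bl_finite)
qed simp

lemma E_countable: "countable E"
proof -
 have "E \<subseteq> (%(x, y). {x, y}) ` (V \<times> V)"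
 proof
  fix e assume "e \<in> E"
  then obtain x y where "x \<in> V" "y \<in> V" "e = {x, y}" using edge_form by blast
  thus "e \<in> (%(x, y). {x, y}) ` (V \<times> V)" by auto
 qed
 thus ?thesis by (rule countable_subset) (use V_countable in auto)
qed

lemma infinite_iff_ball: "v \<in> V ==> X \<subseteq> V ==> infinite X \<longleftrightarrow> (\<forall>n. \<exists>x\<in>V. x \<notin> bl n v \<and> x \<in> X)"
proof
 assume v: "v \<in> V" and X: "X \<subseteq> V" and inf: "infinite X"
 show "\<forall>n. \<exists>x\<in>V. x \<notin> bl n v \<and> x \<in> X"
 proof
  fix n
  have "\<not> X \<subseteq> bl n v" using inf bl_finite finite_subset by blast
  thus "\<exists>x\<in>V. x \<notin> bl n v \<and> x \<in> X" using X by blast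
 qed
next
 assume v: "v \<in> V" and X: "X \<subseteq> V" and all: "\<forall>n. \<exists>x\<in>V. x \<notin> bl n v \<and> x \<in> X"
 show "infinite X"
 proof
  assume fin: "finite X"
  have "\<forall>x\<in>X. \<exists>n. x \<in> bl n v" using bl_cover[OF v] X by blast
  then obtain f where f: "\<forall>x\<in>X. x \<in> bl (f x) v" by metis
  obtain N where N: "\<forall>x\<in>X. f x <= N" using fin by (metis finite_nat_set_iff_bounded_le finite_imageI imageI)
  have "X \<subseteq> bl N v" using f N bl_mono by blast
  thus False using all by blast
 qed
qed

definition inf_event :: "'v set set \<Rightarrow> ('v set \<Rightarrow> bool) \<Rightarrow> bool" where
 "inf_event D om \<longleftrightarrow> (\<exists>v\<in>V. infinite {x \<in> V. linked {e \<in> D. om e} v x})"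

lemma inf_event_measurable:
 assumes "sigma_algebra \<Omega> \<A>" "D \<subseteq> E" "\<And>e. e \<in> D ==> {om \<in> \<Omega>. om e} \<in> \<A>"
 shows "{om \<in> \<Omega>. inf_event D om} \<in> \<A>"
proof -
 interpret sigma_algebra \<Omega> \<A> by (rule assms)
 have cD: "countable D" using assms(2) E_countable by (rule countable_subset)
 have L: "{om \<in> \<Omega>. linked {e \<in> D. om e} x y} \<in> \<A>" for x y by (rule linked_measurable[OF assms(1) cD assms(3)])
 have eq: "inf_event D om \<longleftrightarrow> (\<exists>v\<in>V. \<forall>n\<in>UNIV. \<exists>x\<in>V. x \<notin> bl n v \<and> linked {e \<in> D. om e} v x)" for om
 proof -
  have "infinite {x \<in> V. linked {e \<in> D. om e} v x} \<longleftrightarrow> (\<forall>n\<in>UNIV. \<exists>x\<in>V. x \<notin> bl n v \<and> linked {e \<in> D. om e} v x)" if "v \<in> V" for v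
   using infinite_iff_ball[OF that, of "{x \<in> V. linked {e \<in> D. om e} v x}"] by auto
  thus ?thesis by (simp add: inf_event_def)
 qed
 show ?thesis unfolding eq
 proof (rule sets_Collect_countable_Ex'[OF _ V_countable])
  fix v
  show "{om \<in> \<Omega>. \<forall>n\<in>UNIV. \<exists>x\<in>V. x \<notin> bl n v \<and> linked {e \<in> D. om e} v x} \<in> \<A>"
   by (intro sets_Collect_countable_All' sets_Collect_countable_Ex' V_countable sets_Collect_conj sets_Collect_const L) auto
 qed
qed

lemma inf_event_finite_change:
 assumes D: "D \<subseteq> E" "finite (E - D)"
 shows "inf_event D om \<longleftrightarrow> inf_event E om"
proof
 assume "inf_event D om"
 then obtain v where v: "v \<in> V" "infinite {x \<in> V. linked {e \<in> D. om e} v x}" by (auto simp: inf_event_def)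
 have "{x \<in> V. linked {e \<in> D. om e} v x} \<subseteq> {x \<in> V. linked {e \<in> E. om e} v x}"
 proof
  fix x assume x: "x \<in> {x \<in> V. linked {e \<in> D. om e} v x}"
  hence "linked {e \<in> D. om e} v x" by simp
  hence "linked {e \<in> E. om e} v x" by (rule linked_mono) (use D in auto)
  thus "x \<in> {x \<in> V. linked {e \<in> E. om e} v x}" using x by simp
 qed
 thus "inf_event E om" using v infinite_super by (auto simp: inf_event_def)
next
 assume "inf_event E om"
 then obtain v where v: "v \<in> V" "infinite {x \<in> V. linked {e \<in> E. om e} v x}" by (auto simp: inf_event_def)
 show "inf_event D om"
 proof (rule ccontr)
  assume n: "\<not> inf_event D om"
  define S where "S = insert v (\<Union>(E - D))"
  have S: "finite S" "S \<subseteq> V" using D edge_finite edge_sub v(1) by (auto simp: S_def)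
  have "{x \<in> V. linked {e \<in> E. om e} v x} \<subseteq> (\<Union>s\<in>S. {x \<in> V. linked {e \<in> D. om e} s x})"
  proof
   fix x assume x: "x \<in> {x \<in> V. linked {e \<in> E. om e} v x}"
   have l1: "linked {e \<in> E. om e} v x" using x by simp
   have vS: "v \<in> S" by (simp add: S_def)
   from first_hit[of _ x v "%z. z \<in> S", OF linked_sym[OF l1] vS] obtain z where
    z: "z \<in> S" "linked ({e \<in> E. om e} \<inter> {e. \<exists>y\<in>e. y \<notin> S}) x z" by (elim exE conjE)
   have "linked {e \<in> D. om e} x z" by (rule linked_mono[OF z(2)]) (auto simp: S_def)
   hence "linked {e \<in> D. om e} z x" by (rule linked_sym)
   thus "x \<in> (\<Union>s\<in>S. {x \<in> V. linked {e \<in> D. om e} s x})" using x by (intro UN_I[OF z(1)]) simp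
  qed
  moreover have "finite (\<Union>s\<in>S. {x \<in> V. linked {e \<in> D. om e} s x})"
   using n S by (auto simp: inf_event_def)
  ultimately show False using v(2) finite_subset by blast
 qed
qed

lemma inf_event_zero_one:
 assumes inf: "infinite E"
 shows "measure (percolation E p) {om \<in> space (percolation E p). inf_event E om} = 0 \<or>
  measure (percolation E p) {om \<in> space (percolation E p). inf_event E om} = 1"
proof -
 interpret prob_space "percolation E p" by (rule prob_space_percolation)
 let ?O = "space (percolation E p)"
 define en where "en = from_nat_into E"
 have bij: "bij_betw en UNIV E" unfolding en_def by (rule bij_betw_from_nat_into[OF E_countable inf])
 have enE: "en i \<in> E" for i using bij by (auto simp: bij_betw_def)
 have inj: "inj en" using bij by (auto simp: bij_betw_def)
 define A where "A i = {{om \<in> ?O. om (en i) \<in> S} | S. True}" for i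
 have sa: "sigma_algebra ?O (A i)" for i
 proof (rule sigma_algebra_iff2[THEN iffD2], intro conjI ballI allI impI)
  show "A i \<subseteq> Pow ?O" by (auto simp: A_def)
  show "{} \<in> A i" by (auto simp: A_def intro!: exI[of _ "{}"])
  show "?O - s \<in> A i" if "s \<in> A i" for s
  proof -
   obtain S where "s = {om \<in> ?O. om (en i) \<in> S}" using \<open>s \<in> A i\<close> by (auto simp: A_def)
   hence "?O - s = {om \<in> ?O. om (en i) \<in> - S}" by auto
   thus ?thesis by (auto simp: A_def)
  qed
  show "(\<Union>k. B k) \<in> A i" if "range B \<subseteq> A i" for B :: "nat \<Rightarrow> _"
  proof -
   have ex: "\<forall>k. \<exists>S. B k = {om \<in> ?O. om (en i) \<in> S}"
   proof
    fix k
    have "B k \<in> A i" using \<open>range B \<subseteq> A i\<close> rangeI[of B k] by (rule subsetD)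
    thus "\<exists>S. B k = {om \<in> ?O. om (en i) \<in> S}" by (simp add: A_def)
   qed
   from choice[OF ex] obtain S where S: "\<forall>k. B k = {om \<in> ?O. om (en i) \<in> S k}" by (elim exE)
   hence eq: "(\<Union>k. B k) = {om \<in> ?O. om (en i) \<in> (\<Union>k. S k)}" by auto
   show ?thesis unfolding A_def
    by (rule CollectI, rule exI[of _ "\<Union>k. S k"], rule conjI, rule eq, rule TrueI)
  qed
 qed
 have ind: "indep_sets A UNIV"
 proof (rule indep_setsI)
  show "A i \<subseteq> events" for i using open_measurable[OF enE] by (auto simp: A_def)
  fix B :: "nat \<Rightarrow> ('v set \<Rightarrow> bool) set" and J :: "nat set"
  assume J: "J \<noteq> {}" "finite J" "\<forall>j\<in>J. B j \<in> A j"
  have ex: "\<forall>j\<in>J. \<exists>S. B j = {om \<in> ?O. om (en j) \<in> S}" using J(3) by (simp add: A_def)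
  from bchoice[OF ex] obtain S where S: "\<forall>j\<in>J. B j = {om \<in> ?O. om (en j) \<in> S j}" by (elim exE)
  define X where "X e = S (inv_into UNIV en e)" for e
  have X: "X (en j) = S j" for j by (simp add: X_def inv_f_f[OF inj])
  have "(\<Inter>j\<in>J. B j) = {om \<in> ?O. \<forall>e\<in>en ` J. om e \<in> X e}" using S J(1) X by auto
  hence "prob (\<Inter>j\<in>J. B j) = (\<Prod>e\<in>en ` J. measure (measure_pmf (bernoulli_pmf p)) (X e))"
   using percolation_cylinder(2)[of "en ` J" E p X] enE J(2) by auto
  also have "... = (\<Prod>j\<in>J. measure (measure_pmf (bernoulli_pmf p)) (S j))"
   by (subst prod.reindex) (use inj X in \<open>auto simp: inj_on_def\<close>)
  also have "... = (\<Prod>j\<in>J. prob (B j))"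
  proof (rule prod.cong[OF refl])
   fix j assume "j \<in> J"
   hence "B j = {om \<in> ?O. \<forall>e\<in>{en j}. om e \<in> X e}" using S X by auto
   thus "measure (measure_pmf (bernoulli_pmf p)) (S j) = prob (B j)"
    using percolation_cylinder(2)[of "{en j}" E p X] enE X by auto
  qed
  finally show "prob (\<Inter>j\<in>J. B j) = (\<Prod>j\<in>J. prob (B j))" .
 qed
 have tail: "{om \<in> ?O. inf_event E om} \<in> tail_events A"
  unfolding tail_events_def
 proof
  fix n :: nat
  define D where "D = en ` {n..}"
  have DE: "D \<subseteq> E" using enE by (auto simp: D_def)
  have "E - D \<subseteq> en ` {..<n}"
  proof
   fix e assume e: "e \<in> E - D"
   then obtain i where i: "e = en i" using bij by (auto simp: bij_betw_def)
   hence "i < n" using e by (auto simp: D_def not_le)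
   thus "e \<in> en ` {..<n}" using i by auto
  qed
  hence fin: "finite (E - D)" by (rule finite_subset) simp
  have eq: "{om \<in> ?O. inf_event E om} = {om \<in> ?O. inf_event D om}" using inf_event_finite_change[OF DE fin] by simp
  show "{om \<in> ?O. inf_event E om} \<in> sigma_sets ?O (\<Union> (A ` {n..}))"
   unfolding eq
  proof (rule inf_event_measurable[OF _ DE])
   show "sigma_algebra ?O (sigma_sets ?O (\<Union> (A ` {n..})))"
    by (rule sigma_algebra_sigma_sets) (auto simp: A_def)
   fix e assume "e \<in> D"
   then obtain i where i: "n <= i" "e = en i" by (auto simp: D_def)
   have "{om \<in> ?O. om e} \<in> A i" unfolding A_def using i(2) by (auto intro!: exI[of _ "{True}"])
   thus "{om \<in> ?O. om e} \<in> sigma_sets ?O (\<Union> (A ` {n..}))" using i(1) by (intro sigma_sets.Basic) auto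
  qed
 qed
 show ?thesis by (rule kolmogorov_0_1_law[OF sa ind tail])
qed

lemma cluster_inf_event: "(\<exists>v\<in>V. infinite (cluster V E om v)) \<longleftrightarrow> inf_event E om"
 by (simp add: inf_event_def cluster_def open_edges_def)

lemma linked_event_measurable:
 "{om \<in> space (percolation E p). linked (open_edges E om) x y} \<in> sets (percolation E p)"
proof -
 have "{om \<in> space (percolation E p). om e} \<in> sets (percolation E p)" if "e \<in> E" for e
  using open_measurable[OF that, of p "{True}"] by simp
 thus ?thesis unfolding open_edges_def by (intro linked_measurable E_countable sets.sigma_algebra_axioms)
qed

theorem two_point_le:
 assumes p: "0 <= p" "p <= 1" and x: "x \<in> V"
  and le: "\<And>F. finite F ==> F \<subseteq> E ==> conn F p x y <= c"
 shows "two_point E p x y <= c"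
proof -
 interpret prob_space "percolation E p" by (rule prob_space_percolation)
 define F where "F n = {e \<in> E. e \<subseteq> bl n x}" for n
 have F: "finite (F n)" "F n \<subseteq> E" for n using ball_edges_finite by (auto simp: F_def)
 define A where "A n = {om \<in> space (percolation E p). linked (open_edges E om \<inter> F n) x y}" for n
 have mono: "F m \<subseteq> F n" if "m <= n" for m n using bl_mono[OF that] by (auto simp: F_def)
 have Fw: "{om \<in> space (percolation E p). om e} \<in> sets (percolation E p)" if "e \<in> E" for e
  using open_measurable[OF that, of p "{True}"] by simp
 have As: "A n \<in> sets (percolation E p)" for n
 proof -
  have "open_edges E om \<inter> F n = {e \<in> F n. om e}" for om using F(2) by (auto simp: open_edges_def)
  moreover have "{om \<in> space (percolation E p). linked {e \<in> F n. om e} x y} \<in> sets (percolation E p)"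
   by (rule linked_measurable[OF sets.sigma_algebra_axioms countable_finite[OF F(1)] Fw]) (use F(2) in blast)
  ultimately show ?thesis unfolding A_def by simp
 qed
 have Ainc: "incseq A"
 proof (rule incseq_SucI, rule subsetI)
  fix n om assume w: "om \<in> A n"
  hence l: "linked (open_edges E om \<inter> F n) x y" by (simp add: A_def)
  have "linked (open_edges E om \<inter> F (Suc n)) x y" by (rule linked_mono[OF l]) (use mono[of n "Suc n"] in auto)
  thus "om \<in> A (Suc n)" using w by (simp add: A_def)
 qed
 have "(\<Union>n. A n) = {om \<in> space (percolation E p). linked (open_edges E om) x y}"
 proof (rule Set.set_eqI, rule iffI)
  fix om assume "om \<in> (\<Union>n. A n)"
  then obtain n where n: "om \<in> space (percolation E p)" "linked (open_edges E om \<inter> F n) x y" by (auto simp: A_def)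
  have "linked (open_edges E om) x y" by (rule linked_mono[OF n(2)]) auto
  thus "om \<in> {om \<in> space (percolation E p). linked (open_edges E om) x y}" using n by simp
 next
  fix om assume w: "om \<in> {om \<in> space (percolation E p). linked (open_edges E om) x y}"
  hence l: "linked (open_edges E om) x y" by simp
  from linked_finite_witness[OF l] obtain J where J: "finite J" "J \<subseteq> open_edges E om" "linked J x y"
   by (elim exE conjE)
  have "J \<subseteq> E" using J(2) by (auto simp: open_edges_def)
  then obtain R where R: "\<forall>e\<in>J. e \<subseteq> bl R x" using finite_edges_ball[OF J(1) _ x] by blast
  have "linked (open_edges E om \<inter> F R) x y" by (rule linked_mono[OF J(3)]) (use J(2) R \<open>J \<subseteq> E\<close> in \<open>auto simp: F_def\<close>)
  thus "om \<in> (\<Union>n. A n)" using w by (auto simp: A_def)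
 qed
 hence "(%n. measure (percolation E p) (A n)) \<longlonglongrightarrow> two_point E p x y"
  using finite_Lim_measure_incseq[OF _ Ainc] As unfolding two_point_def by auto
 moreover have "measure (percolation E p) (A n) <= c" for n
  unfolding A_def using measure_finite_event[OF p F(1,2)[of n], of "%om. linked om x y"] le[OF F] by simp
 ultimately show ?thesis by (intro LIMSEQ_le_const2) auto
qed

lemma inf_event_pos:
 assumes p: "0 <= p" "p <= 1" and v: "v \<in> V"
  and ge: "\<And>n. \<eta> <= Pr {e \<in> E. e \<subseteq> bl (Suc n) v} p (escape (bl n v) v)"
 shows "\<eta> <= measure (percolation E p) {om \<in> space (percolation E p). inf_event E om}"
proof -
 interpret prob_space "percolation E p" by (rule prob_space_percolation)
 define A where "A n = {om \<in> space (percolation E p). \<exists>y\<in>V. y \<notin> bl n v \<and> linked (open_edges E om) v y}" for n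
 have As: "A n \<in> sets (percolation E p)" for n
  unfolding A_def
  by (intro sets.sets_Collect_countable_Ex' V_countable sets.sets_Collect_conj sets.sets_Collect_const linked_event_measurable)
 have Adec: "decseq A"
  by (rule decseq_SucI, rule subsetI) (use bl_mono[of _ "Suc _" v] in \<open>auto simp: A_def\<close>)
 have "measure (percolation E p) (A n) \<ge> \<eta>" for n
 proof -
  let ?F = "{e \<in> E. e \<subseteq> bl (Suc n) v}"
  have F: "finite ?F" "?F \<subseteq> E" by (rule ball_edges_finite) blast
  have "\<eta> <= Pr ?F p (escape (bl n v) v)" by (rule ge)
  also have "... = measure (percolation E p) {om \<in> space (percolation E p). escape (bl n v) v (open_edges E om \<inter> ?F)}"
   by (rule measure_finite_event[OF p F, symmetric])
  also have "... <= measure (percolation E p) (A n)"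
  proof (rule finite_measure_mono[OF subsetI As])
   fix om assume w: "om \<in> {om \<in> space (percolation E p). escape (bl n v) v (open_edges E om \<inter> ?F)}"
   then obtain y where y: "y \<notin> bl n v" "linked (open_edges E om \<inter> ?F) v y" by (auto simp: escape_def)
   have "linked (open_edges E om) v y" by (rule linked_mono[OF y(2)]) auto
   moreover have "y \<in> V" by (rule linked_in[OF _ v y(2)]) auto
   ultimately show "om \<in> A n" using w y(1) by (auto simp: A_def)
  qed
  finally show ?thesis .
 qed
 moreover have "(%n. measure (percolation E p) (A n)) \<longlonglongrightarrow> measure (percolation E p) (\<Inter>n. A n)"
  using finite_Lim_measure_decseq[OF _ Adec] As by auto
 ultimately have "\<eta> <= measure (percolation E p) (\<Inter>n. A n)" by (intro LIMSEQ_le_const) auto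
 also have "... <= measure (percolation E p) {om \<in> space (percolation E p). inf_event E om}"
 proof (rule finite_measure_mono[OF subsetI])
  show "{om \<in> space (percolation E p). inf_event E om} \<in> sets (percolation E p)"
  proof (rule inf_event_measurable[OF sets.sigma_algebra_axioms order_refl])
   fix e assume "e \<in> E"
   thus "{om \<in> space (percolation E p). om e} \<in> sets (percolation E p)"
    using open_measurable[of e E p "{True}"] by simp
  qed
  fix om assume w: "om \<in> (\<Inter>n. A n)"
  hence "\<forall>n. \<exists>x\<in>V. x \<notin> bl n v \<and> x \<in> {x \<in> V. linked {e \<in> E. om e} v x}"
   unfolding A_def open_edges_def by blast
  hence "infinite {x \<in> V. linked {e \<in> E. om e} v x}"
   using infinite_iff_ball[OF v, of "{x \<in> V. linked {e \<in> E. om e} v x}"] by auto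
  hence "inf_event E om" using v by (auto simp: inf_event_def)
  thus "om \<in> {om \<in> space (percolation E p). inf_event E om}" using w by (auto simp: A_def)
 qed
 finally show ?thesis .
qed

lemma critical_le:
 assumes v: "v \<in> V" and p: "0 <= p" "p < q" "q <= 1" and infE: "infinite E"
  and phi: "\<And>S. finite S ==> S \<subseteq> V ==> v \<in> S ==> 1 <= phi p v S"
 shows "critical_probability V E <= q"
proof -
 interpret prob_space "percolation E q" by (rule prob_space_percolation)
 have "1 - exp (p - q) <= measure (percolation E q) {om \<in> space (percolation E q). inf_event E om}"
 proof (rule inf_event_pos[OF _ p(3) v])
  show "0 <= q" using p by simp
  show "1 - exp (p - q) <= Pr {e \<in> E. e \<subseteq> bl (Suc n) v} q (escape (bl n v) v)" for n
   by (rule supercritical_escape) (use p v phi in auto)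
 qed
 moreover have "0 < 1 - exp (p - q)" using p by simp
 ultimately have one: "measure (percolation E q) {om \<in> space (percolation E q). inf_event E om} = 1"
  using inf_event_zero_one[OF infE, of q] by linarith
 have "AE om in percolation E q. om \<in> {om \<in> space (percolation E q). inf_event E om}"
  by (rule AE_prob_1[OF one])
 hence "AE om in percolation E q. \<exists>v\<in>V. infinite (cluster V E om v)"
  by eventually_elim (simp add: cluster_inf_event)
 thus ?thesis unfolding critical_probability_def
  using p by (intro cInf_lower) (auto intro!: bdd_belowI[of _ 0])
qed

lemma critical_bounds:
 assumes "infinite V"
 shows "0 <= critical_probability V E" "critical_probability V E <= 1"
proof -
 let ?S = "{p \<in> {0..1}. AE om in percolation E p. \<exists>v\<in>V. infinite (cluster V E om v)}"
 interpret prob_space "percolation E 1" by (rule prob_space_percolation)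
 obtain v where v: "v \<in> V" using assms by fastforce
 have "AE om in percolation E 1. om e" if e: "e \<in> E" for e
 proof -
  have "measure (percolation E 1) {om \<in> space (percolation E 1). \<forall>e\<in>{e}. om e \<in> {True}} = 1"
   using percolation_cylinder(2)[of "{e}" E 1 "%_. {True}"] e by (simp add: measure_pmf_single)
  hence "AE om in percolation E 1. om \<in> {om \<in> space (percolation E 1). \<forall>e\<in>{e}. om e \<in> {True}}"
   by (rule AE_prob_1)
  thus ?thesis by eventually_elim simp
 qed
 hence "AE om in percolation E 1. \<forall>e\<in>E. om e" using E_countable by (subst AE_ball_countable) auto
 hence "AE om in percolation E 1. \<exists>v\<in>V. infinite (cluster V E om v)"
 proof eventually_elim
  case (elim om)
  hence "open_edges E om = E" by (auto simp: open_edges_def)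
  hence "cluster V E om v = V" using conn v by (auto simp: cluster_def connected_graph_def)
  hence "infinite (cluster V E om v)" using assms by simp
  thus ?case using v by blast
 qed
 hence one: "1 \<in> ?S" by simp
 show "critical_probability V E <= 1" unfolding critical_probability_def
  by (rule cInf_lower[OF one]) (auto intro!: bdd_belowI[of _ 0])
 show "0 <= critical_probability V E" unfolding critical_probability_def
  by (rule cInf_greatest) (use one in auto)
qed

theorem sharpness:
 assumes V: "infinite V" and q: "0 <= q" "q < critical_probability V E"
 shows "\<exists>C. \<forall>v\<in>V. \<forall>F X. finite F --> F \<subseteq> E --> finite X --> (\<Sum>x\<in>X. conn F q v x) <= C"
proof (rule subcritical_bound[OF q(1)])
 show q1: "q <= 1" using q critical_bounds[OF V] by simp
 have infE: "infinite E"
 proof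
  assume fin: "finite E"
  obtain v where v: "v \<in> V" using V by fastforce
  have "V \<subseteq> insert v (\<Union>E)"
  proof
   fix x assume x: "x \<in> V"
   show "x \<in> insert v (\<Union>E)"
   proof (cases "x = v")
    case False
    have "linked E v x" using conn v x by (auto simp: connected_graph_def)
    thus ?thesis using linked_last_edge[of E v x] False by blast
   qed simp
  qed
  moreover have "finite (\<Union>E)" using fin edge_finite by blast
  ultimately show False using V finite_subset by blast
 qed
 fix v assume v: "v \<in> V"
 show "\<exists>S. finite S \<and> S \<subseteq> V \<and> v \<in> S \<and> phi q v S < 1"
 proof (rule ccontr)
  assume n: "\<not> (\<exists>S. finite S \<and> S \<subseteq> V \<and> v \<in> S \<and> phi q v S < 1)"
  define q' where "q' = (q + critical_probability V E) / 2"
  have q': "q < q'" "q' < critical_probability V E" "q' <= 1" using q critical_bounds[OF V] by (auto simp: q'_def)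
  have "critical_probability V E <= q'"
   by (rule critical_le[OF v q(1) q'(1,3) infE]) (use n in \<open>auto simp: not_less\<close>)
  thus False using q' by simp
 qed
qed

end

section \<open>The exponent of an upward crossing\<close>

context qt_graph
begin

lemma tau_mono:
 assumes p: "0 <= p" "p <= 1" and D: "D \<subseteq> D'"
 shows "tau p D x y <= tau p D' x y"
 by (rule tau_least) (use D in \<open>auto intro!: tau_upper[OF p]\<close>)

end

locale crit = climb V E \<Gamma> u l \<theta> D B \<kappa> 1 pm for V :: "'v set" and E \<Gamma> u l \<theta> D B \<kappa> pm +
 fixes pc :: real
 assumes pc: "pm < pc" "pc <= 1"
  and chi: "\<And>q. pm <= q ==> q < pc ==> \<exists>C. \<forall>v\<in>V. \<forall>F X. finite F --> F \<subseteq> E --> finite X -->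
   (\<Sum>x\<in>X. conn F q v x) <= C"
  and ne: "V \<noteq> {}"
begin

lemma modr_le1: "x \<in> V ==> y \<in> V ==> modr x y <= \<kappa> * exp (u x - u y)"
 using modr_le[of x y] by simp

lemma chi_tau:
 assumes q: "pm <= q" "q < pc"
 shows "\<exists>C\<ge>0. \<forall>v\<in>V. \<forall>X. finite X --> (\<Sum>x\<in>X. tau q UNIV v x) <= C"
proof -
 have q01: "0 <= q" "q <= 1" using q pm pc by auto
 obtain C where C: "\<forall>v\<in>V. \<forall>F X. finite F --> F \<subseteq> E --> finite X --> (\<Sum>x\<in>X. conn F q v x) <= C"
  using chi[OF q] by (elim exE)
 have "(\<Sum>x\<in>X. tau q UNIV v x) <= max C 0" if v: "v \<in> V" and X: "finite X" for v X
 proof -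
  have "(\<Sum>x\<in>X. 1 * tau q UNIV v x) <= C"
  proof (rule tau_sum_le[OF q01 X])
   fix F assume F: "finite F" "F \<subseteq> E"
   show "(\<Sum>x\<in>X. 1 * conn (F \<inter> UNIV) q v x) <= C"
    using C[THEN bspec, OF v, THEN spec, THEN spec, THEN mp, OF F(1), THEN mp, OF F(2), THEN mp, OF X] by simp
  qed simp
  thus ?thesis by simp
 qed
 thus ?thesis by (intro exI[of _ "max C 0"]) auto
qed

lemma crude:
 assumes q: "pm <= q" "q < pc"
 shows "\<exists>C\<ge>0. \<forall>v\<in>V. \<forall>d X. finite X --> X \<subseteq> V --> (\<forall>x\<in>X. u v + d <= u x) --> (\<Sum>x\<in>X. tau q UNIV v x) <= C * exp (- d)"
proof -
 have q01: "0 <= q" "q <= 1" using q pm pc by auto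
 obtain C where C: "0 <= C" "\<forall>v\<in>V. \<forall>X. finite X --> (\<Sum>x\<in>X. tau q UNIV v x) <= C" using chi_tau[OF q] by (elim exE conjE)
 obtain r :: real where r: "0 < r" and mtb: "transport_const r" using mass_transport_bound by (elim exE conjE)
 have "(\<Sum>x\<in>X. tau q UNIV v x) <= r * (\<kappa> * exp (- d) * C)" if v: "v \<in> V" and X: "finite X" "X \<subseteq> V" "\<forall>x\<in>X. u v + d <= u x" for v d X
 proof -
  define F where "F z w = tau q UNIV z w * of_bool (u z + d <= u w)" for z w
  have inv: "\<forall>g\<in>\<Gamma>. \<forall>x\<in>V. \<forall>y\<in>V. F (g x) (g y) = F x y"
  proof (intro ballI)
   fix g x y assume g: "g \<in> \<Gamma>" and xy: "x \<in> V" "y \<in> V"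
   have "tau q UNIV (g x) (g y) = tau q UNIV x y" by (rule tau_img[OF q01 g xy]) simp
   thus "F (g x) (g y) = F x y" using equivariant_le_iff(3)[OF u_inv g xy(2,1), of d] by (simp add: F_def)
  qed
  have nn: "\<forall>x y. 0 <= F x y" by (simp add: F_def tau_nonneg q01)
  have wt: "\<forall>w\<in>V. \<forall>Z. finite Z --> Z \<subseteq> V --> (\<Sum>z\<in>Z. F z w * modr z w) <= \<kappa> * exp (- d) * C"
  proof (intro ballI allI impI)
   fix w Z assume w: "w \<in> V" and Z: "finite Z" "Z \<subseteq> V"
   have "(\<Sum>z\<in>Z. F z w * modr z w) <= (\<Sum>z\<in>Z. \<kappa> * exp (- d) * tau q UNIV w z)"
   proof (rule sum_mono)
    fix z assume "z \<in> Z"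
    hence z: "z \<in> V" using Z by auto
    have t0: "0 <= tau q UNIV w z" by (rule tau_nonneg[OF q01])
    show "F z w * modr z w <= \<kappa> * exp (- d) * tau q UNIV w z"
    proof (cases "u z + d <= u w")
     case True
     have "modr z w <= \<kappa> * exp (u z - u w)" by (rule modr_le1[OF z w])
     also have "... <= \<kappa> * exp (- d)" using True \<kappa> by simp
     finally have "tau q UNIV w z * modr z w <= tau q UNIV w z * (\<kappa> * exp (- d))" using t0 by (rule mult_left_mono)
     thus ?thesis using True by (simp add: F_def tau_commute[of q UNIV z w] mult.commute)
    qed (use t0 \<kappa> in \<open>simp add: F_def\<close>)
   qed
   also have "... = \<kappa> * exp (- d) * (\<Sum>z\<in>Z. tau q UNIV w z)" by (simp add: sum_distrib_left)
   also have "... <= \<kappa> * exp (- d) * C" using C w Z \<kappa> by (intro mult_left_mono) auto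
   finally show "(\<Sum>z\<in>Z. F z w * modr z w) <= \<kappa> * exp (- d) * C" .
  qed
  have "(\<Sum>w\<in>X. F v w) <= r * (\<kappa> * exp (- d) * C)"
   using mtb[THEN spec, THEN spec, THEN mp, OF inv, THEN mp, OF nn, THEN mp, OF wt] v X(1,2) by blast
  moreover have "(\<Sum>w\<in>X. F v w) = (\<Sum>x\<in>X. tau q UNIV v x)" by (rule sum.cong) (use X(3) in \<open>auto simp: F_def\<close>)
  ultimately show ?thesis by simp
 qed
 thus ?thesis using r C(1) \<kappa> by (intro exI[of _ "r * \<kappa> * C"]) (auto simp: mult_ac)
qed

definition up :: "real \<Rightarrow> 'v \<Rightarrow> real \<Rightarrow> real \<Rightarrow> real" where
 "up q v t K = (SUP F\<in>{F. finite F \<and> F \<subseteq> E \<inter> hi u (u v - K)}. Pr F q (reaches u (u v + t) v))"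

definition fq :: "real \<Rightarrow> real \<Rightarrow> real" where
 "fq q t = (INF v\<in>V. up q v t 0)"

lemma up_bdd: "0 <= q ==> q <= 1 ==> bdd_above ((%F. Pr F q A) ` {F. finite F \<and> F \<subseteq> S})"
 by (rule bdd_aboveI2[where M = 1]) (auto intro: Pr_le_1)

lemma up_upper:
 assumes q: "0 <= q" "q <= 1" and F: "finite F" "F \<subseteq> E \<inter> hi u (u v - K)"
 shows "Pr F q (reaches u (u v + t) v) <= up q v t K"
 unfolding up_def by (rule cSUP_upper[OF _ up_bdd[OF q]]) (use F in simp)

lemma up_least:
 assumes "\<And>F. finite F ==> F \<subseteq> E \<inter> hi u (u v - K) ==> Pr F q (reaches u (u v + t) v) <= c"
 shows "up q v t K <= c"
 unfolding up_def by (rule cSUP_least) (use assms in auto)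

lemma up_nonneg: "0 <= q ==> q <= 1 ==> 0 <= up q v t K"
 using up_upper[of q "{}" v K t] Pr_nonneg[of q "{}" "%om. \<exists>x. u v + t <= u x \<and> linked om v x"] by auto

lemma up_le_1: "0 <= q ==> q <= 1 ==> up q v t K <= 1"
 by (rule up_least) (auto intro: Pr_le_1)

lemma up_img_le:
 assumes q: "0 <= q" "q <= 1" and g: "g \<in> \<Gamma>" and v: "v \<in> V"
 shows "up q v t K <= up q (g v) t K"
proof (rule up_least)
 fix F assume F: "finite F" "F \<subseteq> E \<inter> hi u (u v - K)"
 have inj: "inj_on ((`) g) F" by (rule inj_on_subset[OF img_inj[OF g]]) (use F in auto)
 have "Pr F q (reaches u (u v + t) v) <= Pr F q (%om. \<exists>x. u (g v) + t <= u x \<and> linked ((`) g ` om) (g v) x)"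
 proof (rule Pr_mono[OF q])
  fix om assume w: "om \<subseteq> F" and "\<exists>x. u v + t <= u x \<and> linked om v x"
  then obtain x where x: "u v + t <= u x" "linked om v x" by blast
  have xV: "x \<in> V" by (rule linked_in[OF _ v x(2)]) (use w F in auto)
  show "\<exists>x. u (g v) + t <= u x \<and> linked ((`) g ` om) (g v) x"
   using equivariant_le_iff(3)[OF u_inv g xV v, of t] x(1) linked_image[OF x(2), of g] by blast
 qed
 also have "... = Pr ((`) g ` F) q (reaches u (u (g v) + t) (g v))"
  by (rule Pr_image[OF inj, symmetric])
 also have "... <= up q (g v) t K"
 proof (rule up_upper[OF q])
  show "(`) g ` F \<subseteq> E \<inter> hi u (u (g v) - K)"
   using F(2) img_edge[OF g] img_hi_iff[OF u_inv g _ v, of _ "- K"] by auto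
 qed (use F in simp)
 finally show "Pr F q (reaches u (u v + t) v) <= up q (g v) t K" .
qed

lemma fq_le: "0 <= q ==> q <= 1 ==> v \<in> V ==> fq q t <= up q v t 0"
 unfolding fq_def by (rule cINF_lower) (auto intro!: bdd_belowI2[where m = 0] up_nonneg)

lemma fq_greatest: "(\<And>v. v \<in> V ==> c <= up q v t 0) ==> c <= fq q t"
 unfolding fq_def by (rule cINF_greatest) (use ne in auto)

lemma fq_nonneg: "0 <= q ==> q <= 1 ==> 0 <= fq q t"
 by (rule fq_greatest) (rule up_nonneg)

lemma increasing_up: "increasing_event (reaches u T v)"
 using increasing_reach[of "{v}" T] by simp

lemma up_mono_q:
 assumes "0 <= q" "q <= q'" "q' <= 1"
 shows "up q v t K <= up q' v t K"
proof (rule up_least)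
 fix F assume F: "finite F" "F \<subseteq> E \<inter> hi u (u v - K)"
 have "Pr F q (reaches u (u v + t) v) <= Pr F q' (reaches u (u v + t) v)"
  by (rule Pr_mono_p[OF F(1) increasing_up assms])
 also have "... <= up q' v t K" by (rule up_upper) (use F assms in auto)
 finally show "Pr F q (reaches u (u v + t) v) <= up q' v t K" .
qed

lemma fq_mono_q:
 assumes "0 <= q" "q <= q'" "q' <= 1"
 shows "fq q t <= fq q' t"
proof (rule fq_greatest)
 fix v assume v: "v \<in> V"
 have "fq q t <= up q v t 0" by (rule fq_le) (use assms v in auto)
 also have "... <= up q' v t 0" by (rule up_mono_q[OF assms])
 finally show "fq q t <= up q' v t 0" .
qed

lemma fq_pos:
 assumes q: "pm <= q" "q <= 1"
 shows "0 < fq q t"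
proof -
 define k where "k = nat \<lceil>t / \<theta>\<rceil>"
 have k: "t <= real k * \<theta>" using real_nat_ceiling_ge[of "t / \<theta>"] \<theta> by (simp add: k_def field_simps)
 have "pm ^ k <= fq q t"
 proof (rule fq_greatest)
  fix v assume v: "v \<in> V"
  from up_chain[of u, OF u_up \<theta> v, of "u v + t" k] k
  obtain z J where z: "u v + t <= u z" "finite J" "J \<subseteq> E \<inter> hi u (u v)" "card J <= k" "linked J v z" by auto
  have "pm ^ k <= pm ^ card J" using z(4) pm by (intro power_decreasing) auto
  also have "... <= q ^ card J" using q pm by (intro power_mono) auto
  also have "... <= Pr J q (%om. J \<subseteq> om)" using z q pm by (intro Pr_all_open) auto
  also have "... <= Pr J q (reaches u (u v + t) v)"
  proof (rule Pr_mono)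
   fix om assume "J \<subseteq> om"
   hence "linked om v z" using linked_mono[OF z(5)] by blast
   thus "\<exists>x. u v + t <= u x \<and> linked om v x" using z(1) by blast
  qed (use q pm in auto)
  also have "... <= up q v t 0" by (rule up_upper) (use q pm z in auto)
  finally show "pm ^ k <= up q v t 0" .
 qed
 moreover have "0 < pm ^ k" using pm by simp
 ultimately show ?thesis by linarith
qed

lemma fq_super:
 assumes q: "pm <= q" "q <= 1" and s: "0 <= s"
 shows "fq q s * fq q t <= fq q (s + t)"
proof (rule fq_greatest)
 fix v assume v: "v \<in> V"
 have q0: "0 <= q" using q pm by simp
 have step: "c * up q v s 0 <= up q v (s + t) 0" if c: "0 < c" "c < fq q t" for c
 proof -
  have "up q v s 0 <= up q v (s + t) 0 / c"
  proof (rule up_least)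
   fix F assume F: "finite F" "F \<subseteq> E \<inter> hi u (u v - 0)"
   define P where "P om \<longleftrightarrow> (\<exists>x. u v + s <= u x \<and> linked om v x)" for om
   define Q where "Q om \<longleftrightarrow> (\<exists>x. u v + (s + t) <= u x \<and> linked om v x)" for om
   define F' where "F' = F \<inter> lo u (u v + s)"
   have F': "finite F'" "F' \<subseteq> E \<inter> hi u (u v - 0)" using F by (auto simp: F'_def)
   have "Pr F q P <= Pr F q (%om. P (om \<inter> lo u (u v + s)))"
   proof (rule Pr_mono[OF q0 q(2)])
    fix om assume "P om"
    then obtain x where x: "u v + s <= u x" "linked om v x" by (auto simp: P_def)
    from first_hit_level[of om v x "u v + s" u, OF x(2,1)] show "P (om \<inter> lo u (u v + s))" unfolding P_def by blast
   qed
   also have "... = Pr F' q P" unfolding F'_def by (rule Pr_restrict[OF F(1)])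
   finally have 1: "Pr F q P <= Pr F' q P" .
   have "\<exists>G. finite G \<and> G \<subseteq> E \<inter> hi u (u v + s) \<and> c * Pr F' q P <= Pr (F' \<union> G) q Q"
   proof (rule perc_two_stage[OF F'(1) _ q0 q(2)])
    show "F' \<inter> (E \<inter> hi u (u v + s)) = {}" using lo_hi_disjoint by (fastforce simp: F'_def)
    show "increasing_event Q" unfolding Q_def by (rule increasing_up)
    fix om assume w: "om \<subseteq> F'" "P om"
    then obtain x where x: "u v + s <= u x" "linked om v x" by (auto simp: P_def)
    have xV: "x \<in> V" by (rule linked_in[OF _ v x(2)]) (use w F' in auto)
    have "c < up q x t 0" using c fq_le[OF q0 q(2) xV, of t] by linarith
    then obtain G where G: "finite G" "G \<subseteq> E \<inter> hi u (u x - 0)" "c < Pr G q (reaches u (u x + t) x)"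
     unfolding up_def by (subst (asm) less_cSUP_iff[OF _ up_bdd[OF q0 q(2)]]) auto
    have "Pr G q (reaches u (u x + t) x) <= Pr G q (%\<eta>. Q (om \<union> \<eta>))"
    proof (rule Pr_mono[OF q0 q(2)])
     fix \<eta> assume "\<exists>y. u x + t <= u y \<and> linked \<eta> x y"
     then obtain y where y: "u x + t <= u y" "linked \<eta> x y" by blast
     have "linked (om \<union> \<eta>) v y" by (rule linked_trans[OF linked_mono[OF x(2)] linked_mono[OF y(2)]]) auto
     moreover have "u v + (s + t) <= u y" using x(1) y(1) by simp
     ultimately show "Q (om \<union> \<eta>)" by (auto simp: Q_def)
    qed
    hence "c <= Pr G q (%\<eta>. Q (om \<union> \<eta>))" using G(3) by linarith
    moreover have "G \<subseteq> E \<inter> hi u (u v + s)" using G(2) hi_antimono[OF x(1)] by auto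
    ultimately show "\<exists>G. finite G \<and> G \<subseteq> E \<inter> hi u (u v + s) \<and> c <= Pr G q (%\<eta>. Q (om \<union> \<eta>))"
     by (intro exI[of _ G] conjI G(1))
   qed (use c in simp)
   then obtain G where G: "finite G" "G \<subseteq> E \<inter> hi u (u v + s)" "c * Pr F' q P <= Pr (F' \<union> G) q Q"
    by (elim exE conjE)
   have "hi u (u v + s) \<subseteq> hi u (u v - 0)" by (rule hi_antimono) (use s in simp)
   hence "Pr (F' \<union> G) q Q <= up q v (s + t) 0" unfolding Q_def
    by (intro up_upper q0 q) (use F' G in auto)
   hence "c * Pr F' q P <= up q v (s + t) 0" using G(3) by linarith
   hence "Pr F' q P <= up q v (s + t) 0 / c" using c(1) by (simp add: pos_le_divide_eq mult.commute)
   thus "Pr F q (reaches u (u v + s) v) <= up q v (s + t) 0 / c"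
    using 1 unfolding P_def by linarith
  qed
  thus ?thesis using c(1) by (simp add: pos_le_divide_eq mult.commute)
 qed
 have sp: "0 < up q v s 0" using fq_pos[OF q, of s] fq_le[OF q0 q(2) v, of s] by linarith
 have "fq q t <= up q v (s + t) 0 / up q v s 0"
 proof (rule dense_le_bounded[OF fq_pos[OF q, of t]])
  fix c assume c: "0 < c" "c < fq q t"
  show "c <= up q v (s + t) 0 / up q v s 0" using step[OF c] sp by (simp add: pos_le_divide_eq)
 qed
 hence "fq q t * up q v s 0 <= up q v (s + t) 0" using sp by (simp add: pos_le_divide_eq)
 moreover have "fq q s * fq q t <= up q v s 0 * fq q t"
  by (intro mult_right_mono fq_le fq_nonneg q0 q v)
 ultimately show "fq q s * fq q t <= up q v (s + t) 0" by (simp add: mult.commute)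
qed

lemma fq_power:
 assumes q: "pm <= q" "q <= 1" and t: "0 <= t"
 shows "fq q t ^ Suc n <= fq q (real (Suc n) * t)"
proof (induction n)
 case (Suc n)
 have "fq q t ^ Suc (Suc n) <= fq q t * fq q (real (Suc n) * t)"
  using Suc fq_pos[OF q, of t] by (simp add: mult_left_mono)
 also have "... <= fq q (t + real (Suc n) * t)" by (rule fq_super[OF q t])
 also have "t + real (Suc n) * t = real (Suc (Suc n)) * t" by (simp add: algebra_simps)
 finally show ?case .
qed simp

lemma fq_le_exp:
 assumes q: "pm <= q" "q < pc" and t: "0 <= t"
 shows "fq q t <= exp (- t)"
proof (rule ccontr)
 have q1: "0 <= q" "q <= 1" using q pc pm by auto
 assume "\<not> fq q t <= exp (- t)"
 hence y: "1 < fq q t * exp t" by (simp add: exp_minus field_simps)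
 obtain C where C: "0 <= C" "\<forall>v\<in>V. \<forall>d X. finite X --> X \<subseteq> V --> (\<forall>x\<in>X. u v + d <= u x) --> (\<Sum>x\<in>X. tau q UNIV v x) <= C * exp (- d)"
  using crude[OF q] by (elim exE conjE)
 obtain v where v: "v \<in> V" using ne by blast
 have le: "fq q d <= C * exp (- d)" for d
 proof -
  have "fq q d <= up q v d 0" by (rule fq_le[OF q1 v])
  also have "... <= C * exp (- d)"
  proof (rule up_least)
   fix F assume F: "finite F" "F \<subseteq> E \<inter> hi u (u v - 0)"
   define X where "X = {x \<in> insert v (\<Union>F). u v + d <= u x}"
   have "finite (\<Union>F)" using F edge_finite by blast
   hence "finite (insert v (\<Union>F))" by simp
   hence "finite X" by (rule rev_finite_subset) (auto simp: X_def)
   moreover have "X \<subseteq> V" "\<forall>x\<in>X. u v + d <= u x" using F(2) edge_sub v by (auto simp: X_def)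
   ultimately have X: "finite X" "X \<subseteq> V" "\<forall>x\<in>X. u v + d <= u x" by blast+
   have "Pr F q (reaches u (u v + d) v) <= Pr F q (%om. \<exists>x\<in>X. linked om v x)"
   proof (rule Pr_mono[OF q1])
    fix om assume w: "om \<subseteq> F" and "\<exists>x. u v + d <= u x \<and> linked om v x"
    then obtain x where x: "u v + d <= u x" "linked om v x" by blast
    have "x \<in> insert v (\<Union>F)"
    proof (cases "x = v")
     case False
     thus ?thesis using linked_last_edge[OF x(2)] w by blast
    qed simp
    thus "\<exists>x\<in>X. linked om v x" using x by (auto simp: X_def)
   qed
   also have "... <= (\<Sum>x\<in>X. conn F q v x)" by (rule Pr_Bex_le[OF q1 X(1)])
   also have "... <= (\<Sum>x\<in>X. tau q UNIV v x)" by (intro sum_mono tau_upper q1) (use F in auto)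
   also have "... <= C * exp (- d)" using C(2) v X by blast
   finally show "Pr F q (reaches u (u v + d) v) <= C * exp (- d)" .
  qed
  finally show ?thesis .
 qed
 obtain n where n: "C < (fq q t * exp t) ^ n" using real_arch_pow[OF y] by blast
 have "(fq q t * exp t) ^ n <= (fq q t * exp t) ^ Suc n" using y by (intro power_increasing) auto
 also have "... = fq q t ^ Suc n * exp (real (Suc n) * t)" by (simp only: power_mult_distrib exp_of_nat_mult)
 also have "... <= C * exp (- (real (Suc n) * t)) * exp (real (Suc n) * t)"
  using order_trans[OF fq_power[OF q(1) q1(2) t, of n] le[of "real (Suc n) * t"]] by (intro mult_right_mono) auto
 also have "... = C" by (simp add: exp_minus)
 finally show False using n by simp
qed

definition fs :: "real \<Rightarrow> real" where
 "fs t = (SUP q\<in>{pm..<pc}. fq q t)"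

definition \<alpha> :: real where
 "\<alpha> = (INF t\<in>{0<..}. - ln (fs t) / t)"

lemma fs_upper:
 assumes q: "pm <= q" "q < pc" and t: "0 <= t"
 shows "fq q t <= fs t"
 unfolding fs_def
proof (rule cSUP_upper)
 show "bdd_above ((%q. fq q t) ` {pm..<pc})" by (rule bdd_aboveI2[where M = "exp (- t)"]) (use fq_le_exp t in auto)
qed (use q in simp)

lemma fs_pos: "0 <= t ==> 0 < fs t"
 using fs_upper[of pm t] fq_pos[of pm t] pm pc by simp

lemma fs_le_exp: "0 <= t ==> fs t <= exp (- t)"
 unfolding fs_def by (rule cSUP_least) (use fq_le_exp pc in auto)

lemma ln_fs_ge: "0 < t ==> 1 <= - ln (fs t) / t"
proof -
 assume t: "0 < t"
 have "ln (fs t) <= ln (exp (- t))" using fs_le_exp[of t] fs_pos[of t] t by (subst ln_le_cancel_iff) auto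
 thus ?thesis using t by (simp add: field_simps)
qed

lemma \<alpha>_ge_1: "1 <= \<alpha>"
 unfolding \<alpha>_def by (rule cINF_greatest) (use ln_fs_ge in \<open>auto intro: exI[of _ 1]\<close>)

lemma fs_le: "0 < t ==> fs t <= exp (- \<alpha> * t)"
proof -
 assume t: "0 < t"
 have "\<alpha> <= - ln (fs t) / t" unfolding \<alpha>_def
  by (rule cINF_lower) (use t ln_fs_ge in \<open>auto intro!: bdd_belowI2[where m = 1]\<close>)
 hence "ln (fs t) <= - \<alpha> * t" using t by (simp add: field_simps)
 thus ?thesis using fs_pos[of t] t by (metis exp_le_cancel_iff exp_ln less_imp_le)
qed

lemma fq_lower:
 assumes "0 < \<epsilon>"
 shows "\<exists>q1 t1. pm <= q1 \<and> q1 < pc \<and> 0 < t1 \<and>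
  (\<forall>n q. q1 <= q --> q < pc --> exp (- (\<alpha> + \<epsilon>) * (real (Suc n) * t1)) <= fq q (real (Suc n) * t1))"
proof -
 have "(INF t\<in>{0<..}. - ln (fs t) / t) < \<alpha> + \<epsilon>" using assms by (simp add: \<alpha>_def)
 then obtain t where t: "0 < t" "- ln (fs t) / t < \<alpha> + \<epsilon>"
  by (subst (asm) cINF_less_iff) (use ln_fs_ge in \<open>auto intro!: bdd_belowI2[where m = 1]\<close>)
 have "- (\<alpha> + \<epsilon>) * t < ln (fs t)" using t by (simp add: field_simps)
 hence "exp (- (\<alpha> + \<epsilon>) * t) < fs t" using fs_pos[of t] t by (metis exp_less_cancel_iff exp_ln less_imp_le)
 then obtain q1 where q1: "pm <= q1" "q1 < pc" "exp (- (\<alpha> + \<epsilon>) * t) < fq q1 t"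
  unfolding fs_def using pc(1)
  by (subst (asm) less_cSUP_iff) (use fq_le_exp t in \<open>auto intro!: bdd_aboveI2[where M = "exp (- t)"]\<close>)
 have "exp (- (\<alpha> + \<epsilon>) * (real (Suc n) * t)) <= fq q (real (Suc n) * t)" if q: "q1 <= q" "q < pc" for n q
 proof -
  have qq: "pm <= q" "q <= 1" using q q1 pc by auto
  have "exp (- (\<alpha> + \<epsilon>) * t) <= fq q t" using q1(3) fq_mono_q[of q1 q t] q q1 pm pc by force
  hence "exp (- (\<alpha> + \<epsilon>) * t) ^ Suc n <= fq q t ^ Suc n" by (intro power_mono) auto
  also have "... <= fq q (real (Suc n) * t)" by (rule fq_power[OF qq]) (use t in simp)
  also have "exp (- (\<alpha> + \<epsilon>) * t) ^ Suc n = exp (- (\<alpha> + \<epsilon>) * (real (Suc n) * t))"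
   by (simp only: exp_of_nat_mult[symmetric] mult_ac)
  finally show ?thesis .
 qed
 thus ?thesis using q1 t by blast
qed

text \<open>Opening a path of bounded length upwards moves the start of a crossing to the bottom of its region.\<close>

theorem crossing_bound:
 "\<exists>a b. 0 <= a \<and> 0 <= b \<and> (\<forall>q v t K. pm <= q --> q < pc --> v \<in> V --> 0 <= t --> 0 <= K --> up q v t K <= exp (a * K + b - \<alpha> * t))"
proof -
 obtain L where L: "\<forall>x\<in>V. \<forall>v\<in>V. \<exists>g\<in>\<Gamma>. g v \<in> bl L x" using cocompact by blast
 define LD where "LD = real L * D"
 have LD0: "0 <= LD" using D0 by (simp add: LD_def)
 define k where "k K = nat \<lceil>(K + 2 * LD) / \<theta>\<rceil>" for K
 define a where "a = - ln pm / \<theta>"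
 define b where "b = - ln pm * (2 * LD / \<theta> + 1 + real L)"
 have lp: "0 <= - ln pm" using pm by (simp add: ln_le_zero_iff)
 have ab: "0 <= a" "0 <= b" unfolding a_def b_def using lp \<theta> LD0 by (intro divide_nonneg_pos mult_nonneg_nonneg add_nonneg_nonneg; simp)+
 have "up q x t K <= exp (a * K + b - \<alpha> * t)"
  if q: "pm <= q" "q < pc" and x: "x \<in> V" and t: "0 <= t" and K: "0 <= K" for q x t K
 proof -
  have q1: "0 <= q" "q <= 1" using q pm pc by auto
  have kk: "K + 2 * LD <= real (k K) * \<theta>" using real_nat_ceiling_ge[of "(K + 2 * LD) / \<theta>"] \<theta> by (simp add: k_def field_simps)
  have main: "pm ^ (k K + L) * up q x t K <= fq q t"
  proof (rule fq_greatest)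
   fix v assume v: "v \<in> V"
   from up_chain[of u, OF u_up \<theta> v, of "u v + (K + 2 * LD)" "k K"] kk
   obtain z J where z: "u v + (K + 2 * LD) <= u z" "finite J" "J \<subseteq> E \<inter> hi u (u v)" "card J <= k K" "linked J v z" "z \<in> bl (k K) v" by auto
   have zV: "z \<in> V" using z(6) bl_in[OF v] by blast
   obtain g where g: "g \<in> \<Gamma>" "g z \<in> bl L x" using L x zV by blast
   have gv: "g v \<in> V" using G_in g v by blast
   obtain J2 where J2: "finite J2" "card J2 <= L" "J2 \<subseteq> E" "\<forall>e\<in>J2. e \<subseteq> bl L x" "linked J2 x (g z)" using bl_path[OF g(2)] by blast
   have hz: "u (g v) + (K + 2 * LD) <= u (g z)" using equivariant_le_iff(3)[OF u_inv g(1) zV v] z(1) by simp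
   have "\<bar>u (g z) - u x\<bar> <= LD" unfolding LD_def by (rule u_ball[OF g(2)])
   hence hx: "u (g v) + K + LD <= u x" using hz by simp
   define J' where "J' = (`) g ` J \<union> J2"
   have J'f: "finite J'" using z(2) J2(1) by (simp add: J'_def)
   have J'c: "card J' <= k K + L"
    using card_Un_le[of "(`) g ` J" J2] card_image_le[OF z(2), of "(`) g"] z(4) J2(2) by (simp add: J'_def)
   have J'r: "J' \<subseteq> E \<inter> hi u (u (g v) - 0)"
   proof -
    have "(`) g ` J \<subseteq> E \<inter> hi u (u (g v))"
     using z(3) img_edge[OF g(1)] img_hi_iff[OF u_inv g(1) _ v, of _ 0] by auto
    moreover have "J2 \<subseteq> hi u (u (g v))"
    proof
     fix e assume e: "e \<in> J2"
     have "u (g v) <= u y" if "y \<in> e" for y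
     proof -
      have "\<bar>u y - u x\<bar> <= LD" unfolding LD_def using u_ball J2(4) e that by blast
      thus ?thesis using hx K by simp
     qed
     thus "e \<in> hi u (u (g v))" by (simp add: hi_def)
    qed
    ultimately show ?thesis using J2(3) by (auto simp: J'_def)
   qed
   have lJ: "linked J' (g v) x"
   proof (rule linked_trans)
    show "linked J' (g v) (g z)" by (rule linked_mono[OF linked_image[OF z(5)]]) (auto simp: J'_def)
    show "linked J' (g z) x" by (rule linked_mono[OF linked_sym[OF J2(5)]]) (auto simp: J'_def)
   qed
   have pmn: "0 < pm ^ (k K + L)" using pm by simp
   have "up q x t K <= up q (g v) t 0 / pm ^ (k K + L)"
   proof (rule up_least)
    fix F assume F: "finite F" "F \<subseteq> E \<inter> hi u (u x - K)"
    have "pm ^ (k K + L) <= pm ^ card J'" using J'c pm by (intro power_decreasing) auto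
    also have "... <= q ^ card J'" using q pm by (intro power_mono) auto
    finally have "pm ^ (k K + L) * Pr F q (reaches u (u x + t) x) <=
     q ^ card J' * Pr F q (reaches u (u x + t) x)"
     by (intro mult_right_mono Pr_nonneg q1)
    also have "... <= Pr (F \<union> J') q (reaches u (u (g v) + t) (g v))"
    proof (rule Pr_force[OF F(1) J'f q1])
     fix om assume "\<exists>y. u x + t <= u y \<and> linked om x y"
     then obtain y where y: "u x + t <= u y" "linked om x y" by blast
     have "linked (om \<union> J') (g v) y" by (rule linked_trans[OF linked_mono[OF lJ] linked_mono[OF y(2)]]) auto
     moreover have "u (g v) + t <= u y" using hx y(1) K LD0 by simp
     ultimately show "\<exists>y. u (g v) + t <= u y \<and> linked (om \<union> J') (g v) y" by blast
    qed
    also have "... <= up q (g v) t 0"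
    proof (rule up_upper[OF q1])
     have "hi u (u x - K) \<subseteq> hi u (u (g v) - 0)" by (rule hi_antimono) (use hx LD0 in simp)
     thus "F \<union> J' \<subseteq> E \<inter> hi u (u (g v) - 0)" using F(2) J'r by auto
    qed (use F J'f in simp)
    finally show "Pr F q (reaches u (u x + t) x) <= up q (g v) t 0 / pm ^ (k K + L)"
     using pmn by (simp add: pos_le_divide_eq mult.commute)
   qed
   hence "pm ^ (k K + L) * up q x t K <= up q (g v) t 0" using pmn by (simp add: pos_le_divide_eq mult.commute)
   also have "... <= up q v t 0"
   proof -
    obtain j where j: "j \<in> \<Gamma>" "\<forall>x\<in>V. j (g x) = x \<and> g (j x) = x" using G_inv[OF g(1)] by blast
    show ?thesis using up_img_le[OF q1 j(1) gv, of t 0] j(2) v by simp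
   qed
   finally show "pm ^ (k K + L) * up q x t K <= up q v t 0" .
  qed
  have "fq q t <= exp (- \<alpha> * t)"
  proof (cases "t = 0")
   case True
   obtain v where v: "v \<in> V" using ne by blast
   thus ?thesis using fq_le[OF q1 v, of 0] up_le_1[OF q1, of v 0 0] True by simp
  next
   case False
   thus ?thesis using fs_upper[OF q t] fs_le[of t] t by simp
  qed
  with main have "up q x t K * pm ^ (k K + L) <= exp (- \<alpha> * t)" by (simp add: mult.commute)
  hence "up q x t K <= exp (- \<alpha> * t) / pm ^ (k K + L)" using pm by (simp add: pos_le_divide_eq)
  also have "... = exp (- \<alpha> * t + real (k K + L) * (- ln pm))"
  proof -
   have "pm ^ (k K + L) = exp (real (k K + L) * ln pm)" using pm by (simp only: exp_of_nat_mult exp_ln)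
   thus ?thesis by (simp only: exp_diff[symmetric]) (simp add: algebra_simps)
  qed
  also have "... <= exp (a * K + b - \<alpha> * t)"
  proof -
   have "real (k K) <= (K + 2 * LD) / \<theta> + 1"
    unfolding k_def using K LD0 \<theta> by (simp add: of_nat_ceiling)
   hence "real (k K + L) * (- ln pm) <= ((K + 2 * LD) / \<theta> + 1 + real L) * (- ln pm)"
    using lp by (intro mult_right_mono) auto
   also have "... = a * K + b" by (simp add: a_def b_def field_simps add_divide_distrib)
   finally show ?thesis by simp
  qed
  finally show ?thesis .
 qed
 thus ?thesis using ab by blast
qed

end

section \<open>Bootstrap estimates\<close>

lemma layer_sum:
 fixes a :: "'a \<Rightarrow> real" and k :: "'a \<Rightarrow> nat"
 assumes Z: "finite Z" and r: "0 <= r" "r < 1" and c: "0 <= c"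
  and le: "\<And>j. (\<Sum>z\<in>{z \<in> Z. k z = j}. a z) <= c * r ^ j"
 shows "(\<Sum>z\<in>Z. a z) <= c / (1 - r)"
proof -
 obtain N where N: "k ` Z \<subseteq> {..<N}" using Z finite_nat_iff_bounded by blast
 have "(\<Sum>z\<in>Z. a z) = (\<Sum>j\<in>k ` Z. \<Sum>z\<in>{z \<in> Z. k z = j}. a z)" by (rule sum.image_gen[OF Z])
 also have "... <= (\<Sum>j\<in>k ` Z. c * r ^ j)" by (intro sum_mono le)
 also have "... <= (\<Sum>j<N. c * r ^ j)" by (rule sum_mono2) (use N r c in auto)
 also have "... = c * ((1 - r ^ N) / (1 - r))" using r by (simp add: sum_distrib_left[symmetric] sum_gp_strict)
 also have "... <= c * (1 / (1 - r))" using r c by (intro mult_left_mono divide_right_mono) auto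
 finally show ?thesis by simp
qed

context climb
begin

lemma tau_force:
 assumes q: "pm <= q" "q <= 1" and J: "finite J" "J \<subseteq> E \<inter> Dd" "card J <= k" "linked J x z"
 shows "pm ^ k * tau q Dd v x <= tau q Dd v z"
proof -
 have q0: "0 <= q" using q pm by simp
 have pk: "0 < pm ^ k" using pm by simp
 have "tau q Dd v x <= tau q Dd v z / pm ^ k"
 proof (rule tau_least)
  fix F assume F: "finite F" "F \<subseteq> E \<inter> Dd"
  have "pm ^ k <= pm ^ card J" using J(3) pm by (intro power_decreasing) auto
  also have "... <= q ^ card J" using q pm by (intro power_mono) auto
  finally have "pm ^ k * conn F q v x <= q ^ card J * conn F q v x"
   by (intro mult_right_mono Pr_nonneg q0 q)
  also have "... <= conn (F \<union> J) q v z"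
  proof (rule Pr_force[OF F(1) J(1) q0 q(2)])
   fix om assume l: "linked om v x"
   show "linked (om \<union> J) v z" by (rule linked_trans[OF linked_mono[OF l] linked_mono[OF J(4)]]) auto
  qed
  also have "... <= tau q Dd v z" by (rule tau_upper[OF q0 q(2)]) (use F J in auto)
  finally show "conn F q v x <= tau q Dd v z / pm ^ k"
   using pk by (simp add: pos_le_divide_eq mult.commute)
 qed
 thus ?thesis using pk by (simp add: pos_le_divide_eq mult.commute)
qed

abbreviation chain_const :: "real \<Rightarrow> real \<Rightarrow> bool" where
 "chain_const m C \<equiv>
  (\<forall>q v T H M X. pm <= q --> q <= 1 -->
  (\<forall>Z. finite Z --> Z \<subseteq> V --> (\<forall>z\<in>Z. T <= u z) --> (\<Sum>z\<in>Z. tau q (lo u T \<inter> H) v z) <= M) -->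
  finite X --> X \<subseteq> V --> (\<forall>x\<in>X. T - m <= u x \<and> hi u (u x) \<subseteq> H) -->
  (\<Sum>x\<in>X. tau q (lo u T \<inter> H) v x) <= C * M)"

lemma chain_sum:
 "\<exists>C\<ge>1. chain_const m C"
proof -
 define k where "k = nat \<lceil>m / \<theta>\<rceil>"
 have k: "m <= real k * \<theta>" using real_nat_ceiling_ge[of "m / \<theta>"] \<theta> by (simp add: k_def field_simps)
 obtain N where N: "\<forall>x\<in>V. card (bl k x) <= N" using bl_card by blast
 have pk: "0 < pm ^ k" "pm ^ k <= 1" using pm by (auto intro: power_le_one)
 define C where "C = real (Suc N) / pm ^ k"
 have C: "1 <= C" using pk by (simp add: C_def field_simps)
 have fin: "(\<Sum>x\<in>X. tau q (lo u T \<inter> H) v x) <= C * M"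
  if q: "pm <= q" "q <= 1" and M: "\<forall>Z. finite Z --> Z \<subseteq> V --> (\<forall>z\<in>Z. T <= u z) --> (\<Sum>z\<in>Z. tau q (lo u T \<inter> H) v z) <= M"
   and X: "finite X" "X \<subseteq> V" "\<forall>x\<in>X. T - m <= u x \<and> hi u (u x) \<subseteq> H" for q v T H M X
 proof -
  have q0: "0 <= q" using q pm by simp
  have ex: "\<forall>x\<in>X. \<exists>z. z \<in> bl k x \<and> T <= u z \<and> pm ^ k * tau q (lo u T \<inter> H) v x <= tau q (lo u T \<inter> H) v z"
  proof
   fix x assume x: "x \<in> X"
   hence xV: "x \<in> V" and h: "T - u x <= real k * \<theta>" "hi u (u x) \<subseteq> H" using X k by force+
   from up_chain[of u, OF u_up \<theta> xV h(1)]
   obtain z J where z: "z \<in> bl k x" "T <= u z" "finite J" "J \<subseteq> E \<inter> hi u (u x) \<inter> lo u T" "card J <= k" "linked J x z" by auto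
   have "pm ^ k * tau q (lo u T \<inter> H) v x <= tau q (lo u T \<inter> H) v z"
    by (rule tau_force[OF q z(3) _ z(5,6)]) (use z(4) h(2) in auto)
   thus "\<exists>z. z \<in> bl k x \<and> T <= u z \<and> pm ^ k * tau q (lo u T \<inter> H) v x <= tau q (lo u T \<inter> H) v z" using z(1,2) by blast
  qed
  from bchoice[OF ex] obtain f where f: "\<forall>x\<in>X. f x \<in> bl k x \<and> T <= u (f x) \<and> pm ^ k * tau q (lo u T \<inter> H) v x <= tau q (lo u T \<inter> H) v (f x)"
   by (elim exE)
  have fV: "f ` X \<subseteq> V" using f bl_in X(2) by blast
  have "pm ^ k * (\<Sum>x\<in>X. tau q (lo u T \<inter> H) v x) <= (\<Sum>x\<in>X. tau q (lo u T \<inter> H) v (f x))"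
   unfolding sum_distrib_left using f by (intro sum_mono) auto
  also have "... = (\<Sum>z\<in>f ` X. \<Sum>x\<in>{x \<in> X. f x = z}. tau q (lo u T \<inter> H) v (f x))" by (rule sum.image_gen[OF X(1)])
  also have "... <= (\<Sum>z\<in>f ` X. real (Suc N) * tau q (lo u T \<inter> H) v z)"
  proof (rule sum_mono)
   fix z assume z: "z \<in> f ` X"
   hence zV: "z \<in> V" using fV by auto
   have t0: "0 <= tau q (lo u T \<inter> H) v z" by (rule tau_nonneg[OF q0 q(2)])
   have "{x \<in> X. f x = z} \<subseteq> bl k z" using f bl_sym by blast
   hence "card {x \<in> X. f x = z} <= card (bl k z)" by (rule card_mono[OF bl_finite])
   hence c: "card {x \<in> X. f x = z} <= N" using N zV by (meson order_trans)
   have "(\<Sum>x\<in>{x \<in> X. f x = z}. tau q (lo u T \<inter> H) v (f x)) = real (card {x \<in> X. f x = z}) * tau q (lo u T \<inter> H) v z" by simp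
   also have "... <= real (Suc N) * tau q (lo u T \<inter> H) v z" using c t0 by (intro mult_right_mono) auto
   finally show "(\<Sum>x\<in>{x \<in> X. f x = z}. tau q (lo u T \<inter> H) v (f x)) <= real (Suc N) * tau q (lo u T \<inter> H) v z" .
  qed
  also have "... = real (Suc N) * (\<Sum>z\<in>f ` X. tau q (lo u T \<inter> H) v z)" by (simp add: sum_distrib_left)
  also have "... <= real (Suc N) * M"
  proof (rule mult_left_mono)
   show "(\<Sum>z\<in>f ` X. tau q (lo u T \<inter> H) v z) <= M" using M X(1) fV f by simp
  qed simp
  finally have "(\<Sum>x\<in>X. tau q (lo u T \<inter> H) v x) <= real (Suc N) * M / pm ^ k" using pk by (simp only: pos_le_divide_eq mult.commute)
  thus ?thesis by (simp add: C_def)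
 qed
 show ?thesis by (rule exI[of _ C], intro conjI C allI impI, rule fin)
qed

end

context crit
begin

definition LbH :: "real \<Rightarrow> 'v set set \<Rightarrow> 'v \<Rightarrow> real \<Rightarrow> bool" where
 "LbH q H v a \<longleftrightarrow> (\<forall>d\<ge>0. \<forall>X. finite X --> X \<subseteq> V --> (\<forall>x\<in>X. u v + d <= u x) -->
  (\<Sum>x\<in>X. tau q (lo u (u v + d) \<inter> H) v x) <= a * exp (- (3/4) * d))"

definition Lb :: "real \<Rightarrow> real \<Rightarrow> bool" where
 "Lb q A \<longleftrightarrow> (\<forall>v\<in>V. LbH q UNIV v A)"

definition Sb :: "real \<Rightarrow> real \<Rightarrow> bool" where
 "Sb q a \<longleftrightarrow> (\<forall>v\<in>V. LbH q (hi u (u v)) v a)"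

lemma LbHD:
 "LbH q H v a ==> 0 <= d ==> finite X ==> X \<subseteq> V ==> (\<And>x. x \<in> X ==> u v + d <= u x) ==>
  (\<Sum>x\<in>X. tau q (lo u (u v + d) \<inter> H) v x) <= a * exp (- (3/4) * d)"
 unfolding LbH_def by blast

lemma Lb_finite:
 assumes q: "pm <= q" "q < pc"
 shows "\<exists>A\<ge>1. Lb q A"
proof -
 have q01: "0 <= q" "q <= 1" using q pm pc by auto
 obtain C where C: "0 <= C" "\<forall>v\<in>V. \<forall>d X. finite X --> X \<subseteq> V --> (\<forall>x\<in>X. u v + d <= u x) --> (\<Sum>x\<in>X. tau q UNIV v x) <= C * exp (- d)"
  using crude[OF q] by (elim exE conjE)
 have "LbH q UNIV v (C + 1)" if v: "v \<in> V" for v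
  unfolding LbH_def
 proof (intro allI impI)
  fix d X assume d: "0 <= d" and X: "finite X" "X \<subseteq> V" "\<forall>x\<in>X. u v + d <= u x"
  have "(\<Sum>x\<in>X. tau q (lo u (u v + d) \<inter> UNIV) v x) <= (\<Sum>x\<in>X. tau q UNIV v x)" by (intro sum_mono tau_mono q01) simp
  also have "... <= C * exp (- d)" using C(2) v X by blast
  also have "... <= (C + 1) * exp (- (3/4) * d)" using C(1) d by (intro mult_mono) auto
  finally show "(\<Sum>x\<in>X. tau q (lo u (u v + d) \<inter> UNIV) v x) <= (C + 1) * exp (- (3/4) * d)" .
 qed
 thus ?thesis using C(1) by (intro exI[of _ "C + 1"]) (auto simp: Lb_def)
qed

text \<open>The start may lie slightly above the level \<open>T\<close>, and the end points slightly below it.\<close>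

abbreviation window_const :: "real \<Rightarrow> real \<Rightarrow> bool" where
 "window_const m C \<equiv>
  (\<forall>q v T H a X. pm <= q --> q <= 1 --> 0 <= a --> v \<in> V --> LbH q H v a --> u v <= T + m -->
  finite X --> X \<subseteq> V --> (\<forall>x\<in>X. T - m <= u x \<and> hi u (u x) \<subseteq> H) -->
  (\<Sum>x\<in>X. tau q (lo u T \<inter> H) v x) <= C * a * exp (- (3/4) * (T - u v)))"

lemma window_sum:
 assumes m: "0 <= m"
 shows "\<exists>C\<ge>1. window_const m C"
proof -
 obtain C where C: "1 <= C" and ch: "chain_const (2 * m) C" using chain_sum[of "2 * m"] by (elim exE conjE)
 have fin: "(\<Sum>x\<in>X. tau q (lo u T \<inter> H) v x) <= C * a * exp (- (3/4) * (T - u v))"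
  if q: "pm <= q" "q <= 1" and a: "0 <= a" and v: "v \<in> V" and L: "LbH q H v a" and vT: "u v <= T + m"
   and X: "finite X" "X \<subseteq> V" "\<forall>x\<in>X. T - m <= u x \<and> hi u (u x) \<subseteq> H" for q v T H a X
 proof (cases "X = {}")
  case True
  thus ?thesis using a C by simp
 next
  case False
  have q0: "0 <= q" using q pm by simp
  define S where "S = max T (u v)"
  define M where "M = a * exp (- (3/4) * (S - u v))"
  have hM: "\<forall>Z. finite Z --> Z \<subseteq> V --> (\<forall>z\<in>Z. S <= u z) --> (\<Sum>z\<in>Z. tau q (lo u S \<inter> H) v z) <= M"
   using LbHD[OF L, of "S - u v"] by (auto simp: M_def S_def)
  have hX': "\<forall>x\<in>X. S - 2 * m <= u x \<and> hi u (u x) \<subseteq> H" using X(3) vT m by (auto simp: S_def)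
  have "(\<Sum>x\<in>X. tau q (lo u T \<inter> H) v x) <= (\<Sum>x\<in>X. tau q (lo u S \<inter> H) v x)"
   by (intro sum_mono tau_mono q0 q) (use lo_mono[of T S u] in \<open>auto simp: S_def\<close>)
  also have "... <= C * M"
   by (rule ch[THEN spec, THEN spec, THEN spec, THEN spec, THEN spec, THEN spec, THEN mp, OF q(1), THEN mp, OF q(2),
    THEN mp, OF hM, THEN mp, OF X(1), THEN mp, OF X(2), THEN mp, OF hX'])
  also have "... <= C * (a * exp (- (3/4) * (T - u v)))"
   unfolding M_def using C a by (intro mult_left_mono) (auto simp: S_def)
  finally show ?thesis by (simp add: mult.assoc)
 qed
 show ?thesis by (rule exI[of _ C], intro conjI C allI impI, rule fin)
qed

definition wc :: "real \<Rightarrow> real" where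
 "wc m = (SOME C. C \<ge> 1 \<and> (window_const m C))"

lemma wc_ge_1: "0 <= m ==> 1 <= wc m"
 and window:
 "0 <= m ==> pm <= q ==> q <= 1 ==> 0 <= a ==> v \<in> V ==> LbH q H v a ==> u v <= T + m ==>
  finite X ==> X \<subseteq> V ==> (\<And>x. x \<in> X ==> T - m <= u x \<and> hi u (u x) \<subseteq> H) ==>
  (\<Sum>x\<in>X. tau q (lo u T \<inter> H) v x) <= wc m * a * exp (- (3/4) * (T - u v))"
proof -
 assume m: "0 <= m"
 note w = someI_ex[OF window_sum[OF m], folded wc_def]
 show "1 <= wc m" using w by (rule conjunct1)
 assume h: "pm <= q" "q <= 1" "0 <= a" "v \<in> V" "LbH q H v a" "u v <= T + m"
  "finite X" "X \<subseteq> V" "\<And>x. x \<in> X ==> T - m <= u x \<and> hi u (u x) \<subseteq> H"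
 have b: "\<forall>x\<in>X. T - m <= u x \<and> hi u (u x) \<subseteq> H" using h(9) by blast
 show "(\<Sum>x\<in>X. tau q (lo u T \<inter> H) v x) <= wc m * a * exp (- (3/4) * (T - u v))"
  by (rule w[THEN conjunct2, THEN spec, THEN spec, THEN spec, THEN spec, THEN spec, THEN spec, THEN mp, OF h(1), THEN mp, OF h(2),
   THEN mp, OF h(3), THEN mp, OF h(4), THEN mp, OF h(5), THEN mp, OF h(6), THEN mp, OF h(7), THEN mp, OF h(8), THEN mp, OF b])
qed

definition c4 :: real where "c4 = 1 / (1 - exp (- 1/4))"

lemma e4: "0 <= exp (- 1/4 :: real)" "exp (- 1/4 :: real) < 1"
 by auto

lemma c4_ge_1: "1 <= c4"
 unfolding c4_def by (simp add: field_simps)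

lemma exp_quarter: "exp (- (1/4) * real j) = exp (- 1/4) ^ j"
 using exp_of_nat_mult[of j "- 1/4 :: real"] by (simp add: mult.commute)

lemma up_layers:
 assumes q: "pm <= q" "q <= 1" and a: "0 <= a" and v: "v \<in> V" and L: "LbH q H v a"
  and Z: "finite Z" "Z \<subseteq> V" "\<And>z. z \<in> Z ==> u v <= u z \<and> hi u (u z) \<subseteq> H"
  and g: "\<And>z T. z \<in> Z ==> u z < T ==> g z <= tau q (lo u T \<inter> H) v z"
 shows "(\<Sum>z\<in>Z. g z * exp ((u z - u v) / 2)) <= wc 1 * a * c4"
proof -
 define k where "k z = nat \<lfloor>u z - u v\<rfloor>" for z
 have "(\<Sum>z\<in>Z. g z * exp ((u z - u v) / 2)) <= (wc 1 * a) / (1 - exp (- 1/4))"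
 proof (rule layer_sum[OF Z(1) e4, where k = k])
  show "0 <= wc 1 * a" using wc_ge_1[of 1] a by simp
  fix j
  define S where "S = u v + real j + 1"
  have h: "real j <= u z - u v \<and> u z < S" if "z \<in> {z \<in> Z. k z = j}" for z
  proof -
   have z: "z \<in> Z" "k z = j" using that by auto
   have "0 <= u z - u v" using Z(3)[OF z(1)] by simp
   thus ?thesis using z(2) unfolding k_def S_def by linarith
  qed
  have t0: "0 <= tau q (lo u S \<inter> H) v z" for z by (rule tau_nonneg) (use q pm in auto)
  have "(\<Sum>z\<in>{z \<in> Z. k z = j}. g z * exp ((u z - u v) / 2)) <= (\<Sum>z\<in>{z \<in> Z. k z = j}. tau q (lo u S \<inter> H) v z * exp ((real j + 1) / 2))"
  proof (rule sum_mono)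
   fix z assume z: "z \<in> {z \<in> Z. k z = j}"
   have "g z <= tau q (lo u S \<inter> H) v z" by (rule g) (use z h in auto)
   moreover have "exp ((u z - u v) / 2) <= exp ((real j + 1) / 2)" using h[OF z] by (simp add: S_def)
   ultimately show "g z * exp ((u z - u v) / 2) <= tau q (lo u S \<inter> H) v z * exp ((real j + 1) / 2)"
    using t0[of z] by (intro order_trans[OF mult_right_mono mult_left_mono]) auto
  qed
  also have "... = (\<Sum>z\<in>{z \<in> Z. k z = j}. tau q (lo u S \<inter> H) v z) * exp ((real j + 1) / 2)" by (simp add: sum_distrib_right)
  also have "... <= (wc 1 * a * exp (- (3/4) * (S - u v))) * exp ((real j + 1) / 2)"
  proof (intro mult_right_mono window[OF _ q a v L])
   show "S - 1 <= u z \<and> hi u (u z) \<subseteq> H" if "z \<in> {z \<in> Z. k z = j}" for z using h[OF that] Z(3) that by (auto simp: S_def)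
  qed (use Z in \<open>auto simp: S_def\<close>)
  also have "... = wc 1 * a * exp (- (1/4) * real j - 1/4)"
   by (simp add: S_def mult.assoc exp_add[symmetric]) (simp add: field_simps)
  also have "... <= wc 1 * a * exp (- (1/4) * real j)" using wc_ge_1[of 1] a by (intro mult_left_mono) auto
  finally show "(\<Sum>z\<in>{z \<in> Z. k z = j}. g z * exp ((u z - u v) / 2)) <= wc 1 * a * exp (- 1/4) ^ j"
   by (simp only: exp_quarter)
 qed
 thus ?thesis by (simp add: c4_def)
qed

lemma down_layers:
 assumes q: "pm <= q" "q <= 1" and a: "0 <= a" and v: "v \<in> V" and L: "LbH q UNIV v a" and T: "u v <= T"
  and Z: "finite Z" "Z \<subseteq> V" "\<And>z. z \<in> Z ==> u v <= u z \<and> u z <= T + D"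
  and g: "\<And>z. z \<in> Z ==> 0 <= g z \<and> g z <= tau q (lo u (u z)) v z"
 shows "(\<Sum>z\<in>Z. g z * exp (- (3/2) * (T - u z))) <= wc 1 * a * exp D * c4 * exp (- (3/4) * (T - u v))"
proof -
 define k where "k z = nat \<lfloor>T + D - u z\<rfloor>" for z
 define c where "c = wc 1 * a * exp D * exp (- (3/4) * (T - u v))"
 have c0: "0 <= c" using wc_ge_1[of 1] a by (simp add: c_def)
 have "(\<Sum>z\<in>Z. g z * exp (- (3/2) * (T - u z))) <= c / (1 - exp (- 1/4))"
 proof (rule layer_sum[OF Z(1) e4 c0, where k = k])
  fix j
  define S where "S = T + D - real j"
  have h: "S - 1 < u z \<and> u z <= S" if "z \<in> {z \<in> Z. k z = j}" for z
  proof -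
   have z: "z \<in> Z" "k z = j" using that by auto
   have "0 <= T + D - u z" using Z(3)[OF z(1)] by simp
   thus ?thesis using z(2) unfolding k_def S_def by linarith
  qed
  show "(\<Sum>z\<in>{z \<in> Z. k z = j}. g z * exp (- (3/2) * (T - u z))) <= c * exp (- 1/4) ^ j"
  proof (cases "{z \<in> Z. k z = j} = {}")
   case True
   show ?thesis unfolding True using c0 by simp
  next
   case False
   then obtain z0 where z0: "z0 \<in> {z \<in> Z. k z = j}" by blast
   have vS: "u v <= S" using h[OF z0] Z(3)[of z0] z0 by auto
   have t0: "0 <= tau q (lo u S \<inter> UNIV) v z" for z by (rule tau_nonneg) (use q pm in auto)
   have "(\<Sum>z\<in>{z \<in> Z. k z = j}. g z * exp (- (3/2) * (T - u z))) <= (\<Sum>z\<in>{z \<in> Z. k z = j}. tau q (lo u S \<inter> UNIV) v z * exp (- (3/2) * (T - S)))"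
   proof (rule sum_mono)
    fix z assume z: "z \<in> {z \<in> Z. k z = j}"
    have zS: "u z <= S" using h[OF z] by simp
    have "g z <= tau q (lo u (u z)) v z" using g z by auto
    also have "... <= tau q (lo u S \<inter> UNIV) v z" by (rule tau_mono) (use q pm lo_mono[OF zS, of u] in auto)
    finally have 1: "g z <= tau q (lo u S \<inter> UNIV) v z" .
    have 2: "exp (- (3/2) * (T - u z)) <= exp (- (3/2) * (T - S))" using zS by simp
    show "g z * exp (- (3/2) * (T - u z)) <= tau q (lo u S \<inter> UNIV) v z * exp (- (3/2) * (T - S))"
     using 1 2 t0[of z] by (intro mult_mono) auto
   qed
   also have "... = (\<Sum>z\<in>{z \<in> Z. k z = j}. tau q (lo u S \<inter> UNIV) v z) * exp (- (3/2) * (T - S))" by (simp add: sum_distrib_right)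
   also have "... <= (wc 1 * a * exp (- (3/4) * (S - u v))) * exp (- (3/2) * (T - S))"
   proof (intro mult_right_mono window[OF _ q a v L])
    show "S - 1 <= u z \<and> hi u (u z) \<subseteq> UNIV" if "z \<in> {z \<in> Z. k z = j}" for z using h[OF that] by auto
   qed (use Z vS in auto)
   also have "... = wc 1 * a * exp (- (3/4) * (S - u v) + - (3/2) * (T - S))" by (simp only: exp_add mult.assoc)
   also have "... <= wc 1 * a * exp (D + - (3/4) * (T - u v) + - (1/4) * real j)"
    using wc_ge_1[of 1] a D0 by (intro mult_left_mono) (auto simp: S_def field_simps)
   also have "... = c * exp (- (1/4) * real j)" by (simp only: c_def exp_add mult.assoc)
   finally show ?thesis by (simp only: exp_quarter)
  qed
 qed
 thus ?thesis by (simp add: c4_def c_def field_simps)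
qed

abbreviation inner_const :: "real \<Rightarrow> bool" where
 "inner_const C \<equiv>
  (\<forall>q A. pm <= q --> q <= 1 --> 0 <= A --> Lb q A --> (\<forall>z\<in>V. \<forall>W. finite W --> W \<subseteq> V -->
  (\<Sum>w\<in>W. tau q (le u (u z)) z w * (exp ((u w - u z) / 2) * of_bool (u w <= u z))) <= C * A))"

lemma inner_sum:
 "\<exists>C\<ge>1. inner_const C"
proof -
 obtain r :: real where r: "0 < r" and mtb: "transport_const r" using mass_transport_bound by (elim exE conjE)
 define C where "C = max 1 (r * (\<kappa> * (wc 1 * c4)))"
 have "(\<Sum>w\<in>W. tau q (le u (u z)) z w * (exp ((u w - u z) / 2) * of_bool (u w <= u z))) <= C * A"
  if q: "pm <= q" "q <= 1" and A: "0 <= A" "Lb q A" and z: "z \<in> V" and W: "finite W" "W \<subseteq> V" for q A z W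
 proof -
  have q0: "0 <= q" using q pm by simp
  define F where "F z w = tau q (le u (u z)) z w * (exp ((u w - u z) / 2) * of_bool (u w <= u z))" for z w
  have inv: "\<forall>g\<in>\<Gamma>. \<forall>x\<in>V. \<forall>y\<in>V. F (g x) (g y) = F x y"
  proof (intro ballI)
   fix g x y assume g: "g \<in> \<Gamma>" and xy: "x \<in> V" "y \<in> V"
   have "tau q (le u (u (g x))) (g x) (g y) = tau q (le u (u x)) x y"
    by (rule tau_img[OF q0 q(2) g xy]) (use img_le_iff[OF u_inv g _ xy(1), of _ 0] in simp)
   thus "F (g x) (g y) = F x y"
    using equivariantD[OF u_inv g xy(2,1)] equivariant_le_iff(1)[OF u_inv g xy(2,1), of 0] by (simp add: F_def)
  qed
  have nn: "\<forall>x y. 0 <= F x y" by (simp add: F_def tau_nonneg q0 q)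
  have wt: "\<forall>w\<in>V. \<forall>Z. finite Z --> Z \<subseteq> V --> (\<Sum>z\<in>Z. F z w * modr z w) <= \<kappa> * (wc 1 * A * c4)"
  proof (intro ballI allI impI)
   fix w Z assume w: "w \<in> V" and Z: "finite Z" "Z \<subseteq> V"
   define Z' where "Z' = {z \<in> Z. u w <= u z}"
   have "(\<Sum>z\<in>Z. F z w * modr z w) = (\<Sum>z\<in>Z'. F z w * modr z w)"
    unfolding Z'_def using Z by (intro sum.mono_neutral_right) (auto simp: F_def)
   also have "... <= (\<Sum>z\<in>Z'. \<kappa> * (tau q (le u (u z)) z w * exp ((u z - u w) / 2)))"
   proof (rule sum_mono)
    fix z assume "z \<in> Z'"
    hence z: "z \<in> V" "u w <= u z" using Z by (auto simp: Z'_def)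
    have "F z w * modr z w <= F z w * (\<kappa> * exp (u z - u w))" using nn modr_le1[OF z(1) w] by (intro mult_left_mono) auto
    also have "... = \<kappa> * (tau q (le u (u z)) z w * (exp ((u w - u z) / 2) * exp (u z - u w)))" using z(2) by (simp add: F_def)
    also have "exp ((u w - u z) / 2) * exp (u z - u w) = exp ((u z - u w) / 2)" by (simp only: exp_add[symmetric]) (simp add: field_simps)
    finally show "F z w * modr z w <= \<kappa> * (tau q (le u (u z)) z w * exp ((u z - u w) / 2))" .
   qed
   also have "... = \<kappa> * (\<Sum>z\<in>Z'. tau q (le u (u z)) z w * exp ((u z - u w) / 2))" by (simp add: sum_distrib_left)
   also have "... <= \<kappa> * (wc 1 * A * c4)"
   proof (rule mult_left_mono[OF up_layers[OF q A(1) w, of UNIV]])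
    show "LbH q UNIV w A" using A(2) w by (simp add: Lb_def)
    show "finite Z'" "Z' \<subseteq> V" using Z by (auto simp: Z'_def)
    show "u w <= u z \<and> hi u (u z) \<subseteq> UNIV" if "z \<in> Z'" for z using that by (simp add: Z'_def)
    fix z T assume "z \<in> Z'" "u z < T"
    have "tau q (le u (u z)) z w = tau q (le u (u z)) w z" by (rule tau_commute)
    also have "... = tau q (E \<inter> le u (u z)) w z" by (simp add: tau_def)
    also have "... <= tau q (lo u T \<inter> UNIV) w z"
    proof (rule tau_mono[OF q0 q(2)])
     show "E \<inter> le u (u z) \<subseteq> lo u T \<inter> UNIV"
     proof
      fix e assume e: "e \<in> E \<inter> le u (u z)"
      then obtain y where y: "y \<in> e" using edge_ne by blast
      hence "u y <= u z" using e by (simp add: le_def)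
      hence "u y < T" using \<open>u z < T\<close> by simp
      thus "e \<in> lo u T \<inter> UNIV" using y by (auto simp: lo_def)
     qed
    qed
    finally show "tau q (le u (u z)) z w <= tau q (lo u T \<inter> UNIV) w z" .
   qed (use \<kappa> in simp)
   finally show "(\<Sum>z\<in>Z. F z w * modr z w) <= \<kappa> * (wc 1 * A * c4)" .
  qed
  have "(\<Sum>w\<in>W. F z w) <= r * (\<kappa> * (wc 1 * A * c4))"
   using mtb[THEN spec, THEN spec, THEN mp, OF inv, THEN mp, OF nn, THEN mp, OF wt] z W by blast
  also have "... = (r * (\<kappa> * (wc 1 * c4))) * A" by (simp add: mult_ac)
  also have "... <= C * A" using A by (intro mult_right_mono) (auto simp: C_def)
  finally show ?thesis by (simp add: F_def)
 qed
 thus ?thesis by (intro exI[of _ C]) (auto simp: C_def)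
qed

definition ic :: real where
 "ic = (SOME C. C \<ge> 1 \<and> (inner_const C))"

lemma ic_ge_1: "1 <= ic"
 and inner:
 "pm <= q ==> q <= 1 ==> 0 <= A ==> Lb q A ==> z \<in> V ==> finite W ==> W \<subseteq> V ==>
  (\<Sum>w\<in>W. tau q (le u (u z)) z w * (exp ((u w - u z) / 2) * of_bool (u w <= u z))) <= ic * A"
proof -
 note w = someI_ex[OF inner_sum, folded ic_def]
 show "1 <= ic" using w by (rule conjunct1)
 assume h: "pm <= q" "q <= 1" "0 <= A" "Lb q A" "z \<in> V" "finite W" "W \<subseteq> V"
 show "(\<Sum>w\<in>W. tau q (le u (u z)) z w * (exp ((u w - u z) / 2) * of_bool (u w <= u z))) <= ic * A"
  by (rule w[THEN conjunct2, THEN spec, THEN spec, THEN mp, OF h(1), THEN mp, OF h(2), THEN mp, OF h(3), THEN mp, OF h(4),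
   THEN bspec, OF h(5), THEN spec, THEN mp, OF h(6), THEN mp, OF h(7)])
qed

lemma max_sum:
 assumes q: "pm <= q" "q <= 1" and A: "0 <= A" "Lb q A" and F: "finite F" "F \<subseteq> E" and v: "v \<in> V"
  and W: "finite W" "W \<subseteq> V" and Z: "finite Z" "Z \<subseteq> V" "\<And>z. linked F v z ==> u v <= u z ==> z \<in> Z"
  and g: "\<And>w. 0 <= g w" and G: "\<And>z. 0 <= G z" and gG: "\<And>z w. z \<in> Z ==> w \<in> W ==> u w <= u z ==> g w <= G z * exp ((u w - u z) / 2)"
  and M: "(\<Sum>z\<in>Z. conn (F \<inter> lo u (u z)) q v z * G z) <= M"
 shows "(\<Sum>w\<in>W. conn F q v w * g w) <= ic * A * M"
proof -
 have q0: "0 <= q" using q pm by simp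
 define P1 where "P1 z = conn (F \<inter> lo u (u z)) q v z" for z
 define P2 where "P2 z w = conn (F \<inter> le u (u z)) q z w" for z w
 have P1: "0 <= P1 z" and P2: "0 <= P2 z w" for z w using q0 q by (auto simp: P1_def P2_def intro: Pr_nonneg)
 have "(\<Sum>w\<in>W. conn F q v w * g w) <= (\<Sum>w\<in>W. \<Sum>z\<in>Z. P1 z * G z * (P2 z w * (exp ((u w - u z) / 2) * of_bool (u w <= u z))))"
 proof (rule sum_mono)
  fix w assume w: "w \<in> W"
  have "conn F q v w <= (\<Sum>z\<in>{z \<in> Z. u w <= u z}. P1 z * P2 z w)"
   unfolding P1_def P2_def
   by (rule linked_prob_max[OF F(1) _ q0 q(2)]) (use F(2) edge_finite Z in auto)
  hence "conn F q v w * g w <= (\<Sum>z\<in>{z \<in> Z. u w <= u z}. P1 z * P2 z w) * g w"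
   using g by (rule mult_right_mono)
  also have "... = (\<Sum>z\<in>{z \<in> Z. u w <= u z}. P1 z * P2 z w * g w)" by (rule sum_distrib_right)
  also have "... <= (\<Sum>z\<in>{z \<in> Z. u w <= u z}. P1 z * G z * (P2 z w * (exp ((u w - u z) / 2) * of_bool (u w <= u z))))"
  proof (rule sum_mono)
   fix z assume z: "z \<in> {z \<in> Z. u w <= u z}"
   have "P1 z * P2 z w * g w <= P1 z * P2 z w * (G z * exp ((u w - u z) / 2))"
    using gG[of z w] z w P1 P2 by (intro mult_left_mono) auto
   thus "P1 z * P2 z w * g w <= P1 z * G z * (P2 z w * (exp ((u w - u z) / 2) * of_bool (u w <= u z)))"
    using z by (simp add: mult_ac)
  qed
  also have "... <= (\<Sum>z\<in>Z. P1 z * G z * (P2 z w * (exp ((u w - u z) / 2) * of_bool (u w <= u z))))"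
   using Z(1) P1 P2 G by (intro sum_mono2) auto
  finally show "conn F q v w * g w <= (\<Sum>z\<in>Z. P1 z * G z * (P2 z w * (exp ((u w - u z) / 2) * of_bool (u w <= u z))))" .
 qed
 also have "... = (\<Sum>z\<in>Z. P1 z * G z * (\<Sum>w\<in>W. P2 z w * (exp ((u w - u z) / 2) * of_bool (u w <= u z))))"
  by (subst sum.swap) (simp add: sum_distrib_left)
 also have "... <= (\<Sum>z\<in>Z. P1 z * G z * (ic * A))"
 proof (rule sum_mono)
  fix z assume z: "z \<in> Z"
  have "(\<Sum>w\<in>W. P2 z w * (exp ((u w - u z) / 2) * of_bool (u w <= u z))) <= (\<Sum>w\<in>W. tau q (le u (u z)) z w * (exp ((u w - u z) / 2) * of_bool (u w <= u z)))"
   unfolding P2_def by (intro sum_mono mult_right_mono tau_upper q0 q) (use F in auto)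
  also have "... <= ic * A" by (rule inner[OF q A _ W]) (use z Z in auto)
  finally show "P1 z * G z * (\<Sum>w\<in>W. P2 z w * (exp ((u w - u z) / 2) * of_bool (u w <= u z))) <= P1 z * G z * (ic * A)"
   using P1 G by (intro mult_left_mono) auto
 qed
 also have "... = ic * A * (\<Sum>z\<in>Z. P1 z * G z)" by (simp add: sum_distrib_left mult_ac)
 also have "... <= ic * A * M" using M ic_ge_1 A by (intro mult_left_mono) (auto simp: P1_def)
 finally show ?thesis .
qed

end

lemma linked_prob_min:
 fixes h :: "'v \<Rightarrow> real"
 assumes F: "finite F" and p: "0 <= p" "p <= 1"
  and W: "finite W" "\<And>w. linked F v w ==> h w < S ==> w \<in> W"
 shows "conn F p v x <= conn (F \<inter> hi h S) p v x +
  (\<Sum>w\<in>W. conn (F \<inter> hi h (h w)) p v w * conn (F \<inter> hi h (h w)) p w x)"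
proof -
 define B where "B w om \<longleftrightarrow> (\<exists>P Q. P \<subseteq> om \<inter> hi h (h w) \<and> Q \<subseteq> om \<inter> hi h (h w) \<and> P \<inter> Q = {} \<and> linked P v w \<and> linked Q w x)" for w om
 have "conn F p v x <= Pr F p (%om. linked (om \<inter> hi h S) v x \<or> (\<exists>w\<in>W. B w om))"
 proof (rule Pr_mono[OF p])
  fix om assume w: "om \<subseteq> F" and l: "linked om v x"
  from split_at_min[of om v x h, OF l] obtain z P Q where z: "P \<subseteq> om \<inter> hi h (h z)" "Q \<subseteq> om \<inter> hi h (h z)" "P \<inter> Q = {}" "linked P v z" "linked Q z x"
   by (elim exE conjE)
  show "linked (om \<inter> hi h S) v x \<or> (\<exists>w\<in>W. B w om)"
  proof (cases "S <= h z")
   case True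
   have hs: "hi h (h z) \<subseteq> hi h S" by (rule hi_antimono[OF True])
   have "linked (om \<inter> hi h S) v x"
    by (rule linked_trans[OF linked_mono[OF z(4)] linked_mono[OF z(5)]]) (use z(1,2) hs in auto)
   thus ?thesis by (rule disjI1)
  next
   case False
   have "linked F v z" by (rule linked_mono[OF z(4)]) (use z(1) w in auto)
   hence "z \<in> W" using W(2) False by simp
   moreover have "B z om" unfolding B_def by (rule exI[of _ P], rule exI[of _ Q], intro conjI z)
   ultimately show ?thesis by blast
  qed
 qed
 also have "... <= Pr F p (%om. linked (om \<inter> hi h S) v x) + Pr F p (%om. \<exists>w\<in>W. B w om)"
  by (rule Pr_disj_le[OF p])
 also have "Pr F p (%om. linked (om \<inter> hi h S) v x) = conn (F \<inter> hi h S) p v x"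
  by (rule Pr_restrict[OF F])
 also have "Pr F p (%om. \<exists>w\<in>W. B w om) <= (\<Sum>w\<in>W. Pr F p (B w))" by (rule Pr_Bex_le[OF p W(1)])
 also have "... <= (\<Sum>w\<in>W. conn (F \<inter> hi h (h w)) p v w * conn (F \<inter> hi h (h w)) p w x)"
  unfolding B_def by (intro sum_mono BK_linked2[OF F p])
 finally show ?thesis by simp
qed

context qt_graph
begin

lemma reach_finite: "finite F ==> F \<subseteq> E ==> finite {z. linked F v z}"
 by (rule linked_reach_finite) (use edge_finite in auto)

lemma reach_in: "F \<subseteq> E ==> v \<in> V ==> {z. linked F v z} \<subseteq> V"
 using linked_in by blast

end

context crit
begin

theorem second_moment:
 assumes q: "pm <= q" "q <= 1" and A: "0 <= A" "Lb q A" and v: "v \<in> V" and d: "0 <= d"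
  and F: "finite F" "F \<subseteq> E \<inter> lo u (u v + d)"
 shows "pexp F q (%om. (real (card {x. u v + d <= u x \<and> linked om v x}))\<^sup>2) <=
  (wc D)\<^sup>2 * ic * wc 1 * exp D * c4 * A ^ 4 * exp (- (3/4) * d)"
proof -
 define T where "T = u v + d"
 have q0: "0 <= q" using q pm by simp
 have FE: "F \<subseteq> E" using F(2) by auto
 define Z where "Z = {z. linked F v z}"
 have Z: "finite Z" "Z \<subseteq> V" using reach_finite[OF F(1) FE] reach_in[OF FE v] by (auto simp: Z_def)
 have Zu: "u z <= T + D" if "z \<in> Z" for z
 proof (cases "T <= u z")
  case True
  thus ?thesis using level_window[of F T z v] F(2) that d D0 by (auto simp: Z_def T_def)
 qed (use D0 in simp)
 define X where "X = {x \<in> Z. T <= u x}"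
 have X: "finite X" "X \<subseteq> V" using Z by (auto simp: X_def)
 define P where "P x y = conn F q x y" for x y
 have P0: "0 <= P x y" for x y unfolding P_def by (rule Pr_nonneg[OF q0 q(2)])
 have Lw: "LbH q UNIV w A" if "w \<in> V" for w using A(2) that by (simp add: Lb_def)
 have sq: "(real (card {x. u v + d <= u x \<and> linked om v x}))\<^sup>2 = (\<Sum>x\<in>X. \<Sum>y\<in>X. of_bool (linked om v x \<and> linked om v y))"
  if w: "om \<subseteq> F" for om
 proof -
  have "{x. u v + d <= u x \<and> linked om v x} = {x \<in> X. linked om v x}"
   using linked_mono[OF _ w] by (auto simp: X_def Z_def T_def)
  hence "real (card {x. u v + d <= u x \<and> linked om v x}) = (\<Sum>x\<in>X. of_bool (linked om v x))"
   using X(1) by (simp add: of_bool_def sum.If_cases Int_def)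
  thus ?thesis by (simp add: power2_eq_square sum_product of_bool_conj)
 qed
 have "pexp F q (%om. (real (card {x. u v + d <= u x \<and> linked om v x}))\<^sup>2) =
  pexp F q (%om. \<Sum>x\<in>X. \<Sum>y\<in>X. of_bool (linked om v x \<and> linked om v y))"
  by (rule pexp_cong) (rule sq)
 also have "... = (\<Sum>x\<in>X. \<Sum>y\<in>X. Pr F q (%om. linked om v x \<and> linked om v y))"
  by (simp add: pexp_sum Pr_def)
 also have "... <= (\<Sum>x\<in>X. \<Sum>y\<in>X. \<Sum>w\<in>Z. P v w * P w x * P w y)"
  unfolding P_def by (intro sum_mono linked_prob_tree[OF F(1) _ q0 q(2) Z(1)]) (use FE edge_finite in \<open>auto simp: Z_def\<close>)
 also have "... = (\<Sum>x\<in>X. \<Sum>w\<in>Z. \<Sum>y\<in>X. P v w * P w x * P w y)"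
  by (rule sum.cong[OF refl]) (rule sum.swap)
 also have "... = (\<Sum>w\<in>Z. \<Sum>x\<in>X. \<Sum>y\<in>X. P v w * P w x * P w y)" by (rule sum.swap)
 also have "... = (\<Sum>w\<in>Z. P v w * (\<Sum>x\<in>X. P w x)\<^sup>2)"
  unfolding power2_eq_square sum_product by (simp only: sum_distrib_left mult.assoc)
 also have "... <= (\<Sum>w\<in>Z. P v w * ((wc D * A)\<^sup>2 * exp (- (3/2) * (T - u w))))"
 proof (rule sum_mono)
  fix w assume w: "w \<in> Z"
  have wV: "w \<in> V" using w Z by auto
  have "(\<Sum>x\<in>X. P w x) <= (\<Sum>x\<in>X. tau q (lo u T \<inter> UNIV) w x)"
   unfolding P_def by (intro sum_mono tau_upper q0 q) (use F in \<open>auto simp: T_def\<close>)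
  also have "... <= wc D * A * exp (- (3/4) * (T - u w))"
   by (rule window[OF D0 q A(1) wV Lw[OF wV] Zu[OF w] X]) (use D0 in \<open>auto simp: X_def\<close>)
  finally have "(\<Sum>x\<in>X. P w x)\<^sup>2 <= (wc D * A * exp (- (3/4) * (T - u w)))\<^sup>2"
   by (intro power_mono sum_nonneg P0)
  also have "... = (wc D * A)\<^sup>2 * (exp (- (3/4) * (T - u w)) * exp (- (3/4) * (T - u w)))"
   by (simp only: power2_eq_square mult_ac)
  also have "exp (- (3/4) * (T - u w)) * exp (- (3/4) * (T - u w)) = exp (- (3/2) * (T - u w))"
   by (simp only: exp_add[symmetric]) (simp add: field_simps)
  finally show "P v w * (\<Sum>x\<in>X. P w x)\<^sup>2 <= P v w * ((wc D * A)\<^sup>2 * exp (- (3/2) * (T - u w)))"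
   by (rule mult_left_mono) (rule P0)
 qed
 also have "... = (wc D * A)\<^sup>2 * (\<Sum>w\<in>Z. P v w * exp (- (3/2) * (T - u w)))"
  by (simp add: sum_distrib_left mult_ac)
 also have "... <= (wc D * A)\<^sup>2 * (ic * A * (wc 1 * A * exp D * c4 * exp (- (3/4) * (T - u v))))"
 proof (rule mult_left_mono)
  define Z' where "Z' = {z \<in> Z. u v <= u z}"
  show "(\<Sum>w\<in>Z. P v w * exp (- (3/2) * (T - u w))) <= ic * A * (wc 1 * A * exp D * c4 * exp (- (3/4) * (T - u v)))"
   unfolding P_def
  proof (rule max_sum[OF q A F(1) FE v Z, of Z' "%w. exp (- (3/2) * (T - u w))" "%z. exp (- (3/2) * (T - u z))"])
   show "finite Z'" "Z' \<subseteq> V" using Z by (auto simp: Z'_def)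
   show "z \<in> Z'" if zz: "linked F v z" "u v <= u z" for z using zz by (simp add: Z'_def Z_def)
   show "exp (- (3/2) * (T - u w)) <= exp (- (3/2) * (T - u z)) * exp ((u w - u z) / 2)" if le: "u w <= u z" for z w
   proof -
    have "- (3/2) * (T - u w) <= - (3/2) * (T - u z) + (u w - u z) / 2" using le by (simp add: field_simps)
    thus ?thesis by (simp only: exp_add[symmetric] exp_le_cancel_iff)
   qed
   show "(\<Sum>z\<in>Z'. conn (F \<inter> lo u (u z)) q v z * exp (- (3/2) * (T - u z))) <=
    wc 1 * A * exp D * c4 * exp (- (3/4) * (T - u v))"
   proof (rule down_layers[OF q A(1) v Lw[OF v]])
    show "u v <= T" using d by (simp add: T_def)
    show "finite Z'" "Z' \<subseteq> V" using Z by (auto simp: Z'_def)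
    show "u v <= u z \<and> u z <= T + D" if "z \<in> Z'" for z using that Zu by (auto simp: Z'_def)
    show "0 <= conn (F \<inter> lo u (u z)) q v z \<and>
     conn (F \<inter> lo u (u z)) q v z <= tau q (lo u (u z)) v z" for z
     by (intro conjI Pr_nonneg tau_upper q0 q) (use F in auto)
   qed
  qed auto
 qed simp
 also have "... = (wc D)\<^sup>2 * ic * wc 1 * exp D * c4 * A ^ 4 * exp (- (3/4) * d)"
  by (simp add: T_def power2_eq_square power4_eq_xxxx mult_ac)
 finally show ?thesis .
qed

abbreviation dip_const :: "real \<Rightarrow> bool" where
 "dip_const C \<equiv>
  (\<forall>q A a K. pm <= q --> q <= 1 --> 0 <= A --> Lb q A --> 0 <= a --> Sb q a --> (\<forall>v\<in>V. \<forall>W. finite W --> W \<subseteq> V -->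
  (\<Sum>w\<in>W. tau q (hi u (u w)) v w * (exp (- (3/4) * (u v - u w)) * of_bool (K < u v - u w))) <= C * (a * A * exp (- K / 4))))"

lemma dip_weight:
 "\<exists>C\<ge>1. dip_const C"
proof -
 obtain r :: real where r: "0 < r" and mtb: "transport_const r" using mass_transport_bound by (elim exE conjE)
 define C where "C = max 1 (r * (\<kappa> * (ic * (wc 1 * c4))))"
 have fin: "(\<Sum>w\<in>W. tau q (hi u (u w)) v w * (exp (- (3/4) * (u v - u w)) * of_bool (K < u v - u w))) <= C * (a * A * exp (- K / 4))"
  if q: "pm <= q" "q <= 1" and A: "0 <= A" "Lb q A" and a: "0 <= a" "Sb q a" and v: "v \<in> V" and W: "finite W" "W \<subseteq> V" for q A a K v W
 proof -
  have q0: "0 <= q" using q pm by simp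
  define F where "F z w = tau q (hi u (u w)) z w * (exp (- (3/4) * (u z - u w)) * of_bool (K < u z - u w))" for z w
  have inv: "\<forall>g\<in>\<Gamma>. \<forall>x\<in>V. \<forall>y\<in>V. F (g x) (g y) = F x y"
  proof (intro ballI)
   fix g x y assume g: "g \<in> \<Gamma>" and xy: "x \<in> V" "y \<in> V"
   have "tau q (hi u (u (g y))) (g x) (g y) = tau q (hi u (u y)) x y"
    by (rule tau_img[OF q0 q(2) g xy]) (use img_hi_iff[OF u_inv g _ xy(2), of _ 0] in simp)
   thus "F (g x) (g y) = F x y"
    using equivariantD[OF u_inv g xy] by (simp add: F_def)
  qed
  have nn: "\<forall>x y. 0 <= F x y" by (simp add: F_def tau_nonneg q0 q)
  have wt: "\<forall>w\<in>V. \<forall>Z. finite Z --> Z \<subseteq> V --> (\<Sum>z\<in>Z. F z w * modr z w) <= \<kappa> * (ic * A * (exp (- K / 4) * (wc 1 * a * c4)))"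
  proof (intro ballI allI impI)
   fix w Z assume w: "w \<in> V" and Z: "finite Z" "Z \<subseteq> V"
   define g where "g z = exp ((u z - u w) / 4) * of_bool (K < u z - u w)" for z
   have g0: "0 <= g z" for z by (simp add: g_def)
   have "(\<Sum>z\<in>Z. F z w * modr z w) <= (\<Sum>z\<in>Z. \<kappa> * (g z * tau q (hi u (u w)) w z))"
   proof (rule sum_mono)
    fix z assume "z \<in> Z"
    hence z: "z \<in> V" using Z by auto
    have "F z w * modr z w <= F z w * (\<kappa> * exp (u z - u w))" using nn modr_le1[OF z w] by (intro mult_left_mono) auto
    also have "... = \<kappa> * (tau q (hi u (u w)) w z * (exp (- (3/4) * (u z - u w)) * exp (u z - u w) * of_bool (K < u z - u w)))"
     by (simp add: F_def tau_commute[of q _ z w])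
    also have "exp (- (3/4) * (u z - u w)) * exp (u z - u w) = exp ((u z - u w) / 4)" by (simp only: exp_add[symmetric]) (simp add: field_simps)
    finally show "F z w * modr z w <= \<kappa> * (g z * tau q (hi u (u w)) w z)" by (simp add: g_def mult_ac)
   qed
   also have "... = \<kappa> * (\<Sum>z\<in>Z. g z * tau q (hi u (u w)) w z)" by (simp add: sum_distrib_left)
   also have "... <= \<kappa> * (ic * A * (exp (- K / 4) * (wc 1 * a * c4)))"
   proof (rule mult_left_mono[OF tau_sum_le[OF q0 q(2) Z(1) g0]])
    fix G assume G: "finite G" "G \<subseteq> E"
    define G' where "G' = G \<inter> hi u (u w)"
    have G': "finite G'" "G' \<subseteq> E" using G by (auto simp: G'_def)
    define Y where "Y = {y. linked G' w y \<and> u w <= u y}"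
    have "Y \<subseteq> {y. linked G' w y}" by (auto simp: Y_def)
    hence Y: "finite Y" "Y \<subseteq> V" using reach_finite[OF G', of w] reach_in[OF G'(2) w] finite_subset by blast+
    have "(\<Sum>z\<in>Z. conn G' q w z * g z) <= ic * A * (exp (- K / 4) * (wc 1 * a * c4))"
    proof (rule max_sum[OF q A G' w Z Y, of g "%y. exp ((u y - u w) / 2) * exp (- K / 4)"])
     show "y \<in> Y" if yy: "linked G' w y" "u w <= u y" for y using yy by (simp add: Y_def)
     show "g z <= exp ((u y - u w) / 2) * exp (- K / 4) * exp ((u z - u y) / 2)" for y z
     proof -
      have "exp ((u z - u w) / 4) <= exp ((u y - u w) / 2 + - K / 4 + (u z - u y) / 2)" if "K < u z - u w"
       using that by (simp add: field_simps)
      thus ?thesis unfolding g_def exp_add[symmetric] by (cases "K < u z - u w") auto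
     qed
     have "(\<Sum>y\<in>Y. conn (G' \<inter> lo u (u y)) q w y * exp ((u y - u w) / 2)) <= wc 1 * a * c4"
     proof (rule up_layers[OF q a(1) w, of "hi u (u w)"])
      show "LbH q (hi u (u w)) w a" using a(2) w by (simp add: Sb_def)
      show "u w <= u y \<and> hi u (u y) \<subseteq> hi u (u w)" if "y \<in> Y" for y using that hi_antimono[of "u w" "u y" u] by (simp add: Y_def)
      fix y T assume "y \<in> Y" "u y < T"
      thus "conn (G' \<inter> lo u (u y)) q w y <= tau q (lo u T \<inter> hi u (u w)) w y"
       using lo_mono[of "u y" T u] G by (intro tau_upper q0 q) (auto simp: G'_def)
     qed (use Y in auto)
     hence "exp (- K / 4) * (\<Sum>y\<in>Y. conn (G' \<inter> lo u (u y)) q w y * exp ((u y - u w) / 2)) <= exp (- K / 4) * (wc 1 * a * c4)"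
      by (rule mult_left_mono) simp
     thus "(\<Sum>y\<in>Y. conn (G' \<inter> lo u (u y)) q w y * (exp ((u y - u w) / 2) * exp (- K / 4))) <= exp (- K / 4) * (wc 1 * a * c4)"
      by (simp add: sum_distrib_left mult_ac)
    qed (use g0 in auto)
    thus "(\<Sum>z\<in>Z. g z * conn (G \<inter> hi u (u w)) q w z) <= ic * A * (exp (- K / 4) * (wc 1 * a * c4))"
     by (simp add: G'_def mult.commute)
   qed (use \<kappa> in simp)
   finally show "(\<Sum>z\<in>Z. F z w * modr z w) <= \<kappa> * (ic * A * (exp (- K / 4) * (wc 1 * a * c4)))" .
  qed
  have "(\<Sum>w\<in>W. F v w) <= r * (\<kappa> * (ic * A * (exp (- K / 4) * (wc 1 * a * c4))))"
   using mtb[THEN spec, THEN spec, THEN mp, OF inv, THEN mp, OF nn, THEN mp, OF wt] v W by blast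
  also have "... = (r * (\<kappa> * (ic * (wc 1 * c4)))) * (a * A * exp (- K / 4))" by (simp add: mult_ac)
  also have "... <= C * (a * A * exp (- K / 4))" using A a by (intro mult_right_mono) (auto simp: C_def)
  finally show ?thesis by (simp add: F_def)
 qed
 have C1: "1 <= C" by (simp add: C_def)
 show ?thesis by (rule exI[of _ C], intro conjI C1 allI impI ballI, rule fin)
qed

theorem dips:
 "\<exists>C\<ge>1. \<forall>q A a K aK. pm <= q --> q <= 1 --> 0 <= A --> Lb q A --> 0 <= a --> Sb q a --> 0 <= K -->
  (\<forall>v\<in>V. LbH q (hi u (u v - K)) v aK) --> Lb q (aK + C * (a\<^sup>2 * A * exp (- K / 4)))"
proof -
 obtain C where C: "1 <= C" and dw: "dip_const C"
  using dip_weight by (elim exE conjE)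
 have fin: "Lb q (aK + C * (a\<^sup>2 * A * exp (- K / 4)))"
  if q: "pm <= q" "q <= 1" and A: "0 <= A" "Lb q A" and a: "0 <= a" "Sb q a" and K: "0 <= K"
   and aK: "\<forall>v\<in>V. LbH q (hi u (u v - K)) v aK" for q A a K aK
  unfolding Lb_def LbH_def
 proof (intro ballI allI impI)
  fix v d X assume v: "v \<in> V" and d: "0 <= d" and X: "finite X" "X \<subseteq> V" "\<forall>x\<in>X. u v + d <= u x"
  have q0: "0 <= q" using q pm by simp
  define T where "T = u v + d"
  have "(\<Sum>x\<in>X. 1 * tau q (lo u T) v x) <= (aK + C * (a\<^sup>2 * A * exp (- K / 4))) * exp (- (3/4) * d)"
  proof (rule tau_sum_le[OF q0 q(2) X(1)])
   fix G assume G: "finite G" "G \<subseteq> E"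
   define F where "F = G \<inter> lo u T"
   have F: "finite F" "F \<subseteq> E" using G by (auto simp: F_def)
   define W where "W = {w. linked F v w \<and> u w < u v - K}"
   have "W \<subseteq> {w. linked F v w}" by (auto simp: W_def)
   hence W: "finite W" "W \<subseteq> V" using reach_finite[OF F, of v] reach_in[OF F(2) v] finite_subset by blast+
   define P where "P w x = conn (F \<inter> hi u (u w)) q w x" for w x
   define P' where "P' w = conn (F \<inter> hi u (u w)) q v w" for w
   have P0: "0 <= P w x" "0 <= P' w" for w x unfolding P_def P'_def by (rule Pr_nonneg[OF q0 q(2)])+
   have "(\<Sum>x\<in>X. conn F q v x) <= (\<Sum>x\<in>X. conn (F \<inter> hi u (u v - K)) q v x + (\<Sum>w\<in>W. P' w * P w x))"
    unfolding P_def P'_def by (intro sum_mono linked_prob_min[OF F(1) q0 q(2) W(1)]) (simp add: W_def)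
   also have "... = (\<Sum>x\<in>X. conn (F \<inter> hi u (u v - K)) q v x) + (\<Sum>x\<in>X. \<Sum>w\<in>W. P' w * P w x)"
    by (rule sum.distrib)
   also have "(\<Sum>x\<in>X. \<Sum>w\<in>W. P' w * P w x) = (\<Sum>w\<in>W. P' w * (\<Sum>x\<in>X. P w x))"
    by (subst sum.swap) (simp add: sum_distrib_left)
   also have "(\<Sum>x\<in>X. conn (F \<inter> hi u (u v - K)) q v x) <= aK * exp (- (3/4) * d)"
   proof -
    have "(\<Sum>x\<in>X. conn (F \<inter> hi u (u v - K)) q v x) <= (\<Sum>x\<in>X. tau q (lo u (u v + d) \<inter> hi u (u v - K)) v x)"
     by (intro sum_mono tau_upper q0 q) (use G in \<open>auto simp: F_def T_def\<close>)
    also have "... <= aK * exp (- (3/4) * d)" by (rule LbHD[OF _ d X(1,2)]) (use aK v X(3) in auto)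
    finally show ?thesis .
   qed
   also have "(\<Sum>w\<in>W. P' w * (\<Sum>x\<in>X. P w x)) <=
    (\<Sum>w\<in>W. (a * exp (- (3/4) * d)) * (tau q (hi u (u w)) v w * (exp (- (3/4) * (u v - u w)) * of_bool (K < u v - u w))))"
   proof (rule sum_mono)
    fix w assume w: "w \<in> W"
    have wV: "w \<in> V" and wK: "u w < u v - K" using w W by (auto simp: W_def)
    have wT: "u w + (T - u w) = T" "0 <= T - u w" using wK K d by (auto simp: T_def)
    have "(\<Sum>x\<in>X. P w x) <= (\<Sum>x\<in>X. tau q (lo u (u w + (T - u w)) \<inter> hi u (u w)) w x)"
     unfolding P_def wT(1) by (intro sum_mono tau_upper q0 q) (use G in \<open>auto simp: F_def\<close>)
    also have "... <= a * exp (- (3/4) * (T - u w))"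
     by (rule LbHD[OF _ wT(2) X(1,2)]) (use a(2) wV X(3) in \<open>auto simp: Sb_def T_def\<close>)
    also have "... = a * (exp (- (3/4) * d) * exp (- (3/4) * (u v - u w)))"
    proof -
     have "- k * (T - u w) = - k * d + - k * (u v - u w)" for k :: real by (simp add: T_def algebra_simps)
     from this[of "3/4"] show ?thesis by (simp only: exp_add)
    qed
    finally have 1: "(\<Sum>x\<in>X. P w x) <= a * (exp (- (3/4) * d) * exp (- (3/4) * (u v - u w)))" .
    have 2: "P' w <= tau q (hi u (u w)) v w" unfolding P'_def by (intro tau_upper q0 q) (use F in auto)
    have "P' w * (\<Sum>x\<in>X. P w x) <= tau q (hi u (u w)) v w * (a * (exp (- (3/4) * d) * exp (- (3/4) * (u v - u w))))"
     using 1 2 P0 tau_nonneg[OF q0 q(2)] by (intro mult_mono sum_nonneg) auto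
    moreover have "K < u v - u w" using wK by simp
    ultimately show "P' w * (\<Sum>x\<in>X. P w x) <=
     (a * exp (- (3/4) * d)) * (tau q (hi u (u w)) v w * (exp (- (3/4) * (u v - u w)) * of_bool (K < u v - u w)))"
     by (simp add: mult_ac)
   qed
   also have "... = (a * exp (- (3/4) * d)) * (\<Sum>w\<in>W. tau q (hi u (u w)) v w * (exp (- (3/4) * (u v - u w)) * of_bool (K < u v - u w)))"
    by (simp add: sum_distrib_left)
   also have "... <= (a * exp (- (3/4) * d)) * (C * (a * A * exp (- K / 4)))"
   proof (rule mult_left_mono)
    show "(\<Sum>w\<in>W. tau q (hi u (u w)) v w * (exp (- (3/4) * (u v - u w)) * of_bool (K < u v - u w))) <= C * (a * A * exp (- K / 4))"
     by (rule dw[THEN spec, THEN spec, THEN spec, THEN spec, THEN mp, OF q(1), THEN mp, OF q(2), THEN mp, OF A(1), THEN mp, OF A(2),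
      THEN mp, OF a(1), THEN mp, OF a(2), THEN bspec, OF v, THEN spec, THEN mp, OF W(1), THEN mp, OF W(2)])
   qed (use a in simp)
   finally have "(\<Sum>x\<in>X. conn F q v x) <= aK * exp (- (3/4) * d) + (a * exp (- (3/4) * d)) * (C * (a * A * exp (- K / 4)))"
    by linarith
   thus "(\<Sum>x\<in>X. 1 * conn (G \<inter> lo u T) q v x) <= (aK + C * (a\<^sup>2 * A * exp (- K / 4))) * exp (- (3/4) * d)"
    by (simp add: F_def power2_eq_square algebra_simps)
  qed simp
  thus "(\<Sum>x\<in>X. tau q (lo u (u v + d) \<inter> UNIV) v x) <= (aK + C * (a\<^sup>2 * A * exp (- K / 4))) * exp (- (3/4) * d)"
   by (simp add: T_def)
 qed
 show ?thesis by (rule exI[of _ C], intro conjI C allI impI, rule fin)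
qed

theorem weighted_sum:
 assumes q: "pm <= q" "q <= 1" and A: "0 <= A" "Lb q A" and v: "v \<in> V" and X: "finite X" "X \<subseteq> V"
 shows "(\<Sum>x\<in>X. exp ((u x - u v) / 2) * tau q UNIV v x) <= ic * A * (wc 1 * A * c4)"
proof (rule tau_sum_le)
 show q0: "0 <= q" using q pm by simp
 fix F assume F: "finite F" "F \<subseteq> E"
 define Z where "Z = {z. linked F v z \<and> u v <= u z}"
 have "Z \<subseteq> {z. linked F v z}" by (auto simp: Z_def)
 hence Z: "finite Z" "Z \<subseteq> V" using reach_finite[OF F, of v] reach_in[OF F(2) v] finite_subset by blast+
 have "(\<Sum>x\<in>X. conn F q v x * exp ((u x - u v) / 2)) <= ic * A * (wc 1 * A * c4)"
 proof (rule max_sum[OF q A F v X Z, of "%x. exp ((u x - u v) / 2)" "%x. exp ((u x - u v) / 2)"])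
  show "z \<in> Z" if zz: "linked F v z" "u v <= u z" for z using zz by (simp add: Z_def)
  show "exp ((u w - u v) / 2) <= exp ((u z - u v) / 2) * exp ((u w - u z) / 2)" for z w
   unfolding exp_add[symmetric] by (simp add: field_simps)
  show "(\<Sum>z\<in>Z. conn (F \<inter> lo u (u z)) q v z * exp ((u z - u v) / 2)) <= wc 1 * A * c4"
  proof (rule up_layers[OF q A(1) v, of UNIV])
   show "LbH q UNIV v A" using A(2) v by (simp add: Lb_def)
   show "u v <= u z \<and> hi u (u z) \<subseteq> UNIV" if "z \<in> Z" for z using that by (simp add: Z_def)
   fix z T assume "z \<in> Z" "u z < T"
   thus "conn (F \<inter> lo u (u z)) q v z <= tau q (lo u T \<inter> UNIV) v z"
    using lo_mono[of "u z" T u] F by (intro tau_upper q0 q) auto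
  qed (use Z in auto)
 qed auto
 thus "(\<Sum>x\<in>X. exp ((u x - u v) / 2) * conn (F \<inter> UNIV) q v x) <= ic * A * (wc 1 * A * c4)"
  by (simp add: mult.commute)
qed (use q X in auto)

end

section \<open>Downward crossings\<close>

lemma truncation:
 fixes C b :: real and Z :: nat
 assumes "0 < C" "0 <= b"
 shows "real Z <= C * of_bool (1 <= Z) + (\<Sum>k<m. C * b ^ Suc k * of_bool (C * b ^ k <= real Z)) + real Z * of_bool (C * b ^ m <= real Z)"
proof (induction m)
 case 0
 show ?case using assms by (cases "Z = 0"; cases "C <= real Z") auto
next
 case (Suc m)
 have "real Z * of_bool (C * b ^ m <= real Z) <= C * b ^ Suc m * of_bool (C * b ^ m <= real Z) + real Z * of_bool (C * b ^ Suc m <= real Z)"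
  using assms by (cases "C * b ^ m <= real Z"; cases "C * b ^ Suc m <= real Z") auto
 thus ?case using Suc by simp
qed

lemma tail_expectation:
 fixes Z :: "'e set \<Rightarrow> nat"
 assumes F: "finite F" and q: "0 <= q" "q <= 1" and C: "0 < C" "0 <= b"
  and p1: "Pr F q (%om. 1 <= Z om) <= p1" and tl: "\<And>k. Pr F q (%om. C * b ^ k <= real (Z om)) <= \<tau> k"
 shows "pexp F q (%om. real (Z om)) <= C * p1 + (\<Sum>k<m. C * b ^ Suc k * \<tau> k) + pexp F q (%om. real (Z om) * of_bool (C * b ^ m <= real (Z om)))"
proof -
 have "pexp F q (%om. real (Z om)) <= pexp F q (%om. C * of_bool (1 <= Z om) + (\<Sum>k<m. C * b ^ Suc k * of_bool (C * b ^ k <= real (Z om))) + real (Z om) * of_bool (C * b ^ m <= real (Z om)))"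
  by (intro pexp_mono q truncation C)
 also have "... = C * Pr F q (%om. 1 <= Z om) + (\<Sum>k<m. C * b ^ Suc k * Pr F q (%om. C * b ^ k <= real (Z om)))
  + pexp F q (%om. real (Z om) * of_bool (C * b ^ m <= real (Z om)))"
  by (simp only: pexp_add pexp_sum pexp_cmult Pr_def)
 also have "... <= C * p1 + (\<Sum>k<m. C * b ^ Suc k * \<tau> k) + pexp F q (%om. real (Z om) * of_bool (C * b ^ m <= real (Z om)))"
  using C p1 tl by (intro add_mono sum_mono mult_left_mono) auto
 finally show ?thesis .
qed

lemma exp_small: "0 < a ==> 0 < \<eta> ==> - ln \<eta> / a <= t ==> exp (- a * t) <= (\<eta>::real)"
proof -
 assume a: "0 < a" "0 < \<eta>" "- ln \<eta> / a <= t"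
 hence "- a * t <= ln \<eta>" by (simp add: field_simps)
 thus ?thesis using a by (metis exp_le_cancel_iff exp_ln)
qed

context climb
begin

lemma cross_Zy:
 assumes w: "w \<in> V" and t: "0 < t" and o: "om \<subseteq> E \<inter> lo u (u w)" "\<forall>e\<in>om. e \<subseteq> bl R w"
  and x: "l x <= l w - t" "linked om w x"
 shows "Zy t R w om \<noteq> {}"
proof -
 have "- l w + t <= - l x" using x(1) by simp
 from first_hit_level[of om w x "- l w + t" "%z. - l z", OF x(2) this]
 obtain z where z: "- l w + t <= - l z" "linked (om \<inter> lo (%z. - l z) (- l w + t)) w z" by blast
 have sub: "om \<inter> lo (%z. - l z) (- l w + t) \<subseteq> om \<inter> Qy t R w"
 proof
  fix e assume e: "e \<in> om \<inter> lo (%z. - l z) (- l w + t)"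
  then obtain y where "y \<in> e" "- l y < - l w + t" by (auto simp: lo_def)
  hence "\<exists>x\<in>e. l w - t < l x" by (intro bexI[of _ y]) auto
  thus "e \<in> om \<inter> Qy t R w" using e o by (auto simp: Qy_def)
 qed
 have "z \<noteq> w" using z(1) t by auto
 then obtain c where c: "{c, z} \<in> om \<inter> lo (%z. - l z) (- l w + t)" using linked_last_edge[OF z(2)] by blast
 have e: "{c, z} \<in> E" "{c, z} \<subseteq> bl R w" using c o by auto
 have "- l c < - l w + t" using c z(1) by (auto simp: lo_def)
 moreover have "\<bar>l c - l z\<bar> <= D" using l_lip e(1) by blast
 ultimately have "z \<in> Bz t R w" using z(1) e(2) by (auto simp: Bz_def)
 hence "z \<in> Zy t R w om" using linked_mono[OF z(2) sub] by (simp add: Zy_def)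
 thus ?thesis by blast
qed

lemma Zy_increasing: "increasing_event (%om. Zy t R y om \<noteq> {})"
 unfolding increasing_event_def
proof (intro allI impI)
 fix om om' :: "'v set set" assume s: "om \<subseteq> om'" and "Zy t R y om \<noteq> {}"
 then obtain b where b: "b \<in> Bz t R y" "linked (om \<inter> Qy t R y) y b" by (auto simp: Zy_def)
 have "linked (om' \<inter> Qy t R y) y b" by (rule linked_mono[OF b(2)]) (use s in auto)
 hence "b \<in> Zy t R y om'" using b(1) by (simp add: Zy_def)
 thus "Zy t R y om' \<noteq> {}" by blast
qed

lemma cross_prob:
 assumes q: "0 <= q" "q <= 1" and w: "w \<in> V" and t: "0 < t" and F: "finite F" "F \<subseteq> E \<inter> lo u (u w)" "\<forall>e\<in>F. e \<subseteq> bl R w"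
 shows "Pr F q (%om. \<exists>x. l x <= l w - t \<and> linked om w x) <= Pr (Qy t R w) q (%om. Zy t R w om \<noteq> {})"
proof -
 have "Pr F q (%om. \<exists>x. l x <= l w - t \<and> linked om w x) <= Pr F q (%om. Zy t R w (om \<inter> Qy t R w) \<noteq> {})"
 proof (rule Pr_mono[OF q])
  fix om assume o: "om \<subseteq> F" and "\<exists>x. l x <= l w - t \<and> linked om w x"
  then obtain x where x: "l x <= l w - t" "linked om w x" by blast
  have "Zy t R w om \<noteq> {}" by (rule cross_Zy[OF w t _ _ x]) (use o F in auto)
  moreover have "Zy t R w (om \<inter> Qy t R w) = Zy t R w om" by (simp add: Zy_def)
  ultimately show "Zy t R w (om \<inter> Qy t R w) \<noteq> {}" by simp
 qed
 also have "... = Pr (F \<inter> Qy t R w) q (%om. Zy t R w om \<noteq> {})" by (rule Pr_restrict[OF F(1)])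
 also have "... <= Pr (Qy t R w) q (%om. Zy t R w om \<noteq> {})"
  by (rule Pr_mono_edges[OF Qy_finite _ Zy_increasing q]) auto
 finally show ?thesis .
qed

lemma level_expectation:
 assumes q: "0 <= q" "q <= 1" and b: "0 <= b" and C: "0 < C" and t: "0 <= t"
  and lvl: "climbs_with q t C b"
  and v: "v \<in> V" and d: "0 <= d" and R: "E \<inter> hi u (u v + d) \<subseteq> R"
  and cross: "\<And>F s. finite F ==> F \<subseteq> E \<inter> R ==> d <= s ==> Pr F q (reaches u (u v + s) v) <= g s"
  and F0: "finite F0" "F0 \<subseteq> E \<inter> lo u (u v + d) \<inter> R" and X: "finite X" "\<forall>x\<in>X. u v + d <= u x"
  and Z: "Z = (%om. card {x. u v + d <= u x \<and> linked om v x})"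
 shows "(\<Sum>x\<in>X. conn F0 q v x) <= C * g d + (\<Sum>k<m. C * b ^ Suc k * (2 * g (d + real k * t)))
  + pexp F0 q (%om. real (Z om) * of_bool (C * b ^ m <= real (Z om)))"
proof -
 have FR: "F0 \<subseteq> E \<inter> R" and Flo: "F0 \<subseteq> E \<inter> lo u (u v + d)" using F0 by auto
 have Zfin: "finite {x. u v + d <= u x \<and> linked om v x}" if "om \<subseteq> F0" for om
 proof (rule finite_subset[OF _ reach_finite])
  show "finite om" "om \<subseteq> E" using that F0 finite_subset by auto
 qed auto
 have tail: "Pr F0 q (%om. C * b ^ k <= real (Z om)) <= 2 * g (d + real k * t)" for k
 proof -
  have uv: "u v <= u v + d + D" using d D0 by simp
  from lvl[THEN spec, THEN spec, THEN spec, THEN spec, THEN mp, OF v, THEN mp, OF uv, THEN mp, OF F0(1), THEN mp, OF Flo, of k]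
  obtain F1 where F1: "finite F1" "F1 \<subseteq> E \<inter> hi u (u v + d)"
   "Pr F0 q (%om. C * b ^ k <= real (card {x. u v + d <= u x \<and> linked om v x}))
     <= 2 * Pr (F0 \<union> F1) q (reaches u (u v + d + real k * t) v)" by (elim exE conjE)
  have "Pr (F0 \<union> F1) q (reaches u (u v + (d + real k * t)) v) <= g (d + real k * t)"
   by (rule cross) (use F0 F1 FR R t in auto)
  thus ?thesis using F1(3) by (simp add: Z add.assoc)
 qed
 have first: "Pr F0 q (%om. 1 <= Z om) <= g d"
 proof -
  have "Pr F0 q (%om. 1 <= Z om) <= Pr F0 q (reaches u (u v + d) v)"
  proof (rule Pr_mono[OF q])
   fix om assume "1 <= Z om"
   hence "{x. u v + d <= u x \<and> linked om v x} \<noteq> {}" unfolding Z by (metis card.empty not_one_le_zero)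
   thus "\<exists>x. u v + d <= u x \<and> linked om v x" by blast
  qed
  also have "... <= g d" by (rule cross[OF F0(1) FR order_refl])
  finally show ?thesis .
 qed
 have "(\<Sum>x\<in>X. conn F0 q v x) = pexp F0 q (%om. \<Sum>x\<in>X. of_bool (linked om v x))"
  by (simp add: pexp_sum Pr_def)
 also have "... <= pexp F0 q (%om. real (Z om))"
 proof (rule pexp_mono[OF q])
  fix om assume o: "om \<subseteq> F0"
  have "(\<Sum>x\<in>X. of_bool (linked om v x)) = real (card {x \<in> X. linked om v x})" using X(1) by (simp add: of_bool_def sum.If_cases Int_def)
  also have "... <= real (Z om)" unfolding Z of_nat_le_iff
   by (rule card_mono[OF Zfin[OF o]]) (use X(2) in auto)
  finally show "(\<Sum>x\<in>X. of_bool (linked om v x)) <= real (Z om)" .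
 qed
 also have "... <= C * g d + (\<Sum>k<m. C * b ^ Suc k * (2 * g (d + real k * t)))
  + pexp F0 q (%om. real (Z om) * of_bool (C * b ^ m <= real (Z om)))"
  by (rule tail_expectation[OF F0(1) q C b first tail])
 finally show ?thesis .
qed

end

context crit
begin

sublocale d: climb V E \<Gamma> "%x. - l x" "%x. - u x" \<theta> D B "\<kappa> * exp (2 * B)" "-1" pm
proof unfold_locales
 show "equivariant (%x. - l x)" "equivariant (%x. - u x)" using u_inv l_inv by (auto intro: equivariant_uminus)
 show "\<bar>- l x - - l y\<bar> <= D" if "{x, y} \<in> E" for x y using l_lip[OF that] by simp
 show "\<bar>- u x - - u y\<bar> <= D" if "{x, y} \<in> E" for x y using u_lip[OF that] by simp
 show "\<bar>- l x - - u x\<bar> <= B" if "x \<in> V" for x using ul[OF that] by simp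
 show "\<exists>z. {x, z} \<in> E \<and> - l x + \<theta> <= - l z" if "x \<in> V" for x using l_down[OF that] by force
 show "\<exists>z. {x, z} \<in> E \<and> - u z <= - u x - \<theta>" if "x \<in> V" for x using u_up[OF that] by force
 show "modr x y <= \<kappa> * exp (2 * B) * exp (- 1 * (- l x - - l y))" if xy: "x \<in> V" "y \<in> V" for x y
 proof -
  have "modr x y <= \<kappa> * exp (u x - u y)" by (rule modr_le1[OF xy])
  also have "... <= \<kappa> * exp (2 * B + (l x - l y))" using ul[OF xy(1)] ul[OF xy(2)] \<kappa> by simp
  finally show ?thesis by (simp add: exp_add)
 qed
qed (use \<theta> D0 B0 \<kappa> pm in auto)

text \<open>The BK inequality at the last visit below the starting level turns an upward crossing inside
 \<open>hi u\<close> into one for the dual pair of heights, at the cost of a factor given by the (finite) susceptibility.\<close>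

lemma dual_crossing:
 assumes \<epsilon>: "0 < \<epsilon>"
 shows "\<exists>t\<ge>t1. \<exists>y\<in>V. \<exists>R q1. pm <= q1 \<and> q1 < pc \<and>
  (\<forall>q. q1 <= q --> q < pc --> exp (- (\<alpha> + \<epsilon>) * t) <= Pr (d.Qy t R y) q (%om. d.Zy t R y om \<noteq> {}))"
proof -
 have "0 < \<epsilon> / 2" using \<epsilon> by simp
 from fq_lower[OF this] obtain q1 \<tau> where q1: "pm <= q1" "q1 < pc" "0 < \<tau>"
  "\<forall>n q. q1 <= q --> q < pc --> exp (- (\<alpha> + \<epsilon> / 2) * (real (Suc n) * \<tau>)) <= fq q (real (Suc n) * \<tau>)" by blast
 have q01: "0 <= q1" "q1 <= 1" using q1 pm pc by auto
 obtain X where X: "0 <= X" "\<forall>v\<in>V. \<forall>Y. finite Y --> (\<Sum>x\<in>Y. tau q1 UNIV v x) <= X" using chi_tau[OF q1(1,2)] by (elim exE conjE)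
 obtain v where v: "v \<in> V" using ne by blast
 define \<eta> where "\<eta> = exp (- (\<alpha> + \<epsilon>) * (2 * B)) / (2 * (X + 1))"
 have \<eta>: "0 < \<eta>" using X by (simp add: \<eta>_def)
 obtain n :: nat where n: "max (max (t1 + 2 * B) (2 * B + 1)) (- ln \<eta> / (\<epsilon> / 2)) / \<tau> <= real n" using real_arch_simple by blast
 define s where "s = real (Suc n) * \<tau>"
 have "max (max (t1 + 2 * B) (2 * B + 1)) (- ln \<eta> / (\<epsilon> / 2)) <= real n * \<tau>" using n q1(3) by (simp add: pos_divide_le_eq)
 also have "... <= s" using q1(3) by (simp add: s_def)
 finally have s: "t1 + 2 * B <= s" "2 * B + 1 <= s" "- ln \<eta> / (\<epsilon> / 2) <= s" by auto
 define t where "t = s - 2 * B"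
 have t: "t1 <= t" "0 < t" using s by (auto simp: t_def)
 have "exp (- (\<alpha> + \<epsilon> / 2) * s) <= up q1 v s 0"
  using q1(4) q1(1,2) fq_le[OF q01 v, of s] unfolding s_def by (meson order_trans order_refl)
 hence "exp (- (\<alpha> + \<epsilon> / 2) * s) / 2 < up q1 v s 0" using exp_gt_zero[of "- (\<alpha> + \<epsilon> / 2) * s"] by linarith
 then obtain F where F: "finite F" "F \<subseteq> E \<inter> hi u (u v - 0)"
  "exp (- (\<alpha> + \<epsilon> / 2) * s) / 2 < Pr F q1 (reaches u (u v + s) v)"
  unfolding up_def by (subst (asm) less_cSUP_iff[OF _ up_bdd[OF q01]]) auto
 have FE: "F \<subseteq> E" using F(2) by auto
 define Y where "Y = {y. linked F v y \<and> l y <= l v}"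
 have "Y \<subseteq> {y. linked F v y}" by (auto simp: Y_def)
 hence Y: "finite Y" "Y \<subseteq> V" using reach_finite[OF F(1) FE, of v] reach_in[OF FE v] finite_subset by blast+
 define \<A> where "\<A> b = {P. linked P v b}" for b
 define \<B> where "\<B> b = {P. P \<subseteq> lo (%x. - l x) (- l b) \<and> (\<exists>x. u v + s <= u x \<and> linked P b x)}" for b
 define pr where "pr b = Pr F q1 (%om. \<exists>Q\<in>\<B> b. Q \<subseteq> om)" for b
 have "Pr F q1 (reaches u (u v + s) v) <=
  Pr F q1 (%om. \<exists>b\<in>Y. \<exists>P Q. P \<in> \<A> b \<and> Q \<in> \<B> b \<and> P \<inter> Q = {} \<and> P \<subseteq> om \<and> Q \<subseteq> om)"
 proof (rule Pr_mono[OF q01])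
  fix om assume o: "om \<subseteq> F" and "\<exists>x. u v + s <= u x \<and> linked om v x"
  then obtain x where x: "u v + s <= u x" "linked om v x" by blast
  have xV: "x \<in> V" by (rule linked_in[OF _ v x(2)]) (use o FE in auto)
  define S where "S = {y. l v < l y}"
  have "l v < l x" using ul[OF xV] ul[OF v] x(1) s(2) by linarith
  hence S: "x \<in> S" "v \<notin> S" by (auto simp: S_def)
  from split_at_boundary[OF linked_sym[OF x(2)] S] obtain a b P Q where
   ab: "a \<in> S" "b \<notin> S" "{a, b} \<in> om" "P \<subseteq> om \<inter> Pow S" "Q \<subseteq> om" "P \<inter> {{a, b}} = {}" "(P \<union> {{a, b}}) \<inter> Q = {}" "linked P x a" "linked Q b v"
   by (elim exE conjE)
  have bl: "l b <= l v" using ab(2) by (simp add: S_def)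
  have lF: "linked F v b" by (rule linked_mono[OF linked_sym[OF ab(9)]]) (use ab(5) o in auto)
  have bY: "b \<in> Y" using lF bl by (simp add: Y_def)
  have QA: "Q \<in> \<A> b" using linked_sym[OF ab(9)] by (simp add: \<A>_def)
  have "linked (P \<union> {{a, b}}) b x"
  proof (rule linked_trans)
   show "linked (P \<union> {{a, b}}) b a" by (rule linked_edge) (simp add: insert_commute)
   show "linked (P \<union> {{a, b}}) a x" by (rule linked_mono[OF linked_sym[OF ab(8)]]) auto
  qed
  moreover have "P \<union> {{a, b}} \<subseteq> lo (%x. - l x) (- l b)"
  proof
   fix e assume e: "e \<in> P \<union> {{a, b}}"
   have "\<exists>y\<in>e. y \<in> S"
   proof (cases "e \<in> P")
    case True
    hence "e \<in> E" "e \<subseteq> S" using ab(4) o FE by auto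
    thus ?thesis using edge_ne by blast
   qed (use e ab(1) in auto)
   thus "e \<in> lo (%x. - l x) (- l b)" using bl by (force simp: lo_def S_def)
  qed
  ultimately have PB: "P \<union> {{a, b}} \<in> \<B> b" using x(1) by (auto simp: \<B>_def)
  show "\<exists>b\<in>Y. \<exists>P Q. P \<in> \<A> b \<and> Q \<in> \<B> b \<and> P \<inter> Q = {} \<and> P \<subseteq> om \<and> Q \<subseteq> om"
   by (rule bexI[OF _ bY], rule exI[of _ Q], rule exI[of _ "P \<union> {{a, b}}"], intro conjI QA PB) (use ab in auto)
 qed
 also have "... <= (\<Sum>b\<in>Y. Pr F q1 (%om. \<exists>P Q. P \<in> \<A> b \<and> Q \<in> \<B> b \<and> P \<inter> Q = {} \<and> P \<subseteq> om \<and> Q \<subseteq> om))"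
  by (rule Pr_Bex_le[OF q01 Y(1)])
 also have "... <= (\<Sum>b\<in>Y. Pr F q1 (%om. \<exists>P\<in>\<A> b. P \<subseteq> om) * pr b)"
  unfolding pr_def by (intro sum_mono BK_inequality F q01)
 also have "... <= (\<Sum>b\<in>Y. tau q1 UNIV v b * pr b)"
 proof (intro sum_mono mult_right_mono)
  fix b
  have "Pr F q1 (%om. \<exists>P\<in>\<A> b. P \<subseteq> om) <= conn F q1 v b"
   by (rule Pr_mono[OF q01]) (auto simp: \<A>_def intro: linked_mono)
  also have "... <= tau q1 UNIV v b" by (rule tau_upper[OF q01 F(1)]) (use FE in auto)
  finally show "Pr F q1 (%om. \<exists>P\<in>\<A> b. P \<subseteq> om) <= tau q1 UNIV v b" .
  show "0 <= pr b" unfolding pr_def by (rule Pr_nonneg[OF q01])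
 qed
 finally have big: "exp (- (\<alpha> + \<epsilon> / 2) * s) / 2 < (\<Sum>b\<in>Y. tau q1 UNIV v b * pr b)" using F(3) by linarith
 have "\<exists>b\<in>Y. exp (- (\<alpha> + \<epsilon>) * t) <= pr b"
 proof (rule ccontr)
  assume n: "\<not> (\<exists>b\<in>Y. exp (- (\<alpha> + \<epsilon>) * t) <= pr b)"
  have "(\<Sum>b\<in>Y. tau q1 UNIV v b * pr b) <= (\<Sum>b\<in>Y. tau q1 UNIV v b * exp (- (\<alpha> + \<epsilon>) * t))"
   using n tau_nonneg[OF q01] by (intro sum_mono mult_left_mono) auto
  also have "... = (\<Sum>b\<in>Y. tau q1 UNIV v b) * exp (- (\<alpha> + \<epsilon>) * t)" by (simp add: sum_distrib_right)
  also have "... <= (X + 1) * exp (- (\<alpha> + \<epsilon>) * t)" using X(2)[THEN bspec, OF v, THEN spec, THEN mp, OF Y(1)] by (intro mult_right_mono) auto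
  finally have 1: "exp (- (\<alpha> + \<epsilon> / 2) * s) / 2 < (X + 1) * exp (- (\<alpha> + \<epsilon>) * t)" using big by linarith
  have "exp (- (\<epsilon> / 2) * s) <= \<eta>" by (rule exp_small) (use \<epsilon> \<eta> s in auto)
  hence "exp (- (\<alpha> + \<epsilon> / 2) * s) * exp (- (\<epsilon> / 2) * s) <= exp (- (\<alpha> + \<epsilon> / 2) * s) * \<eta>" by (intro mult_left_mono) auto
  moreover have "exp (- (\<alpha> + \<epsilon> / 2) * s) * exp (- (\<epsilon> / 2) * s) = exp (- (\<alpha> + \<epsilon>) * t) * exp (- (\<alpha> + \<epsilon>) * (2 * B))"
   unfolding exp_add[symmetric] by (simp add: t_def algebra_simps)
  ultimately have "exp (- (\<alpha> + \<epsilon>) * t) * exp (- (\<alpha> + \<epsilon>) * (2 * B)) <= exp (- (\<alpha> + \<epsilon> / 2) * s) * exp (- (\<alpha> + \<epsilon>) * (2 * B)) / (2 * (X + 1))"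
   by (simp add: \<eta>_def)
  hence "exp (- (\<alpha> + \<epsilon>) * t) * exp (- (\<alpha> + \<epsilon>) * (2 * B)) <= (exp (- (\<alpha> + \<epsilon> / 2) * s) / (2 * (X + 1))) * exp (- (\<alpha> + \<epsilon>) * (2 * B))"
   by simp
  hence "exp (- (\<alpha> + \<epsilon>) * t) <= exp (- (\<alpha> + \<epsilon> / 2) * s) / (2 * (X + 1))" by (rule mult_right_le_imp_le) simp
  hence "exp (- (\<alpha> + \<epsilon>) * t) * (X + 1) <= exp (- (\<alpha> + \<epsilon> / 2) * s) / 2" using X(1) by (simp add: field_simps)
  thus False using 1 by (simp add: mult.commute)
 qed
 then obtain b where b: "b \<in> Y" "exp (- (\<alpha> + \<epsilon>) * t) <= pr b" by blast
 have bV: "b \<in> V" using b Y by auto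
 have ub: "u b <= u v + 2 * B" using b(1) ul[OF bV] ul[OF v] unfolding Y_def mem_Collect_eq by linarith
 obtain R where R: "\<forall>e\<in>F. e \<subseteq> bl R b" using finite_edges_ball[OF F(1) FE bV] by blast
 have "exp (- (\<alpha> + \<epsilon>) * t) <= Pr (d.Qy t R b) q (%om. d.Zy t R b om \<noteq> {})" if q: "q1 <= q" "q < pc" for q
 proof -
  have qq: "0 <= q" "q <= 1" using q q01 pc by auto
  have "pr b <= Pr F q1 (%om. \<exists>x. - u x <= - u b - t \<and> linked (om \<inter> lo (%x. - l x) (- l b)) b x)"
   unfolding pr_def
  proof (rule Pr_mono[OF q01])
   fix om assume "\<exists>Q\<in>\<B> b. Q \<subseteq> om"
   then obtain Q x where Q: "Q \<subseteq> om" "Q \<subseteq> lo (%x. - l x) (- l b)" "u v + s <= u x" "linked Q b x" by (auto simp: \<B>_def)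
   have "linked (om \<inter> lo (%x. - l x) (- l b)) b x" by (rule linked_mono[OF Q(4)]) (use Q in auto)
   moreover have "- u x <= - u b - t" using Q(3) ub by (simp add: t_def)
   ultimately show "\<exists>x. - u x <= - u b - t \<and> linked (om \<inter> lo (%x. - l x) (- l b)) b x" by blast
  qed
  also have "... = Pr (F \<inter> lo (%x. - l x) (- l b)) q1 (%om. \<exists>x. - u x <= - u b - t \<and> linked om b x)"
   by (rule Pr_restrict[OF F(1)])
  also have "... <= Pr (d.Qy t R b) q1 (%om. d.Zy t R b om \<noteq> {})"
   by (rule d.cross_prob[OF q01 bV t(2)]) (use F(1) FE R in auto)
  also have "... <= Pr (d.Qy t R b) q (%om. d.Zy t R b om \<noteq> {})"
   by (rule Pr_mono_p[OF d.Qy_finite d.Zy_increasing q01(1) q(1) qq(2)])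
  finally show ?thesis using b(2) by linarith
 qed
 thus ?thesis using t(1) bV q1(1,2) by blast
qed

lemma down_expectation:
 assumes q: "pm <= q" "q <= 1" and b: "2 <= b" and C: "0 < C" and t: "0 < t" "b * exp (- \<beta> * t) <= 1 / 2" and \<beta>: "0 < \<beta>"
  and dn: "\<And>s w F. t1 <= s ==> w \<in> V ==> finite F ==> F \<subseteq> E \<inter> lo u (u w) ==>
   Pr F q (%om. \<exists>x. l x <= l w - s \<and> linked om w x) <= exp (- \<beta> * s)"
  and lvl: "d.climbs_with q t C b"
  and w: "w \<in> V" and dd: "t1 <= dd" "2 * B < dd" "0 <= dd"
  and F0: "finite F0" "F0 \<subseteq> E \<inter> lo u (u w) \<inter> lo (%x. - l x) (- l w + dd)" and X: "finite X" "\<forall>x\<in>X. l x <= l w - dd"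
 shows "(\<Sum>x\<in>X. conn F0 q w x) <= (C + 4 * C * b) * exp (- \<beta> * dd)"
proof -
 have q0: "0 <= q" using q pm by simp
 have FE: "F0 \<subseteq> E" using F0 by auto
 define Z where "Z = (%om. card {x. - l w + dd <= - l x \<and> linked om w x})"
 define N where "N = card {x. linked F0 w x}"
 have ZN: "Z om <= N" if "om \<subseteq> F0" for om
  unfolding Z_def N_def by (rule card_mono[OF reach_finite[OF F0(1) FE]]) (use linked_mono[OF _ that] in auto)
 have "1 < b" using b by simp
 from real_arch_pow[OF this, of "real N / C"] obtain m where m: "real N / C < b ^ m" by (elim exE)
 have "(\<Sum>x\<in>X. conn F0 q w x) <= C * exp (- \<beta> * dd) + (\<Sum>k<m. C * b ^ Suc k * (2 * exp (- \<beta> * (dd + real k * t))))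
  + pexp F0 q (%om. real (Z om) * of_bool (C * b ^ m <= real (Z om)))"
 proof (rule d.level_expectation[OF q0 q(2) _ C _ lvl w dd(3), of "lo u (u w)" "%s. exp (- \<beta> * s)"])
  show "E \<inter> hi (%x. - l x) (- l w + dd) \<subseteq> lo u (u w)"
  proof
   fix e assume e: "e \<in> E \<inter> hi (%x. - l x) (- l w + dd)"
   then obtain y where y: "y \<in> e" using edge_ne by blast
   have yV: "y \<in> V" using y e edge_sub by blast
   have "- l w + dd <= - l y" using e y by (simp add: hi_def)
   hence "u y < u w" using ul[OF yV] ul[OF w] dd(2) by linarith
   thus "e \<in> lo u (u w)" using y by (auto simp: lo_def)
  qed
  fix F s assume F: "finite F" "F \<subseteq> E \<inter> lo u (u w)" and s: "dd <= s"
  have eq: "(- l w + s <= - l x) = (l x <= l w - s)" for x by linarith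
  show "Pr F q (%om. \<exists>x. - l w + s <= - l x \<and> linked om w x) <= exp (- \<beta> * s)"
   unfolding eq by (rule dn[OF _ w F]) (use dd(1) s in simp)
 qed (use F0 X b t Z_def in auto)
 also have "pexp F0 q (%om. real (Z om) * of_bool (C * b ^ m <= real (Z om))) = pexp F0 q (%om. 0)"
 proof (rule pexp_cong)
  fix om assume "om \<subseteq> F0"
  hence "real (Z om) < C * b ^ m" using ZN[of om] m C by (simp add: pos_divide_less_eq mult.commute)
  thus "real (Z om) * of_bool (C * b ^ m <= real (Z om)) = 0" by simp
 qed
 also have "... = 0" by (rule pexp_const[OF F0(1)])
 also have "(\<Sum>k<m. C * b ^ Suc k * (2 * exp (- \<beta> * (dd + real k * t)))) = (\<Sum>k<m. 2 * C * b * exp (- \<beta> * dd) * (b * exp (- \<beta> * t)) ^ k)"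
 proof (rule sum.cong[OF refl])
  fix k
  have "exp (- \<beta> * (dd + real k * t)) = exp (- \<beta> * dd + real k * (- \<beta> * t))" by (simp add: algebra_simps)
  hence "exp (- \<beta> * (dd + real k * t)) = exp (- \<beta> * dd) * exp (- \<beta> * t) ^ k" by (simp only: exp_add exp_of_nat_mult)
  thus "C * b ^ Suc k * (2 * exp (- \<beta> * (dd + real k * t))) = 2 * C * b * exp (- \<beta> * dd) * (b * exp (- \<beta> * t)) ^ k"
   by (simp add: power_mult_distrib mult_ac)
 qed
 also have "... <= (\<Sum>k<m. 2 * C * b * exp (- \<beta> * dd) * (1 / 2) ^ k)"
  using t C b by (intro sum_mono mult_left_mono power_mono) auto
 also have "... = 2 * C * b * exp (- \<beta> * dd) * (2 * (1 - (1 / 2) ^ m))"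
 proof -
  have gs: "(\<Sum>k<m. (1 / 2 :: real) ^ k) = 2 * (1 - (1 / 2) ^ m)" by (subst sum_gp_strict) simp
  show ?thesis unfolding sum_distrib_left[symmetric] gs by (rule refl)
 qed
 also have "... <= 2 * C * b * exp (- \<beta> * dd) * 2"
  using C b by (intro mult_left_mono) auto
 finally show ?thesis by (simp add: algebra_simps)
qed

end

context crit
begin

abbreviation drop_bound :: "real \<Rightarrow> real \<Rightarrow> real \<Rightarrow> bool" where
 "drop_bound q s M \<equiv>
  (\<forall>w F0 X. w \<in> V --> finite F0 --> F0 \<subseteq> E \<inter> lo u (u w) \<inter> lo (%x. - l x) (- l w + (s + D + 2 * B + 1)) -->
   finite X --> (\<forall>x\<in>X. l x <= l w - (s + D + 2 * B + 1)) --> (\<Sum>x\<in>X. conn F0 q w x) <=  M)"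

abbreviation drop_const :: "real \<Rightarrow> bool" where
 "drop_const C \<equiv>
  (\<forall>q s M. pm <= q --> q <= 1 --> 4 * B < s --> 0 <= M --> drop_bound q s M -->
  fq q s <= C * exp (- s) * M)"

lemma up_from_down:
 "\<exists>C>0. drop_const C"
proof -
 obtain r :: real where r: "0 < r" and mtb: "transport_const r" using mass_transport_bound by (elim exE conjE)
 define m where "m = D + 4 * B + 1"
 obtain Cc where Cc: "1 <= Cc" and ch: "d.chain_const m Cc" using d.chain_sum[of m] by (elim exE conjE)
 define C where "C = r * (\<kappa> * Cc)"
 have C: "0 < C" using r \<kappa> Cc by (simp add: C_def)
 have fin: "fq q s <= C * exp (- s) * M"
  if q: "pm <= q" "q <= 1" and s: "4 * B < s" and M: "0 <= M"
   and bd: "drop_bound q s M" for q s M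
 proof -
  have q0: "0 <= q" using q pm by simp
  define F where "F z w = tau q (lo u (u w) \<inter> hi u (u z)) z w * of_bool (u z + s <= u w \<and> u w <= u z + (s + D))" for z w
  have inv: "\<forall>g\<in>\<Gamma>. \<forall>x\<in>V. \<forall>y\<in>V. F (g x) (g y) = F x y"
  proof (intro ballI)
   fix g x y assume g: "g \<in> \<Gamma>" and xy: "x \<in> V" "y \<in> V"
   have "tau q (lo u (u (g y)) \<inter> hi u (u (g x))) (g x) (g y) = tau q (lo u (u y) \<inter> hi u (u x)) x y"
    by (rule tau_img[OF q0 q(2) g xy])
     (use img_hi_iff[OF u_inv g _ xy(1), of _ 0] img_lo_iff[OF u_inv g _ xy(2), of _ 0] in simp)
   thus "F (g x) (g y) = F x y"
    using equivariant_le_iff(1)[OF u_inv g xy(2,1)] equivariant_le_iff(3)[OF u_inv g xy(2,1)] by (simp add: F_def)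
  qed
  have nn: "\<forall>x y. 0 <= F x y" by (simp add: F_def tau_nonneg q0 q)
  have wt: "\<forall>w\<in>V. \<forall>Z. finite Z --> Z \<subseteq> V --> (\<Sum>z\<in>Z. F z w * modr z w) <= \<kappa> * exp (- s) * (Cc * M)"
  proof (intro ballI allI impI)
   fix w Z assume w: "w \<in> V" and Z: "finite Z" "Z \<subseteq> V"
   define T where "T = - l w + (s + D + 2 * B + 1)"
   define H where "H = lo u (u w) \<union> - E"
   define Z' where "Z' = {z \<in> Z. u z + s <= u w \<and> u w <= u z + (s + D)}"
   have Z': "finite Z'" "Z' \<subseteq> V" using Z by (auto simp: Z'_def)
   have "(\<Sum>z\<in>Z. F z w * modr z w) = (\<Sum>z\<in>Z'. F z w * modr z w)"
    using Z(1) by (intro sum.mono_neutral_right) (auto simp: Z'_def F_def)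
   also have "... <= (\<Sum>z\<in>Z'. \<kappa> * exp (- s) * tau q (lo (%x. - l x) T \<inter> H) w z)"
   proof (rule sum_mono)
    fix z assume "z \<in> Z'"
    hence z: "z \<in> V" "u z + s <= u w" "u w <= u z + (s + D)" using Z by (auto simp: Z'_def)
    have "modr z w <= \<kappa> * exp (u z - u w)" by (rule modr_le1[OF z(1) w])
    also have "... <= \<kappa> * exp (- s)" using z(2) \<kappa> by simp
    finally have 1: "modr z w <= \<kappa> * exp (- s)" .
    have "F z w = tau q (E \<inter> (lo u (u w) \<inter> hi u (u z))) w z"
     using z by (simp add: F_def tau_commute[of q _ z w]) (simp add: tau_def)
    also have "... <= tau q (lo (%x. - l x) T \<inter> H) w z"
    proof (rule tau_mono[OF q0 q(2)])
     show "E \<inter> (lo u (u w) \<inter> hi u (u z)) \<subseteq> lo (%x. - l x) T \<inter> H"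
     proof
      fix e assume e: "e \<in> E \<inter> (lo u (u w) \<inter> hi u (u z))"
      then obtain y where y: "y \<in> e" using edge_ne by blast
      have yV: "y \<in> V" using y e edge_sub by blast
      have "u z <= u y" using e y by (simp add: hi_def)
      hence "- l y < T" using z(3) ul[OF yV] ul[OF w] unfolding T_def by linarith
      thus "e \<in> lo (%x. - l x) T \<inter> H" using e y by (auto simp: lo_def H_def)
     qed
    qed
    finally have 2: "F z w <= tau q (lo (%x. - l x) T \<inter> H) w z" .
    have "F z w * modr z w <= tau q (lo (%x. - l x) T \<inter> H) w z * (\<kappa> * exp (- s))"
     using 1 2 nn modr_pos[OF z(1) w] tau_nonneg[OF q0 q(2)] by (intro mult_mono) auto
    thus "F z w * modr z w <= \<kappa> * exp (- s) * tau q (lo (%x. - l x) T \<inter> H) w z" by (simp add: mult_ac)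
   qed
   also have "... = \<kappa> * exp (- s) * (\<Sum>z\<in>Z'. tau q (lo (%x. - l x) T \<inter> H) w z)" by (simp add: sum_distrib_left)
   also have "... <= \<kappa> * exp (- s) * (Cc * M)"
   proof (rule mult_left_mono)
    have hM: "\<forall>Z. finite Z --> Z \<subseteq> V --> (\<forall>z\<in>Z. T <= - l z) --> (\<Sum>z\<in>Z. tau q (lo (%x. - l x) T \<inter> H) w z) <= M"
    proof (intro allI impI)
     fix Z2 assume Z2: "finite Z2" "Z2 \<subseteq> V" "\<forall>z\<in>Z2. T <= - l z"
     have "(\<Sum>z\<in>Z2. 1 * tau q (lo (%x. - l x) T \<inter> H) w z) <= M"
     proof (rule tau_sum_le[OF q0 q(2) Z2(1)])
      fix G assume G: "finite G" "G \<subseteq> E"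
      have h1: "finite (G \<inter> (lo (%x. - l x) T \<inter> H))" using G by simp
      have h2: "G \<inter> (lo (%x. - l x) T \<inter> H) \<subseteq> E \<inter> lo u (u w) \<inter> lo (%x. - l x) (- l w + (s + D + 2 * B + 1))"
       using G by (auto simp: H_def T_def)
      have h3: "\<forall>x\<in>Z2. l x <= l w - (s + D + 2 * B + 1)" using Z2(3) by (force simp: T_def)
      show "(\<Sum>z\<in>Z2. 1 * conn (G \<inter> (lo (%x. - l x) T \<inter> H)) q w z) <= M"
       using bd[THEN spec, THEN spec, THEN spec, THEN mp, OF w, THEN mp, OF h1, THEN mp, OF h2, THEN mp, OF Z2(1), THEN mp, OF h3] by simp
     qed simp
     thus "(\<Sum>z\<in>Z2. tau q (lo (%x. - l x) T \<inter> H) w z) <= M" by simp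
    qed
    have hX: "\<forall>x\<in>Z'. T - m <= - l x \<and> hi (%x. - l x) (- l x) \<subseteq> H"
    proof
     fix x assume x: "x \<in> Z'"
     have xV: "x \<in> V" and xs: "u x + s <= u w" using x Z' by (auto simp: Z'_def)
     have "T - m <= - l x" using xs ul[OF xV] ul[OF w] unfolding T_def m_def by linarith
     moreover have "hi (%x. - l x) (- l x) \<subseteq> H"
     proof
      fix e assume e: "e \<in> hi (%x. - l x) (- l x)"
      show "e \<in> H"
      proof (cases "e \<in> E")
       case True
       then obtain y where y: "y \<in> e" using edge_ne by blast
       have yV: "y \<in> V" using y True edge_sub by blast
       have "- l x <= - l y" using e y by (simp add: hi_def)
       hence "u y < u w" using xs s ul[OF xV] ul[OF yV] B0 by linarith
       thus ?thesis using y by (auto simp: H_def lo_def)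
      qed (simp add: H_def)
     qed
     ultimately show "T - m <= - l x \<and> hi (%x. - l x) (- l x) \<subseteq> H" by blast
    qed
    show "(\<Sum>z\<in>Z'. tau q (lo (%x. - l x) T \<inter> H) w z) <= Cc * M"
     by (rule ch[THEN spec, THEN spec, THEN spec, THEN spec, THEN spec, THEN spec, THEN mp, OF q(1), THEN mp, OF q(2),
      THEN mp, OF hM, THEN mp, OF Z'(1), THEN mp, OF Z'(2), THEN mp, OF hX])
   qed (use \<kappa> in simp)
   finally show "(\<Sum>z\<in>Z. F z w * modr z w) <= \<kappa> * exp (- s) * (Cc * M)" .
  qed
  obtain v where v: "v \<in> V" using ne by blast
  have "fq q s <= up q v s 0" by (rule fq_le[OF q0 q(2) v])
  also have "... <= r * (\<kappa> * exp (- s) * (Cc * M))"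
  proof (rule up_least)
   fix G assume G: "finite G" "G \<subseteq> E \<inter> hi u (u v - 0)"
   have GE: "G \<subseteq> E" using G by auto
   define X where "X = {x. linked G v x \<and> u v + s <= u x \<and> u x <= u v + (s + D)}"
   have "X \<subseteq> {x. linked G v x}" by (auto simp: X_def)
   hence X: "finite X" "X \<subseteq> V" using reach_finite[OF G(1) GE, of v] reach_in[OF GE v] finite_subset by blast+
   have "Pr G q (reaches u (u v + s) v) <= Pr G q (%om. \<exists>x\<in>X. linked (om \<inter> lo u (u x)) v x)"
   proof (rule Pr_mono[OF q0 q(2)])
    fix om assume o: "om \<subseteq> G" and "\<exists>x. u v + s <= u x \<and> linked om v x"
    then obtain x where x: "u v + s <= u x" "linked om v x" by blast
    from first_hit_level[of om v x "u v + s" u, OF x(2,1)]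
    obtain z where z: "u v + s <= u z" "linked (om \<inter> lo u (u v + s)) v z" by blast
    have "u z <= u v + s + D"
     by (rule level_window[of "om \<inter> lo u (u v + s)" "u v + s" z v]) (use z o GE s D0 B0 in auto)
    moreover have "linked G v z" by (rule linked_mono[OF z(2)]) (use o in auto)
    ultimately have zX: "z \<in> X" using z(1) by (simp add: X_def)
    have "linked (om \<inter> lo u (u z)) v z" by (rule linked_mono[OF z(2)]) (use lo_mono[OF z(1), of u] in auto)
    thus "\<exists>x\<in>X. linked (om \<inter> lo u (u x)) v x" using zX by blast
   qed
   also have "... <= (\<Sum>x\<in>X. Pr G q (%om. linked (om \<inter> lo u (u x)) v x))" by (rule Pr_Bex_le[OF q0 q(2) X(1)])
   also have "... <= (\<Sum>x\<in>X. F v x)"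
   proof (rule sum_mono)
    fix x assume x: "x \<in> X"
    have "Pr G q (%om. linked (om \<inter> lo u (u x)) v x) = conn (G \<inter> lo u (u x)) q v x"
     by (rule Pr_restrict[OF G(1)])
    also have "... <= tau q (lo u (u x) \<inter> hi u (u v)) v x" by (rule tau_upper[OF q0 q(2)]) (use G in auto)
    also have "... = F v x" using x by (simp add: F_def X_def)
    finally show "Pr G q (%om. linked (om \<inter> lo u (u x)) v x) <= F v x" .
   qed
   also have "... <= r * (\<kappa> * exp (- s) * (Cc * M))"
    using mtb[THEN spec, THEN spec, THEN mp, OF inv, THEN mp, OF nn, THEN mp, OF wt] v X by blast
   finally show "Pr G q (reaches u (u v + s) v) <= r * (\<kappa> * exp (- s) * (Cc * M))" .
  qed
  finally show ?thesis by (simp add: C_def mult_ac)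
 qed
 show ?thesis by (rule exI[of _ C], intro conjI C allI impI, rule fin)
qed

text \<open>If all downward crossings were cheaper than \<open>exp (- (\<alpha> - 1 + \<epsilon>) t)\<close>, then climbing along the dual
 pair would bound the expected number of points far below, and mass transport would force the upward
 crossing exponent above \<open>\<alpha>\<close>.\<close>

theorem down_crossing:
 assumes \<epsilon>: "0 < \<epsilon>"
 shows "\<exists>t\<ge>t1. \<exists>y\<in>V. \<exists>R q1. pm <= q1 \<and> q1 < pc \<and>
  (\<forall>q. q1 <= q --> q < pc --> exp (- (\<alpha> - 1 + \<epsilon>) * t) <= Pr (Qy t R y) q (%om. Zy t R y om \<noteq> {}))"
proof (rule ccontr)
 assume n: "\<not> ?thesis"
 define \<beta> where "\<beta> = \<alpha> - 1 + \<epsilon>"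
 have \<beta>: "0 < \<beta>" "\<epsilon> <= \<beta>" using \<alpha>_ge_1 \<epsilon> by (auto simp: \<beta>_def)
 define t2 where "t2 = max t1 1"
 have dn: "Pr F q (%om. \<exists>x. l x <= l w - s \<and> linked om w x) <= exp (- \<beta> * s)"
  if q: "pm <= q" "q < pc" and s: "t2 <= s" and w: "w \<in> V" and F: "finite F" "F \<subseteq> E \<inter> lo u (u w)" for q s w F
 proof -
  have qq: "0 <= q" "q <= 1" using q pm pc by auto
  have s1: "t1 <= s" "0 < s" using s by (auto simp: t2_def)
  have "F \<subseteq> E" using F by auto
  then obtain R where R: "\<forall>e\<in>F. e \<subseteq> bl R w" using finite_edges_ball[OF F(1) _ w] by blast
  have "\<not> (\<forall>q'. q <= q' --> q' < pc --> exp (- \<beta> * s) <= Pr (Qy s R w) q' (%om. Zy s R w om \<noteq> {}))"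
   using n s1(1) w q unfolding \<beta>_def by blast
  then obtain q' where q': "q <= q'" "q' < pc" "Pr (Qy s R w) q' (%om. Zy s R w om \<noteq> {}) < exp (- \<beta> * s)" by force
  have "Pr F q (%om. \<exists>x. l x <= l w - s \<and> linked om w x) <= Pr (Qy s R w) q (%om. Zy s R w om \<noteq> {})"
   by (rule cross_prob[OF qq w s1(2) F R])
  also have "... <= Pr (Qy s R w) q' (%om. Zy s R w om \<noteq> {})"
   by (rule Pr_mono_p[OF Qy_finite Zy_increasing qq(1) q'(1)]) (use q' pc in simp)
  finally show ?thesis using q'(3) by linarith
 qed
 obtain c1 tc where c1: "0 < c1" and lev: "\<forall>t\<ge>tc. \<forall>y0\<in>V. \<forall>R. \<forall>\<psi>>0. \<forall>b\<ge>2. 1 <= b * (c1 * exp (- (- 1) * t) * \<psi>) -->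
  (\<exists>C>0. \<forall>q. pm <= q --> q <= 1 --> \<psi> <= Pr (d.Qy t R y0) q (%om. d.Zy t R y0 om \<noteq> {}) -->
  d.climbs_with q t C b)"
  using d.climb_from_level by (elim exE conjE)
 define \<epsilon>' where "\<epsilon>' = \<epsilon> / 4"
 have \<epsilon>': "0 < \<epsilon>'" using \<epsilon> by (simp add: \<epsilon>'_def)
 define ts where "ts = max (max tc 1) (max (- ln (1/4) / \<beta>) (- ln (c1 / 2) / (3 * \<epsilon>')))"
 from dual_crossing[OF \<epsilon>', of ts] obtain t y R q1 where t: "ts <= t" and y: "y \<in> V" and q1: "pm <= q1" "q1 < pc"
  and cr: "\<forall>q. q1 <= q --> q < pc --> exp (- (\<alpha> + \<epsilon>') * t) <= Pr (d.Qy t R y) q (%om. d.Zy t R y om \<noteq> {})" by blast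
 have tt: "tc <= t" "0 < t" "- ln (1/4) / \<beta> <= t" "- ln (c1 / 2) / (3 * \<epsilon>') <= t" using t by (auto simp: ts_def)
 define \<psi> where "\<psi> = exp (- (\<alpha> + \<epsilon>') * t)"
 have \<psi>: "0 < \<psi>" by (simp add: \<psi>_def)
 define b0 where "b0 = exp ((\<alpha> - 1 + \<epsilon>') * t) / c1"
 define b where "b = max 2 b0"
 have b2: "2 <= b" by (simp add: b_def)
 have "b0 * (c1 * exp (- (- 1) * t) * \<psi>) = exp ((\<alpha> - 1 + \<epsilon>') * t + (t + - (\<alpha> + \<epsilon>') * t))"
  using c1 by (simp add: b0_def \<psi>_def exp_add)
 also have "(\<alpha> - 1 + \<epsilon>') * t + (t + - (\<alpha> + \<epsilon>') * t) = 0" by (simp add: algebra_simps)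
 finally have "b0 * (c1 * exp (- (- 1) * t) * \<psi>) = 1" by simp
 moreover have "b0 * (c1 * exp (- (- 1) * t) * \<psi>) <= b * (c1 * exp (- (- 1) * t) * \<psi>)"
  using c1 \<psi> by (intro mult_right_mono) (auto simp: b_def)
 ultimately have b1: "1 <= b * (c1 * exp (- (- 1) * t) * \<psi>)" by linarith
 note lev[THEN spec, THEN mp, OF tt(1), THEN bspec, OF y, THEN spec[of _ R], THEN spec[of _ \<psi>], THEN mp, OF \<psi>, THEN spec[of _ b], THEN mp, OF b2, THEN mp, OF b1]
 then obtain C where C: "0 < C" and CC: "\<forall>q. pm <= q --> q <= 1 --> \<psi> <= Pr (d.Qy t R y) q (%om. d.Zy t R y om \<noteq> {}) -->
  d.climbs_with q t C b" by (elim exE conjE)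
 have half: "b * exp (- \<beta> * t) <= 1 / 2"
 proof -
  have "exp (- \<beta> * t) <= 1 / 4" by (rule exp_small[OF \<beta>(1) _ tt(3)]) simp
  hence 1: "2 * exp (- \<beta> * t) <= 1 / 2" by simp
  have "exp (- (3 * \<epsilon>') * t) <= c1 / 2" by (rule exp_small[OF _ _ tt(4)]) (use \<epsilon>' c1 in auto)
  moreover have "b0 * exp (- \<beta> * t) = exp (- (3 * \<epsilon>') * t) / c1"
  proof -
   have "(\<alpha> - 1 + \<epsilon>') * t + - \<beta> * t = - (3 * \<epsilon>') * t" by (simp add: \<beta>_def \<epsilon>'_def algebra_simps)
   thus ?thesis by (simp add: b0_def exp_add[symmetric])
  qed
  moreover have "(c1 / 2) / c1 = 1 / 2" using c1 by simp
  ultimately have 2: "b0 * exp (- \<beta> * t) <= 1 / 2" using divide_right_mono[of "exp (- (3 * \<epsilon>') * t)" "c1 / 2" c1] c1 by simp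
  show ?thesis using 1 2 by (simp add: b_def max_def)
 qed
 obtain C9 where C9: "0 < C9" and ufd: "drop_const C9" using up_from_down by (elim exE conjE)
 define C5 where "C5 = C + 4 * C * b"
 have C5: "0 < C5" using C b2 by (simp add: C5_def add_pos_pos)
 have fb: "fq q s <= C9 * C5 * exp (- (\<alpha> + \<epsilon>) * s)" if q: "q1 <= q" "q < pc" and s: "4 * B < s" "t2 <= s" for q s
 proof -
  have qq: "pm <= q" "q <= 1" using q q1 pc by auto
  define dd where "dd = s + D + 2 * B + 1"
  have dd: "t2 <= dd" "2 * B < dd" "0 <= dd" "s <= dd" using s D0 B0 by (auto simp: dd_def)
  have cq: "\<psi> <= Pr (d.Qy t R y) q (%om. d.Zy t R y om \<noteq> {})" unfolding \<psi>_def using cr q by blast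
  have bd: "drop_bound q s (C5 * exp (- \<beta> * dd))"
   unfolding dd_def[symmetric] C5_def
  proof (intro allI impI)
   fix w F0 X assume w: "w \<in> V" and F0: "finite F0" "F0 \<subseteq> E \<inter> lo u (u w) \<inter> lo (%x. - l x) (- l w + dd)"
    and X: "finite X" "\<forall>x\<in>X. l x <= l w - dd"
   show "(\<Sum>x\<in>X. conn F0 q w x) <= (C + 4 * C * b) * exp (- \<beta> * dd)"
   proof (rule down_expectation[OF qq b2 C tt(2) half \<beta>(1) _ CC[THEN spec, THEN mp, OF qq(1), THEN mp, OF qq(2), THEN mp, OF cq] w dd(1-3) F0 X])
    show "Pr F q (%om. \<exists>x. l x <= l w - s \<and> linked om w x) <= exp (- \<beta> * s)"
     if "t2 <= s" "w \<in> V" "finite F" "F \<subseteq> E \<inter> lo u (u w)" for s w F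
     by (rule dn[OF qq(1) q(2) that])
   qed
  qed
  have M0: "0 <= C5 * exp (- \<beta> * dd)" using C5 by simp
  have "fq q s <= C9 * exp (- s) * (C5 * exp (- \<beta> * dd))"
   by (rule ufd[THEN spec, THEN spec, THEN spec, THEN mp, OF qq(1), THEN mp, OF qq(2), THEN mp, OF s(1), THEN mp, OF M0, THEN mp, OF bd])
  also have "... <= C9 * exp (- s) * (C5 * exp (- \<beta> * s))"
   using C9 C5 dd(4) \<beta>(1) by (intro mult_left_mono) auto
  also have "... = C9 * C5 * (exp (- s) * exp (- \<beta> * s))" by (simp add: mult_ac)
  also have "exp (- s) * exp (- \<beta> * s) = exp (- (\<alpha> + \<epsilon>) * s)"
   unfolding exp_add[symmetric] by (simp add: \<beta>_def algebra_simps)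
  finally show ?thesis .
 qed
 have e2: "0 < \<epsilon> / 2" using \<epsilon> by simp
 from fq_lower[OF e2] obtain q2 \<tau> where q2: "pm <= q2" "q2 < pc" "0 < \<tau>"
  "\<forall>n q. q2 <= q --> q < pc --> exp (- (\<alpha> + \<epsilon> / 2) * (real (Suc n) * \<tau>)) <= fq q (real (Suc n) * \<tau>)" by blast
 define q where "q = max q1 q2"
 have q: "q1 <= q" "q2 <= q" "q < pc" using q1 q2 by (auto simp: q_def)
 define \<eta> where "\<eta> = 1 / (2 * (C9 * C5))"
 have \<eta>: "0 < \<eta>" using C9 C5 by (simp add: \<eta>_def)
 obtain n :: nat where n: "max (max t2 (4 * B + 1)) (- ln \<eta> / (\<epsilon> / 2)) / \<tau> <= real n" using real_arch_simple by blast
 define s where "s = real (Suc n) * \<tau>"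
 have "max (max t2 (4 * B + 1)) (- ln \<eta> / (\<epsilon> / 2)) <= real n * \<tau>" using n q2(3) by (simp add: pos_divide_le_eq)
 also have "... <= s" using q2(3) by (simp add: s_def)
 finally have s: "t2 <= s" "4 * B < s" "- ln \<eta> / (\<epsilon> / 2) <= s" by auto
 have "exp (- (\<alpha> + \<epsilon> / 2) * s) <= fq q s" unfolding s_def using q2(4) q by blast
 also have "... <= C9 * C5 * exp (- (\<alpha> + \<epsilon>) * s)" by (rule fb[OF q(1,3) s(2,1)])
 also have "exp (- (\<alpha> + \<epsilon>) * s) = exp (- (\<epsilon> / 2) * s) * exp (- (\<alpha> + \<epsilon> / 2) * s)"
  unfolding exp_add[symmetric] by (simp add: algebra_simps)
 also have "C9 * C5 * (exp (- (\<epsilon> / 2) * s) * exp (- (\<alpha> + \<epsilon> / 2) * s)) <= C9 * C5 * (\<eta> * exp (- (\<alpha> + \<epsilon> / 2) * s))"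
  using exp_small[OF e2 \<eta> s(3)] C9 C5 by (intro mult_left_mono mult_right_mono) auto
 also have "... = exp (- (\<alpha> + \<epsilon> / 2) * s) / 2" using C9 C5 by (simp add: \<eta>_def)
 finally show False using exp_gt_zero[of "- (\<alpha> + \<epsilon> / 2) * s"] by linarith
qed

end

context crit
begin

definition sm :: real where "sm = (wc D)\<^sup>2 * ic * wc 1 * exp D * c4"

lemma sm_nonneg: "0 <= sm"
 using ic_ge_1 wc_ge_1[of 1] c4_ge_1 by (simp add: sm_def)

lemma upward_expectation:
 assumes q: "pm <= q" "q <= 1" and A: "0 <= A" "Lb q A" and b: "0 < b" and C: "0 < C" and t: "0 < t"
  and lvl: "climbs_with q t C b"
  and v: "v \<in> V" and d: "0 <= d" and K: "0 <= K" and up: "\<And>s. 0 <= s ==> up q v s K <= exp (G - \<alpha> * s)"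
  and F0: "finite F0" "F0 \<subseteq> E \<inter> lo u (u v + d) \<inter> hi u (u v - K)" and X: "finite X" "\<forall>x\<in>X. u v + d <= u x"
 shows "(\<Sum>x\<in>X. conn F0 q v x) <=
  C * exp (G - \<alpha> * d) + (\<Sum>k<m. C * b ^ Suc k * (2 * exp (G - \<alpha> * (d + real k * t)))) + sm * A ^ 4 * exp (- (3/4) * d) / (C * b ^ m)"
proof -
 have q0: "0 <= q" using q pm by simp
 have Flo: "F0 \<subseteq> E \<inter> lo u (u v + d)" using F0 by auto
 define Z where "Z = (%om. card {x. u v + d <= u x \<and> linked om v x})"
 have "(\<Sum>x\<in>X. conn F0 q v x) <= C * exp (G - \<alpha> * d) + (\<Sum>k<m. C * b ^ Suc k * (2 * exp (G - \<alpha> * (d + real k * t))))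
  + pexp F0 q (%om. real (Z om) * of_bool (C * b ^ m <= real (Z om)))"
 proof (rule level_expectation[OF q0 q(2) _ C _ lvl v d, of "hi u (u v - K)" "%s. exp (G - \<alpha> * s)"])
  have "hi u (u v + d) \<subseteq> hi u (u v - K)" by (rule hi_antimono) (use d K in simp)
  thus "E \<inter> hi u (u v + d) \<subseteq> hi u (u v - K)" by blast
  fix F s assume F: "finite F" "F \<subseteq> E \<inter> hi u (u v - K)" and s: "d <= s"
  have "Pr F q (reaches u (u v + s) v) <= up q v s K" by (rule up_upper[OF q0 q(2) F])
  also have "... <= exp (G - \<alpha> * s)" by (rule up) (use d s in simp)
  finally show "Pr F q (reaches u (u v + s) v) <= exp (G - \<alpha> * s)" .
 qed (use F0 X b t Z_def in auto)
 also have "pexp F0 q (%om. real (Z om) * of_bool (C * b ^ m <= real (Z om))) <= pexp F0 q (%om. 1 / (C * b ^ m) * (real (Z om))\<^sup>2)"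
 proof (rule pexp_mono[OF q0 q(2)])
  fix om
  have Cb: "0 < C * b ^ m" using C b by simp
  show "real (Z om) * of_bool (C * b ^ m <= real (Z om)) <= 1 / (C * b ^ m) * (real (Z om))\<^sup>2"
  proof (cases "C * b ^ m <= real (Z om)")
   case True
   have "real (Z om) * (C * b ^ m) <= real (Z om) * real (Z om)" using True by (intro mult_left_mono) auto
   hence "real (Z om) <= real (Z om) * real (Z om) / (C * b ^ m)" using Cb by (simp only: pos_le_divide_eq)
   thus ?thesis using True by (simp add: power2_eq_square)
  qed (use Cb in simp)
 qed
 also have "pexp F0 q (%om. 1 / (C * b ^ m) * (real (Z om))\<^sup>2) = 1 / (C * b ^ m) * pexp F0 q (%om. (real (Z om))\<^sup>2)"
  by (rule pexp_cmult)
 also have "... <= 1 / (C * b ^ m) * (sm * A ^ 4 * exp (- (3/4) * d))"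
  unfolding Z_def sm_def using C b by (intro mult_left_mono second_moment[OF q A v d F0(1) Flo]) auto
 finally show ?thesis by simp
qed

lemma Lb_mono:
 assumes "Lb q A" "A <= A'"
 shows "Lb q A'"
 unfolding Lb_def LbH_def
proof (intro ballI allI impI)
 fix v d X assume v: "v \<in> V" and d: "0 <= d" and X: "finite X" "X \<subseteq> V" "\<forall>x\<in>X. u v + d <= u x"
 have "LbH q UNIV v A" using assms(1) v by (simp add: Lb_def)
 hence "(\<Sum>x\<in>X. tau q (lo u (u v + d) \<inter> UNIV) v x) <= A * exp (- (3/4) * d)" by (rule LbHD[OF _ d X(1,2)]) (use X in auto)
 also have "... <= A' * exp (- (3/4) * d)" using assms(2) by (intro mult_right_mono) auto
 finally show "(\<Sum>x\<in>X. tau q (lo u (u v + d) \<inter> UNIV) v x) <= A' * exp (- (3/4) * d)" .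
qed

lemma Lb_fixpoint:
 assumes q: "pm <= q" "q < pc" and \<epsilon>: "0 < \<epsilon>" and C: "1 <= C"
  and st: "\<And>A. 1 <= A ==> Lb q A ==> Lb q (C * exp ((1 - \<epsilon>) * ln A))" and e1: "\<epsilon> <= 1"
 shows "Lb q (exp (ln C / \<epsilon>))"
proof -
 define S where "S = {A. 1 <= A \<and> Lb q A}"
 obtain A1 where A1: "A1 \<in> S" using Lb_finite[OF q] by (auto simp: S_def)
 have bdd: "bdd_below S" by (rule bdd_belowI[of _ 1]) (auto simp: S_def)
 define A where "A = Inf S"
 have A_ge: "1 <= A" unfolding A_def by (rule cInf_greatest) (use A1 in \<open>auto simp: S_def\<close>)
 have LA: "Lb q A"
  unfolding Lb_def LbH_def
 proof (intro ballI allI impI)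
  fix v d X assume v: "v \<in> V" and d: "0 <= d" and X: "finite X" "X \<subseteq> V" "\<forall>x\<in>X. u v + d <= u x"
  have "(\<Sum>x\<in>X. tau q (lo u (u v + d) \<inter> UNIV) v x) / exp (- (3/4) * d) <= A"
   unfolding A_def
  proof (rule cInf_greatest)
   fix A' assume "A' \<in> S"
   hence "LbH q UNIV v A'" using v by (simp add: S_def Lb_def)
   hence "(\<Sum>x\<in>X. tau q (lo u (u v + d) \<inter> UNIV) v x) <= A' * exp (- (3/4) * d)" by (rule LbHD[OF _ d X(1,2)]) (use X in auto)
   thus "(\<Sum>x\<in>X. tau q (lo u (u v + d) \<inter> UNIV) v x) / exp (- (3/4) * d) <= A'"
    by (simp only: pos_divide_le_eq exp_gt_zero)
  qed (use A1 in auto)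
  thus "(\<Sum>x\<in>X. tau q (lo u (u v + d) \<inter> UNIV) v x) <= A * exp (- (3/4) * d)" by (simp only: pos_divide_le_eq exp_gt_zero)
 qed
 have L0: "0 <= ln A" using A_ge by simp
 have "1 * 1 <= C * exp ((1 - \<epsilon>) * ln A)" using C L0 e1 by (intro mult_mono) auto
 hence "C * exp ((1 - \<epsilon>) * ln A) \<in> S" using st[OF A_ge LA] by (simp add: S_def)
 hence "A <= C * exp ((1 - \<epsilon>) * ln A)" unfolding A_def by (rule cInf_lower[OF _ bdd])
 hence "ln A <= ln (C * exp ((1 - \<epsilon>) * ln A))" using A_ge by (subst ln_le_cancel_iff) auto
 also have "... = ln C + (1 - \<epsilon>) * ln A" using C by (simp add: ln_mult)
 finally have "\<epsilon> * ln A <= ln C" by (simp add: algebra_simps)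
 hence "ln A <= ln C / \<epsilon>" using \<epsilon> by (simp add: pos_le_divide_eq mult.commute)
 hence "A <= exp (ln C / \<epsilon>)" using A_ge by (metis exp_le_cancel_iff exp_ln less_le_trans zero_less_one)
 thus ?thesis by (rule Lb_mono[OF LA])
qed

theorem uniform_bound:
 "\<exists>q1 A. pm <= q1 \<and> q1 < pc \<and> 1 <= A \<and> (\<forall>q. q1 <= q --> q < pc --> Lb q A)"
proof -
 obtain a b' where ab: "0 <= a" "0 <= b'" and cb: "\<forall>q v t K. pm <= q --> q < pc --> v \<in> V --> 0 <= t --> 0 <= K --> up q v t K <= exp (a * K + b' - \<alpha> * t)"
  using crossing_bound by (elim exE conjE)
 obtain Cd where Cd: "1 <= Cd" and dp: "\<forall>q A a K aK. pm <= q --> q <= 1 --> 0 <= A --> Lb q A --> 0 <= a --> Sb q a --> 0 <= K -->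
  (\<forall>v\<in>V. LbH q (hi u (u v - K)) v aK) --> Lb q (aK + Cd * (a\<^sup>2 * A * exp (- K / 4)))" using dips by (elim exE conjE)
 define \<epsilon> where "\<epsilon> = 1 / (2 * (12 + 100 * a))"
 have \<epsilon>: "0 < \<epsilon>" "\<epsilon> <= 1 / 24" "(12 + 100 * a) * \<epsilon> = 1 / 2"
 proof -
  show "0 < \<epsilon>" using ab by (simp add: \<epsilon>_def)
  show "\<epsilon> <= 1 / 24" unfolding \<epsilon>_def by (rule divide_left_mono) (use ab in auto)
  have "12 + 100 * a \<noteq> 0" using ab by simp
  thus "(12 + 100 * a) * \<epsilon> = 1 / 2" by (simp add: \<epsilon>_def)
 qed
 obtain c1 tc where c1: "0 < c1" and lev: "\<forall>t\<ge>tc. \<forall>y0\<in>V. \<forall>R. \<forall>\<psi>>0. \<forall>b\<ge>2. 1 <= b * (c1 * exp (- 1 * t) * \<psi>) -->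
  (\<exists>C>0. \<forall>q. pm <= q --> q <= 1 --> \<psi> <= Pr (Qy t R y0) q (%om. Zy t R y0 om \<noteq> {}) -->
  climbs_with q t C b)"
  using climb_from_level by (elim exE conjE)
 from down_crossing[OF \<epsilon>(1), of "max (max tc 1) (- ln c1 / \<epsilon>)"] obtain t y R q1
  where t0: "max (max tc 1) (- ln c1 / \<epsilon>) <= t" and y: "y \<in> V" and q1: "pm <= q1" "q1 < pc"
   and cr: "\<forall>q. q1 <= q --> q < pc --> exp (- (\<alpha> - 1 + \<epsilon>) * t) <= Pr (Qy t R y) q (%om. Zy t R y om \<noteq> {})" by blast
 have t: "tc <= t" "1 <= t" "- ln c1 / \<epsilon> <= t" using t0 by auto
 define \<psi> where "\<psi> = exp (- (\<alpha> - 1 + \<epsilon>) * t)"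
 have \<psi>: "0 < \<psi>" by (simp add: \<psi>_def)
 define b where "b = exp ((\<alpha> + 2 * \<epsilon>) * t)"
 have a1: "1 <= \<alpha> + 2 * \<epsilon>" using \<alpha>_ge_1 \<epsilon> by simp
 have b2: "2 <= b"
 proof -
  have "1 * 1 <= (\<alpha> + 2 * \<epsilon>) * t" using a1 t by (intro mult_mono) auto
  moreover have "1 + (\<alpha> + 2 * \<epsilon>) * t <= b" unfolding b_def by (rule exp_ge_add_one_self)
  ultimately show ?thesis by simp
 qed
 have b0: "0 < b" using b2 by simp
 have b1: "1 <= b * (c1 * exp (- 1 * t) * \<psi>)"
 proof -
  have "exp (- \<epsilon> * t) <= c1" by (rule exp_small[OF \<epsilon>(1) c1 t(3)])
  hence "exp (- \<epsilon> * t) * exp (\<epsilon> * t) <= c1 * exp (\<epsilon> * t)" by (rule mult_right_mono) simp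
  moreover have "exp (- \<epsilon> * t) * exp (\<epsilon> * t) = 1" by (simp add: exp_minus)
  moreover have "b * (c1 * exp (- 1 * t) * \<psi>) = c1 * exp (\<epsilon> * t)"
  proof -
   have "b * (c1 * exp (- 1 * t) * \<psi>) = c1 * exp ((\<alpha> + 2 * \<epsilon>) * t + (- 1 * t + - (\<alpha> - 1 + \<epsilon>) * t))"
    by (simp only: b_def \<psi>_def exp_add mult_ac)
   also have "(\<alpha> + 2 * \<epsilon>) * t + (- 1 * t + - (\<alpha> - 1 + \<epsilon>) * t) = \<epsilon> * t" by (simp add: algebra_simps)
   finally show ?thesis .
  qed
  ultimately show ?thesis by linarith
 qed
 note lev[THEN spec, THEN mp, OF t(1), THEN bspec, OF y, THEN spec[of _ R], THEN spec[of _ \<psi>], THEN mp, OF \<psi>, THEN spec[of _ b], THEN mp, OF b2, THEN mp, OF b1]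
 then obtain C where C: "0 < C" and CC: "\<forall>q. pm <= q --> q <= 1 --> \<psi> <= Pr (Qy t R y) q (%om. Zy t R y om \<noteq> {}) -->
  climbs_with q t C b" by (elim exE conjE)
 define C10 where "C10 = exp b' * C * (1 + 2 * b * (exp (3 * \<epsilon> * t) / (\<epsilon> * t))) + sm / C + 1"
 have C10: "1 <= C10" using C b0 \<epsilon> t sm_nonneg unfolding C10_def by (simp add: add_nonneg_nonneg)
 have slab: "LbH q (hi u (u v - K)) v (C10 * exp (a * K + 12 * \<epsilon> * ln A))"
  if q: "q1 <= q" "q < pc" and A: "1 <= A" "Lb q A" and v: "v \<in> V" and K: "0 <= K" for q A v K
  unfolding LbH_def
 proof (intro allI impI)
  fix d X assume d: "0 <= d" and X: "finite X" "X \<subseteq> V" "\<forall>x\<in>X. u v + d <= u x"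
  have qq: "pm <= q" "q <= 1" "0 <= q" using q q1 pc pm by auto
  have cq: "\<psi> <= Pr (Qy t R y) q (%om. Zy t R y om \<noteq> {})" unfolding \<psi>_def using cr q by blast
  define L where "L = ln A"
  have L0: "0 <= L" using A by (simp add: L_def)
  have AL: "A = exp L" using A by (simp add: L_def)
  define m where "m = nat \<lceil>4 * L / ((\<alpha> + 2 * \<epsilon>) * t)\<rceil>"
  have at: "1 <= (\<alpha> + 2 * \<epsilon>) * t" using mult_mono[of 1 "\<alpha> + 2 * \<epsilon>" 1 t] a1 t by simp
  have "4 * L / ((\<alpha> + 2 * \<epsilon>) * t) <= real m" unfolding m_def by (rule real_nat_ceiling_ge)
  hence m1: "4 * L <= real m * ((\<alpha> + 2 * \<epsilon>) * t)" using at by (simp add: pos_divide_le_eq)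
  have "real m <= 4 * L / ((\<alpha> + 2 * \<epsilon>) * t) + 1" unfolding m_def using L0 at by (simp add: of_nat_ceiling)
  hence "real m * t <= (4 * L / ((\<alpha> + 2 * \<epsilon>) * t) + 1) * t" using t by (intro mult_right_mono) auto
  also have "... = 4 * L / (\<alpha> + 2 * \<epsilon>) + t"
  proof -
   have "(4 * L / (c * t) + 1) * t = 4 * L / c + t" if "1 <= c" for c using t that by (simp add: field_simps)
   thus ?thesis using a1 by blast
  qed
  also have "... <= 4 * L + t"
  proof -
   have "4 * L / (\<alpha> + 2 * \<epsilon>) <= 4 * L / 1" using L0 a1 by (intro divide_left_mono) auto
   thus ?thesis by simp
  qed
  finally have m2: "real m * t <= 4 * L + t" .
  have bm: "b ^ m = exp (real m * ((\<alpha> + 2 * \<epsilon>) * t))" by (simp only: b_def exp_of_nat_mult)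
  have A4: "A ^ 4 <= b ^ m"
  proof -
   have "A ^ 4 = exp (4 * L)" using exp_of_nat_mult[of 4 L] by (simp add: AL)
   thus ?thesis using m1 by (simp add: bm)
  qed
  define G where "G = a * K + b'"
  have "(\<Sum>x\<in>X. 1 * tau q (lo u (u v + d) \<inter> hi u (u v - K)) v x) <=
   C * exp (G - \<alpha> * d) + (\<Sum>k<m. C * b ^ Suc k * (2 * exp (G - \<alpha> * (d + real k * t)))) + sm * A ^ 4 * exp (- (3/4) * d) / (C * b ^ m)"
  proof (rule tau_sum_le[OF qq(3,2) X(1)])
   fix F assume F: "finite F" "F \<subseteq> E"
   have "(\<Sum>x\<in>X. conn (F \<inter> (lo u (u v + d) \<inter> hi u (u v - K))) q v x) <=
    C * exp (G - \<alpha> * d) + (\<Sum>k<m. C * b ^ Suc k * (2 * exp (G - \<alpha> * (d + real k * t)))) + sm * A ^ 4 * exp (- (3/4) * d) / (C * b ^ m)"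
   proof (rule upward_expectation[OF qq(1,2) _ A(2) b0 C _ CC[THEN spec, THEN mp, OF qq(1), THEN mp, OF qq(2), THEN mp, OF cq] v d K])
    fix s :: real assume "0 <= s"
    thus "up q v s K <= exp (G - \<alpha> * s)" unfolding G_def using cb qq(1) q(2) v K by blast
   qed (use A t F X in auto)
   thus "(\<Sum>x\<in>X. 1 * conn (F \<inter> (lo u (u v + d) \<inter> hi u (u v - K))) q v x) <=
    C * exp (G - \<alpha> * d) + (\<Sum>k<m. C * b ^ Suc k * (2 * exp (G - \<alpha> * (d + real k * t)))) + sm * A ^ 4 * exp (- (3/4) * d) / (C * b ^ m)"
    by simp
  qed simp
  moreover have ed: "exp (G - \<alpha> * d) <= exp G * exp (- (3/4) * d)"
  proof -
   have "1 * d <= \<alpha> * d" using \<alpha>_ge_1 d by (rule mult_right_mono)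
   thus ?thesis unfolding exp_add[symmetric] using d by simp
  qed
  moreover have "(\<Sum>k<m. C * b ^ Suc k * (2 * exp (G - \<alpha> * (d + real k * t)))) <=
   exp G * C * (2 * b * (exp (3 * \<epsilon> * t) / (\<epsilon> * t))) * exp (12 * \<epsilon> * L) * exp (- (3/4) * d)"
  proof -
   have "(\<Sum>k<m. C * b ^ Suc k * (2 * exp (G - \<alpha> * (d + real k * t)))) <= (\<Sum>k<m. C * (2 * b) * exp (G - \<alpha> * d) * exp (2 * \<epsilon> * (real m * t)))"
   proof (rule sum_mono)
    fix k assume "k \<in> {..<m}"
    hence km: "real k * t <= real m * t" using t by (intro mult_right_mono) auto
    have "b ^ k * exp (G - \<alpha> * (d + real k * t)) = exp (real k * ((\<alpha> + 2 * \<epsilon>) * t) + (G - \<alpha> * (d + real k * t)))"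
     by (simp only: b_def exp_of_nat_mult exp_add)
    also have "real k * ((\<alpha> + 2 * \<epsilon>) * t) + (G - \<alpha> * (d + real k * t)) = (G - \<alpha> * d) + 2 * \<epsilon> * (real k * t)"
     by (simp add: algebra_simps)
    also have "exp ... <= exp ((G - \<alpha> * d) + 2 * \<epsilon> * (real m * t))" using km \<epsilon> by simp
    also have "... = exp (G - \<alpha> * d) * exp (2 * \<epsilon> * (real m * t))" by (rule exp_add)
    finally have "C * (2 * b) * (b ^ k * exp (G - \<alpha> * (d + real k * t))) <= C * (2 * b) * (exp (G - \<alpha> * d) * exp (2 * \<epsilon> * (real m * t)))"
     using C b0 by (intro mult_left_mono) auto
    thus "C * b ^ Suc k * (2 * exp (G - \<alpha> * (d + real k * t))) <= C * (2 * b) * exp (G - \<alpha> * d) * exp (2 * \<epsilon> * (real m * t))"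
     by (simp add: mult_ac)
   qed
   also have "... = C * (2 * b) * exp (G - \<alpha> * d) * (real m * exp (2 * \<epsilon> * (real m * t)))" by simp
   also have "... <= C * (2 * b) * (exp G * exp (- (3/4) * d)) * (exp (3 * \<epsilon> * t) / (\<epsilon> * t) * exp (12 * \<epsilon> * L))"
   proof (rule mult_mono[OF mult_left_mono[OF ed]])
    have et: "0 < \<epsilon> * t" using \<epsilon> t by simp
    have "\<epsilon> * (real m * t) <= exp (\<epsilon> * (real m * t))" using exp_ge_add_one_self[of "\<epsilon> * (real m * t)"] by linarith
    hence "real m <= exp (\<epsilon> * (real m * t)) / (\<epsilon> * t)" using et by (simp add: pos_le_divide_eq mult_ac)
    hence "real m * exp (2 * \<epsilon> * (real m * t)) <= exp (\<epsilon> * (real m * t)) / (\<epsilon> * t) * exp (2 * \<epsilon> * (real m * t))"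
     by (rule mult_right_mono) simp
    also have "... = exp (\<epsilon> * (real m * t) + 2 * \<epsilon> * (real m * t)) / (\<epsilon> * t)" by (simp only: exp_add times_divide_eq_left)
    also have "... <= exp (3 * \<epsilon> * t + 12 * \<epsilon> * L) / (\<epsilon> * t)"
    proof (rule divide_right_mono)
     have "3 * \<epsilon> * (real m * t) <= 3 * \<epsilon> * (4 * L + t)" using m2 \<epsilon> by (intro mult_left_mono) auto
     thus "exp (\<epsilon> * (real m * t) + 2 * \<epsilon> * (real m * t)) <= exp (3 * \<epsilon> * t + 12 * \<epsilon> * L)" by (simp add: algebra_simps)
    qed (use et in simp)
    finally show "real m * exp (2 * \<epsilon> * (real m * t)) <= exp (3 * \<epsilon> * t) / (\<epsilon> * t) * exp (12 * \<epsilon> * L)" by (simp add: exp_add)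
   qed (use C b0 in auto)
   finally show ?thesis by (simp add: mult_ac)
  qed
  moreover have "sm * A ^ 4 * exp (- (3/4) * d) / (C * b ^ m) <= sm / C * exp (- (3/4) * d)"
  proof -
   have "A ^ 4 / b ^ m <= 1" using A4 b0 by (simp add: pos_divide_le_eq)
   hence "(sm / C * exp (- (3/4) * d)) * (A ^ 4 / b ^ m) <= (sm / C * exp (- (3/4) * d)) * 1"
    using sm_nonneg C by (intro mult_left_mono) auto
   thus ?thesis by (simp add: mult_ac)
  qed
  moreover have "C * exp (G - \<alpha> * d) <= C * (exp G * exp (- (3/4) * d))" using ed C by (intro mult_left_mono) auto
  ultimately have "(\<Sum>x\<in>X. tau q (lo u (u v + d) \<inter> hi u (u v - K)) v x) <=
   C * (exp G * exp (- (3/4) * d)) + exp G * C * (2 * b * (exp (3 * \<epsilon> * t) / (\<epsilon> * t))) * exp (12 * \<epsilon> * L) * exp (- (3/4) * d) + sm / C * exp (- (3/4) * d)"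
   by simp
  also have "... <= (C10 * exp (a * K + 12 * \<epsilon> * L)) * exp (- (3/4) * d)"
  proof -
   define W where "W = exp (a * K) * exp (12 * \<epsilon> * L)"
   define Q where "Q = 2 * b * (exp (3 * \<epsilon> * t) / (\<epsilon> * t))"
   have eL: "1 <= exp (12 * \<epsilon> * L)" "1 <= exp (a * K)" using \<epsilon> L0 ab K by auto
   hence W1: "1 <= W" "exp (a * K) <= W" using mult_mono[of 1 "exp (a * K)" 1 "exp (12 * \<epsilon> * L)"] by (auto simp: W_def)
   have Q0: "0 <= Q" using b0 \<epsilon> t by (simp add: Q_def)
   have "C * exp G + exp G * C * Q * exp (12 * \<epsilon> * L) + sm / C = exp b' * C * exp (a * K) + exp b' * C * Q * W + sm / C * 1"
    by (simp add: G_def exp_add W_def mult_ac)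
   also have "... <= exp b' * C * W + exp b' * C * Q * W + sm / C * W"
    using W1 C sm_nonneg Q0 by (intro add_mono mult_left_mono) auto
   also have "... = (exp b' * C * (1 + Q) + sm / C) * W" by (simp add: algebra_simps)
   also have "... <= C10 * W" using W1 by (intro mult_right_mono) (auto simp: C10_def Q_def)
   finally have "C * exp G + exp G * C * Q * exp (12 * \<epsilon> * L) + sm / C <= C10 * exp (a * K + 12 * \<epsilon> * L)"
    by (simp add: W_def exp_add)
   hence "(C * exp G + exp G * C * Q * exp (12 * \<epsilon> * L) + sm / C) * exp (- (3/4) * d) <= (C10 * exp (a * K + 12 * \<epsilon> * L)) * exp (- (3/4) * d)"
    by (rule mult_right_mono) simp
   thus ?thesis unfolding Q_def[symmetric] by (simp only: distrib_right mult.assoc)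
  qed
  finally show "(\<Sum>x\<in>X. tau q (lo u (u v + d) \<inter> hi u (u v - K)) v x) <= (C10 * exp (a * K + 12 * \<epsilon> * ln A)) * exp (- (3/4) * d)"
   by (simp only: L_def)
 qed
 define C11 where "C11 = C10 + Cd * C10\<^sup>2"
 have C11: "1 <= C11" using C10 Cd by (simp add: C11_def add_increasing2)
 have st: "Lb q (C11 * exp ((1 - \<epsilon>) * ln A))" if q: "q1 <= q" "q < pc" and A: "1 <= A" "Lb q A" for q A
 proof -
  have qq: "pm <= q" "q <= 1" using q q1 pc by auto
  define L where "L = ln A"
  have L0: "0 <= L" using A by (simp add: L_def)
  have AL: "A = exp L" using A by (simp add: L_def)
  define K where "K = 100 * \<epsilon> * L"
  have K: "0 <= K" using \<epsilon> L0 by (simp add: K_def)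
  define s where "s = C10 * exp (12 * \<epsilon> * L)"
  have s0: "0 <= s" using C10 by (simp add: s_def)
  have S: "Sb q s" unfolding Sb_def
  proof
   fix v assume v: "v \<in> V"
   show "LbH q (hi u (u v)) v s" using slab[OF q A v, of 0] by (simp add: s_def L_def)
  qed
  have aK: "\<forall>v\<in>V. LbH q (hi u (u v - K)) v (C10 * exp (a * K + 12 * \<epsilon> * L))" using slab[OF q A _ K] by (simp add: L_def)
  have A0: "0 <= A" using A by simp
  have new: "Lb q (C10 * exp (a * K + 12 * \<epsilon> * L) + Cd * (s\<^sup>2 * A * exp (- K / 4)))"
   by (rule dp[THEN spec, THEN spec, THEN spec, THEN spec, THEN spec, THEN mp, OF qq(1), THEN mp, OF qq(2), THEN mp, OF A0, THEN mp, OF A(2),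
    THEN mp, OF s0, THEN mp, OF S, THEN mp, OF K, THEN mp, OF aK])
  have "a * K + 12 * \<epsilon> * L = ((12 + 100 * a) * \<epsilon>) * L" by (simp add: K_def algebra_simps)
  also have "... <= (1 - \<epsilon>) * L" unfolding \<epsilon>(3) using \<epsilon>(2) L0 by (intro mult_right_mono) auto
  finally have 1: "exp (a * K + 12 * \<epsilon> * L) <= exp ((1 - \<epsilon>) * L)" by simp
  have "s\<^sup>2 * A * exp (- K / 4) = C10\<^sup>2 * (exp (12 * \<epsilon> * L) * exp (12 * \<epsilon> * L) * exp L * exp (- K / 4))"
   by (simp add: s_def AL power2_eq_square mult_ac)
  also have "exp (12 * \<epsilon> * L) * exp (12 * \<epsilon> * L) * exp L * exp (- K / 4) = exp ((1 - \<epsilon>) * L)"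
   unfolding exp_add[symmetric] by (simp add: K_def algebra_simps)
  finally have 2: "s\<^sup>2 * A * exp (- K / 4) = C10\<^sup>2 * exp ((1 - \<epsilon>) * L)" .
  have "C10 * exp (a * K + 12 * \<epsilon> * L) + Cd * (s\<^sup>2 * A * exp (- K / 4)) <= C10 * exp ((1 - \<epsilon>) * L) + Cd * (C10\<^sup>2 * exp ((1 - \<epsilon>) * L))"
   unfolding 2 using 1 C10 Cd by (intro add_mono mult_left_mono) auto
  also have "... = C11 * exp ((1 - \<epsilon>) * ln A)" by (simp add: C11_def L_def algebra_simps)
  finally show ?thesis by (rule Lb_mono[OF new])
 qed
 have "Lb q (exp (ln C11 / \<epsilon>))" if q: "q1 <= q" "q < pc" for q
  by (rule Lb_fixpoint[OF _ q(2) \<epsilon>(1) C11 st[OF q]]) (use q q1 \<epsilon> in auto)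
 moreover have "1 <= exp (ln C11 / \<epsilon>)" using C11 \<epsilon> by simp
 ultimately show ?thesis using q1 by blast
qed

end

section \<open>The triangle condition\<close>

context qt_graph
begin

text \<open>The exponential weights multiply to one around a triangle.\<close>

lemma triangle_bound:
 fixes T :: "'v \<Rightarrow> 'v \<Rightarrow> real"
 assumes T: "\<And>x y. 0 <= T x y" and C: "0 <= C"
  and le: "\<And>v X. v \<in> V ==> finite X ==> X \<subseteq> V ==> (\<Sum>x\<in>X. exp ((h x - h v) / 2) * T v x) <= C" and v: "v \<in> V"
 shows "(\<Sum>\<^sub>\<infinity>(x, y)\<in>V \<times> V. ennreal (T v x * T x y * T y v)) < \<infinity>"
proof -
 have "(\<Sum>\<^sub>\<infinity>(x, y)\<in>V \<times> V. ennreal (T v x * T x y * T y v)) <= ennreal (C * C * C)"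
 proof (rule infsum_le_finite_sums)
  show "(%(x, y). ennreal (T v x * T x y * T y v)) summable_on V \<times> V" by (rule nonneg_summable_on_complete) simp
  fix F assume F: "finite F" "F \<subseteq> V \<times> V"
  define X where "X = fst ` F"
  define Y where "Y = snd ` F"
  have XY: "finite X" "finite Y" "X \<subseteq> V" "Y \<subseteq> V" "F \<subseteq> X \<times> Y" using F by (auto simp: X_def Y_def image_iff) (metis fst_conv snd_conv)+
  have w: "T v x * T x y * T y v <= C * (exp ((h x - h v) / 2) * T v x * (exp ((h y - h x) / 2) * T x y))" if "x \<in> X" "y \<in> Y" for x y
  proof -
   have yV: "y \<in> V" using that XY by auto
   have 1: "exp ((h v - h y) / 2) * T y v <= C" using le[OF yV, of "{v}"] v by simp
   have "exp ((h x - h v) / 2) * exp ((h y - h x) / 2) * exp ((h v - h y) / 2) = 1"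
    unfolding exp_add[symmetric] by (simp add: field_simps)
   hence "T v x * T x y * T y v = (exp ((h x - h v) / 2) * exp ((h y - h x) / 2) * exp ((h v - h y) / 2)) * (T v x * T x y * T y v)" by simp
   also have "... = (exp ((h v - h y) / 2) * T y v) * (exp ((h x - h v) / 2) * T v x * (exp ((h y - h x) / 2) * T x y))" by (simp only: mult_ac)
   also have "... <= C * (exp ((h x - h v) / 2) * T v x * (exp ((h y - h x) / 2) * T x y))"
    using 1 T by (intro mult_right_mono mult_nonneg_nonneg) auto
   finally show ?thesis .
  qed
  have "(\<Sum>(x, y)\<in>F. ennreal (T v x * T x y * T y v)) = ennreal (\<Sum>(x, y)\<in>F. T v x * T x y * T y v)"
   using T by (subst sum_ennreal[symmetric]) (auto simp: split_beta)
  also have "... <= ennreal (C * C * C)"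
  proof (rule ennreal_leI)
   have "(\<Sum>(x, y)\<in>F. T v x * T x y * T y v) <= (\<Sum>(x, y)\<in>X \<times> Y. T v x * T x y * T y v)"
    by (rule sum_mono2) (use XY T in \<open>auto simp: split_beta intro!: mult_nonneg_nonneg\<close>)
   also have "... = (\<Sum>x\<in>X. \<Sum>y\<in>Y. T v x * T x y * T y v)" by (rule sum.cartesian_product[symmetric])
   also have "... <= (\<Sum>x\<in>X. \<Sum>y\<in>Y. C * (exp ((h x - h v) / 2) * T v x * (exp ((h y - h x) / 2) * T x y)))"
    by (intro sum_mono w)
   also have "... = C * (\<Sum>x\<in>X. exp ((h x - h v) / 2) * T v x * (\<Sum>y\<in>Y. exp ((h y - h x) / 2) * T x y))"
    by (simp add: sum_distrib_left)
   also have "... <= C * (\<Sum>x\<in>X. exp ((h x - h v) / 2) * T v x * C)"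
    using C T XY by (intro mult_left_mono sum_mono le) auto
   also have "... = C * ((\<Sum>x\<in>X. exp ((h x - h v) / 2) * T v x) * C)" by (simp add: sum_distrib_right)
   also have "... <= C * (C * C)" using C le[OF v XY(1,3)] by (intro mult_left_mono mult_right_mono) auto
   finally show "(\<Sum>(x, y)\<in>F. T v x * T x y * T y v) <= C * C * C" by (simp add: mult.assoc)
  qed
  finally show "(\<Sum>(x, y)\<in>F. ennreal (T v x * T x y * T y v)) <= ennreal (C * C * C)" .
 qed
 thus ?thesis by (rule le_less_trans) simp
qed

lemma two_point_nonneg: "0 <= two_point E p x y"
 by (simp add: two_point_def)

lemma triangle_zero:
 assumes v: "v \<in> V"
 shows "triangle_diagram V E 0 v < \<infinity>"
 unfolding triangle_diagram_def
proof (rule triangle_bound[OF two_point_nonneg _ _ v, of 1 "%_. 0"])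
 fix v X assume v: "v \<in> V" and X: "finite X" "X \<subseteq> V"
 have "two_point E 0 v x <= of_bool (x = v)" for x
 proof (rule two_point_le[OF _ _ v])
  fix F assume F: "finite F" "F \<subseteq> E"
  have "conn F 0 v x = (\<Sum>om\<in>Pow F. if om = {} then of_bool (linked {} v x) else 0)"
   unfolding Pr_def pexp_def
   by (rule sum.cong[OF refl]) (use F in \<open>auto simp: card_eq_0_iff power_0_left dest: finite_subset\<close>)
  also have "... = of_bool (linked {} v x)" using F by simp
  also have "... <= of_bool (x = v)" using linked_last_edge[of "{}" v x] by auto
  finally show "conn F 0 v x <= of_bool (x = v)" .
 qed auto
 hence "(\<Sum>x\<in>X. exp ((0 - 0) / 2) * two_point E 0 v x) <= (\<Sum>x\<in>X. of_bool (x = v))" by (intro sum_mono) simp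
 also have "... <= 1" using X by (simp add: of_bool_def)
 finally show "(\<Sum>x\<in>X. exp ((0 - 0) / 2) * two_point E 0 v x) <= 1" .
qed simp

end

context crit
begin

theorem critical_weighted_sum:
 "\<exists>C\<ge>0. \<forall>v\<in>V. \<forall>X. finite X --> X \<subseteq> V --> (\<Sum>x\<in>X. exp ((u x - u v) / 2) * tau pc UNIV v x) <= C"
proof -
 obtain q1 A where q1: "pm <= q1" "q1 < pc" and A: "1 <= A" and LbA: "\<forall>q. q1 <= q --> q < pc --> Lb q A"
  using uniform_bound by (elim exE conjE)
 define C where "C = ic * A * (wc 1 * A * c4)"
 have C: "0 <= C" using ic_ge_1 A wc_ge_1[of 1] c4_ge_1 by (simp add: C_def)
 have p01: "0 <= pc" "pc <= 1" using pm pc by auto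
 have "(\<Sum>x\<in>X. exp ((u x - u v) / 2) * tau pc UNIV v x) <= C" if v: "v \<in> V" and X: "finite X" "X \<subseteq> V" for v X
 proof (rule tau_sum_le[OF p01 X(1)])
  fix F assume F: "finite F" "F \<subseteq> E"
  define \<phi> where "\<phi> q = (\<Sum>x\<in>X. exp ((u x - u v) / 2) * conn (F \<inter> UNIV) q v x)" for q
  have le: "\<phi> q <= C" if q: "q1 < q" "q < pc" for q
  proof -
   have qq: "pm <= q" "q <= 1" "0 <= q" using q q1 pc pm by auto
   have "\<phi> q <= (\<Sum>x\<in>X. exp ((u x - u v) / 2) * tau q UNIV v x)"
    unfolding \<phi>_def by (intro sum_mono mult_left_mono tau_upper qq) (use F in auto)
   also have "... <= C" unfolding C_def by (rule weighted_sum[OF qq(1,2) _ _ v X]) (use A LbA q in auto)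
   finally show ?thesis .
  qed
  have "continuous_on UNIV \<phi>" unfolding \<phi>_def Pr_def by (intro continuous_intros continuous_on_pexp)
  hence "isCont \<phi> pc" by (simp add: continuous_on_eq_continuous_at)
  hence "(\<phi> \<longlongrightarrow> \<phi> pc) (at_left pc)" unfolding isCont_def by (rule tendsto_within_subset) simp
  moreover have "\<forall>\<^sub>F q in at_left pc. \<phi> q <= C"
   unfolding eventually_at_left_field using le q1(2) by blast
  ultimately have "\<phi> pc <= C" by (rule tendsto_upperbound) simp
  thus "(\<Sum>x\<in>X. exp ((u x - u v) / 2) * conn (F \<inter> UNIV) pc v x) <= C" by (simp add: \<phi>_def)
 qed simp
 thus ?thesis using C by blast
qed

end

context qt_graph
begin

lemma edge_lipschitz:
 assumes h: "equivariant h"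
 shows "\<exists>D\<ge>0. \<forall>x y. {x, y} \<in> E --> \<bar>h x - h y\<bar> <= D"
proof -
 define \<phi> where "\<phi> x = (\<Sum>y\<in>nb x. \<bar>h x - h y\<bar>)" for x
 have "\<phi> (g x) = \<phi> x" if g: "g \<in> \<Gamma>" and x: "x \<in> V" for g x
 proof -
  have sub: "nb x \<subseteq> V" using nb_in by blast
  have "\<phi> (g x) = (\<Sum>y\<in>g ` nb x. \<bar>h (g x) - h y\<bar>)" by (simp add: \<phi>_def nb_G[OF g x])
  also have "... = (\<Sum>y\<in>nb x. \<bar>h (g x) - h (g y)\<bar>)"
   by (subst sum.reindex[OF inj_on_subset[OF G_inj[OF g] sub]]) simp
  also have "... = \<phi> x" unfolding \<phi>_def
   by (rule sum.cong[OF refl]) (use equivariantD[OF h g x] sub in auto)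
  finally show ?thesis .
 qed
 hence "\<exists>C. \<forall>x\<in>V. \<phi> x <= C" by (rule unif_bound)
 then obtain C where C: "\<forall>x\<in>V. \<phi> x <= C" by blast
 have "\<bar>h x - h y\<bar> <= max C 0" if e: "{x, y} \<in> E" for x y
 proof -
  have x: "x \<in> V" "y \<in> nb x" using edge_in[OF e] e by (auto simp: nb_def)
  have "\<bar>h x - h y\<bar> <= \<phi> x" unfolding \<phi>_def by (rule member_le_sum[OF x(2)]) (auto simp: nb_finite)
  also have "... <= max C 0" using C x(1) by (simp add: le_max_iff_disj)
  finally show ?thesis .
 qed
 thus ?thesis by (intro exI[of _ "max C 0"]) auto
qed

theorem triangle_condition:
 assumes v0: "v0 \<in> V" "g0 \<in> \<Gamma>" "modr v0 (g0 v0) \<noteq> 1" and v: "v \<in> V"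
 shows "triangle_diagram V E (critical_probability V E) v < \<infinity>"
proof -
 define H where "H x = ln (modr x v0)" for x
 have g0v0: "g0 v0 \<in> V" using G_in v0 by blast
 have mself: "modr x x = 1" if "x \<in> V" for x using sorb_card_pos[OF that that] by (simp add: modr_def)
 have Hd: "H x - H y = ln (modr x y)" if xy: "x \<in> V" "y \<in> V" for x y
 proof -
  have "modr x v0 = modr x y * modr y v0" by (rule modr_cocycle) (use xy v0 in auto)
  hence "ln (modr x v0) = ln (modr x y) + ln (modr y v0)" using modr_pos[OF xy] modr_pos[OF xy(2) v0(1)] by (simp add: ln_mult)
  thus ?thesis by (simp add: H_def)
 qed
 have Hinv: "H (g x) - H (g y) = H x - H y" if "g \<in> \<Gamma>" "x \<in> V" "y \<in> V" for g x y
  using that Hd[of x y] Hd[of "g x" "g y"] modr_G[OF that] G_in by simp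
 obtain j0 where j0: "j0 \<in> \<Gamma>" "\<forall>x\<in>V. j0 (g0 x) = x \<and> g0 (j0 x) = x" using G_inv[OF v0(2)] by blast
 have Hne: "H v0 \<noteq> H (g0 v0)"
 proof
  assume "H v0 = H (g0 v0)"
  hence "ln (modr v0 (g0 v0)) = 0" using Hd[OF v0(1) g0v0] by simp
  thus False using v0(3) modr_pos[OF v0(1) g0v0] by (simp add: ln_eq_zero_iff)
 qed
 have jj: "j0 (g0 v0) = v0" using j0 v0 by simp
 have upex: "\<exists>w\<in>V. \<exists>g\<in>\<Gamma>. H w < H (g w)"
 proof (cases "H v0 < H (g0 v0)")
  case False
  hence "H (g0 v0) < H (j0 (g0 v0))" using Hne jj by simp
  thus ?thesis using g0v0 j0(1) by blast
 qed (use v0 in blast)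
 have dnex: "\<exists>w\<in>V. \<exists>g\<in>\<Gamma>. - H w < - H (g w)"
 proof (cases "H v0 < H (g0 v0)")
  case True
  hence "- H (g0 v0) < - H (j0 (g0 v0))" using jj by simp
  thus ?thesis using g0v0 j0(1) by blast
 next
  case False
  hence "- H v0 < - H (g0 v0)" using Hne by simp
  thus ?thesis using v0 by blast
 qed
 obtain w1 g1 where w1: "w1 \<in> V" "g1 \<in> \<Gamma>" "H w1 < H (g1 w1)" using upex by blast
 obtain w2 g2 where w2: "w2 \<in> V" "g2 \<in> \<Gamma>" "- H w2 < - H (g2 w2)" using dnex by blast
 have Hinv': "- H (g x) - - H (g y) = - H x - - H y" if "g \<in> \<Gamma>" "x \<in> V" "y \<in> V" for g x y
  using Hinv[OF that] by simp
 have mh1: "\<exists>u \<theta> C. 0 < \<theta> \<and> (\<forall>x\<in>V. \<bar>u x - H x\<bar> <= C) \<and>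
  (\<forall>g\<in>\<Gamma>. \<forall>x\<in>V. \<forall>y\<in>V. u (g x) - u (g y) = u x - u y) \<and>
  (\<forall>x\<in>V. \<exists>z. {x, z} \<in> E \<and> u x + \<theta> <= u z)"
  by (rule monotone_height[of H, OF _ w1]) (rule Hinv)
 have mh2: "\<exists>u \<theta> C. 0 < \<theta> \<and> (\<forall>x\<in>V. \<bar>u x - - H x\<bar> <= C) \<and>
  (\<forall>g\<in>\<Gamma>. \<forall>x\<in>V. \<forall>y\<in>V. u (g x) - u (g y) = u x - u y) \<and>
  (\<forall>x\<in>V. \<exists>z. {x, z} \<in> E \<and> u x + \<theta> <= u z)"
  by (rule monotone_height[of "%x. - H x", OF _ w2]) (rule Hinv')
 obtain u \<theta>1 C1 where u: "0 < \<theta>1" "\<forall>x\<in>V. \<bar>u x - H x\<bar> <= C1" "\<forall>g\<in>\<Gamma>. \<forall>x\<in>V. \<forall>y\<in>V. u (g x) - u (g y) = u x - u y"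
  "\<forall>x\<in>V. \<exists>z. {x, z} \<in> E \<and> u x + \<theta>1 <= u z"
  using mh1 by (elim exE conjE)
 obtain l' \<theta>2 C2 where l': "0 < \<theta>2" "\<forall>x\<in>V. \<bar>l' x - - H x\<bar> <= C2" "\<forall>g\<in>\<Gamma>. \<forall>x\<in>V. \<forall>y\<in>V. l' (g x) - l' (g y) = l' x - l' y"
  "\<forall>x\<in>V. \<exists>z. {x, z} \<in> E \<and> l' x + \<theta>2 <= l' z"
  using mh2 by (elim exE conjE)
 define l where "l x = - l' x" for x
 have u_inv: "equivariant u" using u(3) by (simp add: equivariant_def)
 have "equivariant l'" using l'(3) by (simp add: equivariant_def)
 hence l_inv: "equivariant l" unfolding l_def[abs_def] by (rule equivariant_uminus)
 define \<theta> where "\<theta> = min \<theta>1 \<theta>2"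
 obtain D1 where D1: "0 <= D1" "\<forall>x y. {x, y} \<in> E --> \<bar>u x - u y\<bar> <= D1" using edge_lipschitz[OF u_inv] by blast
 obtain D2 where D2: "0 <= D2" "\<forall>x y. {x, y} \<in> E --> \<bar>l x - l y\<bar> <= D2" using edge_lipschitz[OF l_inv] by blast
 have C12: "0 <= C1" "0 <= C2" using u(2) l'(2) v by (smt (verit))+
 have infV: "infinite V"
 proof
  assume fin: "finite V"
  have "Max (u ` V) \<in> u ` V" using fin v by (intro Max_in) auto
  then obtain x where x: "x \<in> V" "u x = Max (u ` V)" by auto
  then obtain z where z: "{x, z} \<in> E" "u x + \<theta>1 <= u z" using u(4) by blast
  have "u z <= Max (u ` V)" using edge_in[OF z(1)] fin by simp
  thus False using x z u(1) by simp
 qed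
 define pc where "pc = critical_probability V E"
 have pcb: "0 <= pc" "pc <= 1" using critical_bounds[OF infV] by (auto simp: pc_def)
 show ?thesis
 proof (cases "pc = 0")
  case True
  thus ?thesis using triangle_zero[OF v] by (simp add: pc_def)
 next
  case False
  hence pc0: "0 < pc" using pcb by simp
  interpret c: crit V E \<Gamma> u l \<theta> "max D1 D2" "C1 + C2" "exp (2 * C1)" "pc / 2" pc
  proof unfold_locales
   show "equivariant u" "equivariant l" by (fact u_inv l_inv)+
   show "\<bar>u x - u y\<bar> <= max D1 D2" if "{x, y} \<in> E" for x y using D1(2) that by (simp add: le_max_iff_disj)
   show "\<bar>l x - l y\<bar> <= max D1 D2" if "{x, y} \<in> E" for x y using D2(2) that by (simp add: le_max_iff_disj)
   show "\<bar>u x - l x\<bar> <= C1 + C2" if x: "x \<in> V" for x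
   proof -
    have "\<bar>u x - H x\<bar> <= C1" "\<bar>l' x - - H x\<bar> <= C2" using u(2) l'(2) x by auto
    thus ?thesis unfolding l_def by linarith
   qed
   show "\<exists>z. {x, z} \<in> E \<and> u x + \<theta> <= u z" if x: "x \<in> V" for x
   proof -
    obtain z where "{x, z} \<in> E" "u x + \<theta>1 <= u z" using u(4) x by blast
    thus ?thesis by (intro exI[of _ z]) (auto simp: \<theta>_def)
   qed
   show "\<exists>z. {x, z} \<in> E \<and> l z <= l x - \<theta>" if x: "x \<in> V" for x
   proof -
    obtain z where "{x, z} \<in> E" "l' x + \<theta>2 <= l' z" using l'(4) x by blast
    thus ?thesis by (intro exI[of _ z]) (auto simp: \<theta>_def l_def)
   qed
   show "0 < \<theta>" using u(1) l'(1) by (simp add: \<theta>_def)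
   show "0 <= max D1 D2" using D1(1) by simp
   show "0 <= C1 + C2" using C12 by simp
   show "modr x y <= exp (2 * C1) * exp (1 * (u x - u y))" if xy: "x \<in> V" "y \<in> V" for x y
   proof -
    have "\<bar>u x - H x\<bar> <= C1" "\<bar>u y - H y\<bar> <= C1" using u(2) xy by auto
    hence "H x - H y <= 2 * C1 + (u x - u y)" by linarith
    hence "exp (ln (modr x y)) <= exp (2 * C1 + (u x - u y))" using Hd[OF xy] by simp
    thus ?thesis using modr_pos[OF xy] by (simp add: exp_add)
   qed
   show "\<exists>C. \<forall>v\<in>V. \<forall>F X. finite F --> F \<subseteq> E --> finite X --> (\<Sum>x\<in>X. conn F q v x) <= C"
    if "pc / 2 <= q" "q < pc" for q
    by (rule sharpness[OF infV]) (use that pc0 in \<open>auto simp: pc_def\<close>)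
  qed (use pc0 pcb infV in auto)
  obtain C where C: "0 <= C" "\<forall>v\<in>V. \<forall>X. finite X --> X \<subseteq> V --> (\<Sum>x\<in>X. exp ((u x - u v) / 2) * tau pc UNIV v x) <= C"
   using c.critical_weighted_sum by (elim exE conjE)
  have tp: "two_point E pc x y <= tau pc UNIV x y" if x: "x \<in> V" for x y
   by (rule two_point_le[OF pcb x]) (auto intro: tau_upper pcb)
  show ?thesis
   unfolding triangle_diagram_def pc_def[symmetric]
  proof (rule triangle_bound[OF two_point_nonneg C(1) _ v, of u])
   fix v X assume v: "v \<in> V" and X: "finite X" "X \<subseteq> V"
   have "(\<Sum>x\<in>X. exp ((u x - u v) / 2) * two_point E pc v x) <= (\<Sum>x\<in>X. exp ((u x - u v) / 2) * tau pc UNIV v x)"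
    by (intro sum_mono mult_left_mono tp v) simp
   also have "... <= C" using C(2) v X by blast
   finally show "(\<Sum>x\<in>X. exp ((u x - u v) / 2) * two_point E pc v x) <= C" .
  qed
 qed
qed

end

lemma vertex_orbit_eq: "vertex_orbit V E \<Gamma> x = (%g. g x) ` \<Gamma>"
 by (auto simp: orbit_def)

lemma vertex_stabilizer_eq: "vertex_stabilizer V E \<Gamma> x = {g \<in> \<Gamma>. g x = x}"
 by (auto simp: stabilizer_def)

lemma qt_graph_subgroup:
 assumes G: "simple_graph V E" "connected_graph V E" "locally_finite_graph V E"
  and \<Gamma>: "subgroup \<Gamma> (Aut V E)" "quasi_transitive V E \<Gamma>"
 shows "qt_graph V E \<Gamma>"
proof -
 interpret A: group "Aut V E" by (rule group_Aut)
 interpret S: subgroup \<Gamma> "Aut V E" by (rule \<Gamma>(1))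
 have car: "g \<in> Bij V \<and> (\<forall>u\<in>V. \<forall>v\<in>V. {g u, g v} \<in> E \<longleftrightarrow> {u, v} \<in> E)" if "g \<in> \<Gamma>" for g
  using S.subset that by (auto simp: Aut_def)
 have bij: "bij_betw g V V" if "g \<in> \<Gamma>" for g using car[OF that] by (simp add: Bij_def)
 have inV: "g x \<in> V" if "g \<in> \<Gamma>" "x \<in> V" for g x using bij[OF that(1)] that(2) by (auto simp: bij_betw_def)
 have mult: "(g \<otimes>\<^bsub>Aut V E\<^esub> k) x = g (k x)" if "g \<in> \<Gamma>" "k \<in> \<Gamma>" "x \<in> V" for g k x
  using car[OF that(1)] car[OF that(2)] that(3) by (simp add: Aut_def BijGroup_def compose_eq)
 have one: "\<one>\<^bsub>Aut V E\<^esub> x = x" if "x \<in> V" for x using that by (simp add: Aut_def BijGroup_def)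
 show ?thesis
 proof
  show "simple_graph V E" "connected_graph V E" "locally_finite_graph V E" by (fact G)+
  show "bij_betw g V V" if "g \<in> \<Gamma>" for g by (rule bij[OF that])
  show "{g x, g y} \<in> E \<longleftrightarrow> {x, y} \<in> E" if "g \<in> \<Gamma>" "x \<in> V" "y \<in> V" for g x y using car[OF that(1)] that by blast
  show "\<exists>j\<in>\<Gamma>. \<forall>x\<in>V. j x = g (k x)" if "g \<in> \<Gamma>" "k \<in> \<Gamma>" for g k
   by (rule bexI[of _ "g \<otimes>\<^bsub>Aut V E\<^esub> k"]) (use mult that S.m_closed in auto)
  show "\<exists>j\<in>\<Gamma>. \<forall>x\<in>V. j (g x) = x \<and> g (j x) = x" if g: "g \<in> \<Gamma>" for g
  proof
   let ?j = "inv\<^bsub>Aut V E\<^esub> g"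
   show j: "?j \<in> \<Gamma>" by (rule S.m_inv_closed[OF g])
   show "\<forall>x\<in>V. ?j (g x) = x \<and> g (?j x) = x"
   proof
    fix x assume x: "x \<in> V"
    have "?j (g x) = (?j \<otimes>\<^bsub>Aut V E\<^esub> g) x" by (rule mult[OF j g x, symmetric])
    also have "... = x" using A.l_inv[OF S.mem_carrier[OF g]] one[OF x] by simp
    finally have 1: "?j (g x) = x" .
    have "g (?j x) = (g \<otimes>\<^bsub>Aut V E\<^esub> ?j) x" by (rule mult[OF g j x, symmetric])
    also have "... = x" using A.r_inv[OF S.mem_carrier[OF g]] one[OF x] by simp
    finally show "?j (g x) = x \<and> g (?j x) = x" using 1 by simp
   qed
  qed
  show "\<exists>j\<in>\<Gamma>. \<forall>x\<in>V. j x = x" using S.one_closed one by blast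
  show "\<exists>R. finite R \<and> R \<subseteq> V \<and> (\<forall>x\<in>V. \<exists>r\<in>R. \<exists>g\<in>\<Gamma>. x = g r)"
  proof -
   define Os where "Os = orbits ((Aut V E)\<lparr>carrier := \<Gamma>\<rparr>) V (%g. g)"
   have fin: "finite Os" using \<Gamma>(2) by (simp add: quasi_transitive_def Os_def)
   have Oeq: "Os = (%x. (%g. g x) ` \<Gamma>) ` V" by (auto simp: Os_def orbits_def vertex_orbit_eq)
   have "\<forall>Ob\<in>Os. \<exists>r. r \<in> V \<and> Ob = (%g. g r) ` \<Gamma>" by (auto simp: Oeq)
   from bchoice[OF this] obtain f where f: "\<forall>Ob\<in>Os. f Ob \<in> V \<and> Ob = (%g. g (f Ob)) ` \<Gamma>" by (elim exE)
   have "\<exists>r\<in>f ` Os. \<exists>g\<in>\<Gamma>. x = g r" if x: "x \<in> V" for x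
   proof -
    define Ob where "Ob = (%g. g x) ` \<Gamma>"
    have Ob: "Ob \<in> Os" using x by (auto simp: Oeq Ob_def)
    have "\<one>\<^bsub>Aut V E\<^esub> x \<in> Ob" unfolding Ob_def using S.one_closed by blast
    hence "x \<in> Ob" by (simp add: one[OF x])
    moreover have "Ob = (%g. g (f Ob)) ` \<Gamma>" using f Ob by blast
    ultimately have "x \<in> (%g. g (f Ob)) ` \<Gamma>" by simp
    thus ?thesis using Ob by blast
   qed
   moreover have "finite (f ` Os)" "f ` Os \<subseteq> V" using fin f by auto
   ultimately show ?thesis by blast
  qed
 qed
qed

theorem theorem1p7:
  fixes V :: "'v set" and E :: "'v set set"
  assumes "simple_graph V E"
    and "connected_graph V E"
    and "locally_finite_graph V E"
    and "\<exists>\<Gamma>. subgroup \<Gamma> (Aut V E) \<and> quasi_transitive V E \<Gamma> \<and> \<not> unimodular V E \<Gamma>"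
  shows "\<forall>v\<in>V. triangle_diagram V E (critical_probability V E) v < \<infinity>"
proof
 fix v assume v: "v \<in> V"
 obtain \<Gamma> where \<Gamma>: "subgroup \<Gamma> (Aut V E)" "quasi_transitive V E \<Gamma>" "\<not> unimodular V E \<Gamma>" using assms(4) by blast
 interpret qt_graph V E \<Gamma> by (rule qt_graph_subgroup[OF assms(1-3) \<Gamma>(1,2)])
 have sorb_eq: "vertex_orbit V E (vertex_stabilizer V E \<Gamma> x) y = sorb x y" for x y
  unfolding vertex_orbit_eq vertex_stabilizer_eq sorb_def stab_def ..
 obtain a b where ab: "a \<in> V" "b \<in> V" "a \<in> vertex_orbit V E \<Gamma> b" "card (sorb b a) \<noteq> card (sorb a b)"
  using \<Gamma>(3) unfolding unimodular_def sorb_eq by blast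
 obtain g where g: "g \<in> \<Gamma>" "a = g b" using ab(3) unfolding vertex_orbit_eq by blast
 have "modr b (g b) \<noteq> 1"
  using ab(4) sorb_card_pos[OF ab(1,2)] unfolding g(2) by (simp add: modr_def)
 thus "triangle_diagram V E (critical_probability V E) v < \<infinity>"
  by (rule triangle_condition[OF ab(2) g(1) _ v])
qed

end
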